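(* Let $\Bbbk$ be a field and let $A,Q$ be cocommutative Hopf algebras over $\Bbbk$. Let $A\wr Q=A^Q\#Q$ be their wreath product and $\tau\colon A\wr Q\to Q$, $\tau(x\#q)=\varepsilon(x)q$, the natural projection. Call a Hopf subalgebra $E\le A\wr Q$ admissible if (i) $\tau|_E\colon E\to Q$ has a coalgebra section, and (ii) evaluation at $1$, $x\#1\mapsto x@1$, restricts to an isomorphism of Hopf algebras from $E^{\operatorname{co}Q}=E\cap A^Q$ onto $A$, where $E^{\operatorname{co}Q}$ is formed with respect to $\tau|_E$ and $A^Q$ is identified with $A^Q\#1$. To an admissible $E$ associate the sequence $\Bbbk\to A\to E\to Q\to\Bbbk$ whose map $A\to E$ is the inverse of the isomorphism in (ii) followed by inclusion, and whose map $E\to Q$ is $\tau|_E$. Then this sequence is a coalgebra-split extension of $A$ by $Q$ for every admissible $E$, and the correspondence $E\mapsto E$, sending a coalgebra-split extension to the class of the admissible Hopf subalgebras whose associated extension is equivalent to it, is a well-defined bijection from $$\{\text{coalgebra-split extensions } \Bbbk\to A\to E\to Q\to\Bbbk\}\,/\,\text{equivalence of extensions}$$ to $$\{\text{admissible Hopf subalgebras } E\le A\wr Q\}\,/\,\text{conjugation by normalized coalgebra maps } Q\to A .$$ Here $E$ and $E'$ are conjugate if $E'=\operatorname{Ad}_\phi(E)$ for some normalized coalgebra map $\phi\colon Q\to A$.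
   Context: All coalgebras and Hopf algebras are cocommutative, over the field $\Bbbk$; coalgebra maps preserve comultiplication and counit. Sweedler notation $\Delta(u)=u_1\otimes u_2$ is used with summation suppressed. Exponential: the category of cocommutative counital $\Bbbk$-coalgebras is cartesian closed (with product $\otimes$). For coalgebras $C,D$ the exponential $D^C$ comes with a coalgebra map $@\colon D^C\otimes C\to D$, $u\otimes c\mapsto u@c$, such that for every cocommutative coalgebra $R$, $\phi\mapsto @(\phi\otimes 1_C)$ is a bijection from coalgebra maps $R\to D^C$ to coalgebra maps $R\otimes C\to D$ (the image of $\phi$ is called its transpose). An element of $D^C$ need not be determined by its evaluations at elements of $C$. Hopf structure on $A^Q$: $A^Q$ is a cocommutative Hopf algebra whose structure maps are the unique coalgebra maps whose transposes are given by $(xy)@c=(x@c_1)(y@c_2)$, $1@c=\varepsilon(c)1$, $(Sx)@c=S(x@c)$. The Hopf algebra $Q$ acts on $A^Q$ through the unique coalgebra map $\star\colon Q\otimes A^Q\to A^Q$ whose transpose is given by $(q\star x)@r=x@(rq)$. Wreath product: $A\wr Q=A^Q\#Q$ is the smash product Hopf algebra, with underlying coalgebra $A^Q\otimes Q$, multiplication $(h\#q)(k\#r)=h(q_1\star k)\#q_2r$ and antipode $S(h\#q)=(S(q_1)\star S(h))\#S(q_2)$. Extensions: for a Hopf map $\pi\colon E\to Q$, $E^{\operatorname{co}Q}=\{e\in E: e_1\otimes\pi(e_2)=e\otimes 1\}$. An extension (exact sequence) $\Bbbk\to A\xrightarrow{\iota}E\xrightarrow{\pi}Q\to\Bbbk$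 consists of a cocommutative Hopf algebra $E$ and Hopf maps with $\iota$ injective, $\pi$ surjective, $\iota(A)=E^{\operatorname{co}Q}$ and $\ker\pi=E\,\iota(A)^+$, where $\iota(A)^+=\iota(A)\cap\ker\varepsilon$. It is coalgebra-split if there is a coalgebra map $\gamma\colon Q\to E$ with $\pi\gamma=1_Q$ (a coalgebra section). An equivalence of two extensions of $A$ by $Q$ is a Hopf algebra isomorphism $E\to E'$ inducing the identity on $A$ and on $Q$. Conjugation: a coalgebra map $\phi\colon Q\to A$ is normalized if $\phi(1)=1$. By the exponential bijection with $R=\Bbbk$ it corresponds to a group-like element $\widehat\phi\in A^Q$ with $\widehat\phi@q=\phi(q)$. The inner Hopf automorphism $\operatorname{Ad}_\phi$ of $A\wr Q$ is $\operatorname{Ad}_\phi(z)=(\widehat\phi\#1)\,z\,(S(\widehat\phi)\#1)$. *)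

theory Defs
  imports "HOL-Algebra.Module" "HOL-Algebra.AbelCoset" "HOL-Library.Equipollence"
begin

section \<open>Tensor products of vector spaces\<close>

definition linear_maps ::
  "('k, 'm) ring_scheme \<Rightarrow> ('k, 'a, 'v) module_scheme \<Rightarrow> ('k, 'b, 'w) module_scheme \<Rightarrow> ('a \<Rightarrow> 'b) set"
  where
  "linear_maps K V W = {f \<in> carrier V \<rightarrow> carrier W.
     (\<forall>x \<in> carrier V. \<forall>y \<in> carrier V. f (x \<oplus>\<^bsub>V\<^esub> y) = f x \<oplus>\<^bsub>W\<^esub> f y) \<and>
     (\<forall>a \<in> carrier K. \<forall>x \<in> carrier V. f (a \<odot>\<^bsub>V\<^esub> x) = a \<odot>\<^bsub>W\<^esub> f x)}"

definition linear_span ::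
  "('k, 'm) ring_scheme \<Rightarrow> ('k, 'a, 'v) module_scheme \<Rightarrow> 'a set \<Rightarrow> 'a set" where
  "linear_span K V S = \<Inter> {N. submodule N K V \<and> S \<subseteq> N}"

text \<open>
  The multiplicative fields of the ring part of a module record carry no meaning for a bare vector
  space or coalgebra and are filled in arbitrarily.
\<close>

definition free_module :: "('k, 'm) ring_scheme \<Rightarrow> 'x set \<Rightarrow> ('k, 'x \<Rightarrow> 'k) module" where
  "free_module K X = \<lparr>
     carrier = {f. f ` X \<subseteq> carrier K \<and> (\<forall>x. x \<notin> X \<longrightarrow> f x = \<zero>\<^bsub>K\<^esub>) \<and> finite {x. f x \<noteq> \<zero>\<^bsub>K\<^esub>}},
     mult = undefined, one = undefined,
     zero = (\<lambda>_. \<zero>\<^bsub>K\<^esub>), add = (\<lambda>f g x. f x \<oplus>\<^bsub>K\<^esub> g x),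
     smult = (\<lambda>a f x. a \<otimes>\<^bsub>K\<^esub> f x)\<rparr>"

definition free_gen :: "('k, 'm) ring_scheme \<Rightarrow> 'x \<Rightarrow> 'x \<Rightarrow> 'k" where
  "free_gen K p = (\<lambda>x. if x = p then \<one>\<^bsub>K\<^esub> else \<zero>\<^bsub>K\<^esub>)"

definition quotient_module ::
  "('k, 'a, 'v) module_scheme \<Rightarrow> 'a set \<Rightarrow> ('k, 'a set) module" where
  "quotient_module M N = \<lparr>
     carrier = a_rcosets\<^bsub>M\<^esub> N,
     mult = undefined, one = undefined,
     zero = N, add = (\<lambda>X Y. X <+>\<^bsub>M\<^esub> Y),
     smult = (\<lambda>a X. N <+>\<^bsub>M\<^esub> ((\<lambda>x. a \<odot>\<^bsub>M\<^esub> x) ` X))\<rparr>"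

definition tensor_relations ::
  "('k, 'm) ring_scheme \<Rightarrow> ('k, 'a, 'v) module_scheme \<Rightarrow> ('k, 'b, 'w) module_scheme
     \<Rightarrow> ('a \<times> 'b \<Rightarrow> 'k) set" where
  "tensor_relations K V W =
    (let F = free_module K (carrier V \<times> carrier W); \<delta> = (\<lambda>v w. free_gen K (v, w)) in
       {\<delta> (v \<oplus>\<^bsub>V\<^esub> v') w \<ominus>\<^bsub>F\<^esub> (\<delta> v w \<oplus>\<^bsub>F\<^esub> \<delta> v' w) | v v' w.
          v \<in> carrier V \<and> v' \<in> carrier V \<and> w \<in> carrier W} \<union>
       {\<delta> v (w \<oplus>\<^bsub>W\<^esub> w') \<ominus>\<^bsub>F\<^esub> (\<delta> v w \<oplus>\<^bsub>F\<^esub> \<delta> v w') | v w w'.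
          v \<in> carrier V \<and> w \<in> carrier W \<and> w' \<in> carrier W} \<union>
       {\<delta> (a \<odot>\<^bsub>V\<^esub> v) w \<ominus>\<^bsub>F\<^esub> (a \<odot>\<^bsub>F\<^esub> \<delta> v w) | a v w.
          a \<in> carrier K \<and> v \<in> carrier V \<and> w \<in> carrier W} \<union>
       {\<delta> v (a \<odot>\<^bsub>W\<^esub> w) \<ominus>\<^bsub>F\<^esub> (a \<odot>\<^bsub>F\<^esub> \<delta> v w) | a v w.
          a \<in> carrier K \<and> v \<in> carrier V \<and> w \<in> carrier W})"

definition tensor_null ::
  "('k, 'm) ring_scheme \<Rightarrow> ('k, 'a, 'v) module_scheme \<Rightarrow> ('k, 'b, 'w) module_scheme
     \<Rightarrow> ('a \<times> 'b \<Rightarrow> 'k) set" where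
  "tensor_null K V W =
     linear_span K (free_module K (carrier V \<times> carrier W)) (tensor_relations K V W)"

type_synonym ('k, 'a, 'b) tensor = "('a \<times> 'b \<Rightarrow> 'k) set"

definition tensor_module ::
  "('k, 'm) ring_scheme \<Rightarrow> ('k, 'a, 'v) module_scheme \<Rightarrow> ('k, 'b, 'w) module_scheme
     \<Rightarrow> ('k, ('k, 'a, 'b) tensor) module" where
  "tensor_module K V W =
     quotient_module (free_module K (carrier V \<times> carrier W)) (tensor_null K V W)"

definition pure_tensor ::
  "('k, 'm) ring_scheme \<Rightarrow> ('k, 'a, 'v) module_scheme \<Rightarrow> ('k, 'b, 'w) module_scheme
     \<Rightarrow> 'a \<Rightarrow> 'b \<Rightarrow> ('k, 'a, 'b) tensor" where
  "pure_tensor K V W v w =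
     tensor_null K V W +>\<^bsub>free_module K (carrier V \<times> carrier W)\<^esub> free_gen K (v, w)"

text \<open>The linear map on \<open>V \<otimes> W\<close> induced by a bilinear map \<open>\<beta>\<close> on \<open>V \<times> W\<close>.\<close>

definition tensor_lift ::
  "('k, 'm) ring_scheme \<Rightarrow> ('k, 'a, 'v) module_scheme \<Rightarrow> ('k, 'b, 'w) module_scheme
     \<Rightarrow> ('k, 'c, 'u) module_scheme \<Rightarrow> ('a \<Rightarrow> 'b \<Rightarrow> 'c) \<Rightarrow> ('k, 'a, 'b) tensor \<Rightarrow> 'c" where
  "tensor_lift K V W U \<beta> =
     (THE f. f \<in> linear_maps K (tensor_module K V W) U \<and>
             f \<in> extensional (carrier (tensor_module K V W)) \<and>
             (\<forall>v \<in> carrier V. \<forall>w \<in> carrier W. f (pure_tensor K V W v w) = \<beta> v w))"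

definition tensor_map ::
  "('k, 'm) ring_scheme \<Rightarrow> ('k, 'a, 'v) module_scheme \<Rightarrow> ('k, 'b, 'w) module_scheme
     \<Rightarrow> ('k, 'c, 'v1) module_scheme \<Rightarrow> ('k, 'd, 'w1) module_scheme
     \<Rightarrow> ('a \<Rightarrow> 'c) \<Rightarrow> ('b \<Rightarrow> 'd) \<Rightarrow> ('k, 'a, 'b) tensor \<Rightarrow> ('k, 'c, 'd) tensor" where
  "tensor_map K V W V' W' f g =
     tensor_lift K V W (tensor_module K V' W') (\<lambda>v w. pure_tensor K V' W' (f v) (g w))"

definition tensor_swap ::
  "('k, 'm) ring_scheme \<Rightarrow> ('k, 'a, 'v) module_scheme \<Rightarrow> ('k, 'b, 'w) module_scheme
     \<Rightarrow> ('k, 'a, 'b) tensor \<Rightarrow> ('k, 'b, 'a) tensor" where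
  "tensor_swap K V W =
     tensor_lift K V W (tensor_module K W V) (\<lambda>v w. pure_tensor K W V w v)"

definition tensor_assoc ::
  "('k, 'm) ring_scheme \<Rightarrow> ('k, 'a, 'u) module_scheme \<Rightarrow> ('k, 'b, 'v) module_scheme
     \<Rightarrow> ('k, 'c, 'w) module_scheme
     \<Rightarrow> ('k, ('k, 'a, 'b) tensor, 'c) tensor \<Rightarrow> ('k, 'a, ('k, 'b, 'c) tensor) tensor" where
  "tensor_assoc K U V W =
     (let VW = tensor_module K V W; T = tensor_module K U VW in
        tensor_lift K (tensor_module K U V) W T
          (\<lambda>t w. tensor_lift K U V T
             (\<lambda>u v. pure_tensor K U VW u (pure_tensor K V W v w)) t))"

definition ground_module :: "('k, 'm) ring_scheme \<Rightarrow> ('k, 'k) module" where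
  "ground_module K = \<lparr>carrier = carrier K, mult = mult K, one = one K, zero = zero K,
     add = add K, smult = mult K\<rparr>"


section \<open>Cocommutative coalgebras and Hopf algebras\<close>

record ('k, 'a) coalgebra = "('k, 'a) module" +
  comult :: "'a \<Rightarrow> ('k, 'a, 'a) tensor"
  counit :: "'a \<Rightarrow> 'k"

record ('k, 'a) hopf_algebra = "('k, 'a) coalgebra" +
  antipode :: "'a \<Rightarrow> 'a"

text \<open>\<open>sweedler K C U \<beta> c\<close> is \<open>\<beta>(c\<^sub>1, c\<^sub>2)\<close> (summation suppressed), for \<open>\<beta>\<close> bilinear with values in \<open>U\<close>.\<close>

definition sweedler ::
  "('k, 'm) ring_scheme \<Rightarrow> ('k, 'a, 'c) coalgebra_scheme \<Rightarrow> ('k, 'b, 'u) module_scheme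
     \<Rightarrow> ('a \<Rightarrow> 'a \<Rightarrow> 'b) \<Rightarrow> 'a \<Rightarrow> 'b" where
  "sweedler K C U \<beta> c = tensor_lift K C C U \<beta> (comult C c)"

locale cocomm_coalgebra = field K + module K C
  for K :: "('k, 'm) ring_scheme" and C :: "('k, 'a, 'c) coalgebra_scheme" +
  assumes comult_linear: "comult C \<in> linear_maps K C (tensor_module K C C)"
    and counit_linear: "counit C \<in> linear_maps K C (ground_module K)"
    and coassoc: "c \<in> carrier C \<Longrightarrow>
      tensor_assoc K C C C
        (tensor_map K C C (tensor_module K C C) C (comult C) (\<lambda>x. x) (comult C c)) =
      tensor_map K C C C (tensor_module K C C) (\<lambda>x. x) (comult C) (comult C c)"
    and counit_left: "c \<in> carrier C \<Longrightarrow> sweedler K C C (\<lambda>c1 c2. counit C c1 \<odot>\<^bsub>C\<^esub> c2) c = c"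
    and counit_right: "c \<in> carrier C \<Longrightarrow> sweedler K C C (\<lambda>c1 c2. counit C c2 \<odot>\<^bsub>C\<^esub> c1) c = c"
    and cocomm: "c \<in> carrier C \<Longrightarrow> tensor_swap K C C (comult C c) = comult C c"

locale cocomm_hopf_algebra = cocomm_coalgebra K H + ring H
  for K :: "('k, 'm) ring_scheme" and H :: "('k, 'a, 'h) hopf_algebra_scheme" +
  assumes smult_mult_left: "\<lbrakk>a \<in> carrier K; x \<in> carrier H; y \<in> carrier H\<rbrakk> \<Longrightarrow>
      (a \<odot>\<^bsub>H\<^esub> x) \<otimes>\<^bsub>H\<^esub> y = a \<odot>\<^bsub>H\<^esub> (x \<otimes>\<^bsub>H\<^esub> y)"
    and smult_mult_right: "\<lbrakk>a \<in> carrier K; x \<in> carrier H; y \<in> carrier H\<rbrakk> \<Longrightarrow>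
      x \<otimes>\<^bsub>H\<^esub> (a \<odot>\<^bsub>H\<^esub> y) = a \<odot>\<^bsub>H\<^esub> (x \<otimes>\<^bsub>H\<^esub> y)"
    and comult_mult: "\<lbrakk>x \<in> carrier H; y \<in> carrier H\<rbrakk> \<Longrightarrow>
      comult H (x \<otimes>\<^bsub>H\<^esub> y) =
        sweedler K H (tensor_module K H H) (\<lambda>x1 x2.
          sweedler K H (tensor_module K H H) (\<lambda>y1 y2.
            pure_tensor K H H (x1 \<otimes>\<^bsub>H\<^esub> y1) (x2 \<otimes>\<^bsub>H\<^esub> y2)) y) x"
    and comult_one: "comult H \<one>\<^bsub>H\<^esub> = pure_tensor K H H \<one>\<^bsub>H\<^esub> \<one>\<^bsub>H\<^esub>"
    and counit_mult: "\<lbrakk>x \<in> carrier H; y \<in> carrier H\<rbrakk> \<Longrightarrow>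
      counit H (x \<otimes>\<^bsub>H\<^esub> y) = counit H x \<otimes>\<^bsub>K\<^esub> counit H y"
    and counit_one: "counit H \<one>\<^bsub>H\<^esub> = \<one>\<^bsub>K\<^esub>"
    and antipode_linear: "antipode H \<in> linear_maps K H H"
    and antipode_left: "x \<in> carrier H \<Longrightarrow>
      sweedler K H H (\<lambda>x1 x2. antipode H x1 \<otimes>\<^bsub>H\<^esub> x2) x = counit H x \<odot>\<^bsub>H\<^esub> \<one>\<^bsub>H\<^esub>"
    and antipode_right: "x \<in> carrier H \<Longrightarrow>
      sweedler K H H (\<lambda>x1 x2. x1 \<otimes>\<^bsub>H\<^esub> antipode H x2) x = counit H x \<odot>\<^bsub>H\<^esub> \<one>\<^bsub>H\<^esub>"

definition coalgebra_hom ::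
  "('k, 'm) ring_scheme \<Rightarrow> ('k, 'a, 'c) coalgebra_scheme \<Rightarrow> ('k, 'b, 'd) coalgebra_scheme
     \<Rightarrow> ('a \<Rightarrow> 'b) set" where
  "coalgebra_hom K C D = {f \<in> linear_maps K C D. \<forall>c \<in> carrier C.
     comult D (f c) = tensor_map K C C D D f f (comult C c) \<and> counit D (f c) = counit C c}"

definition hopf_hom ::
  "('k, 'm) ring_scheme \<Rightarrow> ('k, 'a, 'g) hopf_algebra_scheme \<Rightarrow> ('k, 'b, 'h) hopf_algebra_scheme
     \<Rightarrow> ('a \<Rightarrow> 'b) set" where
  "hopf_hom K G H = {f \<in> coalgebra_hom K G H \<inter> ring_hom G H.
     \<forall>x \<in> carrier G. f (antipode G x) = antipode H (f x)}"

definition hopf_iso ::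
  "('k, 'm) ring_scheme \<Rightarrow> ('k, 'a, 'g) hopf_algebra_scheme \<Rightarrow> ('k, 'b, 'h) hopf_algebra_scheme
     \<Rightarrow> ('a \<Rightarrow> 'b) set" where
  "hopf_iso K G H = {f \<in> hopf_hom K G H. bij_betw f (carrier G) (carrier H)}"

definition ground_coalgebra :: "('k, 'm) ring_scheme \<Rightarrow> ('k, 'k) coalgebra" where
  "ground_coalgebra K = (let G = ground_module K in
     \<lparr>carrier = carrier G, mult = mult G, one = one G, zero = zero G, add = add G, smult = smult G,
      comult = (\<lambda>a. pure_tensor K G G a \<one>\<^bsub>K\<^esub>), counit = (\<lambda>a. a)\<rparr>)"

definition tensor_coalgebra ::
  "('k, 'm) ring_scheme \<Rightarrow> ('k, 'a, 'c) coalgebra_scheme \<Rightarrow> ('k, 'b, 'd) coalgebra_scheme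
     \<Rightarrow> ('k, ('k, 'a, 'b) tensor) coalgebra" where
  "tensor_coalgebra K C D = (let T = tensor_module K C D; TT = tensor_module K T T in
     \<lparr>carrier = carrier T, mult = mult T, one = one T, zero = zero T, add = add T, smult = smult T,
      comult = tensor_lift K C D TT (\<lambda>c d.
        sweedler K C TT (\<lambda>c1 c2. sweedler K D TT (\<lambda>d1 d2.
          pure_tensor K T T (pure_tensor K C D c1 d1) (pure_tensor K C D c2 d2)) d) c),
      counit = tensor_lift K C D (ground_module K) (\<lambda>c d. counit C c \<otimes>\<^bsub>K\<^esub> counit D d)\<rparr>)"


section \<open>Exponential coalgebras\<close>

text \<open>
  \<open>(X, ev)\<close> is an exponential of \<open>D\<close> by \<open>C\<close>.  Quantification over types not being available, the
  test coalgebras \<open>R\<close> range over all cocommutative coalgebras whose carrier is a set of elements of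
  the type \<open>'u\<close>, which plays the part of a universe.  Maps are compared as extensional functions
  on the carriers.
\<close>

definition exponential ::
  "'u itself \<Rightarrow> ('k, 'm) ring_scheme \<Rightarrow> ('k, 'c, 'y) coalgebra_scheme \<Rightarrow>
     ('k, 'd, 'z) coalgebra_scheme \<Rightarrow> ('k, 'x) coalgebra \<Rightarrow> (('k, 'x, 'c) tensor \<Rightarrow> 'd) \<Rightarrow> bool"
  where
  "exponential (_ :: 'u itself) K C D X ev \<longleftrightarrow>
     cocomm_coalgebra K X \<and>
     ev \<in> coalgebra_hom K (tensor_coalgebra K X C) D \<and>
     (\<forall>R :: ('k, 'u) coalgebra. cocomm_coalgebra K R \<longrightarrow>
        bij_betw
          (\<lambda>\<phi>. restrict (\<lambda>t. ev (tensor_map K R C X C \<phi> (\<lambda>c. c) t))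
                 (carrier (tensor_coalgebra K R C)))
          (coalgebra_hom K R X \<inter> extensional (carrier R))
          (coalgebra_hom K (tensor_coalgebra K R C) D \<inter>
             extensional (carrier (tensor_coalgebra K R C))))"

text \<open>
  The coalgebra map \<open>R \<rightarrow> X = D\<^sup>C\<close> whose transpose sends \<open>r \<otimes> c\<close> to \<open>f r c\<close>.
\<close>

definition exp_curry ::
  "('k, 'm) ring_scheme \<Rightarrow> ('k, 'c, 'y) coalgebra_scheme \<Rightarrow> ('k, 'x) coalgebra
     \<Rightarrow> (('k, 'x, 'c) tensor \<Rightarrow> 'd) \<Rightarrow> ('k, 'r, 'z) coalgebra_scheme \<Rightarrow> ('r \<Rightarrow> 'c \<Rightarrow> 'd)
     \<Rightarrow> 'r \<Rightarrow> 'x" where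
  "exp_curry K C X ev R f =
     (THE g. g \<in> coalgebra_hom K R X \<and> g \<in> extensional (carrier R) \<and>
        (\<forall>r \<in> carrier R. \<forall>c \<in> carrier C. ev (pure_tensor K X C (g r) c) = f r c))"

definition exp_hopf ::
  "('k, 'm) ring_scheme \<Rightarrow> ('k, 'a, 'g) hopf_algebra_scheme \<Rightarrow> ('k, 'q, 'h) hopf_algebra_scheme
     \<Rightarrow> ('k, 'x) coalgebra \<Rightarrow> (('k, 'x, 'q) tensor \<Rightarrow> 'a) \<Rightarrow> ('k, 'x) hopf_algebra" where
  "exp_hopf K A Q X ev =
    (let at = (\<lambda>x c. ev (pure_tensor K X Q x c)) in
     \<lparr>carrier = carrier X,
      mult = (\<lambda>x y. exp_curry K Q X ev (tensor_coalgebra K X X)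
        (\<lambda>t c. tensor_lift K X X A
           (\<lambda>x y. sweedler K Q A (\<lambda>c1 c2. at x c1 \<otimes>\<^bsub>A\<^esub> at y c2) c) t)
        (pure_tensor K X X x y)),
      one = exp_curry K Q X ev (ground_coalgebra K)
        (\<lambda>a c. a \<odot>\<^bsub>A\<^esub> (counit Q c \<odot>\<^bsub>A\<^esub> \<one>\<^bsub>A\<^esub>)) \<one>\<^bsub>K\<^esub>,
      zero = zero X, add = add X, smult = smult X,
      comult = comult X, counit = counit X,
      antipode = exp_curry K Q X ev X (\<lambda>x c. antipode A (at x c))\<rparr>)"

definition exp_action ::
  "('k, 'm) ring_scheme \<Rightarrow> ('k, 'a, 'g) hopf_algebra_scheme \<Rightarrow> ('k, 'q, 'h) hopf_algebra_scheme
     \<Rightarrow> ('k, 'x) coalgebra \<Rightarrow> (('k, 'x, 'q) tensor \<Rightarrow> 'a) \<Rightarrow> 'q \<Rightarrow> 'x \<Rightarrow> 'x" where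
  "exp_action K A Q X ev q x =
     exp_curry K Q X ev (tensor_coalgebra K Q X)
       (\<lambda>t r. tensor_lift K Q X A (\<lambda>q x. ev (pure_tensor K X Q x (r \<otimes>\<^bsub>Q\<^esub> q))) t)
       (pure_tensor K Q X q x)"


section \<open>Smash and wreath products\<close>

definition smash_product ::
  "('k, 'm) ring_scheme \<Rightarrow> ('k, 'x, 'g) hopf_algebra_scheme \<Rightarrow> ('k, 'q, 'h) hopf_algebra_scheme
     \<Rightarrow> ('q \<Rightarrow> 'x \<Rightarrow> 'x) \<Rightarrow> ('k, ('k, 'x, 'q) tensor) hopf_algebra" where
  "smash_product K H Q act =
    (let T = tensor_coalgebra K H Q; sm = pure_tensor K H Q in
     \<lparr>carrier = carrier T,
      mult = (\<lambda>s t. tensor_lift K H Q T (\<lambda>h q. tensor_lift K H Q T (\<lambda>k r.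
        sweedler K Q T (\<lambda>q1 q2. sm (h \<otimes>\<^bsub>H\<^esub> act q1 k) (q2 \<otimes>\<^bsub>Q\<^esub> r)) q) t) s),
      one = sm \<one>\<^bsub>H\<^esub> \<one>\<^bsub>Q\<^esub>,
      zero = zero T, add = add T, smult = smult T,
      comult = comult T, counit = counit T,
      antipode = tensor_lift K H Q T (\<lambda>h q.
        sweedler K Q T (\<lambda>q1 q2. sm (act (antipode Q q1) (antipode H h)) (antipode Q q2)) q)\<rparr>)"

definition wreath_product ::
  "('k, 'm) ring_scheme \<Rightarrow> ('k, 'a, 'g) hopf_algebra_scheme \<Rightarrow> ('k, 'q, 'h) hopf_algebra_scheme
     \<Rightarrow> ('k, 'x) coalgebra \<Rightarrow> (('k, 'x, 'q) tensor \<Rightarrow> 'a)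
     \<Rightarrow> ('k, ('k, 'x, 'q) tensor) hopf_algebra" where
  "wreath_product K A Q X ev =
     smash_product K (exp_hopf K A Q X ev) Q (exp_action K A Q X ev)"

definition wreath_proj ::
  "('k, 'm) ring_scheme \<Rightarrow> ('k, 'q, 'h) hopf_algebra_scheme \<Rightarrow> ('k, 'x) coalgebra
     \<Rightarrow> ('k, 'x, 'q) tensor \<Rightarrow> 'q" where
  "wreath_proj K Q X = tensor_lift K X Q Q (\<lambda>x q. counit X x \<odot>\<^bsub>Q\<^esub> q)"

text \<open>The copy \<open>A\<^sup>Q # 1\<close> of \<open>X = A\<^sup>Q\<close> in the wreath product, and \<open>x # 1 \<mapsto> x @ 1\<close> on it.\<close>

definition wreath_base ::
  "('k, 'm) ring_scheme \<Rightarrow> ('k, 'q, 'h) hopf_algebra_scheme \<Rightarrow> ('k, 'x) coalgebra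
     \<Rightarrow> ('k, 'x, 'q) tensor set" where
  "wreath_base K Q X = (\<lambda>x. pure_tensor K X Q x \<one>\<^bsub>Q\<^esub>) ` carrier X"

definition eval_one ::
  "('k, 'm) ring_scheme \<Rightarrow> ('k, 'q, 'h) hopf_algebra_scheme \<Rightarrow> ('k, 'x) coalgebra
     \<Rightarrow> (('k, 'x, 'q) tensor \<Rightarrow> 'a) \<Rightarrow> ('k, 'x, 'q) tensor \<Rightarrow> 'a" where
  "eval_one K Q X ev w =
     ev (pure_tensor K X Q (THE x. x \<in> carrier X \<and> w = pure_tensor K X Q x \<one>\<^bsub>Q\<^esub>) \<one>\<^bsub>Q\<^esub>)"

definition normalized_maps ::
  "('k, 'm) ring_scheme \<Rightarrow> ('k, 'a, 'g) hopf_algebra_scheme \<Rightarrow> ('k, 'q, 'h) hopf_algebra_scheme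
     \<Rightarrow> ('q \<Rightarrow> 'a) set" where
  "normalized_maps K A Q = {\<phi> \<in> coalgebra_hom K Q A. \<phi> \<one>\<^bsub>Q\<^esub> = \<one>\<^bsub>A\<^esub>}"

definition hat ::
  "('k, 'm) ring_scheme \<Rightarrow> ('k, 'a, 'g) hopf_algebra_scheme \<Rightarrow> ('k, 'q, 'h) hopf_algebra_scheme
     \<Rightarrow> ('k, 'x) coalgebra \<Rightarrow> (('k, 'x, 'q) tensor \<Rightarrow> 'a) \<Rightarrow> ('q \<Rightarrow> 'a) \<Rightarrow> 'x" where
  "hat K A Q X ev \<phi> = exp_curry K Q X ev (ground_coalgebra K) (\<lambda>a q. a \<odot>\<^bsub>A\<^esub> \<phi> q) \<one>\<^bsub>K\<^esub>"

definition wreath_Ad ::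
  "('k, 'm) ring_scheme \<Rightarrow> ('k, 'a, 'g) hopf_algebra_scheme \<Rightarrow> ('k, 'q, 'h) hopf_algebra_scheme
     \<Rightarrow> ('k, 'x) coalgebra \<Rightarrow> (('k, 'x, 'q) tensor \<Rightarrow> 'a) \<Rightarrow> ('q \<Rightarrow> 'a)
     \<Rightarrow> ('k, 'x, 'q) tensor \<Rightarrow> ('k, 'x, 'q) tensor" where
  "wreath_Ad K A Q X ev \<phi> z =
    (let W = wreath_product K A Q X ev; u = hat K A Q X ev \<phi> in
       pure_tensor K X Q u \<one>\<^bsub>Q\<^esub> \<otimes>\<^bsub>W\<^esub> z
         \<otimes>\<^bsub>W\<^esub> pure_tensor K X Q (antipode (exp_hopf K A Q X ev) u) \<one>\<^bsub>Q\<^esub>)"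


section \<open>Hopf subalgebras and extensions\<close>

text \<open>
  A tensor over \<open>E\<close> is not literally a tensor over an ambient space \<open>W \<supseteq> E\<close>, so
  \<open>E \<otimes> E\<close> enters through its (injective) canonical map to \<open>W \<otimes> W\<close>.
\<close>

definition sub_tensor_incl ::
  "('k, 'm) ring_scheme \<Rightarrow> ('k, 'a, 'h) hopf_algebra_scheme \<Rightarrow> 'a set
     \<Rightarrow> ('k, 'a, 'a) tensor \<Rightarrow> ('k, 'a, 'a) tensor" where
  "sub_tensor_incl K W E =
     tensor_map K (W\<lparr>carrier := E\<rparr>) (W\<lparr>carrier := E\<rparr>) W W (\<lambda>x. x) (\<lambda>x. x)"

definition sub_tensors ::
  "('k, 'm) ring_scheme \<Rightarrow> ('k, 'a, 'h) hopf_algebra_scheme \<Rightarrow> 'a set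
     \<Rightarrow> ('k, 'a, 'a) tensor set" where
  "sub_tensors K W E = carrier (tensor_module K (W\<lparr>carrier := E\<rparr>) (W\<lparr>carrier := E\<rparr>))"

definition hopf_subalgebra ::
  "('k, 'm) ring_scheme \<Rightarrow> ('k, 'a, 'h) hopf_algebra_scheme \<Rightarrow> 'a set \<Rightarrow> bool" where
  "hopf_subalgebra K W E \<longleftrightarrow>
     submodule E K W \<and> \<one>\<^bsub>W\<^esub> \<in> E \<and> (\<forall>x \<in> E. \<forall>y \<in> E. x \<otimes>\<^bsub>W\<^esub> y \<in> E) \<and>
     (\<forall>x \<in> E. comult W x \<in> sub_tensor_incl K W E ` sub_tensors K W E) \<and>
     (\<forall>x \<in> E. antipode W x \<in> E)"

definition sub_hopf ::
  "('k, 'm) ring_scheme \<Rightarrow> ('k, 'a) hopf_algebra \<Rightarrow> 'a set \<Rightarrow> ('k, 'a) hopf_algebra" where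
  "sub_hopf K W E = W\<lparr>carrier := E,
     comult := (\<lambda>x. THE t. t \<in> sub_tensors K W E \<and> sub_tensor_incl K W E t = comult W x)\<rparr>"

definition coinvariants ::
  "('k, 'm) ring_scheme \<Rightarrow> ('k, 'e, 'g) hopf_algebra_scheme \<Rightarrow> ('k, 'q, 'h) hopf_algebra_scheme
     \<Rightarrow> ('e \<Rightarrow> 'q) \<Rightarrow> 'e set" where
  "coinvariants K E Q \<pi> = {e \<in> carrier E.
     tensor_map K E E E Q (\<lambda>x. x) \<pi> (comult E e) = pure_tensor K E Q e \<one>\<^bsub>Q\<^esub>}"

type_synonym ('k, 'a, 'e, 'q) ext = "('k, 'e) hopf_algebra \<times> ('a \<Rightarrow> 'e) \<times> ('e \<Rightarrow> 'q)"

definition extension ::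
  "('k, 'm) ring_scheme \<Rightarrow> ('k, 'a, 'g) hopf_algebra_scheme \<Rightarrow> ('k, 'q, 'h) hopf_algebra_scheme
     \<Rightarrow> ('k, 'a, 'e, 'q) ext \<Rightarrow> bool" where
  "extension K A Q = (\<lambda>(E, \<iota>, \<pi>).
     cocomm_hopf_algebra K E \<and> \<iota> \<in> hopf_hom K A E \<and> \<pi> \<in> hopf_hom K E Q \<and>
     inj_on \<iota> (carrier A) \<and> \<pi> ` carrier E = carrier Q \<and>
     \<iota> ` carrier A = coinvariants K E Q \<pi> \<and>
     a_kernel E Q \<pi> = linear_span K E {e \<otimes>\<^bsub>E\<^esub> a | e a.
       e \<in> carrier E \<and> a \<in> \<iota> ` carrier A \<and> counit E a = \<zero>\<^bsub>K\<^esub>})"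

definition has_coalgebra_section ::
  "('k, 'm) ring_scheme \<Rightarrow> ('k, 'e, 'g) hopf_algebra_scheme \<Rightarrow> ('k, 'q, 'h) hopf_algebra_scheme
     \<Rightarrow> ('e \<Rightarrow> 'q) \<Rightarrow> bool" where
  "has_coalgebra_section K E Q \<pi> \<longleftrightarrow>
     (\<exists>\<gamma> \<in> coalgebra_hom K Q E. \<forall>q \<in> carrier Q. \<pi> (\<gamma> q) = q)"

definition split_extensions ::
  "('k, 'm) ring_scheme \<Rightarrow> ('k, 'a, 'g) hopf_algebra_scheme \<Rightarrow> ('k, 'q, 'h) hopf_algebra_scheme
     \<Rightarrow> ('k, 'a, 'e, 'q) ext set" where
  "split_extensions K A Q =
     {(E, \<iota>, \<pi>). extension K A Q (E, \<iota>, \<pi>) \<and> has_coalgebra_section K E Q \<pi>}"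

definition ext_equivalent ::
  "('k, 'm) ring_scheme \<Rightarrow> ('k, 'a, 'g) hopf_algebra_scheme
     \<Rightarrow> ('k, 'a, 'e, 'q) ext \<Rightarrow> ('k, 'a, 'f, 'q) ext \<Rightarrow> bool" where
  "ext_equivalent K A = (\<lambda>(E, \<iota>, \<pi>) (E', \<iota>', \<pi>'). \<exists>f \<in> hopf_iso K E E'.
     (\<forall>a \<in> carrier A. f (\<iota> a) = \<iota>' a) \<and> (\<forall>e \<in> carrier E. \<pi>' (f e) = \<pi> e))"

definition ext_rel ::
  "('k, 'm) ring_scheme \<Rightarrow> ('k, 'a, 'g) hopf_algebra_scheme \<Rightarrow> ('k, 'q, 'h) hopf_algebra_scheme
     \<Rightarrow> ('k, 'a, 'e, 'q) ext rel" where
  "ext_rel K A Q = {(X, Y). X \<in> split_extensions K A Q \<and> Y \<in> split_extensions K A Q \<and>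
     ext_equivalent K A X Y}"


section \<open>Admissible Hopf subalgebras of the wreath product\<close>

definition admissible ::
  "('k, 'm) ring_scheme \<Rightarrow> ('k, 'a, 'g) hopf_algebra_scheme \<Rightarrow> ('k, 'q, 'h) hopf_algebra_scheme
     \<Rightarrow> ('k, 'x) coalgebra \<Rightarrow> (('k, 'x, 'q) tensor \<Rightarrow> 'a) \<Rightarrow> ('k, 'x, 'q) tensor set set" where
  "admissible K A Q X ev =
    (let W = wreath_product K A Q X ev; \<tau> = wreath_proj K Q X in
     {E. hopf_subalgebra K W E \<and>
         has_coalgebra_section K (sub_hopf K W E) Q \<tau> \<and>
         eval_one K Q X ev
           \<in> hopf_iso K (sub_hopf K W (coinvariants K (sub_hopf K W E) Q \<tau>)) A})"

definition assoc_extension ::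
  "('k, 'm) ring_scheme \<Rightarrow> ('k, 'a, 'g) hopf_algebra_scheme \<Rightarrow> ('k, 'q, 'h) hopf_algebra_scheme
     \<Rightarrow> ('k, 'x) coalgebra \<Rightarrow> (('k, 'x, 'q) tensor \<Rightarrow> 'a) \<Rightarrow> ('k, 'x, 'q) tensor set
     \<Rightarrow> ('k, 'a, ('k, 'x, 'q) tensor, 'q) ext" where
  "assoc_extension K A Q X ev E =
    (let W = wreath_product K A Q X ev; \<tau> = wreath_proj K Q X; E' = sub_hopf K W E in
       (E', inv_into (coinvariants K E' Q \<tau>) (eval_one K Q X ev), \<tau>))"

definition conj_rel ::
  "('k, 'm) ring_scheme \<Rightarrow> ('k, 'a, 'g) hopf_algebra_scheme \<Rightarrow> ('k, 'q, 'h) hopf_algebra_scheme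
     \<Rightarrow> ('k, 'x) coalgebra \<Rightarrow> (('k, 'x, 'q) tensor \<Rightarrow> 'a) \<Rightarrow> ('k, 'x, 'q) tensor set rel" where
  "conj_rel K A Q X ev =
     {(E, E'). E \<in> admissible K A Q X ev \<and> E' \<in> admissible K A Q X ev \<and>
        (\<exists>\<phi> \<in> normalized_maps K A Q. E' = wreath_Ad K A Q X ev \<phi> ` E)}"

end

theory Submission
  imports Defs
begin

text \<open>
  A cocommutative Hopf algebra \<open>H\<close> is a group object in the cartesian category of cocommutative
  coalgebras: for every test coalgebra \<open>C\<close> the coalgebra maps \<open>C \<rightarrow> H\<close> form a group under convolution,
  and identities between coalgebra maps may be checked on such points. On points, \<open>A\<^sup>Q\<close> is a group of
  functions and \<open>A \<wr> Q\<close> a semidirect product, so the Kaloujnine--Krasner argument applies: a section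
  \<open>\<gamma>\<close> of \<open>\<pi>\<close>, normalised by \<open>\<gamma>(1) = 1\<close>, embeds \<open>E\<close> by sending \<open>e\<close> to \<open>\<beta>(e)\<close> over \<open>\<pi>(e)\<close>, where
  \<open>\<beta>(e)\<close> is the function \<open>q \<mapsto> \<gamma>(q) e \<gamma>(q \<pi>(e))\<inverse>\<close>. Conversely an admissible \<open>E\<close> contains its sections, so
  every point of \<open>E\<close> is determined by evaluations at \<open>1\<close>; comparing the evaluations of two
  equivalent admissible subalgebras along a section yields the normalised map conjugating them.
  The condition \<open>ker \<pi> = E \<iota>(A)\<^sup>+\<close> is automatic for coalgebra-split sequences.
\<close>

text \<open>An element of \<open>A^Q\<close> is not determined by its values at elements of
  \<open>Q\<close>, so identities in the wreath product cannot be checked value by value. A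
  coalgebra map from \<open>R\<close> to \<open>A^Q\<close> is determined by its value at the
  generic point of \<open>Q\<close> over \<open>R\<close>, the second projection of
  \<open>R \<otimes> Q\<close>; this is \<open>X_eqI\<close>, and it is why points replace elements
  throughout. The price is that every map in an argument must be known to be a coalgebra map. For
  the antipode of an abstract Hopf algebra this is no axiom and is derived from shear maps. For
  subobjects it rests on linear retractions, hence on \<open>K\<close> being a field: a tensor over
  \<open>E\<close> is no tensor over \<open>W\<close>, and only injectivity of the comparison map
  lets structure be pulled back.

  The universal property of the exponential is available only for test coalgebras carried by the
  type \<open>'u\<close>. The test coalgebras to which it is applied are therefore kept small enough
  to embed there, and existence and uniqueness of transposes are carried along the embedding; tensor
  products stay small because the universe is infinite.\<close>

named_theorems lin_intros

section \<open>Linear maps and tensor products\<close>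

text \<open>Composition is cut down to the carrier of the source, so that equality of coalgebra maps
  is plain equality of functions and extensional maps are closed under composition.\<close>

abbreviation cmp :: "('a, 'z) partial_object_scheme \<Rightarrow> ('b \<Rightarrow> 'c) \<Rightarrow> ('a \<Rightarrow> 'b) \<Rightarrow> 'a \<Rightarrow> 'c" where
  "cmp C \<equiv> compose (carrier C)"

definition bilinear_maps ::
  "('k, 'm) ring_scheme \<Rightarrow> ('k, 'a, 'v) module_scheme \<Rightarrow> ('k, 'b, 'w) module_scheme
     \<Rightarrow> ('k, 'c, 'u) module_scheme \<Rightarrow> ('a \<Rightarrow> 'b \<Rightarrow> 'c) set" where
  "bilinear_maps K V W U = {\<beta>. (\<forall>w \<in> carrier W. (\<lambda>v. \<beta> v w) \<in> linear_maps K V U) \<and>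
     (\<forall>v \<in> carrier V. \<beta> v \<in> linear_maps K W U)}"

lemma bilI:
  assumes "\<And>w. w \<in> carrier W \<Longrightarrow> (\<lambda>v. \<beta> v w) \<in> linear_maps K V U"
    and "\<And>v. v \<in> carrier V \<Longrightarrow> (\<lambda>w. \<beta> v w) \<in> linear_maps K W U"
  shows "\<beta> \<in> bilinear_maps K V W U"
  using assms by (simp add: bilinear_maps_def)

lemma bilD:
  assumes "\<beta> \<in> bilinear_maps K V W U"
  shows "w \<in> carrier W \<Longrightarrow> (\<lambda>v. \<beta> v w) \<in> linear_maps K V U"
    and "v \<in> carrier V \<Longrightarrow> (\<lambda>w. \<beta> v w) \<in> linear_maps K W U"
  using assms by (simp_all add: bilinear_maps_def)

lemma linI:
  assumes "\<And>x. x \<in> carrier V \<Longrightarrow> f x \<in> carrier W"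
    and "\<And>x y. x \<in> carrier V \<Longrightarrow> y \<in> carrier V \<Longrightarrow> f (x \<oplus>\<^bsub>V\<^esub> y) = f x \<oplus>\<^bsub>W\<^esub> f y"
    and "\<And>a x. a \<in> carrier K \<Longrightarrow> x \<in> carrier V \<Longrightarrow> f (a \<odot>\<^bsub>V\<^esub> x) = a \<odot>\<^bsub>W\<^esub> f x"
  shows "f \<in> linear_maps K V W"
  using assms by (auto simp: linear_maps_def)

lemma lin_closed: "f \<in> linear_maps K V W \<Longrightarrow> x \<in> carrier V \<Longrightarrow> f x \<in> carrier W"
  by (auto simp: linear_maps_def)

lemma lin_add:
  "f \<in> linear_maps K V W \<Longrightarrow> x \<in> carrier V \<Longrightarrow> y \<in> carrier V \<Longrightarrow> f (x \<oplus>\<^bsub>V\<^esub> y) = f x \<oplus>\<^bsub>W\<^esub> f y"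
  by (auto simp: linear_maps_def)

lemma lin_smult:
  "f \<in> linear_maps K V W \<Longrightarrow> a \<in> carrier K \<Longrightarrow> x \<in> carrier V \<Longrightarrow> f (a \<odot>\<^bsub>V\<^esub> x) = a \<odot>\<^bsub>W\<^esub> f x"
  by (auto simp: linear_maps_def)

lemma bil_closed:
  "\<beta> \<in> bilinear_maps K V W U \<Longrightarrow> v \<in> carrier V \<Longrightarrow> w \<in> carrier W \<Longrightarrow> \<beta> v w \<in> carrier U"
  by (auto simp: bilinear_maps_def linear_maps_def)

lemma lin_comp:
  "f \<in> linear_maps K V W \<Longrightarrow> g \<in> linear_maps K U V \<Longrightarrow> (\<lambda>x. f (g x)) \<in> linear_maps K U W"
  by (rule linI) (auto simp: lin_closed lin_add lin_smult)

lemma lin_id: "(\<lambda>x. x) \<in> linear_maps K V V"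
  by (auto simp: linear_maps_def)

lemma lin_cong:
  assumes "f \<in> linear_maps K V W" "module K V" "\<And>x. x \<in> carrier V \<Longrightarrow> f x = g x"
  shows "g \<in> linear_maps K V W"
proof -
  interpret module K V by fact
  show ?thesis using assms by (auto simp: linear_maps_def Pi_iff)
qed

text \<open>Only the carrier, addition and scalar multiplication of a module record enter linear maps
  and tensor products, so coalgebra records may replace module records freely.\<close>

definition same_module :: "('k, 'a, 'v) module_scheme \<Rightarrow> ('k, 'a, 'w) module_scheme \<Rightarrow> bool" where
  "same_module V W \<longleftrightarrow> carrier V = carrier W \<and> zero V = zero W \<and> add V = add W \<and> smult V = smult W"

lemma same_sym: "same_module V W \<Longrightarrow> same_module W V"
  by (simp add: same_module_def)

lemma same_lin:
  assumes "same_module V V'" "same_module W W'"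
  shows "linear_maps K V W = linear_maps K V' W'"
  using assms by (simp add: same_module_def linear_maps_def)

lemma same_tensor:
  assumes "same_module V V'" "same_module W W'"
  shows "tensor_module K V W = tensor_module K V' W'"
    and "pure_tensor K V W = pure_tensor K V' W'"
proof -
  have *: "tensor_null K V W = tensor_null K V' W'"
    using assms by (simp add: same_module_def tensor_null_def tensor_relations_def)
  show "tensor_module K V W = tensor_module K V' W'" "pure_tensor K V W = pure_tensor K V' W'"
    using assms by (auto simp: same_module_def tensor_module_def pure_tensor_def * fun_eq_iff)
qed

lemma same_tl:
  assumes "same_module V V'" "same_module W W'" "same_module U U'"
  shows "tensor_lift K V W U = tensor_lift K V' W' U'"
  using assms same_tensor[OF assms(1,2), of K]
    same_lin[of "tensor_module K V' W'" "tensor_module K V' W'" U U' K]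
  by (auto simp: same_module_def tensor_lift_def fun_eq_iff)

lemma same_tm:
  assumes "same_module V1 V2" "same_module W1 W2" "same_module V1' V2'" "same_module W1' W2'"
  shows "tensor_map K V1 W1 V1' W1' f g = tensor_map K V2 W2 V2' W2' f g"
  using same_tensor[OF assms(3,4), of K]
    same_tl[OF assms(1,2), of "tensor_module K V2' W2'" "tensor_module K V2' W2'" K]
  by (simp add: tensor_map_def same_module_def)

locale kvec =
  fixes K :: "('k, 'm) ring_scheme"
  assumes field_K: "field K"
begin

abbreviation sub where "sub \<equiv> sub_hopf K"
abbreviation hhom where "hhom \<equiv> hopf_hom K"
abbreviation hiso where "hiso \<equiv> hopf_iso K"
abbreviation hsub where "hsub \<equiv> hopf_subalgebra K"
abbreviation exteq where "exteq \<equiv> ext_equivalent K"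
abbreviation splits where "splits \<equiv> split_extensions K"
abbreviation free where "free \<equiv> free_module K"
abbreviation md where "md \<equiv> module K"
abbreviation lin where "lin \<equiv> linear_maps K"
abbreviation bil where "bil \<equiv> bilinear_maps K"
abbreviation T where "T \<equiv> tensor_module K"
abbreviation pt where "pt \<equiv> pure_tensor K"
abbreviation tl where "tl \<equiv> tensor_lift K"
abbreviation tm where "tm \<equiv> tensor_map K"
abbreviation G where "G \<equiv> ground_module K"
abbreviation sw where "sw \<equiv> sweedler K"
abbreviation coalg where "coalg \<equiv> cocomm_coalgebra K"
abbreviation chom where "chom \<equiv> coalgebra_hom K"

lemma cring_K: "cring K"
  using field_K by (simp add: field_def domain_def)

lemma same_module_module:
  assumes "same_module V W" "md V"
  shows "md W"
proof -
  interpret V: module K V by fact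
  have eq: "carrier W = carrier V" "zero W = zero V" "add W = add V" "smult W = smult V"
    using assms(1) by (simp_all add: same_module_def)
  have "abelian_group W"
    by (rule abelian_groupI)
      (use V.a_closed V.zero_closed V.a_assoc V.a_comm V.l_zero V.a_inv_closed V.l_neg in
        \<open>auto simp: eq intro: bexI[of _ "\<ominus>\<^bsub>V\<^esub> _"]\<close>)
  then show ?thesis
    using V.smult_closed V.smult_l_distr V.smult_r_distr V.smult_assoc1 V.smult_one cring_K
    by (auto intro!: moduleI simp: eq)
qed

lemma lin_zero:
  fixes V (structure)
  assumes "f \<in> lin V W" "md V" "md W"
  shows "f \<zero> = \<zero>\<^bsub>W\<^esub>"
proof -
  interpret V: module K V by fact
  interpret W: module K W by fact
  have "f (\<zero>\<^bsub>K\<^esub> \<odot> \<zero>) = \<zero>\<^bsub>K\<^esub> \<odot>\<^bsub>W\<^esub> f \<zero>"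
    using assms(1) by (intro lin_smult) auto
  then show ?thesis using assms(1) by (simp add: lin_closed)
qed

lemma lin_uminus:
  fixes V (structure)
  assumes "f \<in> lin V W" "md V" "md W" "x \<in> carrier V"
  shows "f (\<ominus> x) = \<ominus>\<^bsub>W\<^esub> f x"
proof -
  interpret V: module K V by fact
  interpret W: module K W by fact
  have "f x \<oplus>\<^bsub>W\<^esub> f (\<ominus> x) = \<zero>\<^bsub>W\<^esub>"
    using assms lin_add[OF assms(1), of x "\<ominus> x"] by (simp add: V.r_neg lin_zero)
  then show ?thesis
    using assms by (metis W.minus_equality W.a_comm V.a_inv_closed lin_closed)
qed

lemma lin_minus:
  assumes "f \<in> lin V W" "md V" "md W" "x \<in> carrier V" "y \<in> carrier V"
  shows "f (x \<ominus>\<^bsub>V\<^esub> y) = f x \<ominus>\<^bsub>W\<^esub> f y"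
proof -
  interpret V: module K V by fact
  show ?thesis using assms by (simp add: a_minus_def lin_add[OF assms(1)] lin_uminus)
qed

lemma submodule_lin_vimage:
  assumes "f \<in> lin V W" "md V" "md W" "submodule N K W"
  shows "submodule {x \<in> carrier V. f x \<in> N} K V"
proof -
  interpret V: module K V by fact
  interpret W: module K W by fact
  note N = W.submoduleE[OF assms(4)]
  have "\<zero>\<^bsub>W\<^esub> \<in> N" using N(1-3,5) by (metis W.l_neg all_not_in_conv subsetD)
  then show ?thesis
    using N assms by (intro V.submoduleI)
      (auto simp: lin_zero lin_uminus lin_add lin_smult)
qed

lemma zero_submodule:
  assumes "md V" shows "submodule {\<zero>\<^bsub>V\<^esub>} K V"
proof -
  interpret V: module K V by fact
  show ?thesis by (intro V.submoduleI) auto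
qed

lemma submodule_lin_image:
  fixes W (structure)
  assumes "f \<in> lin V W" "md V" "md W"
  shows "submodule (f ` carrier V) K W"
proof -
  interpret V: module K V by fact
  interpret W: module K W by fact
  show ?thesis
  proof (rule W.submoduleI)
    show "\<zero> \<in> f ` carrier V" using lin_zero[OF assms] by force
    show "\<ominus> a \<in> f ` carrier V" if "a \<in> f ` carrier V" for a
      using that by (auto simp: lin_uminus[OF assms, symmetric])
    show "a \<oplus> b \<in> f ` carrier V" if "a \<in> f ` carrier V" "b \<in> f ` carrier V" for a b
      using that by (auto simp: lin_add[OF assms(1), symmetric])
    show "a \<odot> b \<in> f ` carrier V" if "a \<in> carrier K" "b \<in> f ` carrier V" for a b
      using that by (auto simp: lin_smult[OF assms(1), symmetric])
  qed (use assms(1) in \<open>auto simp: lin_closed\<close>)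
qed

lemma lin_span_submodule:
  assumes "md V" "S \<subseteq> carrier V"
  shows "submodule (linear_span K V S) K V"
proof -
  interpret V: module K V by fact
  have z: "\<zero>\<^bsub>V\<^esub> \<in> N" if "submodule N K V" for N
    using V.submoduleE[OF that] by (metis V.l_neg all_not_in_conv subsetD)
  show ?thesis
  proof (rule V.submoduleI)
    show "linear_span K V S \<subseteq> carrier V"
      using V.carrier_is_submodule assms(2) by (auto simp: linear_span_def)
  qed (auto simp: linear_span_def z V.submoduleE)
qed

lemma lin_span_superset: "S \<subseteq> linear_span K V S"
  by (auto simp: linear_span_def)

lemma lin_span_minimal: "submodule N K V \<Longrightarrow> S \<subseteq> N \<Longrightarrow> linear_span K V S \<subseteq> N"
  by (auto simp: linear_span_def)

subsection \<open>Free modules and quotients\<close>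

lemma free_simps:
  "zero (free X) = (\<lambda>_. \<zero>\<^bsub>K\<^esub>)"
  "f \<oplus>\<^bsub>free X\<^esub> g = (\<lambda>x. f x \<oplus>\<^bsub>K\<^esub> g x)"
  "a \<odot>\<^bsub>free X\<^esub> f = (\<lambda>x. a \<otimes>\<^bsub>K\<^esub> f x)"
  by (simp_all add: free_module_def)

lemma free_carrier:
  "f \<in> carrier (free X) \<longleftrightarrow>
    (\<forall>x. f x \<in> carrier K) \<and> {x. f x \<noteq> \<zero>\<^bsub>K\<^esub>} \<subseteq> X \<and> finite {x. f x \<noteq> \<zero>\<^bsub>K\<^esub>}"
proof -
  interpret K: cring K by (rule cring_K)
  show ?thesis
    using K.zero_closed by (auto simp: free_module_def image_subset_iff)
qed

lemma free_memD: "f \<in> carrier (free X) \<Longrightarrow> f x \<in> carrier K"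
  by (simp add: free_carrier)

lemma module_free: "md (free X)"
proof -
  interpret K: cring K by (rule cring_K)
  let ?F = "free X"
  have add: "(\<lambda>x. f x \<oplus>\<^bsub>K\<^esub> g x) \<in> carrier ?F" if "f \<in> carrier ?F" "g \<in> carrier ?F" for f g
  proof -
    have "{x. f x \<oplus>\<^bsub>K\<^esub> g x \<noteq> \<zero>\<^bsub>K\<^esub>} \<subseteq> {x. f x \<noteq> \<zero>\<^bsub>K\<^esub>} \<union> {x. g x \<noteq> \<zero>\<^bsub>K\<^esub>}" by auto
    then show ?thesis using that by (auto simp: free_carrier intro: finite_subset)
  qed
  have smult: "(\<lambda>x. a \<otimes>\<^bsub>K\<^esub> f x) \<in> carrier ?F" if "a \<in> carrier K" "f \<in> carrier ?F" for a f
  proof -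
    have "{x. a \<otimes>\<^bsub>K\<^esub> f x \<noteq> \<zero>\<^bsub>K\<^esub>} \<subseteq> {x. f x \<noteq> \<zero>\<^bsub>K\<^esub>}" using that by auto
    then show ?thesis using that by (auto simp: free_carrier intro: finite_subset)
  qed
  have uminus: "(\<lambda>x. \<ominus>\<^bsub>K\<^esub> f x) \<in> carrier ?F" if "f \<in> carrier ?F" for f
  proof -
    have "{x. \<ominus>\<^bsub>K\<^esub> f x \<noteq> \<zero>\<^bsub>K\<^esub>} \<subseteq> {x. f x \<noteq> \<zero>\<^bsub>K\<^esub>}" by auto
    then show ?thesis using that by (auto simp: free_carrier intro: finite_subset)
  qed
  have "abelian_group ?F"
  proof (rule abelian_groupI)
    show "\<exists>g\<in>carrier ?F. g \<oplus>\<^bsub>?F\<^esub> f = \<zero>\<^bsub>?F\<^esub>" if "f \<in> carrier ?F" for f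
      by (rule bexI[OF _ uminus[OF that]]) (simp add: free_simps K.l_neg free_memD[OF that])
  next
    fix x y z assume "x \<in> carrier ?F" "y \<in> carrier ?F" "z \<in> carrier ?F"
    note free_memD[OF this(1), simp] free_memD[OF this(2), simp] free_memD[OF this(3), simp]
    show "x \<oplus>\<^bsub>?F\<^esub> y \<oplus>\<^bsub>?F\<^esub> z = x \<oplus>\<^bsub>?F\<^esub> (y \<oplus>\<^bsub>?F\<^esub> z)" by (simp add: free_simps K.a_assoc)
  next
    fix x y assume "x \<in> carrier ?F" "y \<in> carrier ?F"
    note free_memD[OF this(1), simp] free_memD[OF this(2), simp]
    show "x \<oplus>\<^bsub>?F\<^esub> y = y \<oplus>\<^bsub>?F\<^esub> x" by (simp add: free_simps K.a_comm)
  next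
    fix x assume "x \<in> carrier ?F"
    then show "\<zero>\<^bsub>?F\<^esub> \<oplus>\<^bsub>?F\<^esub> x = x" by (simp add: free_simps free_memD)
  qed (auto simp: free_simps add free_carrier[of "\<lambda>_. \<zero>\<^bsub>K\<^esub>"])
  then show ?thesis
    by (rule moduleI[OF cring_K])
      (auto simp: free_simps smult fun_eq_iff K.l_distr K.r_distr K.m_assoc free_memD[where X = X])
qed

lemma free_gen_closed: "p \<in> X \<Longrightarrow> free_gen K p \<in> carrier (free X)"
proof -
  interpret K: field K by (rule field_K)
  assume "p \<in> X"
  then show ?thesis by (auto simp: free_carrier free_gen_def)
qed

text \<open>Induction on a finite set containing the support: clearing the value at one point
  \<open>p\<close> shrinks that set and splits off a single multiple of a generator.\<close>

lemma free_induct [consumes 1, case_names zero gen add]: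
  assumes "f \<in> carrier (free X)"
    and zero: "P \<zero>\<^bsub>free X\<^esub>"
    and gen: "\<And>a p. a \<in> carrier K \<Longrightarrow> p \<in> X \<Longrightarrow> P (a \<odot>\<^bsub>free X\<^esub> free_gen K p)"
    and add: "\<And>f g. f \<in> carrier (free X) \<Longrightarrow> g \<in> carrier (free X) \<Longrightarrow>
      P f \<Longrightarrow> P g \<Longrightarrow> P (f \<oplus>\<^bsub>free X\<^esub> g)"
  shows "P f"
proof -
  interpret K: cring K by (rule cring_K)
  interpret F: module K "free_module K X" by (rule module_free)
  have "P f" if "finite S" "f \<in> carrier (free X)" "{x. f x \<noteq> \<zero>\<^bsub>K\<^esub>} \<subseteq> S" for f S
    using that
  proof (induction S arbitrary: f rule: finite_induct)
    case empty
    then have "f = \<zero>\<^bsub>free X\<^esub>" by (auto simp: free_simps)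
    then show ?case using zero by simp
  next
    case (insert p S)
    let ?g = "f(p := \<zero>\<^bsub>K\<^esub>)"
    have "{x. ?g x \<noteq> \<zero>\<^bsub>K\<^esub>} \<subseteq> {x. f x \<noteq> \<zero>\<^bsub>K\<^esub>}" by auto
    then have g: "?g \<in> carrier (free X)"
      using insert.prems(1) by (auto simp: free_carrier intro: finite_subset)
    have Pg: "P ?g" using insert.prems by (intro insert.IH g) auto
    show ?case
    proof (cases "p \<in> X")
      case True
      have fp: "f p \<in> carrier K" by (rule free_memD[OF insert.prems(1)])
      have "f = ?g \<oplus>\<^bsub>free X\<^esub> (f p \<odot>\<^bsub>free X\<^esub> free_gen K p)"
        using fp free_memD[OF insert.prems(1)] by (auto simp: free_simps free_gen_def fun_eq_iff)
      then show ?thesis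
        using add[OF g _ Pg gen[OF fp True]] fp True by (simp add: free_gen_closed)
    next
      case False
      then have "f p = \<zero>\<^bsub>K\<^esub>" using insert.prems(1) by (auto simp: free_carrier)
      then have "?g = f" by (simp add: fun_eq_iff)
      then show ?thesis using Pg by simp
    qed
  qed
  then show ?thesis using assms(1) by (auto simp: free_carrier)
qed

text \<open>The lift sums \<open>f x\<close> times \<open>b x\<close> over the support of
  \<open>f\<close>. Supports vary with \<open>f\<close>, so the sum is rewritten over any finite
  superset; additivity is then checked over the union of two supports.\<close>

lemma free_lift_exists:
  fixes U (structure)
  assumes U: "md U" and b: "\<And>x. x \<in> X \<Longrightarrow> b x \<in> carrier U"
  shows "\<exists>f \<in> lin (free X) U. \<forall>x \<in> X. f (free_gen K x) = b x"
proof -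
  interpret K: field K by (rule field_K)
  interpret U: module K U by fact
  interpret F: module K "free_module K X" by (rule module_free)
  define L where "L f = finsum U (\<lambda>x. f x \<odot> b x) {x. f x \<noteq> \<zero>\<^bsub>K\<^esub>}" for f
  have L: "L f = finsum U (\<lambda>x. f x \<odot> b x) S"
    if "f \<in> carrier (free X)" "finite S" "{x. f x \<noteq> \<zero>\<^bsub>K\<^esub>} \<subseteq> S" "S \<subseteq> X" for f S
    unfolding L_def using that b
    by (intro U.add.finprod_mono_neutral_cong_left) (auto simp: free_memD[OF that(1)])
  have "L \<in> lin (free X) U"
  proof (rule linI)
    fix f assume f: "f \<in> carrier (free X)"
    then show "L f \<in> carrier U"
      unfolding L_def using b by (intro U.finsum_closed) (auto simp: free_carrier)
    fix g assume g: "g \<in> carrier (free X)"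
    let ?S = "{x. f x \<noteq> \<zero>\<^bsub>K\<^esub>} \<union> {x. g x \<noteq> \<zero>\<^bsub>K\<^esub>}"
    have S: "finite ?S" "?S \<subseteq> X" using f g by (auto simp: free_carrier)
    have "L (f \<oplus>\<^bsub>free X\<^esub> g) = finsum U (\<lambda>x. (f x \<oplus>\<^bsub>K\<^esub> g x) \<odot> b x) ?S"
      using S f g by (subst L[of _ ?S]) (auto simp: free_simps F.a_closed[unfolded free_simps])
    also have "\<dots> = finsum U (\<lambda>x. f x \<odot> b x \<oplus> g x \<odot> b x) ?S"
      using S b f g by (intro U.finsum_cong') (auto simp: U.smult_l_distr free_memD[where X = X])
    also have "\<dots> = L f \<oplus> L g"
      using S b f g by (subst U.finsum_addf) (auto simp: L[of _ ?S] free_memD[where X = X])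
    finally show "L (f \<oplus>\<^bsub>free X\<^esub> g) = L f \<oplus> L g" .
  next
    fix a f assume a: "a \<in> carrier K" and f: "f \<in> carrier (free X)"
    let ?S = "{x. f x \<noteq> \<zero>\<^bsub>K\<^esub>}"
    have S: "finite ?S" "?S \<subseteq> X" using f by (auto simp: free_carrier)
    have "L (a \<odot>\<^bsub>free X\<^esub> f) = finsum U (\<lambda>x. (a \<otimes>\<^bsub>K\<^esub> f x) \<odot> b x) ?S"
      using S f a by (subst L[of _ ?S]) (auto simp: free_simps F.smult_closed[unfolded free_simps])
    also have "\<dots> = finsum U (\<lambda>x. a \<odot> (f x \<odot> b x)) ?S"
      using S b f a by (intro U.finsum_cong') (auto simp: U.smult_assoc1 free_memD[where X = X])
    also have "\<dots> = a \<odot> L f"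
      unfolding L_def using S b f a by (subst U.finsum_smult_ldistr) (auto simp: free_memD[where X = X])
    finally show "L (a \<odot>\<^bsub>free X\<^esub> f) = a \<odot> L f" .
  qed
  moreover have "L (free_gen K x) = b x" if "x \<in> X" for x
    using that b by (subst L[OF free_gen_closed[OF that], of "{x}"]) (auto simp: free_gen_def)
  ultimately show ?thesis by blast
qed

lemma submodule_abelian_subgroup:
  assumes "md M" "submodule N K M"
  shows "abelian_subgroup N M"
proof -
  interpret M: module K M by fact
  show ?thesis
    by (rule abelian_subgroupI3)
      (use assms(2) in \<open>simp_all add: additive_subgroup_def submodule_def M.abelian_group_axioms\<close>)
qed

lemma quotient_facts:
  assumes M: "md M" and N: "submodule N K M"
  shows "md (quotient_module M N)"
    and "(\<lambda>x. N +>\<^bsub>M\<^esub> x) \<in> lin M (quotient_module M N)"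
    and "carrier (quotient_module M N) = (\<lambda>x. N +>\<^bsub>M\<^esub> x) ` carrier M"
proof -
  interpret M: module K M by fact
  interpret N: abelian_subgroup N M by (rule submodule_abelian_subgroup[OF M N])
  let ?Q = "quotient_module M N"
  have car: "carrier ?Q = (\<lambda>x. N +>\<^bsub>M\<^esub> x) ` carrier M"
    by (auto simp: quotient_module_def A_RCOSETS_def')
  have zero: "\<zero>\<^bsub>?Q\<^esub> = N +>\<^bsub>M\<^esub> \<zero>\<^bsub>M\<^esub>"
    using M.a_coset_add_zero[OF N.a_subset] by (simp add: quotient_module_def)
  have add: "(N +>\<^bsub>M\<^esub> x) \<oplus>\<^bsub>?Q\<^esub> (N +>\<^bsub>M\<^esub> y) = N +>\<^bsub>M\<^esub> (x \<oplus>\<^bsub>M\<^esub> y)"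
    if "x \<in> carrier M" "y \<in> carrier M" for x y
    using N.a_rcos_sum[OF that] by (simp add: quotient_module_def)
  \<comment> \<open>Scaling a coset by \<open>a = 0\<close> yields only the zero element and not a
    coset; adding \<open>N\<close> afterwards repairs this, and for every \<open>a\<close> the
    result is the coset of the scaled representative.\<close>
  have smult: "a \<odot>\<^bsub>?Q\<^esub> (N +>\<^bsub>M\<^esub> x) = N +>\<^bsub>M\<^esub> (a \<odot>\<^bsub>M\<^esub> x)"
    if a: "a \<in> carrier K" and x: "x \<in> carrier M" for a x
  proof -
    have "N <+>\<^bsub>M\<^esub> ((\<lambda>x. a \<odot>\<^bsub>M\<^esub> x) ` (N +>\<^bsub>M\<^esub> x)) = N +>\<^bsub>M\<^esub> (a \<odot>\<^bsub>M\<^esub> x)"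
    proof (intro equalityI subsetI)
      fix z assume "z \<in> N <+>\<^bsub>M\<^esub> ((\<lambda>x. a \<odot>\<^bsub>M\<^esub> x) ` (N +>\<^bsub>M\<^esub> x))"
      then obtain n m where nm: "n \<in> N" "m \<in> N" "z = n \<oplus>\<^bsub>M\<^esub> (a \<odot>\<^bsub>M\<^esub> (m \<oplus>\<^bsub>M\<^esub> x))"
        by (auto simp: set_add_def' a_r_coset_def')
      then have "z = (n \<oplus>\<^bsub>M\<^esub> a \<odot>\<^bsub>M\<^esub> m) \<oplus>\<^bsub>M\<^esub> a \<odot>\<^bsub>M\<^esub> x"
        using a x by (simp add: M.smult_r_distr M.a_assoc)
      moreover have "n \<oplus>\<^bsub>M\<^esub> a \<odot>\<^bsub>M\<^esub> m \<in> N"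
        using nm a by (metis M.submoduleE(4,5)[OF N])
      ultimately show "z \<in> N +>\<^bsub>M\<^esub> (a \<odot>\<^bsub>M\<^esub> x)"
        unfolding a_r_coset_def' by blast
    next
      fix z assume "z \<in> N +>\<^bsub>M\<^esub> (a \<odot>\<^bsub>M\<^esub> x)"
      then obtain n where "n \<in> N" "z = n \<oplus>\<^bsub>M\<^esub> a \<odot>\<^bsub>M\<^esub> x" by (auto simp: a_r_coset_def')
      moreover have "x \<in> N +>\<^bsub>M\<^esub> x" by (rule N.a_rcos_self[OF x])
      ultimately show "z \<in> N <+>\<^bsub>M\<^esub> ((\<lambda>x. a \<odot>\<^bsub>M\<^esub> x) ` (N +>\<^bsub>M\<^esub> x))"
        by (auto simp: set_add_def')
    qed
    then show ?thesis by (simp add: quotient_module_def)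
  qed
  have "abelian_group ?Q"
  proof (rule abelian_groupI)
    show "\<exists>y\<in>carrier ?Q. y \<oplus>\<^bsub>?Q\<^esub> x = \<zero>\<^bsub>?Q\<^esub>" if "x \<in> carrier ?Q" for x
    proof -
      obtain m where "m \<in> carrier M" "x = N +>\<^bsub>M\<^esub> m" using \<open>x \<in> carrier ?Q\<close> by (auto simp: car)
      then show ?thesis
        by (intro bexI[of _ "N +>\<^bsub>M\<^esub> (\<ominus>\<^bsub>M\<^esub> m)"]) (auto simp: car add zero M.l_neg)
    qed
  qed (auto simp: car add zero M.a_assoc M.a_comm M.a_lcomm)
  then show "md ?Q"
    by (rule moduleI[OF cring_K])
      (auto simp: car add smult M.smult_l_distr M.smult_r_distr M.smult_assoc1)
  show "(\<lambda>x. N +>\<^bsub>M\<^esub> x) \<in> lin M ?Q"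
    by (rule linI) (auto simp: car add smult)
  show "carrier ?Q = (\<lambda>x. N +>\<^bsub>M\<^esub> x) ` carrier M" by (rule car)
qed

lemma quotient_lift_exists:
  assumes M: "md M" and N: "submodule N K M" and U: "md U"
    and f: "f \<in> lin M U" and fN: "\<And>x. x \<in> N \<Longrightarrow> f x = \<zero>\<^bsub>U\<^esub>"
  shows "\<exists>g \<in> lin (quotient_module M N) U. \<forall>x \<in> carrier M. g (N +>\<^bsub>M\<^esub> x) = f x"
proof -
  interpret M: module K M by fact
  interpret U: module K U by fact
  interpret N: abelian_subgroup N M by (rule submodule_abelian_subgroup[OF M N])
  note q = quotient_facts[OF M N]
  define g where "g X = f (SOME x. x \<in> X)" for X
  have g: "g (N +>\<^bsub>M\<^esub> x) = f x" if x: "x \<in> carrier M" for x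
  proof -
    have "(SOME y. y \<in> N +>\<^bsub>M\<^esub> x) \<in> N +>\<^bsub>M\<^esub> x"
      using N.a_rcos_self[OF x] by (rule someI)
    then obtain n where "n \<in> N" "(SOME y. y \<in> N +>\<^bsub>M\<^esub> x) = n \<oplus>\<^bsub>M\<^esub> x"
      by (auto simp: a_r_coset_def')
    then show ?thesis
      using x f fN by (simp add: g_def lin_add lin_closed)
  qed
  have "g \<in> lin (quotient_module M N) U"
    by (rule linI)
      (use f in \<open>auto simp: q(3) g lin_closed lin_add lin_smult
        lin_add[OF q(2), symmetric] lin_smult[OF q(2), symmetric]\<close>)
  then show ?thesis using g by blast
qed

subsection \<open>The universal property of the tensor product\<close>

lemma tensor_relations_subset:
  assumes "md V" "md W"
  shows "tensor_relations K V W \<subseteq> carrier (free (carrier V \<times> carrier W))"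
proof -
  interpret V: module K V by fact
  interpret W: module K W by fact
  interpret F: module K "free_module K (carrier V \<times> carrier W)" by (rule module_free)
  show ?thesis
    unfolding tensor_relations_def Let_def
    by (safe; intro F.minus_closed F.a_closed F.smult_closed free_gen_closed) auto
qed

lemma tensor_relationsI:
  fixes F (structure) and V :: "('k, 'a, 'v) module_scheme" and W :: "('k, 'b, 'w) module_scheme"
  defines "F \<equiv> free (carrier V \<times> carrier W)"
  shows "v \<in> carrier V \<Longrightarrow> v' \<in> carrier V \<Longrightarrow> w \<in> carrier W \<Longrightarrow>
      free_gen K (v \<oplus>\<^bsub>V\<^esub> v', w) \<ominus> (free_gen K (v, w) \<oplus> free_gen K (v', w))
        \<in> tensor_relations K V W"
    and "v \<in> carrier V \<Longrightarrow> w \<in> carrier W \<Longrightarrow> w' \<in> carrier W \<Longrightarrow>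
      free_gen K (v, w \<oplus>\<^bsub>W\<^esub> w') \<ominus> (free_gen K (v, w) \<oplus> free_gen K (v, w'))
        \<in> tensor_relations K V W"
    and "a \<in> carrier K \<Longrightarrow> v \<in> carrier V \<Longrightarrow> w \<in> carrier W \<Longrightarrow>
      free_gen K (a \<odot>\<^bsub>V\<^esub> v, w) \<ominus> (a \<odot> free_gen K (v, w)) \<in> tensor_relations K V W"
    and "a \<in> carrier K \<Longrightarrow> v \<in> carrier V \<Longrightarrow> w \<in> carrier W \<Longrightarrow>
      free_gen K (v, a \<odot>\<^bsub>W\<^esub> w) \<ominus> (a \<odot> free_gen K (v, w)) \<in> tensor_relations K V W"
  unfolding tensor_relations_def Let_def F_def by blast+

lemma tensor_null_sub:
  assumes "md V" "md W"
  shows "submodule (tensor_null K V W) K (free (carrier V \<times> carrier W))"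
  unfolding tensor_null_def
  by (rule lin_span_submodule[OF module_free tensor_relations_subset[OF assms]])

lemma module_tensor:
  assumes "md V" "md W"
  shows "md (T V W)"
  unfolding tensor_module_def by (rule quotient_facts[OF module_free tensor_null_sub[OF assms]])

lemma pt_closed:
  assumes "md V" "md W" "v \<in> carrier V" "w \<in> carrier W"
  shows "pt V W v w \<in> carrier (T V W)"
  unfolding tensor_module_def pure_tensor_def
  using quotient_facts(3)[OF module_free tensor_null_sub[OF assms(1,2)]] assms(3,4)
  by (auto intro: free_gen_closed)

lemma pt_bil:
  assumes V: "md V" and W: "md W"
  shows "pt V W \<in> bil V W (T V W)"
proof -
  interpret V: module K V by fact
  interpret W: module K W by fact
  let ?F = "free (carrier V \<times> carrier W)"
  let ?N = "tensor_null K V W"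
  let ?T = "T V W"
  interpret F: module K ?F by (rule module_free)
  interpret N: abelian_subgroup ?N ?F
    by (rule submodule_abelian_subgroup[OF module_free tensor_null_sub[OF V W]])
  note lin = quotient_facts(2)[OF module_free tensor_null_sub[OF V W], folded tensor_module_def]
  let ?d = "\<lambda>v w. free_gen K (v, w)"
  have eq: "?N +>\<^bsub>?F\<^esub> x = ?N +>\<^bsub>?F\<^esub> y"
    if "x \<ominus>\<^bsub>?F\<^esub> y \<in> tensor_relations K V W" "x \<in> carrier ?F" "y \<in> carrier ?F" for x y
  proof -
    have "x \<ominus>\<^bsub>?F\<^esub> y \<in> ?N"
      using subsetD[OF lin_span_superset that(1)] by (simp add: tensor_null_def)
    then have "x \<in> ?N +>\<^bsub>?F\<^esub> y"
      using that(2,3) by (simp add: N.a_rcos_module a_minus_def)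
    then show ?thesis using N.a_repr_independence' that(3) by metis
  qed
  have gen: "?d v w \<in> carrier ?F" if "v \<in> carrier V" "w \<in> carrier W" for v w
    using that by (auto intro: free_gen_closed)
  have a1: "pt V W (v \<oplus>\<^bsub>V\<^esub> v') w = pt V W v w \<oplus>\<^bsub>?T\<^esub> pt V W v' w"
    if "v \<in> carrier V" "v' \<in> carrier V" "w \<in> carrier W" for v v' w
    unfolding pure_tensor_def using gen V.a_closed W.a_closed V.smult_closed W.smult_closed F.a_closed F.smult_closed that
    by (simp add: eq tensor_relationsI lin_add[OF lin, symmetric])
  have a2: "pt V W v (w \<oplus>\<^bsub>W\<^esub> w') = pt V W v w \<oplus>\<^bsub>?T\<^esub> pt V W v w'"
    if "v \<in> carrier V" "w \<in> carrier W" "w' \<in> carrier W" for v w w'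
    unfolding pure_tensor_def using gen V.a_closed W.a_closed V.smult_closed W.smult_closed F.a_closed F.smult_closed that
    by (simp add: eq tensor_relationsI lin_add[OF lin, symmetric])
  have s1: "pt V W (a \<odot>\<^bsub>V\<^esub> v) w = a \<odot>\<^bsub>?T\<^esub> pt V W v w"
    if "a \<in> carrier K" "v \<in> carrier V" "w \<in> carrier W" for v w a
    unfolding pure_tensor_def using gen V.a_closed W.a_closed V.smult_closed W.smult_closed F.a_closed F.smult_closed that
    by (simp add: eq tensor_relationsI lin_smult[OF lin, symmetric])
  have s2: "pt V W v (a \<odot>\<^bsub>W\<^esub> w) = a \<odot>\<^bsub>?T\<^esub> pt V W v w"
    if "a \<in> carrier K" "v \<in> carrier V" "w \<in> carrier W" for v w a
    unfolding pure_tensor_def using gen V.a_closed W.a_closed V.smult_closed W.smult_closed F.a_closed F.smult_closed that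
    by (simp add: eq tensor_relationsI lin_smult[OF lin, symmetric])
  show ?thesis
    by (intro bilI linI) (simp_all add: a1 a2 s1 s2 pt_closed V W)
qed

text \<open>Pure tensors are the only base case: a scalar multiple of a pure tensor is pure, since
  the scalar moves into the left factor, and zero is the pure tensor of two zeros.\<close>

lemma tensor_induct [consumes 3, case_names pure add]:
  assumes V: "md V" and W: "md W" and t: "t \<in> carrier (T V W)"
    and pure: "\<And>v w. v \<in> carrier V \<Longrightarrow> w \<in> carrier W \<Longrightarrow> P (pt V W v w)"
    and add: "\<And>s t. s \<in> carrier (T V W) \<Longrightarrow> t \<in> carrier (T V W) \<Longrightarrow>
      P s \<Longrightarrow> P t \<Longrightarrow> P (s \<oplus>\<^bsub>T V W\<^esub> t)"
  shows "P t"
proof -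
  interpret V: module K V by fact
  interpret W: module K W by fact
  interpret T: module K "T V W" by (rule module_tensor[OF V W])
  let ?F = "free (carrier V \<times> carrier W)"
  let ?N = "tensor_null K V W"
  note q = quotient_facts[OF module_free tensor_null_sub[OF V W], folded tensor_module_def]
  note bil = pt_bil[OF V W]
  obtain f where f: "f \<in> carrier ?F" "t = ?N +>\<^bsub>?F\<^esub> f" using t q(3) by auto
  have "P (?N +>\<^bsub>?F\<^esub> f)" using f(1)
  proof (induction rule: free_induct)
    case zero
    have "?N +>\<^bsub>?F\<^esub> \<zero>\<^bsub>?F\<^esub> = \<zero>\<^bsub>T V W\<^esub>"
      by (rule lin_zero[OF q(2) module_free q(1)])
    also have "\<dots> = pt V W \<zero>\<^bsub>V\<^esub> \<zero>\<^bsub>W\<^esub>"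
      using lin_zero[OF bilD(1)[OF bil] V q(1), of "\<zero>\<^bsub>W\<^esub>"] by simp
    finally show ?case using pure by simp
  next
    case (gen a p)
    then obtain v w where p: "p = (v, w)" "v \<in> carrier V" "w \<in> carrier W" by auto
    have "?N +>\<^bsub>?F\<^esub> (a \<odot>\<^bsub>?F\<^esub> free_gen K p) = a \<odot>\<^bsub>T V W\<^esub> pt V W v w"
      unfolding pure_tensor_def p(1) using gen p
      by (intro lin_smult[OF q(2)] free_gen_closed) auto
    also have "\<dots> = pt V W (a \<odot>\<^bsub>V\<^esub> v) w"
      using lin_smult[OF bilD(1)[OF bil p(3)] gen(1) p(2)] by simp
    finally show ?case using pure gen p by simp
  next
    case (add f g)
    then show ?case
      using assms(5)[of "?N +>\<^bsub>?F\<^esub> f" "?N +>\<^bsub>?F\<^esub> g"] lin_add[OF q(2), of f g] q(3) by auto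
  qed
  then show ?thesis using f by simp
qed

lemma tensor_lin_eqI:
  assumes "md V" "md W" "f \<in> lin (T V W) U"
    "g \<in> lin (T V W) U"
    and "\<And>v w. v \<in> carrier V \<Longrightarrow> w \<in> carrier W \<Longrightarrow>
      f (pt V W v w) = g (pt V W v w)"
    and "t \<in> carrier (T V W)"
  shows "f t = g t"
  using assms(1,2,6)
proof (induction t rule: tensor_induct)
  case (add s t)
  then show ?case by (simp add: lin_add[OF assms(3)] lin_add[OF assms(4)])
qed (use assms in auto)

lemma tl_exists:
  assumes V: "md V" and W: "md W" and U: "md U"
    and b: "\<beta> \<in> bil V W U"
  shows "\<exists>f \<in> lin (T V W) U.
    \<forall>v \<in> carrier V. \<forall>w \<in> carrier W. f (pt V W v w) = \<beta> v w"
proof -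
  interpret V: module K V by fact
  interpret W: module K W by fact
  interpret U: module K U by fact
  let ?F = "free (carrier V \<times> carrier W)"
  interpret F: module K ?F by (rule module_free)
  obtain L where L: "L \<in> lin ?F U"
    and Lb: "\<forall>x \<in> carrier V \<times> carrier W. L (free_gen K x) = case_prod \<beta> x"
    using free_lift_exists[OF U, of "carrier V \<times> carrier W" "case_prod \<beta>"]
      bil_closed[OF b] by auto
  have ker: "submodule {x \<in> carrier ?F. L x \<in> {\<zero>\<^bsub>U\<^esub>}} K ?F"
    by (rule submodule_lin_vimage[OF L module_free U zero_submodule[OF U]])
  have *: "x \<in> {x \<in> carrier ?F. L x \<in> {\<zero>\<^bsub>U\<^esub>}}"
    if "x = y \<ominus>\<^bsub>?F\<^esub> z" "y \<in> carrier ?F" "z \<in> carrier ?F" "L y = L z" for x y z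
    using that lin_closed[OF L] by (simp add: lin_minus[OF L module_free U] U.r_neg a_minus_def[of U])
  have gen: "free_gen K (v, w) \<in> carrier ?F" if "v \<in> carrier V" "w \<in> carrier W" for v w
    using that by (auto intro: free_gen_closed)
  note lin = bilD(1)[OF b] bilD(2)[OF b]
  have "tensor_relations K V W \<subseteq> {x \<in> carrier ?F. L x \<in> {\<zero>\<^bsub>U\<^esub>}}"
    unfolding tensor_relations_def Let_def
    by (intro Un_least subsetI; elim CollectE exE conjE; erule *)
      (simp_all add: gen lin_add[OF L] lin_smult[OF L] Lb
        lin_add[OF lin(1)] lin_add[OF lin(2)] lin_smult[OF lin(1)] lin_smult[OF lin(2)])
  then have null: "L x = \<zero>\<^bsub>U\<^esub>" if "x \<in> tensor_null K V W" for x
    using lin_span_minimal[OF ker] that unfolding tensor_null_def by blast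
  obtain g where g: "g \<in> lin (T V W) U"
    "\<forall>x \<in> carrier ?F. g (tensor_null K V W +>\<^bsub>?F\<^esub> x) = L x"
    using quotient_lift_exists[OF module_free tensor_null_sub[OF V W] U L null]
    unfolding tensor_module_def by blast
  then have "\<forall>v \<in> carrier V. \<forall>w \<in> carrier W. g (pt V W v w) = \<beta> v w"
    using Lb gen by (simp add: pure_tensor_def)
  with g(1) show ?thesis by blast
qed

text \<open>\<open>tensor_lift\<close> is a definite description, so uniqueness is needed besides
  \<open>tl_exists\<close>: \<open>tensor_lin_eqI\<close> fixes the map on the carrier, and
  extensionality fixes it elsewhere.\<close>

lemma tl_props:
  assumes V: "md V" and W: "md W" and U: "md U"
    and b: "\<beta> \<in> bil V W U"
  shows tensor_lift_linear: "tl V W U \<beta> \<in> lin (T V W) U"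
    and tensor_lift_extensional: "tl V W U \<beta> \<in> extensional (carrier (T V W))"
    and tensor_lift_pure: "v \<in> carrier V \<Longrightarrow> w \<in> carrier W \<Longrightarrow>
      tl V W U \<beta> (pt V W v w) = \<beta> v w"
proof -
  let ?T = "T V W"
  note mT = module_tensor[OF V W]
  obtain f where f: "f \<in> lin ?T U"
    "\<forall>v \<in> carrier V. \<forall>w \<in> carrier W. f (pt V W v w) = \<beta> v w"
    using tl_exists[OF assms] by blast
  let ?P = "\<lambda>f. f \<in> lin ?T U \<and> f \<in> extensional (carrier ?T) \<and>
    (\<forall>v \<in> carrier V. \<forall>w \<in> carrier W. f (pt V W v w) = \<beta> v w)"
  have "?P (restrict f (carrier ?T))"
    using f by (auto intro: lin_cong[OF f(1) mT] simp: pt_closed V W)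
  moreover have "g = h" if "?P g" "?P h" for g h
  proof (rule extensionalityI[where A = "carrier ?T"])
    show "g t = h t" if "t \<in> carrier ?T" for t
      by (rule tensor_lin_eqI[OF V W _ _ _ that, of g U h]) (use \<open>?P g\<close> \<open>?P h\<close> in auto)
  qed (use that in auto)
  ultimately have "\<exists>!f. ?P f" by blast
  then have "?P (tl V W U \<beta>)"
    unfolding tensor_lift_def by (rule theI')
  then show "tl V W U \<beta> \<in> lin ?T U"
    "tl V W U \<beta> \<in> extensional (carrier ?T)"
    "v \<in> carrier V \<Longrightarrow> w \<in> carrier W \<Longrightarrow> tl V W U \<beta> (pt V W v w) = \<beta> v w"
    by blast+
qed

lemma tl_eqI:
  assumes V: "md V" and W: "md W" and U: "md U"
    and f: "f \<in> lin (T V W) U"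
    and "\<And>v w. v \<in> carrier V \<Longrightarrow> w \<in> carrier W \<Longrightarrow> f (pt V W v w) = \<beta> v w"
    and b: "\<beta> \<in> bil V W U" and t: "t \<in> carrier (T V W)"
  shows "tl V W U \<beta> t = f t"
  by (rule tensor_lin_eqI[OF V W tensor_lift_linear[OF V W U b] f _ t])
    (simp add: tensor_lift_pure[OF V W U b] assms(5))

lemma tl_cong:
  assumes "\<And>v w. v \<in> carrier V \<Longrightarrow> w \<in> carrier W \<Longrightarrow> \<beta> v w = \<beta>' v w"
  shows "tl V W U \<beta> = tl V W U \<beta>'"
  using assms unfolding tensor_lift_def by (simp cong: conj_cong)

section \<open>Multilinear maps and functoriality of the tensor product\<close>

definition tri where
  "tri V1 V2 V3 U = {F.
     (\<forall>y \<in> carrier V2. \<forall>z \<in> carrier V3. (\<lambda>x. F x y z) \<in> lin V1 U) \<and>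
     (\<forall>x \<in> carrier V1. \<forall>z \<in> carrier V3. (\<lambda>y. F x y z) \<in> lin V2 U) \<and>
     (\<forall>x \<in> carrier V1. \<forall>y \<in> carrier V2. (\<lambda>z. F x y z) \<in> lin V3 U)}"

lemma triI:
  assumes "\<And>y z. y \<in> carrier V2 \<Longrightarrow> z \<in> carrier V3 \<Longrightarrow> (\<lambda>x. F x y z) \<in> lin V1 U"
    and "\<And>x z. x \<in> carrier V1 \<Longrightarrow> z \<in> carrier V3 \<Longrightarrow> (\<lambda>y. F x y z) \<in> lin V2 U"
    and "\<And>x y. x \<in> carrier V1 \<Longrightarrow> y \<in> carrier V2 \<Longrightarrow> (\<lambda>z. F x y z) \<in> lin V3 U"
  shows "F \<in> tri V1 V2 V3 U"
  using assms by (simp add: tri_def)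

lemma triD:
  assumes "F \<in> tri V1 V2 V3 U"
  shows "y \<in> carrier V2 \<Longrightarrow> z \<in> carrier V3 \<Longrightarrow> (\<lambda>x. F x y z) \<in> lin V1 U"
    and "x \<in> carrier V1 \<Longrightarrow> z \<in> carrier V3 \<Longrightarrow> (\<lambda>y. F x y z) \<in> lin V2 U"
    and "x \<in> carrier V1 \<Longrightarrow> y \<in> carrier V2 \<Longrightarrow> (\<lambda>z. F x y z) \<in> lin V3 U"
    and "x \<in> carrier V1 \<Longrightarrow> (\<lambda>y z. F x y z) \<in> bil V2 V3 U"
    and "y \<in> carrier V2 \<Longrightarrow> (\<lambda>x z. F x y z) \<in> bil V1 V3 U"
    and "z \<in> carrier V3 \<Longrightarrow> (\<lambda>x y. F x y z) \<in> bil V1 V2 U"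
  using assms by (simp_all add: tri_def bilinear_maps_def)

definition quad where
  "quad V1 V2 V3 V4 U = {F.
     (\<forall>w \<in> carrier V1. F w \<in> tri V2 V3 V4 U) \<and>
     (\<forall>x \<in> carrier V2. \<forall>y \<in> carrier V3. \<forall>z \<in> carrier V4. (\<lambda>w. F w x y z) \<in> lin V1 U)}"

lemma quadI:
  assumes "\<And>x y z. x \<in> carrier V2 \<Longrightarrow> y \<in> carrier V3 \<Longrightarrow> z \<in> carrier V4 \<Longrightarrow> (\<lambda>w. F w x y z) \<in> lin V1 U"
    and "\<And>w y z. w \<in> carrier V1 \<Longrightarrow> y \<in> carrier V3 \<Longrightarrow> z \<in> carrier V4 \<Longrightarrow> (\<lambda>x. F w x y z) \<in> lin V2 U"
    and "\<And>w x z. w \<in> carrier V1 \<Longrightarrow> x \<in> carrier V2 \<Longrightarrow> z \<in> carrier V4 \<Longrightarrow> (\<lambda>y. F w x y z) \<in> lin V3 U"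
    and "\<And>w x y. w \<in> carrier V1 \<Longrightarrow> x \<in> carrier V2 \<Longrightarrow> y \<in> carrier V3 \<Longrightarrow> (\<lambda>z. F w x y z) \<in> lin V4 U"
  shows "F \<in> quad V1 V2 V3 V4 U"
  using assms by (simp add: quad_def tri_def)

lemma quadD:
  assumes "F \<in> quad V1 V2 V3 V4 U"
  shows "x \<in> carrier V2 \<Longrightarrow> y \<in> carrier V3 \<Longrightarrow> z \<in> carrier V4 \<Longrightarrow> (\<lambda>w. F w x y z) \<in> lin V1 U"
    and "w \<in> carrier V1 \<Longrightarrow> y \<in> carrier V3 \<Longrightarrow> z \<in> carrier V4 \<Longrightarrow> (\<lambda>x. F w x y z) \<in> lin V2 U"
    and "w \<in> carrier V1 \<Longrightarrow> x \<in> carrier V2 \<Longrightarrow> z \<in> carrier V4 \<Longrightarrow> (\<lambda>y. F w x y z) \<in> lin V3 U"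
    and "w \<in> carrier V1 \<Longrightarrow> x \<in> carrier V2 \<Longrightarrow> y \<in> carrier V3 \<Longrightarrow> (\<lambda>z. F w x y z) \<in> lin V4 U"
  using assms by (simp_all add: quad_def tri_def)

lemma bil_comp:
  assumes "\<beta> \<in> bil V' W' U" "f \<in> lin V V'" "g \<in> lin W W'"
  shows "(\<lambda>v w. \<beta> (f v) (g w)) \<in> bil V W U"
  using lin_comp[OF bilD(1)[OF assms(1)] assms(2)]
    lin_comp[OF bilD(2)[OF assms(1)] assms(3)] assms(2,3)
  by (intro bilI) (auto simp: lin_closed)

lemma bil_post:
  assumes "\<beta> \<in> bil V W U" "h \<in> lin U U'"
  shows "(\<lambda>v w. h (\<beta> v w)) \<in> bil V W U'"
  using lin_comp[OF assms(2) bilD(1)[OF assms(1)]]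
    lin_comp[OF assms(2) bilD(2)[OF assms(1)]]
  by (intro bilI)

lemma bil_flip: "\<beta> \<in> bil V W U \<Longrightarrow> (\<lambda>w v. \<beta> v w) \<in> bil W V U"
  by (auto simp: bilinear_maps_def)

declare module_tensor [simp, intro] pt_closed [simp, intro]
declare lin_id [lin_intros]

lemma module_ground [simp, intro]: "md G"
proof -
  interpret K: cring K by (rule cring_K)
  have "abelian_group G"
    by (rule abelian_groupI) (auto simp: ground_module_def K.a_ac K.l_neg
      intro: bexI[of _ "\<ominus>\<^bsub>K\<^esub> _"])
  then show ?thesis
    by (rule moduleI[OF cring_K]) (auto simp: ground_module_def K.l_distr K.r_distr K.m_assoc)
qed

lemma ground_simps [simp]:
  "carrier G = carrier K" "zero G = \<zero>\<^bsub>K\<^esub>" "add G = add K" "smult G = mult K"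
  by (simp_all add: ground_module_def)

lemma lin_smult_left [lin_intros]:
  assumes "md U" "u \<in> carrier U" "f \<in> lin V G"
  shows "(\<lambda>x. f x \<odot>\<^bsub>U\<^esub> u) \<in> lin V U"
proof -
  interpret U: module K U by fact
  have "f x \<in> carrier K" if "x \<in> carrier V" for x using lin_closed[OF assms(3) that] by simp
  then show ?thesis
    by (intro linI)
      (use assms(2) in \<open>auto simp: lin_add[OF assms(3)] lin_smult[OF assms(3)] U.smult_l_distr U.smult_assoc1\<close>)
qed

lemma lin_smult_right [lin_intros]:
  assumes "md U" "a \<in> carrier K" "f \<in> lin V U"
  shows "(\<lambda>x. a \<odot>\<^bsub>U\<^esub> f x) \<in> lin V U"
proof -
  interpret K: cring K by (rule cring_K)
  interpret U: module K U by fact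
  show ?thesis
    by (intro linI)
      (use assms(2) in \<open>auto simp: lin_closed[OF assms(3)] lin_add[OF assms(3)] lin_smult[OF assms(3)]
        U.smult_r_distr U.smult_assoc1[symmetric] K.m_comm\<close>)
qed

lemma lin_mult_ground [lin_intros]:
  "a \<in> carrier K \<Longrightarrow> f \<in> lin V G \<Longrightarrow> (\<lambda>x. a \<otimes>\<^bsub>K\<^esub> f x) \<in> lin V G"
  "a \<in> carrier K \<Longrightarrow> f \<in> lin V G \<Longrightarrow> (\<lambda>x. f x \<otimes>\<^bsub>K\<^esub> a) \<in> lin V G"
  using lin_smult_right[of G a f V] lin_smult_left[of G a f V] by simp_all

lemma lin_pt1 [lin_intros]:
  "md V \<Longrightarrow> md W \<Longrightarrow> w \<in> carrier W \<Longrightarrow> f \<in> lin U V \<Longrightarrow> (\<lambda>x. pt V W (f x) w) \<in> lin U (T V W)"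
  by (rule lin_comp[OF bilD(1)[OF pt_bil]])

lemma lin_pt2 [lin_intros]:
  "md V \<Longrightarrow> md W \<Longrightarrow> v \<in> carrier V \<Longrightarrow> f \<in> lin U W \<Longrightarrow> (\<lambda>x. pt V W v (f x)) \<in> lin U (T V W)"
  by (rule lin_comp[OF bilD(2)[OF pt_bil]])

lemma lin_tl:
  assumes "md V" "md W" "md U" "\<beta> \<in> bil V W U" "f \<in> lin A (T V W)"
  shows "(\<lambda>x. tl V W U \<beta> (f x)) \<in> lin A U"
  by (rule lin_comp[OF tensor_lift_linear[OF assms(1-4)] assms(5)])

lemma tl_closed:
  "md V \<Longrightarrow> md W \<Longrightarrow> md U \<Longrightarrow> \<beta> \<in> bil V W U \<Longrightarrow> t \<in> carrier (T V W) \<Longrightarrow> tl V W U \<beta> t \<in> carrier U"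
  by (rule lin_closed[OF tensor_lift_linear])

text \<open>Here the bilinear map varies while the tensor \<open>t\<close> is fixed. A lift is known
  explicitly only on pure tensors, so linearity in the parameter is obtained by induction on
  \<open>t\<close>, as a sum of linear maps.\<close>

lemma lin_tl_param:
  assumes "md V" "md W" "md U" "md A"
    and b: "\<And>a. a \<in> carrier A \<Longrightarrow> F a \<in> bil V W U"
    and l: "\<And>v w. v \<in> carrier V \<Longrightarrow> w \<in> carrier W \<Longrightarrow> (\<lambda>a. F a v w) \<in> lin A U"
    and t: "t \<in> carrier (T V W)"
  shows "(\<lambda>a. tl V W U (F a) t) \<in> lin A U"
  using assms(1,2) t
proof (induction t rule: tensor_induct)
  case (pure v w)
  interpret A: module K A by fact
  show ?case
    by (rule lin_cong[OF l[OF pure] assms(4)])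
      (use assms(1-3) b pure in \<open>simp add: tensor_lift_pure\<close>)
next
  case (add s t)
  interpret U: module K U by fact
  interpret A: module K A by fact
  have "(\<lambda>a. tl V W U (F a) s \<oplus>\<^bsub>U\<^esub> tl V W U (F a) t) \<in> lin A U"
    using add(3,4)
    by (intro linI)
      (simp_all add: lin_closed[OF add(3)] lin_closed[OF add(4)] lin_add[OF add(3)]
        lin_add[OF add(4)] lin_smult[OF add(3)] lin_smult[OF add(4)] U.smult_r_distr U.a_ac)
  then show ?case
    by (rule lin_cong[OF _ assms(4)])
      (use add assms(1-3) b in \<open>simp add: lin_add[OF tensor_lift_linear]\<close>)
qed

lemma tl_push:
  assumes "md V" "md W" "md U" "md U'" "\<beta> \<in> bil V W U" "h \<in> lin U U'" "t \<in> carrier (T V W)"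
  shows "h (tl V W U \<beta> t) = tl V W U' (\<lambda>v w. h (\<beta> v w)) t"
  using assms by (intro tl_eqI[symmetric] lin_tl lin_comp[OF assms(6)])
    (auto simp: tensor_lift_pure intro: bil_post lin_id)

text \<open>Fubini for iterated lifts: both sides are linear in \<open>t\<close>, and at a pure
  \<open>t\<close> the lift over \<open>V \<otimes> W\<close> disappears from each of them.\<close>

lemma tl_exchange:
  assumes md: "md V" "md W" "md V'" "md W'" "md U"
    and F: "F \<in> quad V W V' W' U"
    and t: "t \<in> carrier (T V W)" and t': "t' \<in> carrier (T V' W')"
  shows "tl V W U (\<lambda>v w. tl V' W' U (F v w) t') t =
    tl V' W' U (\<lambda>v' w'. tl V W U (\<lambda>v w. F v w v' w') t) t'"
proof -
  have b1: "F v w \<in> bil V' W' U" if "v \<in> carrier V" "w \<in> carrier W" for v w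
    using that by (intro bilI) (auto intro: quadD[OF F])
  have b2: "(\<lambda>v w. F v w v' w') \<in> bil V W U" if "v' \<in> carrier V'" "w' \<in> carrier W'" for v' w'
    using that by (intro bilI) (auto intro: quadD[OF F])
  show ?thesis
  proof (rule tl_eqI[OF md(1,2,5) _ _ _ t])
    have b3: "(\<lambda>v' w'. tl V W U (\<lambda>v w. F v w v' w') t) \<in> bil V' W' U" if "t \<in> carrier (T V W)" for t
      using md b2 that F by (intro bilI lin_tl_param) (auto intro: quadD)
    show "(\<lambda>t. tl V' W' U (\<lambda>v' w'. tl V W U (\<lambda>v w. F v w v' w') t) t') \<in> lin (T V W) U"
      using md b2 b3 t' by (intro lin_tl_param) (auto intro: lin_tl lin_id)
    show "tl V' W' U (\<lambda>v' w'. tl V W U (\<lambda>v w. F v w v' w') (pt V W v w)) t' = tl V' W' U (F v w) t'"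
      if "v \<in> carrier V" "w \<in> carrier W" for v w
      using that md b2 by (intro tl_cong[THEN fun_cong]) (simp add: tensor_lift_pure)
    show "(\<lambda>v w. tl V' W' U (F v w) t') \<in> bil V W U"
      using md b1 t' F by (intro bilI lin_tl_param) (auto intro: quadD)
  qed
qed

lemma tm_pt:
  assumes "md V" "md W" "md V'" "md W'" "f \<in> lin V V'" "g \<in> lin W W'" "v \<in> carrier V" "w \<in> carrier W"
  shows "tm V W V' W' f g (pt V W v w) = pt V' W' (f v) (g w)"
  unfolding tensor_map_def using assms
  by (simp add: tensor_lift_pure bil_comp[OF pt_bil])

lemma lin_tm [lin_intros]:
  assumes "md V" "md W" "md V'" "md W'" "f \<in> lin V V'" "g \<in> lin W W'" "h \<in> lin A (T V W)"
  shows "(\<lambda>x. tm V W V' W' f g (h x)) \<in> lin A (T V' W')"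
  unfolding tensor_map_def using assms
  by (intro lin_tl) (auto intro: bil_comp[OF pt_bil])

lemma tm_lin:
  assumes "md V" "md W" "md V'" "md W'" "f \<in> lin V V'" "g \<in> lin W W'"
  shows "tm V W V' W' f g \<in> lin (T V W) (T V' W')"
  using lin_tm[OF assms lin_id] by simp

lemma tl_tm:
  assumes "md V" "md W" "md V'" "md W'" "f \<in> lin V V'" "g \<in> lin W W'" "md U" "\<beta> \<in> bil V' W' U"
    "t \<in> carrier (T V W)"
  shows "tl V' W' U \<beta> (tm V W V' W' f g t) = tl V W U (\<lambda>v w. \<beta> (f v) (g w)) t"
  using assms
  by (intro tl_eqI[symmetric] lin_tl[OF _ _ _ assms(8)] tm_lin bil_comp[OF assms(8)])
    (auto simp: tm_pt tensor_lift_pure lin_closed)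

lemma tm_tm:
  assumes "md V" "md W" "md V'" "md W'" "f \<in> lin V V'" "g \<in> lin W W'" "md V''" "md W''"
    "f' \<in> lin V' V''" "g' \<in> lin W' W''" "t \<in> carrier (T V W)"
  shows "tm V' W' V'' W'' f' g' (tm V W V' W' f g t) = tm V W V'' W'' (\<lambda>x. f' (f x)) (\<lambda>x. g' (g x)) t"
  using assms unfolding tensor_map_def[of K V' W' V'' W'']
  by (subst tl_tm) (auto intro: bil_comp[OF pt_bil] simp: tensor_map_def)

lemma tm_cong:
  assumes "\<And>v. v \<in> carrier V \<Longrightarrow> f v = f' v" "\<And>w. w \<in> carrier W \<Longrightarrow> g w = g' w"
  shows "tm V W V' W' f g = tm V W V' W' f' g'"
  unfolding tensor_map_def using assms by (intro tl_cong) simp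

lemma tm_id:
  assumes "md V" "md W" "t \<in> carrier (T V W)"
  shows "tm V W V W (\<lambda>x. x) (\<lambda>x. x) t = t"
  unfolding tensor_map_def using assms
  by (intro tl_eqI lin_id) (auto intro: pt_bil)

lemma tm_closed:
  assumes "md V" "md W" "md V'" "md W'" "f \<in> lin V V'" "g \<in> lin W W'" "t \<in> carrier (T V W)"
  shows "tm V W V' W' f g t \<in> carrier (T V' W')"
  using tm_lin[OF assms(1-6)] assms(7) by (rule lin_closed)

lemma tm_retract:
  assumes "md V" "md W" "md V'" "md W'" "f \<in> lin V V'" "g \<in> lin W W'"
    and "f' \<in> lin V' V" "g' \<in> lin W' W" "t \<in> carrier (T V W)"
    and "\<And>x. x \<in> carrier V \<Longrightarrow> f' (f x) = x" "\<And>x. x \<in> carrier W \<Longrightarrow> g' (g x) = x"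
  shows "tm V' W' V W f' g' (tm V W V' W' f g t) = t"
  using assms tm_cong[of V "\<lambda>x. f' (f x)" "\<lambda>x. x" W "\<lambda>x. g' (g x)" "\<lambda>x. x" V W]
  by (simp add: tm_tm tm_id)

section \<open>Subspaces\<close>

text \<open>Every subspace has a complement; the projection along it splits the inclusion.\<close>

lemma lin_retraction:
  fixes W (structure)
  assumes V: "md V" and W: "md W" and i: "i \<in> lin V W" and inj: "inj_on i (carrier V)"
  obtains p where "p \<in> lin W V" "\<And>x. x \<in> carrier V \<Longrightarrow> p (i x) = x"
proof -
  interpret K: field K by (rule field_K)
  interpret V: module K V by fact
  interpret W: module K W by fact
  define I where "I = i ` carrier V"
  have I: "submodule I K W" unfolding I_def by (rule submodule_lin_image[OF i V W])
  note IE = W.submoduleE[OF I]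
  define S where "S = {N. submodule N K W \<and> N \<inter> I = {\<zero>}}"
  have zero_mem: "\<zero> \<in> N" if "submodule N K W" for N
    using W.submoduleE[OF that] by (metis W.l_neg all_not_in_conv subsetD)
  have "\<exists>M\<in>S. \<forall>X\<in>S. M \<subseteq> X \<longrightarrow> X = M"
  proof (rule subset_Zorn_nonempty)
    show "S \<noteq> {}" using zero_submodule[OF W] zero_mem[OF I] by (auto simp: S_def)
    fix C assume C: "C \<noteq> {}" "subset.chain S C"
    have sub: "submodule N K W" "N \<inter> I = {\<zero>}" if "N \<in> C" for N
      using C(2) that by (auto simp: subset.chain_def S_def)
    have "submodule (\<Union>C) K W"
    proof (rule W.submoduleI)
      show "a \<oplus> b \<in> \<Union>C" if ab: "a \<in> \<Union>C" "b \<in> \<Union>C" for a b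
      proof -
        obtain X Y where XY: "a \<in> X" "X \<in> C" "b \<in> Y" "Y \<in> C" using ab by blast
        then have "X \<subseteq> Y \<or> Y \<subseteq> X" using C(2) by (auto simp: subset.chain_def subset_chain_def)
        then show ?thesis using XY W.submoduleE(5)[OF sub(1)] by (metis Union_iff subsetD)
      qed
      show "\<zero> \<in> \<Union>C" using C(1) sub(1) zero_mem by blast
    qed (use sub(1) W.submoduleE(1,3,4) in blast)+
    moreover have "\<Union>C \<inter> I = {\<zero>}" using C(1) sub(2) by blast
    ultimately show "\<Union>C \<in> S" by (simp add: S_def)
  qed
  then obtain M where M: "M \<in> S" and max: "\<And>X. X \<in> S \<Longrightarrow> M \<subseteq> X \<Longrightarrow> X = M" by blast
  have Ms: "submodule M K W" and MI: "M \<inter> I = {\<zero>}" using M by (simp_all add: S_def)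
  note ME = W.submoduleE[OF Ms]
  have decomp: "\<exists>x \<in> carrier V. \<exists>m \<in> M. w = i x \<oplus> m" if w: "w \<in> carrier W" for w
  proof (rule ccontr)
    assume neg: "\<not> ?thesis"
    \<comment> \<open>\<open>N\<close> adjoins the line through \<open>w\<close> to the maximal
      \<open>M\<close>. If \<open>w\<close> has no decomposition, an element common to
      \<open>N\<close> and \<open>I\<close> cannot involve \<open>w\<close>, since one could divide
      by its coefficient; so \<open>N\<close> contradicts maximality.\<close>
    define N where "N = {m \<oplus> a \<odot> w | m a. m \<in> M \<and> a \<in> carrier K}"
    have M_N: "M \<subseteq> N"
    proof
      fix m assume "m \<in> M"
      then show "m \<in> N" using ME(1) w by (auto simp: N_def intro!: exI[of _ m] exI[of _ "\<zero>\<^bsub>K\<^esub>"])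
    qed
    have "submodule N K W"
    proof (rule W.submoduleI)
      show "N \<subseteq> carrier W" using ME(1) w by (auto simp: N_def)
      show "\<zero> \<in> N" using M_N zero_mem[OF Ms] by blast
      fix x assume "x \<in> N"
      then obtain m a where x: "x = m \<oplus> a \<odot> w" "m \<in> M" "a \<in> carrier K" by (auto simp: N_def)
      have mW: "m \<in> carrier W" using ME(1) x by blast
      have "\<ominus> x = \<ominus> m \<oplus> (\<ominus>\<^bsub>K\<^esub> a) \<odot> w"
        using x w mW by (simp add: W.minus_add W.smult_l_minus)
      then show "\<ominus> x \<in> N" unfolding N_def using x ME(3) by blast
      {
        fix y assume "y \<in> N"
        then obtain m' b where y: "y = m' \<oplus> b \<odot> w" "m' \<in> M" "b \<in> carrier K" by (auto simp: N_def)
        have "m' \<in> carrier W" using ME(1) y by blast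
        then have "x \<oplus> y = (m \<oplus> m') \<oplus> (a \<oplus>\<^bsub>K\<^esub> b) \<odot> w"
          using x y w mW by (simp add: W.smult_l_distr W.a_ac)
        then show "x \<oplus> y \<in> N" unfolding N_def using x y ME(5) K.a_closed by blast
      }
      {
        fix b assume b: "b \<in> carrier K"
        have "b \<odot> x = b \<odot> m \<oplus> (b \<otimes>\<^bsub>K\<^esub> a) \<odot> w"
          using x w mW b by (simp add: W.smult_r_distr W.smult_assoc1)
        then show "b \<odot> x \<in> N" unfolding N_def using x b ME(4) K.m_closed by blast
      }
    qed
    moreover have "N \<inter> I = {\<zero>}"
    proof -
      have "z = \<zero>" if z: "z \<in> N" "z \<in> I" for z
      proof -
        obtain m a where ma: "z = m \<oplus> a \<odot> w" "m \<in> M" "a \<in> carrier K"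
          using z by (auto simp: N_def)
        obtain x where x: "x \<in> carrier V" "z = i x" using z by (auto simp: I_def)
        have mW: "m \<in> carrier W" using ME(1) ma by blast
        have ix: "i x \<in> carrier W" using lin_closed[OF i x(1)] .
        show ?thesis
        proof (cases "a = \<zero>\<^bsub>K\<^esub>")
          case True
          then have "z = m" using ma mW w by simp
          then show ?thesis using MI ma z by blast
        next
          case False
          then have a: "inv\<^bsub>K\<^esub> a \<in> carrier K" "inv\<^bsub>K\<^esub> a \<otimes>\<^bsub>K\<^esub> a = \<one>\<^bsub>K\<^esub>"
            using ma(3) by (auto simp: K.field_Units)
          have "a \<odot> w = i x \<oplus> \<ominus> m"
            using ma x mW w ix by (metis W.a_comm W.a_inv_closed W.r_neg1 W.smult_closed)
          then have "inv\<^bsub>K\<^esub> a \<odot> (a \<odot> w) =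
              i (inv\<^bsub>K\<^esub> a \<odot>\<^bsub>V\<^esub> x) \<oplus> inv\<^bsub>K\<^esub> a \<odot> (\<ominus> m)"
            using a x mW ix by (simp add: W.smult_r_distr lin_smult[OF i])
          then have "w = i (inv\<^bsub>K\<^esub> a \<odot>\<^bsub>V\<^esub> x) \<oplus> inv\<^bsub>K\<^esub> a \<odot> (\<ominus> m)"
            using a ma w by (simp add: W.smult_assoc1[symmetric])
          moreover have "inv\<^bsub>K\<^esub> a \<odot> (\<ominus> m) \<in> M" using ME(3,4) a ma by blast
          ultimately show ?thesis using neg a x V.smult_closed by blast
        qed
      qed
      then show ?thesis using M_N zero_mem[OF Ms] zero_mem[OF I] by blast
    qed
    ultimately have "N = M" using max M_N by (simp add: S_def)
    moreover have "w \<in> N"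
      unfolding N_def using w zero_mem[OF Ms]
      by (auto intro!: exI[of _ "\<zero>"] exI[of _ "\<one>\<^bsub>K\<^esub>"])
    ultimately have "w \<in> M" by simp
    then show False using neg w lin_zero[OF i V W] by (metis V.zero_closed W.l_zero)
  qed
  have uniq: "x = x'" if "x \<in> carrier V" "x' \<in> carrier V" "m \<in> M" "m' \<in> M"
    "i x \<oplus> m = i x' \<oplus> m'" for x x' m m'
  proof -
    have c: "i x \<in> carrier W" "i x' \<in> carrier W" "m \<in> carrier W" "m' \<in> carrier W"
      using lin_closed[OF i] that ME(1) by auto
    have "i x = (i x' \<oplus> m') \<oplus> \<ominus> m"
      using that(5) c by (metis W.a_assoc W.a_inv_closed W.r_neg W.r_zero)
    then have "i x = (m' \<ominus> m) \<oplus> i x'"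
      using c by (simp add: a_minus_def W.a_ac)
    then have "i x \<ominus> i x' = m' \<ominus> m"
      using c by (simp add: a_minus_def W.a_assoc W.r_neg)
    moreover have "i x \<ominus> i x' = i (x \<ominus>\<^bsub>V\<^esub> x')"
      using lin_minus[OF i V W] that by simp
    moreover have "m' \<ominus> m \<in> M" unfolding a_minus_def using ME(3,5) that by blast
    ultimately have "i (x \<ominus>\<^bsub>V\<^esub> x') \<in> M \<inter> I"
      using that V.minus_closed imageI[of "x \<ominus>\<^bsub>V\<^esub> x'" "carrier V" i] by (simp add: I_def)
    then have "i (x \<ominus>\<^bsub>V\<^esub> x') = i \<zero>\<^bsub>V\<^esub>" using MI lin_zero[OF i V W] by auto
    then have "x \<ominus>\<^bsub>V\<^esub> x' = \<zero>\<^bsub>V\<^esub>" using inj that by (auto dest: inj_onD)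
    then show ?thesis using that by (metis V.a_inv_closed V.minus_equality V.minus_minus a_minus_def)
  qed
  define p where "p w = (THE x. x \<in> carrier V \<and> (\<exists>m \<in> M. w = i x \<oplus> m))" for w
  have p: "p (i x \<oplus> m) = x" if "x \<in> carrier V" "m \<in> M" for x m
    unfolding p_def using that uniq by (intro the_equality) blast+
  have "p \<in> lin W V"
  proof (rule linI)
    fix w assume w: "w \<in> carrier W"
    obtain x m where xm: "x \<in> carrier V" "m \<in> M" "w = i x \<oplus> m" using decomp[OF w] by blast
    have c: "i x \<in> carrier W" "m \<in> carrier W" using lin_closed[OF i] xm ME(1) by auto
    show "p w \<in> carrier V" using xm p by simp
    {
      fix w' assume w': "w' \<in> carrier W"
      obtain x' m' where xm': "x' \<in> carrier V" "m' \<in> M" "w' = i x' \<oplus> m'" using decomp[OF w'] by blast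
      have c': "i x' \<in> carrier W" "m' \<in> carrier W" using lin_closed[OF i] xm' ME(1) by auto
      have "w \<oplus> w' = i (x \<oplus>\<^bsub>V\<^esub> x') \<oplus> (m \<oplus> m')"
        using xm xm' c c' by (simp add: lin_add[OF i] W.a_ac)
      then show "p (w \<oplus> w') = p w \<oplus>\<^bsub>V\<^esub> p w'" using xm xm' p ME(5) by simp
    next
      fix a assume a: "a \<in> carrier K"
      have "a \<odot> w = i (a \<odot>\<^bsub>V\<^esub> x) \<oplus> a \<odot> m"
        using xm c a by (simp add: lin_smult[OF i] W.smult_r_distr)
      then show "p (a \<odot> w) = a \<odot>\<^bsub>V\<^esub> p w" using xm p ME(4) a by simp
    }
  qed
  moreover have "p (i x) = x" if "x \<in> carrier V" for x
    using p[OF that zero_mem[OF Ms]] lin_closed[OF i that] by simp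
  ultimately show ?thesis using that by blast
qed

text \<open>The tensor product of linear retractions of \<open>f\<close> and \<open>g\<close> is a
  left inverse; this is where the scalars forming a field matters. In particular tensors over a
  subspace embed into tensors over the ambient space.\<close>

lemma tm_inj:
  assumes "md V" "md W" "md V'" "md W'" "f \<in> lin V V'" "g \<in> lin W W'"
    and "inj_on f (carrier V)" "inj_on g (carrier W)"
  shows "inj_on (tm V W V' W' f g) (carrier (T V W))"
proof -
  obtain p where p: "p \<in> lin V' V" "\<And>x. x \<in> carrier V \<Longrightarrow> p (f x) = x"
    using lin_retraction[OF assms(1,3,5,7)] by blast
  obtain q where q: "q \<in> lin W' W" "\<And>x. x \<in> carrier W \<Longrightarrow> q (g x) = x"
    using lin_retraction[OF assms(2,4,6,8)] by blast
  show ?thesis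
    by (rule inj_on_inverseI[of _ "tm V' W' V W p q"]) (simp add: tm_retract assms(1-6) p q)
qed

section \<open>Sweedler calculus\<close>

lemma coalg_md [simp, intro]: "coalg C \<Longrightarrow> md C"
  by (simp add: cocomm_coalgebra_def)

lemma comult_lin: "coalg C \<Longrightarrow> comult C \<in> lin C (T C C)"
  by (rule cocomm_coalgebra.comult_linear)

lemma counit_lin: "coalg C \<Longrightarrow> counit C \<in> lin C G"
  by (rule cocomm_coalgebra.counit_linear)

lemma comult_closed [simp, intro]: "coalg C \<Longrightarrow> c \<in> carrier C \<Longrightarrow> comult C c \<in> carrier (T C C)"
  by (rule lin_closed[OF comult_lin])

lemma counit_closed [simp, intro]: "coalg C \<Longrightarrow> c \<in> carrier C \<Longrightarrow> counit C c \<in> carrier K"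
  using lin_closed[OF counit_lin] by simp

lemma lin_counit [lin_intros]:
  "coalg C \<Longrightarrow> f \<in> lin V C \<Longrightarrow> (\<lambda>x. counit C (f x)) \<in> lin V G"
  by (rule lin_comp[OF counit_lin])

lemma lin_comult [lin_intros]:
  "coalg C \<Longrightarrow> f \<in> lin V C \<Longrightarrow> (\<lambda>x. comult C (f x)) \<in> lin V (T C C)"
  by (rule lin_comp[OF comult_lin])

lemma sw_cong:
  assumes "\<And>a b. a \<in> carrier C \<Longrightarrow> b \<in> carrier C \<Longrightarrow> \<beta> a b = \<beta>' a b"
  shows "sw C U \<beta> c = sw C U \<beta>' c"
  unfolding sweedler_def by (rule tl_cong[THEN fun_cong]) (rule assms)

lemma sw_closed [intro]:
  "coalg C \<Longrightarrow> md U \<Longrightarrow> \<beta> \<in> bil C C U \<Longrightarrow> c \<in> carrier C \<Longrightarrow> sw C U \<beta> c \<in> carrier U"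
  unfolding sweedler_def by (intro tl_closed) auto

lemma lin_sw:
  assumes "coalg C" "md U" "\<beta> \<in> bil C C U" "f \<in> lin A C"
  shows "(\<lambda>x. sw C U \<beta> (f x)) \<in> lin A U"
  unfolding sweedler_def using assms by (intro lin_tl lin_comult) auto

lemma lin_sw_param:
  assumes "coalg C" "md U" "md A" "\<And>a. a \<in> carrier A \<Longrightarrow> F a \<in> bil C C U"
    and "\<And>v w. v \<in> carrier C \<Longrightarrow> w \<in> carrier C \<Longrightarrow> (\<lambda>a. F a v w) \<in> lin A U" "c \<in> carrier C"
  shows "(\<lambda>a. sw C U (F a) c) \<in> lin A U"
  unfolding sweedler_def using assms by (intro lin_tl_param) auto

lemma sw_push:
  assumes "coalg C" "md U" "md U'" "\<beta> \<in> bil C C U" "h \<in> lin U U'" "c \<in> carrier C"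
  shows "h (sw C U \<beta> c) = sw C U' (\<lambda>a b. h (\<beta> a b)) c"
  unfolding sweedler_def using assms by (intro tl_push) auto

lemma sw_exchange:
  assumes "coalg C" "coalg D" "md U" "F \<in> quad C C D D U" "c \<in> carrier C" "d \<in> carrier D"
  shows "sw C U (\<lambda>a b. sw D U (F a b) d) c = sw D U (\<lambda>x y. sw C U (\<lambda>a b. F a b x y) c) d"
  unfolding sweedler_def using assms by (intro tl_exchange) auto

lemma comult_sw: 
  assumes "coalg C" "c \<in> carrier C"
  shows "sw C (T C C) (pt C C) c = comult C c"
  unfolding sweedler_def using assms
  by (intro tl_eqI lin_id) (auto intro: pt_bil)

lemma sw_counit_left:
  fixes C (structure)
  assumes C: "coalg C" and U: "md U" and h: "h \<in> lin C U" and c: "c \<in> carrier C"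
  shows "sw C U (\<lambda>a b. counit C a \<odot>\<^bsub>U\<^esub> h b) c = h c"
proof -
  have b: "(\<lambda>a b. counit C a \<odot> b) \<in> bil C C C"
    using C by (intro bilI lin_intros) (auto simp: counit_lin)
  have "h c = h (sw C C (\<lambda>a b. counit C a \<odot> b) c)"
    using cocomm_coalgebra.counit_left[OF C c] by simp
  also have "\<dots> = sw C U (\<lambda>a b. h (counit C a \<odot> b)) c"
    using C U b h c by (intro sw_push) auto
  also have "\<dots> = sw C U (\<lambda>a b. counit C a \<odot>\<^bsub>U\<^esub> h b) c"
    using C by (intro sw_cong) (simp add: lin_smult[OF h])
  finally show ?thesis ..
qed

lemma sw_comm:
  assumes C: "coalg C" and U: "md U" and b: "\<beta> \<in> bil C C U" and c: "c \<in> carrier C"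
  shows "sw C U (\<lambda>a b. \<beta> b a) c = sw C U \<beta> c"
proof -
  have 1: "(\<lambda>v w. pt C C w v) \<in> bil C C (T C C)"
    using C by (intro bil_flip[OF pt_bil]) auto
  have "sw C U \<beta> c = tl C C U \<beta> (tl C C (T C C) (\<lambda>v w. pt C C w v) (comult C c))"
    using cocomm_coalgebra.cocomm[OF C c] by (simp add: sweedler_def tensor_swap_def)
  also have "\<dots> = tl C C U (\<lambda>v w. tl C C U \<beta> (pt C C w v)) (comult C c)"
    by (intro tl_push[where h = "tl C C U \<beta>"]) (use assms 1 in \<open>auto intro: tensor_lift_linear\<close>)
  also have "\<dots> = tl C C U (\<lambda>v w. \<beta> w v) (comult C c)"
    using assms by (intro tl_cong[THEN fun_cong]) (simp add: tensor_lift_pure)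
  finally show ?thesis by (simp add: sweedler_def)
qed

lemma sw_counit_right:
  assumes C: "coalg C" and U: "md U" and h: "h \<in> lin C U" and c: "c \<in> carrier C"
  shows "sw C U (\<lambda>a b. counit C b \<odot>\<^bsub>U\<^esub> h a) c = h c"
proof -
  have "(\<lambda>a b. counit C a \<odot>\<^bsub>U\<^esub> h b) \<in> bil C C U"
    using C U h by (intro bilI lin_intros) (auto simp: counit_lin lin_closed)
  from sw_comm[OF C U this c] show ?thesis by (simp only: sw_counit_left[OF C U h c])
qed

lemma
  assumes "md V1" "md V2" "md V3"
  shows assoc_pure: "x \<in> carrier V1 \<Longrightarrow> y \<in> carrier V2 \<Longrightarrow> z \<in> carrier V3 \<Longrightarrow> tensor_assoc K V1 V2 V3 (pt (T V1 V2) V3 (pt V1 V2 x y) z) = pt V1 (T V2 V3) x (pt V2 V3 y z)"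
    and assoc_linear: "tensor_assoc K V1 V2 V3 \<in> lin (T (T V1 V2) V3) (T V1 (T V2 V3))"
proof -
  let ?F = "\<lambda>w u v. pt V1 (T V2 V3) u (pt V2 V3 v w)"
  have b: "?F w \<in> bil V1 V2 (T V1 (T V2 V3))" if "w \<in> carrier V3" for w
    using assms that by (intro bilI lin_intros) auto
  have b': "(\<lambda>t w. tl V1 V2 (T V1 (T V2 V3)) (?F w) t) \<in> bil (T V1 V2) V3 (T V1 (T V2 V3))"
    using assms b
    by (intro bilI lin_tl lin_tl_param lin_intros) auto
  show "tensor_assoc K V1 V2 V3 (pt (T V1 V2) V3 (pt V1 V2 x y) z) = pt V1 (T V2 V3) x (pt V2 V3 y z)"
    if "x \<in> carrier V1" "y \<in> carrier V2" "z \<in> carrier V3"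
    using that assms b b' by (simp add: tensor_assoc_def Let_def tensor_lift_pure)
  show "tensor_assoc K V1 V2 V3 \<in> lin (T (T V1 V2) V3) (T V1 (T V2 V3))"
    unfolding tensor_assoc_def Let_def using assms b' by (intro tensor_lift_linear) auto
qed

text \<open>Assuming just a linear comultiplication lets the same expansion serve both directions:
  \<open>cocomm_coalgebraI\<close> uses it to establish coassociativity, and
  \<open>sw_coassoc\<close> to exploit it.\<close>

lemma assoc_comult:
  fixes C :: "('k, 'a, 'c) coalgebra_scheme"
  assumes C: "md C" and D: "comult C \<in> lin C (T C C)" and c: "c \<in> carrier C"
  defines "TT \<equiv> T C (T C C)"
  shows "tensor_assoc K C C C (tm C C (T C C) C (comult C) (\<lambda>x. x) (comult C c)) =
      sw C TT (\<lambda>a b. sw C TT (\<lambda>x y. pt C (T C C) x (pt C C y b)) a) c" (is "?L = ?L'")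
    and "tm C C C (T C C) (\<lambda>x. x) (comult C) (comult C c) =
      sw C TT (\<lambda>a b. sw C TT (\<lambda>x y. pt C (T C C) a (pt C C x y)) b) c" (is "?R = ?R'")
proof -
  have cl: "comult C a \<in> carrier (T C C)" if "a \<in> carrier C" for a using lin_closed[OF D that] .
  have expand: "s = tl C C (T C C) (pt C C) s" if "s \<in> carrier (T C C)" for s
    using that C by (intro tl_eqI[symmetric] lin_id) (auto intro: pt_bil)
  have b1: "(\<lambda>v w. pt (T C C) C (comult C v) w) \<in> bil C C (T (T C C) C)"
    using C D cl by (intro bilI lin_pt1[OF _ _ _ D] lin_pt2 lin_id) auto
  have "?L = sw C TT (\<lambda>a b. tensor_assoc K C C C (pt (T C C) C (comult C a) b)) c"
    unfolding tensor_map_def sweedler_def TT_def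
    using C cl[OF c] b1 assoc_linear by (intro tl_push[where h = "tensor_assoc K C C C"]) auto
  also have "\<dots> = ?L'"
  proof (rule sw_cong)
    fix a b assume ab: "a \<in> carrier C" "b \<in> carrier C"
    have lin: "(\<lambda>t. tensor_assoc K C C C (pt (T C C) C t b)) \<in> lin (T C C) TT"
      unfolding TT_def using C ab
      by (intro lin_comp[OF assoc_linear] lin_intros) auto
    have "tensor_assoc K C C C (pt (T C C) C (comult C a) b) =
        tensor_assoc K C C C (pt (T C C) C (tl C C (T C C) (pt C C) (comult C a)) b)"
      using expand[OF cl[OF ab(1)]] by simp
    also have "\<dots> = tl C C TT (\<lambda>x y. tensor_assoc K C C C (pt (T C C) C (pt C C x y) b)) (comult C a)"
      unfolding TT_def using C lin cl[OF ab(1)]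
      by (intro tl_push[where h = "\<lambda>t. tensor_assoc K C C C (pt (T C C) C t b)"])
        (auto simp: TT_def intro: pt_bil)
    also have "\<dots> = sw C TT (\<lambda>x y. pt C (T C C) x (pt C C y b)) a"
      unfolding sweedler_def using C ab by (intro tl_cong[THEN fun_cong]) (simp add: assoc_pure)
    finally show "tensor_assoc K C C C (pt (T C C) C (comult C a) b) =
      sw C TT (\<lambda>x y. pt C (T C C) x (pt C C y b)) a" .
  qed
  finally show "?L = ?L'" .
  have "?R = sw C TT (\<lambda>a b. pt C (T C C) a (comult C b)) c"
    by (simp add: tensor_map_def sweedler_def TT_def)
  also have "\<dots> = ?R'"
  proof (rule sw_cong)
    fix a b assume ab: "a \<in> carrier C" "b \<in> carrier C"
    have "pt C (T C C) a (comult C b) = pt C (T C C) a (tl C C (T C C) (pt C C) (comult C b))"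
      using expand[OF cl[OF ab(2)]] by simp
    also have "\<dots> = tl C C TT (\<lambda>x y. pt C (T C C) a (pt C C x y)) (comult C b)"
      unfolding TT_def using C ab cl[OF ab(2)]
      by (intro tl_push[where h = "\<lambda>t. pt C (T C C) a t"] lin_intros) (auto intro: pt_bil)
    finally show "pt C (T C C) a (comult C b) = sw C TT (\<lambda>x y. pt C (T C C) a (pt C C x y)) b"
      by (simp add: sweedler_def)
  qed
  finally show "?R = ?R'" .
qed

text \<open>The right counit law is derived from the left one by flipping the legs with
  cocommutativity. Coassociativity appears as an identity of Sweedler sums, the form in which it
  gets proved.\<close>

lemma cocomm_coalgebraI:
  fixes C :: "('k, 'a, 'c) coalgebra_scheme" (structure)
  assumes C: "md C" and D: "comult C \<in> lin C (T C C)" and e: "counit C \<in> lin C G"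
    and coassoc: "\<And>c. c \<in> carrier C \<Longrightarrow>
      sw C (T C (T C C)) (\<lambda>a b. sw C (T C (T C C)) (\<lambda>x y. pt C (T C C) x (pt C C y b)) a) c =
      sw C (T C (T C C)) (\<lambda>a b. sw C (T C (T C C)) (\<lambda>x y. pt C (T C C) a (pt C C x y)) b) c"
    and counit: "\<And>c. c \<in> carrier C \<Longrightarrow> sw C C (\<lambda>a b. counit C a \<odot> b) c = c"
    and cocomm: "\<And>c. c \<in> carrier C \<Longrightarrow> sw C (T C C) (\<lambda>a b. pt C C b a) c = comult C c"
  shows "coalg C"
proof -
  have cl: "comult C a \<in> carrier (T C C)" if "a \<in> carrier C" for a using lin_closed[OF D that] .
  have flip: "(\<lambda>v w. pt C C w v) \<in> bil C C (T C C)"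
    by (rule bil_flip[OF pt_bil[OF C C]])
  have right: "sw C C (\<lambda>a b. counit C b \<odot> a) c = c" if c: "c \<in> carrier C" for c
  proof -
    have cK: "counit C a \<in> carrier K" if "a \<in> carrier C" for a
      using lin_closed[OF e that] by simp
    have b: "(\<lambda>a b. counit C a \<odot> b) \<in> bil C C C"
      using C e cK by (intro bilI lin_smult_left lin_smult_right lin_id) auto
    have "c = tl C C C (\<lambda>a b. counit C a \<odot> b) (tl C C (T C C) (\<lambda>v w. pt C C w v) (comult C c))"
      using counit[OF c] cocomm[OF c] by (simp add: sweedler_def)
    also have "\<dots> = tl C C C (\<lambda>v w. tl C C C (\<lambda>a b. counit C a \<odot> b) (pt C C w v)) (comult C c)"
      using C b flip cl[OF c]
      by (intro tl_push[where h = "tl C C C (\<lambda>a b. counit C a \<odot> b)"])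
        (auto intro: tensor_lift_linear)
    also have "\<dots> = sw C C (\<lambda>a b. counit C b \<odot> a) c"
      unfolding sweedler_def using C b by (intro tl_cong[THEN fun_cong]) (simp add: tensor_lift_pure)
    finally show ?thesis ..
  qed
  show ?thesis
  proof (intro cocomm_coalgebra.intro cocomm_coalgebra_axioms.intro)
    show "tensor_assoc K C C C (tm C C (T C C) C (comult C) (\<lambda>x. x) (comult C c)) =
        tm C C C (T C C) (\<lambda>x. x) (comult C) (comult C c)" if "c \<in> carrier C" for c
      using coassoc[OF that] by (simp add: assoc_comult[OF C D that])
    show "tensor_swap K C C (comult C c) = comult C c" if "c \<in> carrier C" for c
      using cocomm[OF that] by (simp add: tensor_swap_def sweedler_def)
  qed (use assms right field_K in auto)
qed

text \<open>The trilinear \<open>F\<close> induces a single linear map \<open>H\<close> on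
  \<open>C \<otimes> (C \<otimes> C)\<close>; pushing the coassociativity axiom through
  \<open>H\<close> gives the two iterated sums.\<close>

lemma sw_coassoc:
  assumes C: "coalg C" and U: "md U" and F: "F \<in> tri C C C U" and c: "c \<in> carrier C"
  shows "sw C U (\<lambda>a b. sw C U (\<lambda>x y. F x y b) a) c = sw C U (\<lambda>a b. sw C U (\<lambda>x y. F a x y) b) c"
proof -
  let ?TT = "T C (T C C)"
  define H where "H = tl C (T C C) U (\<lambda>a t. tl C C U (F a) t)"
  note Fb = triD[OF F]
  have bH: "(\<lambda>a t. tl C C U (F a) t) \<in> bil C (T C C) U"
    using C U Fb by (intro bilI lin_tl_param lin_tl lin_id) auto
  have H: "H \<in> lin ?TT U" unfolding H_def using C U bH by (intro tensor_lift_linear) auto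
  have Hp: "H (pt C (T C C) a (pt C C x y)) = F a x y"
    if "a \<in> carrier C" "x \<in> carrier C" "y \<in> carrier C" for a x y
    unfolding H_def using C U bH Fb that by (simp add: tensor_lift_pure)
  have t1: "(\<lambda>x y. pt C (T C C) x (pt C C y b)) \<in> bil C C ?TT" if "b \<in> carrier C" for b
    using C that by (intro bilI lin_intros) auto
  have t2: "(\<lambda>x y. pt C (T C C) b (pt C C x y)) \<in> bil C C ?TT" if "b \<in> carrier C" for b
    using C that by (intro bilI lin_intros) auto
  have b1: "(\<lambda>a b. sw C ?TT (\<lambda>x y. pt C (T C C) x (pt C C y b)) a) \<in> bil C C ?TT"
    using C t1 by (intro bilI lin_sw lin_sw_param lin_intros) auto
  have b2: "(\<lambda>a b. sw C ?TT (\<lambda>x y. pt C (T C C) a (pt C C x y)) b) \<in> bil C C ?TT"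
    using C t2 by (intro bilI lin_sw lin_sw_param lin_intros) auto
  have "sw C U (\<lambda>a b. sw C U (\<lambda>x y. F x y b) a) c =
      sw C U (\<lambda>a b. H (sw C ?TT (\<lambda>x y. pt C (T C C) x (pt C C y b)) a)) c"
    using C U H t1 by (intro sw_cong) (auto simp: sw_push[OF C _ U _ H] Hp intro!: sw_cong)
  also have "\<dots> = H (sw C ?TT (\<lambda>a b. sw C ?TT (\<lambda>x y. pt C (T C C) x (pt C C y b)) a) c)"
    using C U H b1 c by (intro sw_push[symmetric]) auto
  also have "\<dots> = H (sw C ?TT (\<lambda>a b. sw C ?TT (\<lambda>x y. pt C (T C C) a (pt C C x y)) b) c)"
    using cocomm_coalgebra.coassoc[OF C c] assoc_comult[OF coalg_md[OF C] comult_lin[OF C] c] by simp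
  also have "\<dots> = sw C U (\<lambda>a b. H (sw C ?TT (\<lambda>x y. pt C (T C C) a (pt C C x y)) b)) c"
    using C U H b2 c by (intro sw_push) auto
  also have "\<dots> = sw C U (\<lambda>a b. sw C U (\<lambda>x y. F a x y) b) c"
    using C U H t2 by (intro sw_cong) (auto simp: sw_push[OF C _ U _ H] Hp intro!: sw_cong)
  finally show ?thesis .
qed

text \<open>Regrouping the four legs as 1, (2, 3), 4 makes the middle ones the legs of one element,
  where cocommutativity swaps them. This is what makes a pairing of coalgebra maps
  comultiplicative.\<close>

lemma sw_middle4:
  assumes C: "coalg C" and U: "md U" and F: "F \<in> quad C C C C U" and c: "c \<in> carrier C"
  shows "sw C U (\<lambda>a b. sw C U (\<lambda>a1 a2. sw C U (\<lambda>b1 b2. F a1 a2 b1 b2) b) a) c =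
    sw C U (\<lambda>a b. sw C U (\<lambda>a1 a2. sw C U (\<lambda>b1 b2. F a1 b1 a2 b2) b) a) c"
proof -
  have step: "sw C U (\<lambda>a b. sw C U (\<lambda>a1 a2. sw C U (\<lambda>b1 b2. H a1 a2 b1 b2) b) a) c =
      sw C U (\<lambda>a b. sw C U (\<lambda>p y. sw C U (\<lambda>s t. H a s t y) p) b) c"
    if H: "H \<in> quad C C C C U" for H
  proof -
    note Hq = quadD[OF H]
    have b: "H u v \<in> bil C C U" if "u \<in> carrier C" "v \<in> carrier C" for u v
      using that by (intro bilI) (auto intro: Hq)
    have t1: "(\<lambda>u v b. sw C U (H u v) b) \<in> tri C C C U"
      using C U b by (intro triI lin_sw lin_sw_param lin_id) (auto intro: Hq)
    have t2: "(\<lambda>x y z. H a x y z) \<in> tri C C C U" if "a \<in> carrier C" for a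
      using that by (intro triI) (auto intro: Hq)
    have "sw C U (\<lambda>a b. sw C U (\<lambda>a1 a2. sw C U (\<lambda>b1 b2. H a1 a2 b1 b2) b) a) c =
        sw C U (\<lambda>a b. sw C U (\<lambda>x y. sw C U (H a x) y) b) c"
      using sw_coassoc[OF C U t1 c] by simp
    also have "\<dots> = sw C U (\<lambda>a b. sw C U (\<lambda>p y. sw C U (\<lambda>s t. H a s t y) p) b) c"
      by (intro sw_cong sw_coassoc[OF C U t2, symmetric])
    finally show ?thesis .
  qed
  have F': "(\<lambda>a x y z. F a y x z) \<in> quad C C C C U"
    by (intro quadI) (auto intro: quadD[OF F])
  have b: "(\<lambda>s t. F a s t y) \<in> bil C C U" if "a \<in> carrier C" "y \<in> carrier C" for a y
    using that by (intro bilI) (auto intro: quadD[OF F])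
  show ?thesis
    unfolding step[OF F] step[OF F']
    by (intro sw_cong sw_comm[OF C U b, symmetric])
qed

section \<open>Coalgebra maps\<close>

lemma chom_lin: "f \<in> chom C D \<Longrightarrow> f \<in> lin C D"
  by (simp add: coalgebra_hom_def)

lemma chom_closed: "f \<in> chom C D \<Longrightarrow> c \<in> carrier C \<Longrightarrow> f c \<in> carrier D"
  by (rule lin_closed[OF chom_lin])

lemma chom_counit: "f \<in> chom C D \<Longrightarrow> c \<in> carrier C \<Longrightarrow> counit D (f c) = counit C c"
  by (simp add: coalgebra_hom_def)

lemma chom_comult:
  "f \<in> chom C D \<Longrightarrow> c \<in> carrier C \<Longrightarrow> comult D (f c) = sw C (T D D) (\<lambda>a b. pt D D (f a) (f b)) c"
  by (simp add: coalgebra_hom_def sweedler_def tensor_map_def)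

lemma chomI:
  assumes "f \<in> lin C D"
    and "\<And>c. c \<in> carrier C \<Longrightarrow> comult D (f c) = sw C (T D D) (\<lambda>a b. pt D D (f a) (f b)) c"
    and "\<And>c. c \<in> carrier C \<Longrightarrow> counit D (f c) = counit C c"
  shows "f \<in> chom C D"
  using assms by (simp add: coalgebra_hom_def sweedler_def tensor_map_def)

lemma chom_cong:
  assumes "f \<in> chom C D" "coalg C" "\<And>x. x \<in> carrier C \<Longrightarrow> f x = g x"
  shows "g \<in> chom C D"
proof (rule chomI)
  show "g \<in> lin C D" using lin_cong[OF chom_lin[OF assms(1)] coalg_md[OF assms(2)] assms(3)] .
  show "comult D (g c) = sw C (T D D) (\<lambda>a b. pt D D (g a) (g b)) c" if "c \<in> carrier C" for c
    using chom_comult[OF assms(1) that] assms(3)[symmetric] that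
      sw_cong[of C "\<lambda>a b. pt D D (f a) (f b)" "\<lambda>a b. pt D D (g a) (g b)"] by simp
  show "counit D (g c) = counit C c" if "c \<in> carrier C" for c
    using chom_counit[OF assms(1) that] assms(3)[OF that] by simp
qed

lemma sw_chom:
  assumes "coalg C" "md D" "md U" "f \<in> chom C D" "\<beta> \<in> bil D D U" "c \<in> carrier C"
  shows "sw D U \<beta> (f c) = sw C U (\<lambda>a b. \<beta> (f a) (f b)) c"
proof -
  have "sw D U \<beta> (f c) = tl D D U \<beta> (tm C C D D f f (comult C c))"
    using assms(4,6) by (simp add: coalgebra_hom_def sweedler_def)
  also have "\<dots> = sw C U (\<lambda>a b. \<beta> (f a) (f b)) c"
    unfolding sweedler_def using assms chom_lin by (intro tl_tm) auto
  finally show ?thesis .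
qed

lemma chom_id: 
  assumes "coalg C" shows "(\<lambda>x. x) \<in> chom C C"
  using assms comult_sw[of C] by (intro chomI lin_id) auto

lemma chom_comp:
  assumes "coalg C" "md D" "md E" "f \<in> chom D E" "g \<in> chom C D"
  shows "(\<lambda>x. f (g x)) \<in> chom C E"
proof (rule chomI)
  show "(\<lambda>x. f (g x)) \<in> lin C E" by (rule lin_comp[OF chom_lin[OF assms(4)] chom_lin[OF assms(5)]])
  fix c assume c: "c \<in> carrier C"
  have gc: "g c \<in> carrier D" using chom_closed[OF assms(5) c] .
  show "counit E (f (g c)) = counit C c"
    using chom_counit[OF assms(4) gc] chom_counit[OF assms(5) c] by simp
  show "comult E (f (g c)) = sw C (T E E) (\<lambda>a b. pt E E (f (g a)) (f (g b))) c"
    using chom_comult[OF assms(4) gc] assms c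
    by (simp add: sw_chom[OF assms(1,2) _ assms(5)] bil_comp[OF pt_bil] chom_lin)
qed

section \<open>The cartesian category of cocommutative coalgebras\<close>

lemma tensor_coalgebra_simps [simp]:
  "carrier (tensor_coalgebra K C D) = carrier (T C D)"
  "zero (tensor_coalgebra K C D) = zero (T C D)"
  "add (tensor_coalgebra K C D) = add (T C D)"
  "smult (tensor_coalgebra K C D) = smult (T C D)"
  by (simp_all add: tensor_coalgebra_def Let_def)

lemma same_tensor_coalgebra: "same_module (tensor_coalgebra K C D) (T C D)"
  by (simp add: same_module_def)

lemma ground_coalgebra_simps [simp]:
  "carrier (ground_coalgebra K) = carrier K"
  "zero (ground_coalgebra K) = \<zero>\<^bsub>K\<^esub>"
  "add (ground_coalgebra K) = add K"
  "smult (ground_coalgebra K) = mult K"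
  by (simp_all add: ground_coalgebra_def Let_def)

lemma same_ground_coalgebra: "same_module (ground_coalgebra K) G"
  by (simp add: same_module_def)

lemma same_refl: "same_module V V"
  by (simp add: same_module_def)

text \<open>Normalise coalgebra records in module positions to the underlying module records.\<close>

lemma module_norm [simp]:
  "lin V (tensor_coalgebra K C D) = lin V (T C D)"
  "lin (tensor_coalgebra K C D) W = lin (T C D) W"
  "T V (tensor_coalgebra K C D) = T V (T C D)"
  "T (tensor_coalgebra K C D) W = T (T C D) W"
  "pt V (tensor_coalgebra K C D) = pt V (T C D)"
  "pt (tensor_coalgebra K C D) W = pt (T C D) W"
  "tl V W (tensor_coalgebra K C D) = tl V W (T C D)"
  "tl V (tensor_coalgebra K C D) U = tl V (T C D) U"
  "tl (tensor_coalgebra K C D) W U = tl (T C D) W U"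
  "lin V (ground_coalgebra K) = lin V G"
  "lin (ground_coalgebra K) W = lin G W"
  "T V (ground_coalgebra K) = T V G"
  "T (ground_coalgebra K) W = T G W"
  "pt V (ground_coalgebra K) = pt V G"
  "pt (ground_coalgebra K) W = pt G W"
  "tl V W (ground_coalgebra K) = tl V W G"
  "tl V (ground_coalgebra K) U = tl V G U"
  "tl (ground_coalgebra K) W U = tl G W U"
  by (rule same_lin same_tensor same_tl;
      rule same_refl same_tensor_coalgebra same_ground_coalgebra)+

lemma sw_norm [simp]:
  "sw E (tensor_coalgebra K C D) = sw E (T C D)"
  "sw E (ground_coalgebra K) = sw E G"
  by (simp_all add: sweedler_def fun_eq_iff)

lemma bil_norm [simp]:
  "bil V W (tensor_coalgebra K C D) = bil V W (T C D)"
  "bil (tensor_coalgebra K C D) W U = bil (T C D) W U"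
  "bil V (tensor_coalgebra K C D) U = bil V (T C D) U"
  by (simp_all add: bilinear_maps_def)

lemma md_norm [simp]:
  "md (tensor_coalgebra K C D) = md (T C D)"
  "md (ground_coalgebra K) = md G"
proof (rule iffI)
  show "md (T C D)" if "md (tensor_coalgebra K C D)"
    using that by (rule same_module_module[OF same_tensor_coalgebra])
  show "md (tensor_coalgebra K C D)" if "md (T C D)"
    using that by (rule same_module_module[OF same_sym[OF same_tensor_coalgebra]])
  show "md (ground_coalgebra K) = md G"
    using same_module_module[OF same_sym[OF same_ground_coalgebra] module_ground] by simp
qed

text \<open>A map on \<open>C \<otimes> D\<close> obeys \<open>c \<otimes> d \<mapsto> (c\<^sub>1 \<otimes> d\<^sub>1) \<otimes> (c\<^sub>2 \<otimes> d\<^sub>2)\<close>; \<open>sw2\<close> is the resulting double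
  Sweedler sum.\<close>

abbreviation sw2 where
  "sw2 C D U F c d \<equiv> sw C U (\<lambda>c1 c2. sw D U (\<lambda>d1 d2. F c1 d1 c2 d2) d) c"

lemma quad_bil:
  assumes "F \<in> quad C D C D U"
  shows "c \<in> carrier C \<Longrightarrow> c' \<in> carrier C \<Longrightarrow> (\<lambda>d d'. F c d c' d') \<in> bil D D U"
    and "d \<in> carrier D \<Longrightarrow> d' \<in> carrier D \<Longrightarrow> (\<lambda>c c'. F c d c' d') \<in> bil C C U"
  by (intro bilI; auto intro: quadD[OF assms])+

lemma sw2_bil:
  assumes "coalg C" "coalg D" "md U" "F \<in> quad C D C D U"
  shows "(\<lambda>c d. sw2 C D U F c d) \<in> bil C D U"
  using assms quad_bil[OF assms(4)]
  by (intro bilI lin_sw_param lin_sw lin_id) (auto intro: quadD[OF assms(4)])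

lemma sw2_inner_bil:
  assumes "coalg C" "coalg D" "md U" "F \<in> quad C D C D U" "d \<in> carrier D"
  shows "(\<lambda>c1 c2. sw D U (\<lambda>d1 d2. F c1 d1 c2 d2) d) \<in> bil C C U"
  using assms quad_bil[OF assms(4)]
  by (intro bilI lin_sw_param) (auto intro: quadD[OF assms(4)])

lemma sw2_push:
  assumes "coalg C" "coalg D" "md U" "md U'" "F \<in> quad C D C D U" "h \<in> lin U U'"
    "c \<in> carrier C" "d \<in> carrier D"
  shows "h (sw2 C D U F c d) = sw2 C D U' (\<lambda>c1 d1 c2 d2. h (F c1 d1 c2 d2)) c d"
  using assms quad_bil[OF assms(5)] sw2_inner_bil[OF assms(1-3,5)]
  by (simp add: sw_push[OF assms(1,3,4) _ assms(6)]) (intro sw_cong sw_push, auto)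

lemma sw2_cong:
  assumes "\<And>c1 c2 d1 d2. c1 \<in> carrier C \<Longrightarrow> c2 \<in> carrier C \<Longrightarrow> d1 \<in> carrier D \<Longrightarrow> d2 \<in> carrier D \<Longrightarrow>
     F c1 d1 c2 d2 = F' c1 d1 c2 d2"
  shows "sw2 C D U F c d = sw2 C D U F' c d"
  using assms by (intro sw_cong)

lemma quad_pt2:
  assumes "md C" "md D" "\<beta> \<in> bil (T C D) (T C D) U"
  shows "(\<lambda>c d c' d'. \<beta> (pt C D c d) (pt C D c' d')) \<in> quad C D C D U"
  using assms
  by (intro quadI lin_comp[OF bilD(1)[OF assms(3)]]
      lin_comp[OF bilD(2)[OF assms(3)]] lin_intros) auto

lemma tensor_comult_pure:
  assumes "coalg C" "coalg D" "c \<in> carrier C" "d \<in> carrier D"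
  shows "comult (tensor_coalgebra K C D) (pt C D c d) =
    sw2 C D (T (T C D) (T C D)) (\<lambda>c1 d1 c2 d2. pt (T C D) (T C D) (pt C D c1 d1) (pt C D c2 d2)) c d"
  unfolding tensor_coalgebra_def Let_def
  using assms sw2_bil[OF assms(1,2) _ quad_pt2[OF _ _ pt_bil]]
  by (simp add: tensor_lift_pure)

lemma tensor_comult_lin:
  assumes "coalg C" "coalg D"
  shows "comult (tensor_coalgebra K C D) \<in> lin (T C D) (T (T C D) (T C D))"
  unfolding tensor_coalgebra_def Let_def
  using assms sw2_bil[OF assms(1,2) _ quad_pt2[OF _ _ pt_bil]]
  by (simp add: tensor_lift_linear)

lemma counit_mult_bil:
  assumes "coalg C" "coalg D"
  shows "(\<lambda>c d. counit C c \<otimes>\<^bsub>K\<^esub> counit D d) \<in> bil C D G"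
  using assms by (intro bilI lin_intros) auto

lemma tensor_counit_pure:
  assumes "coalg C" "coalg D" "c \<in> carrier C" "d \<in> carrier D"
  shows "counit (tensor_coalgebra K C D) (pt C D c d) = counit C c \<otimes>\<^bsub>K\<^esub> counit D d"
  unfolding tensor_coalgebra_def Let_def
  using assms by (simp add: tensor_lift_pure counit_mult_bil)

lemma tensor_counit_lin:
  assumes "coalg C" "coalg D"
  shows "counit (tensor_coalgebra K C D) \<in> lin (T C D) G"
  unfolding tensor_coalgebra_def Let_def
  using assms by (simp add: tensor_lift_linear counit_mult_bil)

lemma lin_sw_tensor:
  assumes "coalg C" "coalg D" "md U" "\<beta> \<in> bil (T C D) (T C D) U"
  shows "(\<lambda>t. sw (tensor_coalgebra K C D) U \<beta> t) \<in> lin (T C D) U"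
  unfolding sweedler_def using assms
  by simp (intro lin_tl tensor_comult_lin, auto)

lemma sw_tensor_pure:
  assumes C: "coalg C" and D: "coalg D" and U: "md U" and b: "\<beta> \<in> bil (T C D) (T C D) U"
    and c: "c \<in> carrier C" and d: "d \<in> carrier D"
  shows "sw (tensor_coalgebra K C D) U \<beta> (pt C D c d) =
    sw2 C D U (\<lambda>c1 d1 c2 d2. \<beta> (pt C D c1 d1) (pt C D c2 d2)) c d"
proof -
  let ?T = "T C D"
  have "sw (tensor_coalgebra K C D) U \<beta> (pt C D c d) =
      tl ?T ?T U \<beta> (sw2 C D (T ?T ?T) (\<lambda>c1 d1 c2 d2. pt ?T ?T (pt C D c1 d1) (pt C D c2 d2)) c d)"
    by (simp add: sweedler_def tensor_comult_pure[OF C D c d, unfolded sweedler_def])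
  also have "\<dots> = sw2 C D U (\<lambda>c1 d1 c2 d2. tl ?T ?T U \<beta> (pt ?T ?T (pt C D c1 d1) (pt C D c2 d2))) c d"
    using C D U b c d
    by (intro sw2_push[where h = "tl ?T ?T U \<beta>"] quad_pt2 pt_bil tensor_lift_linear) auto
  also have "\<dots> = sw2 C D U (\<lambda>c1 d1 c2 d2. \<beta> (pt C D c1 d1) (pt C D c2 d2)) c d"
    using C D U b by (intro sw2_cong) (simp add: tensor_lift_pure)
  finally show ?thesis .
qed

lemma smult_smult_K:
  fixes U (structure)
  assumes "md U" "a \<in> carrier K" "b \<in> carrier K" "u \<in> carrier U"
  shows "(a \<otimes>\<^bsub>K\<^esub> b) \<odot> u = b \<odot> (a \<odot> u)"
proof -
  interpret K: cring K by (rule cring_K)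
  interpret U: module K U by fact
  show ?thesis using assms by (subst K.m_comm) (auto simp: U.smult_assoc1)
qed

lemma smult_left_commute:
  fixes U (structure)
  assumes "md U" "a \<in> carrier K" "b \<in> carrier K" "u \<in> carrier U"
  shows "a \<odot> (b \<odot> u) = b \<odot> (a \<odot> u)"
  using smult_smult_K[OF assms] module.smult_assoc1[OF assms] by simp

lemma smult_closedK: "md U \<Longrightarrow> a \<in> carrier K \<Longrightarrow> u \<in> carrier U \<Longrightarrow> a \<odot>\<^bsub>U\<^esub> u \<in> carrier U"
  by (rule module.smult_closed)

lemma sw2_counits:
  fixes U (structure)
  assumes C: "coalg C" and D: "coalg D" and U: "md U"
    and b: "\<beta> \<in> bil C D U" and c: "c \<in> carrier C" and d: "d \<in> carrier D"
  shows "sw2 C D U (\<lambda>c1 d1 c2 d2. counit C c1 \<odot> (counit D d1 \<odot> \<beta> c2 d2)) c d = \<beta> c d"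
    and "sw2 C D U (\<lambda>c1 d1 c2 d2. counit C c1 \<odot> (counit D d2 \<odot> \<beta> c2 d1)) c d = \<beta> c d"
proof -
  have eq: "sw C U (\<lambda>c1 c2. counit C c1 \<odot> \<beta> c2 d) c = \<beta> c d"
    using C U bilD(1)[OF b d] c by (intro sw_counit_left)
  note bc = bil_closed[OF b] bilD[OF b]
  have lin2: "(\<lambda>d2. counit C c1 \<odot> \<beta> c2 d2) \<in> lin D U" if "c1 \<in> carrier C" "c2 \<in> carrier C" for c1 c2
    using that C U bc by (intro lin_intros) auto
  have sm: "a \<odot> (b \<odot> u) = b \<odot> (a \<odot> u)" if "a \<in> carrier K" "b \<in> carrier K" "u \<in> carrier U" for a b u
    using that smult_smult_K[OF U] module.smult_assoc1[OF U] by metis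
  have i1: "sw D U (\<lambda>d1 d2. counit C c1 \<odot> (counit D d1 \<odot> \<beta> c2 d2)) d = counit C c1 \<odot> \<beta> c2 d"
    if "c1 \<in> carrier C" "c2 \<in> carrier C" for c1 c2
  proof -
    have "sw D U (\<lambda>d1 d2. counit C c1 \<odot> (counit D d1 \<odot> \<beta> c2 d2)) d =
        sw D U (\<lambda>d1 d2. counit D d1 \<odot> (counit C c1 \<odot> \<beta> c2 d2)) d"
      using that C D bc by (intro sw_cong sm) auto
    then show ?thesis using sw_counit_left[OF D U lin2[OF that] d] by simp
  qed
  have i2: "sw D U (\<lambda>d1 d2. counit C c1 \<odot> (counit D d2 \<odot> \<beta> c2 d1)) d = counit C c1 \<odot> \<beta> c2 d"
    if "c1 \<in> carrier C" "c2 \<in> carrier C" for c1 c2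
  proof -
    have "sw D U (\<lambda>d1 d2. counit C c1 \<odot> (counit D d2 \<odot> \<beta> c2 d1)) d =
        sw D U (\<lambda>d1 d2. counit D d2 \<odot> (counit C c1 \<odot> \<beta> c2 d1)) d"
      using that C D bc by (intro sw_cong sm) auto
    then show ?thesis using sw_counit_right[OF D U lin2[OF that] d] by simp
  qed
  show "sw2 C D U (\<lambda>c1 d1 c2 d2. counit C c1 \<odot> (counit D d1 \<odot> \<beta> c2 d2)) c d = \<beta> c d"
    using i1 eq sw_cong[of C "\<lambda>c1 c2. sw D U (\<lambda>d1 d2. counit C c1 \<odot> (counit D d1 \<odot> \<beta> c2 d2)) d"
      "\<lambda>c1 c2. counit C c1 \<odot> \<beta> c2 d" U c] by simp
  show "sw2 C D U (\<lambda>c1 d1 c2 d2. counit C c1 \<odot> (counit D d2 \<odot> \<beta> c2 d1)) c d = \<beta> c d"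
    using i2 eq sw_cong[of C "\<lambda>c1 c2. sw D U (\<lambda>d1 d2. counit C c1 \<odot> (counit D d2 \<odot> \<beta> c2 d1)) d"
      "\<lambda>c1 c2. counit C c1 \<odot> \<beta> c2 d" U c] by simp
qed

text \<open>The sums over \<open>D\<close> are moved innermost by \<open>sw_exchange\<close>. Then
  coassociativity of \<open>D\<close> acts inside \<open>M\<close> and coassociativity of
  \<open>C\<close> acts on \<open>M\<close> as a trilinear form. The six linearity assumptions say
  that \<open>H\<close> is linear in each slot.\<close>

lemma sw2_coassoc:
  assumes C: "coalg C" and D: "coalg D" and U: "md U"
    and H1: "\<And>p q r s t. p \<in> carrier D \<Longrightarrow> q \<in> carrier C \<Longrightarrow> r \<in> carrier D \<Longrightarrow> s \<in> carrier C \<Longrightarrow> t \<in> carrier D \<Longrightarrow>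
      (\<lambda>x. H x p q r s t) \<in> lin C U"
    and H2: "\<And>p q r s t. p \<in> carrier C \<Longrightarrow> q \<in> carrier C \<Longrightarrow> r \<in> carrier D \<Longrightarrow> s \<in> carrier C \<Longrightarrow> t \<in> carrier D \<Longrightarrow>
      (\<lambda>x. H p x q r s t) \<in> lin D U"
    and H3: "\<And>p q r s t. p \<in> carrier C \<Longrightarrow> q \<in> carrier D \<Longrightarrow> r \<in> carrier D \<Longrightarrow> s \<in> carrier C \<Longrightarrow> t \<in> carrier D \<Longrightarrow>
      (\<lambda>x. H p q x r s t) \<in> lin C U"
    and H4: "\<And>p q r s t. p \<in> carrier C \<Longrightarrow> q \<in> carrier D \<Longrightarrow> r \<in> carrier C \<Longrightarrow> s \<in> carrier C \<Longrightarrow> t \<in> carrier D \<Longrightarrow>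
      (\<lambda>x. H p q r x s t) \<in> lin D U"
    and H5: "\<And>p q r s t. p \<in> carrier C \<Longrightarrow> q \<in> carrier D \<Longrightarrow> r \<in> carrier C \<Longrightarrow> s \<in> carrier D \<Longrightarrow> t \<in> carrier D \<Longrightarrow>
      (\<lambda>x. H p q r s x t) \<in> lin C U"
    and H6: "\<And>p q r s t. p \<in> carrier C \<Longrightarrow> q \<in> carrier D \<Longrightarrow> r \<in> carrier C \<Longrightarrow> s \<in> carrier D \<Longrightarrow> t \<in> carrier C \<Longrightarrow>
      (\<lambda>x. H p q r s t x) \<in> lin D U"
    and c: "c \<in> carrier C" and d: "d \<in> carrier D"
  shows "sw2 C D U (\<lambda>c1 d1 c2 d2. sw2 C D U (\<lambda>x x' y y'. H x x' y y' c2 d2) c1 d1) c d =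
    sw2 C D U (\<lambda>c1 d1 c2 d2. sw2 C D U (\<lambda>x x' y y'. H c1 d1 x x' y y') c2 d2) c d"
proof -
  note Hs = H1 H2 H3 H4 H5 H6
  have bD1: "(\<lambda>y y'. H p y q y' r s) \<in> bil D D U"
    if "p \<in> carrier C" "q \<in> carrier C" "r \<in> carrier C" "s \<in> carrier D" for p q r s
    using that by (intro bilI) (auto intro: Hs)
  have bD2: "(\<lambda>y y'. H p s q y r y') \<in> bil D D U"
    if "p \<in> carrier C" "q \<in> carrier C" "r \<in> carrier C" "s \<in> carrier D" for p q r s
    using that by (intro bilI) (auto intro: Hs)
  have q1: "(\<lambda>d1 d2 x y. sw D U (\<lambda>x' y'. H x x' y y' c2 d2) d1) \<in> quad D D C C U" if "c2 \<in> carrier C" for c2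
    using that C D U bD1 by (intro quadI lin_sw lin_sw_param lin_id) (auto intro: Hs)
  have q2: "(\<lambda>d1 d2 x y. sw D U (\<lambda>x' y'. H c1 d1 x x' y y') d2) \<in> quad D D C C U" if "c1 \<in> carrier C" for c1
    using that C D U bD2 by (intro quadI lin_sw lin_sw_param lin_id) (auto intro: Hs)
  have t: "(\<lambda>x' y' z'. H x x' y y' z z') \<in> tri D D D U" if "x \<in> carrier C" "y \<in> carrier C" "z \<in> carrier C" for x y z
    using that by (intro triI) (auto intro: Hs)
  define M where "M x y z = sw D U (\<lambda>d1 d2. sw D U (\<lambda>x' y'. H x x' y y' z d2) d1) d" for x y z
  have b1: "(\<lambda>d1 d2. sw D U (\<lambda>x' y'. H x x' y y' z d2) d1) \<in> bil D D U"
    if "x \<in> carrier C" "y \<in> carrier C" "z \<in> carrier C" for x y z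
    using that C D U bD1 by (intro bilI lin_sw lin_sw_param lin_id) (auto intro: Hs)
  have M': "M x y z = sw D U (\<lambda>d1 d2. sw D U (\<lambda>x' y'. H x d1 y x' z y') d2) d"
    if "x \<in> carrier C" "y \<in> carrier C" "z \<in> carrier C" for x y z
    unfolding M_def by (rule sw_coassoc[OF D U t[OF that] d])
  have tM: "M \<in> tri C C C U"
    unfolding M_def using C D U d b1 bD1
    by (intro triI lin_sw_param) (auto intro: Hs)
  have "sw2 C D U (\<lambda>c1 d1 c2 d2. sw2 C D U (\<lambda>x x' y y'. H x x' y y' c2 d2) c1 d1) c d =
      sw C U (\<lambda>c1 c2. sw C U (\<lambda>x y. M x y c2) c1) c"
    unfolding M_def by (intro sw_cong) (rule sw_exchange[OF D C U q1 d])
  also have "\<dots> = sw C U (\<lambda>c1 c2. sw C U (\<lambda>x y. M c1 x y) c2) c"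
    by (rule sw_coassoc[OF C U tM c])
  also have "\<dots> = sw C U (\<lambda>c1 c2. sw C U (\<lambda>x y. sw D U (\<lambda>d1 d2. sw D U (\<lambda>x' y'. H c1 d1 x x' y y') d2) d) c2) c"
    using M' by (intro sw_cong)
  also have "\<dots> = sw2 C D U (\<lambda>c1 d1 c2 d2. sw2 C D U (\<lambda>x x' y y'. H c1 d1 x x' y y') c2 d2) c d"
    by (intro sw_cong sw_exchange[OF D C U q2 d, symmetric])
  finally show ?thesis .
qed

text \<open>Each law is an equality of linear maps in the tensor, hence reduces to pure tensors,
  where \<open>sw_tensor_pure\<close> turns it into a double sum over legs of \<open>c\<close> and
  of \<open>d\<close>.\<close>

lemma coalg_tensor [simp, intro]:
  assumes C: "coalg C" and D: "coalg D"
  shows "coalg (tensor_coalgebra K C D)"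
proof (rule cocomm_coalgebraI)
  let ?W = "tensor_coalgebra K C D" and ?T = "T C D"
  let ?T3 = "T ?T (T ?T ?T)"
  have mC: "md C" and mD: "md D" and mT: "md ?T" using C D by auto
  show "md ?W" using mC mD by simp
  show "comult ?W \<in> lin ?W (T ?W ?W)" using tensor_comult_lin[OF C D] by simp
  show "counit ?W \<in> lin ?W G" using tensor_counit_lin[OF C D] by simp
  note dl = tensor_comult_lin[OF C D] and el = tensor_counit_lin[OF C D]
  have dcl: "comult ?W t \<in> carrier (T ?T ?T)" if "t \<in> carrier ?T" for t
    using lin_closed[OF dl that] .
  {
    fix t assume "t \<in> carrier ?W"
    then have t: "t \<in> carrier ?T" by simp
    have b1: "(\<lambda>x y. pt ?T (T ?T ?T) x (pt ?T ?T y b)) \<in> bil ?T ?T ?T3" if "b \<in> carrier ?T" for b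
      using mT that by (intro bilI lin_intros) auto
    have b2: "(\<lambda>x y. pt ?T (T ?T ?T) b (pt ?T ?T x y)) \<in> bil ?T ?T ?T3" if "b \<in> carrier ?T" for b
      using mT that by (intro bilI lin_intros) auto
    have bb1: "(\<lambda>a b. sw ?W ?T3 (\<lambda>x y. pt ?T (T ?T ?T) x (pt ?T ?T y b)) a) \<in> bil ?T ?T ?T3"
    proof (rule bilI)
      show "(\<lambda>a. sw ?W ?T3 (\<lambda>x y. pt ?T (T ?T ?T) x (pt ?T ?T y b)) a) \<in> lin ?T ?T3" if "b \<in> carrier ?T" for b
        using mT b1[OF that] by (intro lin_sw_tensor[OF C D]) auto
      show "(\<lambda>b. sw ?W ?T3 (\<lambda>x y. pt ?T (T ?T ?T) x (pt ?T ?T y b)) a) \<in> lin ?T ?T3" if "a \<in> carrier ?T" for a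
        unfolding sweedler_def using mT b1 dcl[OF that] by simp (intro lin_tl_param lin_intros, auto)
    qed
    have bb2: "(\<lambda>a b. sw ?W ?T3 (\<lambda>x y. pt ?T (T ?T ?T) a (pt ?T ?T x y)) b) \<in> bil ?T ?T ?T3"
    proof (rule bilI)
      show "(\<lambda>b. sw ?W ?T3 (\<lambda>x y. pt ?T (T ?T ?T) a (pt ?T ?T x y)) b) \<in> lin ?T ?T3" if "a \<in> carrier ?T" for a
        using mT b2[OF that] by (intro lin_sw_tensor[OF C D]) auto
      show "(\<lambda>a. sw ?W ?T3 (\<lambda>x y. pt ?T (T ?T ?T) a (pt ?T ?T x y)) b) \<in> lin ?T ?T3" if "b \<in> carrier ?T" for b
        unfolding sweedler_def using mT b2 dcl[OF that] by simp (intro lin_tl_param lin_intros, auto)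
    qed
    have "sw ?W ?T3 (\<lambda>a b. sw ?W ?T3 (\<lambda>x y. pt ?T (T ?T ?T) x (pt ?T ?T y b)) a) t =
        sw ?W ?T3 (\<lambda>a b. sw ?W ?T3 (\<lambda>x y. pt ?T (T ?T ?T) a (pt ?T ?T x y)) b) t"
    proof (rule tensor_lin_eqI[OF mC mD lin_sw_tensor[OF C D _ bb1] lin_sw_tensor[OF C D _ bb2] _ t])
      fix c d assume cd: "c \<in> carrier C" "d \<in> carrier D"
      let ?H = "\<lambda>x x' y y' z z'. pt ?T (T ?T ?T) (pt C D x x') (pt ?T ?T (pt C D y y') (pt C D z z'))"
      have "sw ?W ?T3 (\<lambda>a b. sw ?W ?T3 (\<lambda>x y. pt ?T (T ?T ?T) x (pt ?T ?T y b)) a) (pt C D c d) =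
          sw2 C D ?T3 (\<lambda>c1 d1 c2 d2. sw2 C D ?T3 (\<lambda>x x' y y'. ?H x x' y y' c2 d2) c1 d1) c d"
        using mT mC mD C D cd b1 bb1 by (simp add: sw_tensor_pure) (intro sw2_cong, simp add: sw_tensor_pure)
      also have "\<dots> = sw2 C D ?T3 (\<lambda>c1 d1 c2 d2. sw2 C D ?T3 (\<lambda>x x' y y'. ?H c1 d1 x x' y y') c2 d2) c d"
        using mC mD mT cd by (intro sw2_coassoc[OF C D] lin_intros) auto
      also have "\<dots> = sw ?W ?T3 (\<lambda>a b. sw ?W ?T3 (\<lambda>x y. pt ?T (T ?T ?T) a (pt ?T ?T x y)) b) (pt C D c d)"
        using mT mC mD C D cd b2 bb2 by (simp add: sw_tensor_pure) (intro sw2_cong, simp add: sw_tensor_pure)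
      finally show "sw ?W ?T3 (\<lambda>a b. sw ?W ?T3 (\<lambda>x y. pt ?T (T ?T ?T) x (pt ?T ?T y b)) a) (pt C D c d) =
        sw ?W ?T3 (\<lambda>a b. sw ?W ?T3 (\<lambda>x y. pt ?T (T ?T ?T) a (pt ?T ?T x y)) b) (pt C D c d)" .
    qed (use mT in auto)
    then show "sw ?W (T ?W (T ?W ?W)) (\<lambda>a b. sw ?W (T ?W (T ?W ?W)) (\<lambda>x y. pt ?W (T ?W ?W) x (pt ?W ?W y b)) a) t =
      sw ?W (T ?W (T ?W ?W)) (\<lambda>a b. sw ?W (T ?W (T ?W ?W)) (\<lambda>x y. pt ?W (T ?W ?W) a (pt ?W ?W x y)) b) t"
      by simp
  next
    fix t assume "t \<in> carrier ?W"
    then have t: "t \<in> carrier ?T" by simp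
    have b: "(\<lambda>a b. counit ?W a \<odot>\<^bsub>?T\<^esub> b) \<in> bil ?T ?T ?T"
      using mT el lin_closed[OF el] by (intro bilI lin_smult_left lin_smult_right lin_id) auto
    have "sw ?W ?T (\<lambda>a b. counit ?W a \<odot>\<^bsub>?T\<^esub> b) t = t"
    proof (rule tensor_lin_eqI[OF mC mD lin_sw_tensor[OF C D _ b] lin_id _ t])
      fix c d assume cd: "c \<in> carrier C" "d \<in> carrier D"
      have "sw ?W ?T (\<lambda>a b. counit ?W a \<odot>\<^bsub>?T\<^esub> b) (pt C D c d) =
          sw2 C D ?T (\<lambda>c1 d1 c2 d2. counit ?W (pt C D c1 d1) \<odot>\<^bsub>?T\<^esub> pt C D c2 d2) c d"
        using cd C D mT b by (simp add: sw_tensor_pure)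
      also have "\<dots> = sw2 C D ?T (\<lambda>c1 d1 c2 d2. counit C c1 \<odot>\<^bsub>?T\<^esub> (counit D d1 \<odot>\<^bsub>?T\<^esub> pt C D c2 d2)) c d"
        using C D mC mD mT by (intro sw2_cong) (simp add: tensor_counit_pure module.smult_assoc1[OF mT])
      also have "\<dots> = pt C D c d"
        by (rule sw2_counits[OF C D mT pt_bil[OF mC mD] cd])
      finally show "sw ?W ?T (\<lambda>a b. counit ?W a \<odot>\<^bsub>?T\<^esub> b) (pt C D c d) = pt C D c d" .
    qed (rule mT)
    then show "sw ?W ?W (\<lambda>a b. counit ?W a \<odot>\<^bsub>?W\<^esub> b) t = t" by simp
  next
    fix t assume "t \<in> carrier ?W"
    then have t: "t \<in> carrier ?T" by simp
    have b: "(\<lambda>a b. pt ?T ?T b a) \<in> bil ?T ?T (T ?T ?T)"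
      by (rule bil_flip[OF pt_bil[OF mT mT]])
    have mTT: "md (T ?T ?T)" using mT by simp
    have "sw ?W (T ?T ?T) (\<lambda>a b. pt ?T ?T b a) t = comult ?W t"
    proof (rule tensor_lin_eqI[OF mC mD lin_sw_tensor[OF C D _ b] dl _ t])
      fix c d assume cd: "c \<in> carrier C" "d \<in> carrier D"
      let ?F = "\<lambda>c1 d1 c2 d2. pt ?T ?T (pt C D c1 d1) (pt C D c2 d2)"
      have F: "?F \<in> quad C D C D (T ?T ?T)"
        by (rule quad_pt2[OF mC mD pt_bil[OF mT mT]])
      have "sw ?W (T ?T ?T) (\<lambda>a b. pt ?T ?T b a) (pt C D c d) =
          sw C (T ?T ?T) (\<lambda>c1 c2. sw D (T ?T ?T) (\<lambda>d1 d2. ?F c2 d2 c1 d1) d) c"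
        using cd C D mT b by (simp add: sw_tensor_pure)
      also have "\<dots> = sw C (T ?T ?T) (\<lambda>c1 c2. sw D (T ?T ?T) (\<lambda>d1 d2. ?F c2 d1 c1 d2) d) c"
        by (intro sw_cong sw_comm[OF D mTT quad_bil(1)[OF F] cd(2)])
      also have "\<dots> = sw C (T ?T ?T) (\<lambda>c1 c2. sw D (T ?T ?T) (\<lambda>d1 d2. ?F c1 d1 c2 d2) d) c"
        by (rule sw_comm[OF C mTT sw2_inner_bil[OF C D mTT F cd(2)] cd(1)])
      also have "\<dots> = comult ?W (pt C D c d)"
        by (rule tensor_comult_pure[OF C D cd, symmetric])
      finally show "sw ?W (T ?T ?T) (\<lambda>a b. pt ?T ?T b a) (pt C D c d) = comult ?W (pt C D c d)" .
    qed (rule mTT)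
    then show "sw ?W (T ?W ?W) (\<lambda>a b. pt ?W ?W b a) t = comult ?W t" by simp
  }
qed

section \<open>Tensor products of coalgebras as categorical products\<close>

definition Hom where
  "Hom C D = chom C D \<inter> extensional (carrier C)"

definition p1 where
  "p1 C D = tl C D C (\<lambda>c d. counit D d \<odot>\<^bsub>C\<^esub> c)"

definition p2 where
  "p2 C D = tl C D D (\<lambda>c d. counit C c \<odot>\<^bsub>D\<^esub> d)"

definition pair where
  "pair E C D f g = restrict
     (\<lambda>e. sw E (T C D) (\<lambda>a b. pt C D (f a) (g b)) e) (carrier E)"

abbreviation tc (infixr "\<otimes>\<^sub>c" 75) where "C \<otimes>\<^sub>c D \<equiv> tensor_coalgebra K C D"

lemma HomI: "f \<in> chom C D \<Longrightarrow> f \<in> extensional (carrier C) \<Longrightarrow> f \<in> Hom C D"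
  by (simp add: Hom_def)

lemma Hom_chom: "f \<in> Hom C D \<Longrightarrow> f \<in> chom C D"
  by (simp add: Hom_def)

lemma Hom_ext: "f \<in> Hom C D \<Longrightarrow> f \<in> extensional (carrier C)"
  by (simp add: Hom_def)

lemma Hom_closed: "f \<in> Hom C D \<Longrightarrow> c \<in> carrier C \<Longrightarrow> f c \<in> carrier D"
  by (rule chom_closed[OF Hom_chom])

lemma Hom_lin: "f \<in> Hom C D \<Longrightarrow> f \<in> lin C D"
  by (simp add: Hom_def chom_lin)

lemma Hom_eqI: "f \<in> Hom C D \<Longrightarrow> g \<in> Hom C E \<Longrightarrow> (\<And>c. c \<in> carrier C \<Longrightarrow> f c = g c) \<Longrightarrow> f = g"
  by (auto intro: extensionalityI[where A = "carrier C"] simp: Hom_def)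

lemma restrict_Hom: "coalg C \<Longrightarrow> f \<in> chom C D \<Longrightarrow> restrict f (carrier C) \<in> Hom C D"
  by (auto intro!: HomI intro: chom_cong)

lemma compose_Hom:
  assumes "coalg C" "md D" "md E" "f \<in> Hom D E" "g \<in> Hom C D"
  shows "cmp C f g \<in> Hom C E"
  unfolding compose_def
  by (rule restrict_Hom) (use assms in \<open>auto intro: chom_comp Hom_chom\<close>)

lemma compose_compose:
  assumes "h \<in> Hom B C"
  shows "cmp B (cmp C f g) h = cmp B f (cmp B g h)"
  using Hom_closed[OF assms] by (auto simp: compose_def fun_eq_iff)

lemma compose_ident: "f \<in> Hom C D \<Longrightarrow> cmp C f (\<lambda>x\<in>carrier C. x) = f"
  by (rule extensionalityI[where A = "carrier C"]) (auto simp: compose_def Hom_ext)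

lemma ident_Hom: "coalg C \<Longrightarrow> (\<lambda>x\<in>carrier C. x) \<in> Hom C C"
  by (rule restrict_Hom) (auto intro: chom_id)

lemma tensor_homI:
  assumes C: "coalg C" and D: "coalg D" and E: "coalg E" and b: "\<beta> \<in> bil C D E"
    and co: "\<And>c d. c \<in> carrier C \<Longrightarrow> d \<in> carrier D \<Longrightarrow>
      comult E (\<beta> c d) = sw2 C D (T E E) (\<lambda>c1 d1 c2 d2. pt E E (\<beta> c1 d1) (\<beta> c2 d2)) c d"
    and cu: "\<And>c d. c \<in> carrier C \<Longrightarrow> d \<in> carrier D \<Longrightarrow> counit E (\<beta> c d) = counit C c \<otimes>\<^bsub>K\<^esub> counit D d"
  shows "tl C D E \<beta> \<in> Hom (C \<otimes>\<^sub>c D) E"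
proof (intro HomI chomI)
  have m: "md C" "md D" "md E" using C D E by auto
  let ?f = "tl C D E \<beta>"
  have fl: "?f \<in> lin (T C D) E" by (rule tensor_lift_linear[OF m b])
  show "?f \<in> lin (C \<otimes>\<^sub>c D) E" using fl by simp
  show "?f \<in> extensional (carrier (C \<otimes>\<^sub>c D))" using tensor_lift_extensional[OF m b] by simp
  have b2: "(\<lambda>a b. pt E E (?f a) (?f b)) \<in> bil (T C D) (T C D) (T E E)"
    using fl m by (intro bil_comp[OF pt_bil])
  fix t assume "t \<in> carrier (C \<otimes>\<^sub>c D)"
  then have t: "t \<in> carrier (T C D)" by simp
  show "comult E (?f t) = sw (C \<otimes>\<^sub>c D) (T E E) (\<lambda>a b. pt E E (?f a) (?f b)) t"
  proof (rule tensor_lin_eqI[OF m(1,2) lin_comp[OF comult_lin[OF E] fl] lin_sw_tensor[OF C D _ b2] _ t])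
    fix c d assume cd: "c \<in> carrier C" "d \<in> carrier D"
    show "comult E (?f (pt C D c d)) = sw (C \<otimes>\<^sub>c D) (T E E) (\<lambda>a b. pt E E (?f a) (?f b)) (pt C D c d)"
      using m cd C D b2 co[OF cd]
      by (simp add: sw_tensor_pure tensor_lift_pure b) (intro sw2_cong, simp add: tensor_lift_pure b)
  qed (use m in simp)
  show "counit E (?f t) = counit (C \<otimes>\<^sub>c D) t"
    by (rule tensor_lin_eqI[OF m(1,2) lin_comp[OF counit_lin[OF E] fl] tensor_counit_lin[OF C D] _ t])
      (use m b cu C D in \<open>simp add: tensor_lift_pure tensor_counit_pure\<close>)
qed

lemma proj_bil:
  assumes "coalg C" "coalg D"
  shows "(\<lambda>c d. counit D d \<odot>\<^bsub>C\<^esub> c) \<in> bil C D C" "(\<lambda>c d. counit C c \<odot>\<^bsub>D\<^esub> d) \<in> bil C D D"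
  using assms counit_lin by (auto intro!: bilI lin_smult_left lin_smult_right lin_id)

lemma proj1_pure: "coalg C \<Longrightarrow> coalg D \<Longrightarrow> c \<in> carrier C \<Longrightarrow> d \<in> carrier D \<Longrightarrow>
    p1 C D (pt C D c d) = counit D d \<odot>\<^bsub>C\<^esub> c"
  unfolding p1_def by (simp add: tensor_lift_pure proj_bil)

lemma proj2_pure: "coalg C \<Longrightarrow> coalg D \<Longrightarrow> c \<in> carrier C \<Longrightarrow> d \<in> carrier D \<Longrightarrow>
    p2 C D (pt C D c d) = counit C c \<odot>\<^bsub>D\<^esub> d"
  unfolding p2_def by (simp add: tensor_lift_pure proj_bil)

lemma proj_Hom [simp, intro]:
  fixes C (structure)
  assumes C: "coalg C" and D: "coalg D"
  shows "p1 C D \<in> Hom (C \<otimes>\<^sub>c D) C" "p2 C D \<in> Hom (C \<otimes>\<^sub>c D) D"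
proof -
  have m: "md C" "md D" using C D by auto
  interpret K: cring K by (rule cring_K)
  show "p1 C D \<in> Hom (C \<otimes>\<^sub>c D) C"
    unfolding p1_def
  proof (rule tensor_homI[OF C D C proj_bil(1)[OF C D]])
    fix c d assume cd: "c \<in> carrier C" "d \<in> carrier D"
    have "sw2 C D (T C C) (\<lambda>c1 d1 c2 d2. pt C C (counit D d1 \<odot> c1) (counit D d2 \<odot> c2)) c d =
        sw C (T C C) (\<lambda>c1 c2. counit D d \<odot>\<^bsub>T C C\<^esub> pt C C c1 c2) c"
    proof (rule sw_cong)
      fix c1 c2 assume c12: "c1 \<in> carrier C" "c2 \<in> carrier C"
      have l: "(\<lambda>d. counit D d \<odot>\<^bsub>T C C\<^esub> pt C C c1 c2) \<in> lin D (T C C)"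
        using c12 m D by (intro lin_intros) auto
      have "sw D (T C C) (\<lambda>d1 d2. pt C C (counit D d1 \<odot> c1) (counit D d2 \<odot> c2)) d =
          sw D (T C C) (\<lambda>d1 d2. counit D d1 \<odot>\<^bsub>T C C\<^esub> (counit D d2 \<odot>\<^bsub>T C C\<^esub> pt C C c1 c2)) d"
        using c12 m D
        by (intro sw_cong) (simp add: lin_smult[OF bilD(1)[OF pt_bil]]
          lin_smult[OF bilD(2)[OF pt_bil]] smult_closedK smult_left_commute)
      then show "sw D (T C C) (\<lambda>d1 d2. pt C C (counit D d1 \<odot> c1) (counit D d2 \<odot> c2)) d =
          counit D d \<odot>\<^bsub>T C C\<^esub> pt C C c1 c2"
        using sw_counit_left[OF D _ l cd(2)] m by simp
    qed
    also have "\<dots> = counit D d \<odot>\<^bsub>T C C\<^esub> sw C (T C C) (pt C C) c"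
      using cd C D m by (intro sw_push[symmetric] lin_intros pt_bil) auto
    also have "\<dots> = comult C (counit D d \<odot> c)"
      using cd C D by (simp add: comult_sw lin_smult[OF comult_lin])
    finally show "comult C (counit D d \<odot> c) =
      sw2 C D (T C C) (\<lambda>c1 d1 c2 d2. pt C C (counit D d1 \<odot> c1) (counit D d2 \<odot> c2)) c d" ..
    show "counit C (counit D d \<odot> c) = counit C c \<otimes>\<^bsub>K\<^esub> counit D d"
      using cd C D by (simp add: lin_smult[OF counit_lin] K.m_comm)
  qed
  show "p2 C D \<in> Hom (C \<otimes>\<^sub>c D) D"
    unfolding p2_def
  proof (rule tensor_homI[OF C D D proj_bil(2)[OF C D]])
    fix c d assume cd: "c \<in> carrier C" "d \<in> carrier D"
    have l: "(\<lambda>c. counit C c \<odot>\<^bsub>T D D\<^esub> comult D d) \<in> lin C (T D D)"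
      using cd m C D by (intro lin_intros) auto
    have "sw2 C D (T D D) (\<lambda>c1 d1 c2 d2. pt D D (counit C c1 \<odot>\<^bsub>D\<^esub> d1) (counit C c2 \<odot>\<^bsub>D\<^esub> d2)) c d =
        sw C (T D D) (\<lambda>c1 c2. counit C c1 \<odot>\<^bsub>T D D\<^esub> (counit C c2 \<odot>\<^bsub>T D D\<^esub> comult D d)) c"
    proof (rule sw_cong)
      fix c1 c2 assume c12: "c1 \<in> carrier C" "c2 \<in> carrier C"
      have "sw D (T D D) (\<lambda>d1 d2. pt D D (counit C c1 \<odot>\<^bsub>D\<^esub> d1) (counit C c2 \<odot>\<^bsub>D\<^esub> d2)) d =
          sw D (T D D) (\<lambda>d1 d2. counit C c1 \<odot>\<^bsub>T D D\<^esub> (counit C c2 \<odot>\<^bsub>T D D\<^esub> pt D D d1 d2)) d"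
        using c12 m C
        by (intro sw_cong) (simp add: lin_smult[OF bilD(1)[OF pt_bil]]
          lin_smult[OF bilD(2)[OF pt_bil]] smult_closedK smult_left_commute)
      also have "\<dots> = counit C c1 \<odot>\<^bsub>T D D\<^esub> (counit C c2 \<odot>\<^bsub>T D D\<^esub> sw D (T D D) (pt D D) d)"
        using cd c12 C D m
        by (intro sw_push[where h = "\<lambda>t. counit C c1 \<odot>\<^bsub>T D D\<^esub> (counit C c2 \<odot>\<^bsub>T D D\<^esub> t)", symmetric]
            lin_intros pt_bil) auto
      finally show "sw D (T D D) (\<lambda>d1 d2. pt D D (counit C c1 \<odot>\<^bsub>D\<^esub> d1) (counit C c2 \<odot>\<^bsub>D\<^esub> d2)) d =
          counit C c1 \<odot>\<^bsub>T D D\<^esub> (counit C c2 \<odot>\<^bsub>T D D\<^esub> comult D d)"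
        using cd D by (simp add: comult_sw)
    qed
    also have "\<dots> = comult D (counit C c \<odot>\<^bsub>D\<^esub> d)"
      using cd C D m sw_counit_left[OF C _ l cd(1)] by (simp add: lin_smult[OF comult_lin])
    finally show "comult D (counit C c \<odot>\<^bsub>D\<^esub> d) =
      sw2 C D (T D D) (\<lambda>c1 d1 c2 d2. pt D D (counit C c1 \<odot>\<^bsub>D\<^esub> d1) (counit C c2 \<odot>\<^bsub>D\<^esub> d2)) c d" ..
    show "counit D (counit C c \<odot>\<^bsub>D\<^esub> d) = counit C c \<otimes>\<^bsub>K\<^esub> counit D d"
      using cd C D by (simp add: lin_smult[OF counit_lin])
  qed
qed

lemma sw_proj:
  fixes U (structure)
  assumes C: "coalg C" and D: "coalg D" and U: "md U" and b: "\<beta> \<in> bil C D U"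
    and t: "t \<in> carrier (T C D)"
  shows "sw (C \<otimes>\<^sub>c D) U (\<lambda>a b. \<beta> (p1 C D a) (p2 C D b)) t = tl C D U \<beta> t"
proof -
  have m: "md C" "md D" using C D by auto
  have b': "(\<lambda>a b. \<beta> (p1 C D a) (p2 C D b)) \<in> bil (T C D) (T C D) U"
    using Hom_lin[OF proj_Hom(1)[OF C D]] Hom_lin[OF proj_Hom(2)[OF C D]] by (intro bil_comp[OF b]) auto
  note bc = bil_closed[OF b] bilD[OF b]
  show ?thesis
  proof (rule tensor_lin_eqI[OF m lin_sw_tensor[OF C D U b'] tensor_lift_linear[OF m U b] _ t])
    fix c d assume cd: "c \<in> carrier C" "d \<in> carrier D"
    have "sw (C \<otimes>\<^sub>c D) U (\<lambda>a b. \<beta> (p1 C D a) (p2 C D b)) (pt C D c d) =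
        sw2 C D U (\<lambda>c1 d1 c2 d2. \<beta> (p1 C D (pt C D c1 d1)) (p2 C D (pt C D c2 d2))) c d"
      by (rule sw_tensor_pure[OF C D U b' cd])
    also have "\<dots> = sw C U (\<lambda>c1 c2. sw D U (\<lambda>d1 d2. counit D d1 \<odot> (counit C c2 \<odot> \<beta> c1 d2)) d) c"
      using C D U m bc
      by (intro sw2_cong) (simp add: proj1_pure proj2_pure lin_smult[OF bc(2)] lin_smult[OF bc(3)] smult_closedK smult_left_commute)
    also have "\<dots> = sw C U (\<lambda>c1 c2. counit C c2 \<odot> \<beta> c1 d) c"
      using C D U bc cd by (intro sw_cong sw_counit_left lin_intros) auto
    also have "\<dots> = \<beta> c d"
      using C U bc cd by (intro sw_counit_right) auto
    finally show "sw (C \<otimes>\<^sub>c D) U (\<lambda>a b. \<beta> (p1 C D a) (p2 C D b)) (pt C D c d) = tl C D U \<beta> (pt C D c d)"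
      using m U b cd by (simp add: tensor_lift_pure)
  qed
qed

lemma pairing_bil:
  assumes "md C" "md D" "f \<in> lin E C" "g \<in> lin E D"
  shows "(\<lambda>a b. pt C D (f a) (g b)) \<in> bil E E (T C D)"
  using assms by (intro bil_comp[OF pt_bil])

lemma pairing_apply: "e \<in> carrier E \<Longrightarrow>
    pair E C D f g e = sw E (T C D) (\<lambda>a b. pt C D (f a) (g b)) e"
  by (simp add: pair_def)

lemma pairing_Hom [simp, intro]:
  assumes E: "coalg E" and C: "coalg C" and D: "coalg D" and f: "f \<in> Hom E C" and g: "g \<in> Hom E D"
  shows "pair E C D f g \<in> Hom E (C \<otimes>\<^sub>c D)"
proof -
  have m: "md C" "md D" "md E" "md (T C D)" "md (T (T C D) (T C D))" using C D E by auto
  note fl = Hom_lin[OF f] and gl = Hom_lin[OF g]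
  note b = pairing_bil[OF m(1,2) fl gl]
  let ?h = "\<lambda>e. sw E (T C D) (\<lambda>a b. pt C D (f a) (g b)) e"
  let ?TT = "T (T C D) (T C D)"
  have hl: "?h \<in> lin E (T C D)" using E m b by (intro lin_sw lin_id)
  have "?h \<in> chom E (C \<otimes>\<^sub>c D)"
  proof (rule chomI)
    show "?h \<in> lin E (C \<otimes>\<^sub>c D)" using hl by simp
    fix e assume e: "e \<in> carrier E"
    let ?F = "\<lambda>a1 a2 b1 b2. pt (T C D) (T C D) (pt C D (f a1) (g a2)) (pt C D (f b1) (g b2))"
    let ?F' = "\<lambda>a1 b1 a2 b2. pt (T C D) (T C D) (pt C D (f a1) (g b1)) (pt C D (f a2) (g b2))"
    have q: "?F \<in> quad E E E E ?TT"
      using m lin_closed[OF fl] lin_closed[OF gl] fl gl by (intro quadI lin_intros) auto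
    have q': "(\<lambda>a1 b1 a2 b2. pt (T C D) (T C D) (pt C D (f a1) (g b1)) (pt C D (f a2) (g b2))) \<in> quad E E E E ?TT"
      using m lin_closed[OF fl] lin_closed[OF gl] fl gl by (intro quadI lin_intros) auto
    have "comult (C \<otimes>\<^sub>c D) (?h e) = sw E ?TT (\<lambda>a b. comult (C \<otimes>\<^sub>c D) (pt C D (f a) (g b))) e"
      using E m b e by (intro sw_push tensor_comult_lin C D) auto
    also have "\<dots> = sw E ?TT (\<lambda>a b. sw2 E E ?TT ?F' a b) e"
    proof (rule sw_cong)
      fix a b assume ab: "a \<in> carrier E" "b \<in> carrier E"
      have i: "(\<lambda>y1 y2. pt (T C D) (T C D) (pt C D x1 y1) (pt C D x2 y2)) \<in> bil D D ?TT"
        if "x1 \<in> carrier C" "x2 \<in> carrier C" for x1 x2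
        using that m by (intro bilI lin_intros) auto
      have o: "(\<lambda>x1 x2. sw E ?TT (\<lambda>b1 b2. pt (T C D) (T C D) (pt C D x1 (g b1)) (pt C D x2 (g b2))) b) \<in> bil C C ?TT"
        using m E ab gl lin_closed[OF gl] by (intro bilI lin_sw_param lin_intros) auto
      have "comult (C \<otimes>\<^sub>c D) (pt C D (f a) (g b)) =
          sw C ?TT (\<lambda>x1 x2. sw D ?TT (\<lambda>y1 y2. pt (T C D) (T C D) (pt C D x1 y1) (pt C D x2 y2)) (g b)) (f a)"
        using ab by (intro tensor_comult_pure C D Hom_closed[OF f] Hom_closed[OF g])
      also have "\<dots> = sw C ?TT (\<lambda>x1 x2. sw E ?TT (\<lambda>b1 b2. pt (T C D) (T C D) (pt C D x1 (g b1)) (pt C D x2 (g b2))) b) (f a)"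
        using ab i by (intro sw_cong sw_chom E m Hom_chom g) auto
      also have "\<dots> = sw2 E E ?TT ?F' a b"
        using ab o by (intro sw_chom E m Hom_chom f)
      finally show "comult (C \<otimes>\<^sub>c D) (pt C D (f a) (g b)) = sw2 E E ?TT ?F' a b" .
    qed
    \<comment> \<open>Comultiplying \<open>f(e1) \<otimes> g(e2)\<close> pairs the legs 1, 3 and 2,
      4 of \<open>e\<close>, whereas \<open>h(e1) \<otimes> h(e2)\<close> pairs 1, 2 and 3, 4.
      Exchanging the middle legs is where cocommutativity of \<open>E\<close> enters.\<close>
    also have "\<dots> = sw E ?TT (\<lambda>a b. sw E ?TT (\<lambda>a1 a2. sw E ?TT (\<lambda>b1 b2. ?F a1 a2 b1 b2) b) a) e"
      by (rule sw_middle4[OF E m(5) q e, symmetric])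
    also have "\<dots> = sw E ?TT (\<lambda>a b. pt (T C D) (T C D) (?h a) (?h b)) e"
    proof (rule sw_cong)
      fix a b assume ab: "a \<in> carrier E" "b \<in> carrier E"
      have hb: "?h b \<in> carrier (T C D)" using lin_closed[OF hl ab(2)] .
      have "pt (T C D) (T C D) (?h a) (?h b) = sw E ?TT (\<lambda>a1 a2. pt (T C D) (T C D) (pt C D (f a1) (g a2)) (?h b)) a"
        using E m b ab hb
        by (intro sw_push[where h = "\<lambda>t. pt (T C D) (T C D) t (?h b)"] lin_intros) auto
      also have "\<dots> = sw E ?TT (\<lambda>a1 a2. sw E ?TT (\<lambda>b1 b2. ?F a1 a2 b1 b2) b) a"
        using E m b ab lin_closed[OF fl] lin_closed[OF gl]
        by (intro sw_cong sw_push[where h = "\<lambda>t. pt (T C D) (T C D) (pt C D (f _) (g _)) t"] lin_intros) auto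
      finally show "sw E ?TT (\<lambda>a1 a2. sw E ?TT (\<lambda>b1 b2. ?F a1 a2 b1 b2) b) a =
        pt (T C D) (T C D) (?h a) (?h b)" ..
    qed
    finally show "comult (C \<otimes>\<^sub>c D) (?h e) = sw E (T (C \<otimes>\<^sub>c D) (C \<otimes>\<^sub>c D)) (\<lambda>a b. pt (C \<otimes>\<^sub>c D) (C \<otimes>\<^sub>c D) (?h a) (?h b)) e"
      by simp
    have "counit (C \<otimes>\<^sub>c D) (?h e) = sw E G (\<lambda>a b. counit (C \<otimes>\<^sub>c D) (pt C D (f a) (g b))) e"
      using E m b e by (intro sw_push tensor_counit_lin C D) auto
    also have "\<dots> = sw E G (\<lambda>a b. counit E a \<odot>\<^bsub>G\<^esub> counit E b) e"
      using C D by (intro sw_cong)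
        (simp add: tensor_counit_pure Hom_closed[OF f] Hom_closed[OF g] chom_counit[OF Hom_chom[OF f]] chom_counit[OF Hom_chom[OF g]])
    also have "\<dots> = counit E e"
      by (rule sw_counit_left[OF E module_ground counit_lin[OF E] e])
    finally show "counit (C \<otimes>\<^sub>c D) (?h e) = counit E e" .
  qed
  then show ?thesis unfolding pair_def by (rule restrict_Hom[OF E])
qed

lemma proj_pairing:
  assumes E: "coalg E" and C: "coalg C" and D: "coalg D" and f: "f \<in> Hom E C" and g: "g \<in> Hom E D"
  shows "cmp E (p1 C D) (pair E C D f g) = f"
    and "cmp E (p2 C D) (pair E C D f g) = g"
proof -
  have m: "md C" "md D" "md E" "md (T C D)" using C D E by auto
  note b = pairing_bil[OF m(1,2) Hom_lin[OF f] Hom_lin[OF g]]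
  have l1: "p1 C D \<in> lin (T C D) C" and l2: "p2 C D \<in> lin (T C D) D"
    using Hom_lin[OF proj_Hom(1)[OF C D]] Hom_lin[OF proj_Hom(2)[OF C D]] by auto
  have "p1 C D (pair E C D f g e) = f e" if e: "e \<in> carrier E" for e
  proof -
    have "p1 C D (pair E C D f g e) = sw E C (\<lambda>a b. p1 C D (pt C D (f a) (g b))) e"
      using e E m b l1 by (simp add: pairing_apply sw_push[of E "T C D" C])
    also have "\<dots> = sw E C (\<lambda>a b. counit E b \<odot>\<^bsub>C\<^esub> f a) e"
      using C D by (intro sw_cong) (simp add: proj1_pure Hom_closed[OF f] Hom_closed[OF g] chom_counit[OF Hom_chom[OF g]])
    also have "\<dots> = f e" by (rule sw_counit_right[OF E m(1) Hom_lin[OF f] e])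
    finally show ?thesis .
  qed
  then show "cmp E (p1 C D) (pair E C D f g) = f"
    using Hom_ext[OF f] by (intro extensionalityI[where A = "carrier E"]) (auto simp: compose_def)
  have "p2 C D (pair E C D f g e) = g e" if e: "e \<in> carrier E" for e
  proof -
    have "p2 C D (pair E C D f g e) = sw E D (\<lambda>a b. p2 C D (pt C D (f a) (g b))) e"
      using e E m b l2 by (simp add: pairing_apply sw_push[of E "T C D" D])
    also have "\<dots> = sw E D (\<lambda>a b. counit E a \<odot>\<^bsub>D\<^esub> g b) e"
      using C D by (intro sw_cong) (simp add: proj2_pure Hom_closed[OF f] Hom_closed[OF g] chom_counit[OF Hom_chom[OF f]])
    also have "\<dots> = g e" by (rule sw_counit_left[OF E m(2) Hom_lin[OF g] e])
    finally show ?thesis .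
  qed
  then show "cmp E (p2 C D) (pair E C D f g) = g"
    using Hom_ext[OF g] by (intro extensionalityI[where A = "carrier E"]) (auto simp: compose_def)
qed

lemma pairing_eta:
  assumes E: "coalg E" and C: "coalg C" and D: "coalg D" and h: "h \<in> Hom E (C \<otimes>\<^sub>c D)"
  shows "pair E C D (cmp E (p1 C D) h) (cmp E (p2 C D) h) = h"
proof (rule extensionalityI[where A = "carrier E"])
  have m: "md C" "md D" "md E" "md (T C D)" using C D E by auto
  have l1: "p1 C D \<in> lin (T C D) C" and l2: "p2 C D \<in> lin (T C D) D"
    using Hom_lin[OF proj_Hom(1)[OF C D]] Hom_lin[OF proj_Hom(2)[OF C D]] by auto
  fix e assume e: "e \<in> carrier E"
  have he: "h e \<in> carrier (T C D)" using Hom_closed[OF h e] by simp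
  have "pair E C D (cmp E (p1 C D) h) (cmp E (p2 C D) h) e =
      sw E (T C D) (\<lambda>a b. pt C D (p1 C D (h a)) (p2 C D (h b))) e"
    unfolding pairing_apply[OF e] by (intro sw_cong) (simp add: compose_def)
  also have "\<dots> = sw (C \<otimes>\<^sub>c D) (T C D) (\<lambda>a b. pt C D (p1 C D a) (p2 C D b)) (h e)"
    using E C D m e pairing_bil[OF m(1,2) l1 l2]
    by (intro sw_chom[symmetric] Hom_chom h) auto
  also have "\<dots> = tl C D (T C D) (pt C D) (h e)"
    using C D m he by (intro sw_proj pt_bil)
  also have "\<dots> = h e"
    using m he by (intro tl_eqI lin_id) (auto intro: pt_bil)
  finally show "pair E C D (cmp E (p1 C D) h) (cmp E (p2 C D) h) e = h e" .
qed (use Hom_ext[OF h] in \<open>auto simp: pair_def\<close>)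

lemma Hom_tensor_eqI:
  assumes "coalg E" "coalg C" "coalg D" "h \<in> Hom E (C \<otimes>\<^sub>c D)" "h' \<in> Hom E (C \<otimes>\<^sub>c D)"
    and "cmp E (p1 C D) h = cmp E (p1 C D) h'"
    and "cmp E (p2 C D) h = cmp E (p2 C D) h'"
  shows "h = h'"
  by (subst pairing_eta[OF assms(1-4), symmetric], subst pairing_eta[OF assms(1-3,5), symmetric])
    (simp only: assms(6,7))

lemma pairing_compose:
  assumes E: "coalg E" and C: "coalg C" and D: "coalg D" and B: "coalg B"
    and f: "f \<in> Hom E C" and g: "g \<in> Hom E D" and k: "k \<in> Hom B E"
  shows "cmp B (pair E C D f g) k =
    pair B C D (cmp B f k) (cmp B g k)"
proof (rule extensionalityI[where A = "carrier B"])
  have m: "md C" "md D" "md E" "md (T C D)" using C D E by auto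
  fix b assume b: "b \<in> carrier B"
  have "pair E C D f g (k b) = sw B (T C D) (\<lambda>x y. pt C D (f (k x)) (g (k y))) b"
    using Hom_closed[OF k b] b B m pairing_bil[OF m(1,2) Hom_lin[OF f] Hom_lin[OF g]]
    by (simp add: pairing_apply sw_chom[OF B _ _ Hom_chom[OF k]])
  also have "\<dots> = pair B C D (cmp B f k) (cmp B g k) b"
    unfolding pairing_apply[OF b] by (intro sw_cong) (simp add: compose_def)
  finally show "cmp B (pair E C D f g) k b =
    pair B C D (cmp B f k) (cmp B g k) b"
    using b by (simp add: compose_def)
qed (auto simp: pair_def compose_def)

lemma coalg_ground [simp, intro]: "coalg (ground_coalgebra K)"
proof -
  interpret K: cring K by (rule cring_K)
  let ?g = "ground_coalgebra K"
  have d: "comult ?g = (\<lambda>a. pt G G a \<one>\<^bsub>K\<^esub>)" and e: "counit ?g = (\<lambda>a. a)"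
    by (simp_all add: ground_coalgebra_def Let_def)
  have s: "sw ?g U \<beta> a = \<beta> a \<one>\<^bsub>K\<^esub>" if "\<beta> \<in> bil G G U" "md U" "a \<in> carrier K" for \<beta> U a
    using that by (simp add: sweedler_def d tensor_lift_pure)
  have p: "pt G G a b = pt G G b a" if "a \<in> carrier K" "b \<in> carrier K" for a b
  proof -
    have "pt G G a b = pt G G \<one>\<^bsub>K\<^esub> (a \<otimes>\<^bsub>K\<^esub> b)" if "a \<in> carrier K" "b \<in> carrier K" for a b
      using that lin_smult[OF bilD(1)[OF pt_bil[of G G]], of b a "\<one>\<^bsub>K\<^esub>"]
        lin_smult[OF bilD(2)[OF pt_bil[of G G]], of "\<one>\<^bsub>K\<^esub>" a b] by simp
    from this[OF that] this[OF that(2,1)] show ?thesis using that by (simp add: K.m_comm)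
  qed
  have mT: "md (T G (T G G))" by simp
  show ?thesis
  proof (rule cocomm_coalgebraI)
    show "comult ?g \<in> lin ?g (T ?g ?g)" by (simp add: d, intro lin_intros) auto
    show "counit ?g \<in> lin ?g G" by (simp add: e lin_id)
    fix c assume "c \<in> carrier ?g"
    then have c: "c \<in> carrier K" by simp
    have b1: "(\<lambda>x y. pt G (T G G) x (pt G G y b)) \<in> bil G G (T G (T G G))" if "b \<in> carrier K" for b
      using that by (intro bilI lin_intros) auto
    have b2: "(\<lambda>x y. pt G (T G G) b (pt G G x y)) \<in> bil G G (T G (T G G))" if "b \<in> carrier K" for b
      using that by (intro bilI lin_intros) auto
    have "sw ?g (T G (T G G)) (\<lambda>a b. sw ?g (T G (T G G)) (\<lambda>x y. pt G (T G G) x (pt G G y b)) a) c =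
        sw ?g (T G (T G G)) (\<lambda>a b. pt G (T G G) a (pt G G \<one>\<^bsub>K\<^esub> b)) c"
      by (rule sw_cong) (simp add: s b1)
    also have "\<dots> = sw ?g (T G (T G G)) (\<lambda>a b. pt G (T G G) a (pt G G b \<one>\<^bsub>K\<^esub>)) c"
      by (rule sw_cong) (simp add: p)
    also have "\<dots> = sw ?g (T G (T G G)) (\<lambda>a b. sw ?g (T G (T G G)) (\<lambda>x y. pt G (T G G) a (pt G G x y)) b) c"
      by (rule sw_cong) (simp add: s b2)
    finally show "sw ?g (T ?g (T ?g ?g)) (\<lambda>a b. sw ?g (T ?g (T ?g ?g)) (\<lambda>x y. pt ?g (T ?g ?g) x (pt ?g ?g y b)) a) c =
       sw ?g (T ?g (T ?g ?g)) (\<lambda>a b. sw ?g (T ?g (T ?g ?g)) (\<lambda>x y. pt ?g (T ?g ?g) a (pt ?g ?g x y)) b) c"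
      by simp
    have b3: "(\<lambda>a b. a \<otimes>\<^bsub>K\<^esub> b) \<in> bil G G G" by (intro bilI lin_intros) auto
    show "sw ?g ?g (\<lambda>a b. counit ?g a \<odot>\<^bsub>?g\<^esub> b) c = c" using c by (simp add: e s b3)
    have b4: "(\<lambda>a b. pt G G b a) \<in> bil G G (T G G)"
      by (intro bil_flip[OF pt_bil]) auto
    show "sw ?g (T ?g ?g) (\<lambda>a b. pt ?g ?g b a) c = comult ?g c"
      using c by (simp add: s[OF b4]) (simp add: d p)
  qed simp
qed

section \<open>Cocommutative Hopf algebras as group objects\<close>

definition conv where
  "conv C H f g = restrict (\<lambda>c. sw C H (\<lambda>a b. f a \<otimes>\<^bsub>H\<^esub> g b) c) (carrier C)"

definition const_map where
  "const_map C H g = (\<lambda>c \<in> carrier C. counit C c \<odot>\<^bsub>H\<^esub> g)"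

definition conv_one where
  "conv_one C H = restrict (\<lambda>c. counit C c \<odot>\<^bsub>H\<^esub> \<one>\<^bsub>H\<^esub>) (carrier C)"

definition conv_group where
  "conv_group C H = \<lparr>carrier = Hom C H, mult = conv C H, one = conv_one C H\<rparr>"

text \<open>The data of a Hopf algebra whose structure maps are coalgebra maps; the group identities
  are not part of it.\<close>

definition pre_hopf where
  "pre_hopf H \<longleftrightarrow> coalg H \<and> mult H \<in> bil H H H \<and> \<one>\<^bsub>H\<^esub> \<in> carrier H \<and>
     (\<forall>x \<in> carrier H. \<forall>y \<in> carrier H. comult H (x \<otimes>\<^bsub>H\<^esub> y) =
        sw H (T H H) (\<lambda>x1 x2.
          sw H (T H H) (\<lambda>y1 y2.
            pt H H (x1 \<otimes>\<^bsub>H\<^esub> y1) (x2 \<otimes>\<^bsub>H\<^esub> y2)) y) x) \<and>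
     comult H \<one>\<^bsub>H\<^esub> = pt H H \<one>\<^bsub>H\<^esub> \<one>\<^bsub>H\<^esub> \<and>
     (\<forall>x \<in> carrier H. \<forall>y \<in> carrier H. counit H (x \<otimes>\<^bsub>H\<^esub> y) = counit H x \<otimes>\<^bsub>K\<^esub> counit H y) \<and>
     counit H \<one>\<^bsub>H\<^esub> = \<one>\<^bsub>K\<^esub> \<and> antipode H \<in> chom H H"

abbreviation hopf where "hopf H \<equiv> cocomm_hopf_algebra K H"

text \<open>The first leg is seen only through its \<open>C\<close>-component, so the counit of
  \<open>D\<close> absorbs one of the two legs of \<open>d\<close>. The companion
  \<open>sw_proj_right\<close> does the same with the factors exchanged.\<close>

lemma sw_proj_left:
  assumes C: "coalg C" and D: "coalg D" and U: "md U" and b: "\<beta> \<in> bil C (T C D) U"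
    and c: "c \<in> carrier C" and d: "d \<in> carrier D"
  shows "sw (C \<otimes>\<^sub>c D) U (\<lambda>a b. \<beta> (p1 C D a) b) (pt C D c d) = sw C U (\<lambda>c1 c2. \<beta> c1 (pt C D c2 d)) c"
proof -
  have m: "md C" "md D" using C D by auto
  note bc = bil_closed[OF b] bilD[OF b]
  have b': "(\<lambda>a b. \<beta> (p1 C D a) b) \<in> bil (T C D) (T C D) U"
    using Hom_lin[OF proj_Hom(1)[OF C D]] by (intro bil_comp[OF b] lin_id) auto
  have "sw (C \<otimes>\<^sub>c D) U (\<lambda>a b. \<beta> (p1 C D a) b) (pt C D c d) =
      sw2 C D U (\<lambda>c1 d1 c2 d2. \<beta> (p1 C D (pt C D c1 d1)) (pt C D c2 d2)) c d"
    by (rule sw_tensor_pure[OF C D U b' c d])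
  also have "\<dots> = sw C U (\<lambda>c1 c2. sw D U (\<lambda>d1 d2. counit D d1 \<odot>\<^bsub>U\<^esub> \<beta> c1 (pt C D c2 d2)) d) c"
    using C D m by (intro sw2_cong) (simp add: proj1_pure lin_smult[OF bc(2)])
  also have "\<dots> = sw C U (\<lambda>c1 c2. \<beta> c1 (pt C D c2 d)) c"
    using m d by (intro sw_cong sw_counit_left D U lin_comp[OF bc(3)] lin_intros)
  finally show ?thesis .
qed

lemma sw_proj_right:
  fixes U (structure)
  assumes C: "coalg C" and D: "coalg D" and U: "md U" and b: "\<beta> \<in> bil (T C D) D U"
    and c: "c \<in> carrier C" and d: "d \<in> carrier D"
  shows "sw (C \<otimes>\<^sub>c D) U (\<lambda>a b. \<beta> a (p2 C D b)) (pt C D c d) = sw D U (\<lambda>d1 d2. \<beta> (pt C D c d1) d2) d"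
proof -
  have m: "md C" "md D" using C D by auto
  note bc = bil_closed[OF b] bilD[OF b]
  have b': "(\<lambda>a b. \<beta> a (p2 C D b)) \<in> bil (T C D) (T C D) U"
    using Hom_lin[OF proj_Hom(2)[OF C D]] by (intro bil_comp[OF b] lin_id) auto
  have q: "(\<lambda>d1 d2. \<beta> (pt C D c d1) d2) \<in> bil D D U" if "c \<in> carrier C" for c
    using m that by (intro bil_comp[OF b] lin_intros)
  have l: "(\<lambda>c. sw D U (\<lambda>d1 d2. \<beta> (pt C D c d1) d2) d) \<in> lin C U"
    using m d D U q by (intro lin_sw_param lin_comp[OF bc(2)] lin_intros) auto
  have "sw (C \<otimes>\<^sub>c D) U (\<lambda>a b. \<beta> a (p2 C D b)) (pt C D c d) =
      sw2 C D U (\<lambda>c1 d1 c2 d2. \<beta> (pt C D c1 d1) (p2 C D (pt C D c2 d2))) c d"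
    by (rule sw_tensor_pure[OF C D U b' c d])
  also have "\<dots> = sw C U (\<lambda>c1 c2. counit C c2 \<odot> sw D U (\<lambda>d1 d2. \<beta> (pt C D c1 d1) d2) d) c"
  proof (rule sw_cong)
    fix c1 c2 assume c12: "c1 \<in> carrier C" "c2 \<in> carrier C"
    have "sw D U (\<lambda>d1 d2. \<beta> (pt C D c1 d1) (p2 C D (pt C D c2 d2))) d =
        sw D U (\<lambda>d1 d2. counit C c2 \<odot> \<beta> (pt C D c1 d1) d2) d"
      using C D m c12 by (intro sw_cong) (simp add: proj2_pure lin_smult[OF bc(3)])
    also have "\<dots> = counit C c2 \<odot> sw D U (\<lambda>d1 d2. \<beta> (pt C D c1 d1) d2) d"
      using C D U c12 d q by (intro sw_push[where h = "\<lambda>u. counit C c2 \<odot> u", symmetric] lin_intros) auto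
    finally show "sw D U (\<lambda>d1 d2. \<beta> (pt C D c1 d1) (p2 C D (pt C D c2 d2))) d =
        counit C c2 \<odot> sw D U (\<lambda>d1 d2. \<beta> (pt C D c1 d1) d2) d" .
  qed
  also have "\<dots> = sw D U (\<lambda>d1 d2. \<beta> (pt C D c d1) d2) d"
    by (rule sw_counit_right[OF C U l c])
  finally show ?thesis .
qed

lemma pairing_pure:
  assumes C: "coalg C" and D: "coalg D" and A: "md A" and B: "md B" and f: "f \<in> lin C A" and g: "g \<in> lin D B"
    and c: "c \<in> carrier C" and d: "d \<in> carrier D"
  shows "pair (C \<otimes>\<^sub>c D) A B (cmp (C \<otimes>\<^sub>c D) f (p1 C D)) (cmp (C \<otimes>\<^sub>c D) g (p2 C D)) (pt C D c d)
    = pt A B (f c) (g d)"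
proof -
  have m: "md C" "md D" using C D by auto
  have b: "(\<lambda>a b. pt A B (f a) (g b)) \<in> bil C D (T A B)"
    using A B f g by (intro bil_comp[OF pt_bil])
  have "pair (C \<otimes>\<^sub>c D) A B (cmp (C \<otimes>\<^sub>c D) f (p1 C D)) (cmp (C \<otimes>\<^sub>c D) g (p2 C D)) (pt C D c d)
    = sw (C \<otimes>\<^sub>c D) (T A B) (\<lambda>a b. pt A B (f (p1 C D a)) (g (p2 C D b))) (pt C D c d)"
    using m c d by (simp add: pairing_apply) (intro sw_cong, simp add: compose_def)
  also have "\<dots> = pt A B (f c) (g d)"
    using A B m c d b by (subst sw_proj[OF C D _ b]) (auto simp: tensor_lift_pure)
  finally show ?thesis .
qed

lemma conv_apply: "c \<in> carrier C \<Longrightarrow> conv C H f g c = sw C H (\<lambda>a b. f a \<otimes>\<^bsub>H\<^esub> g b) c"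
  by (simp add: conv_def)

text \<open>Points pulled back from the two factors separate on pure tensors. This is how identities
  between points over \<open>C \<otimes> D\<close> are read off as identities between
  elements.\<close>

lemma conv_pure:
  fixes H (structure)
  assumes C: "coalg C" and D: "coalg D" and H: "md H" and mu: "mult H \<in> bil H H H"
    and f: "f \<in> lin C H" and g: "g \<in> lin D H" and c: "c \<in> carrier C" and d: "d \<in> carrier D"
  shows "conv (C \<otimes>\<^sub>c D) H (cmp (C \<otimes>\<^sub>c D) f (p1 C D)) (cmp (C \<otimes>\<^sub>c D) g (p2 C D)) (pt C D c d)
    = f c \<otimes> g d"
proof -
  have m: "md C" "md D" using C D by auto
  have b: "(\<lambda>a b. f a \<otimes> g b) \<in> bil C D H"
    using f g by (intro bil_comp[OF mu])
  have "conv (C \<otimes>\<^sub>c D) H (cmp (C \<otimes>\<^sub>c D) f (p1 C D)) (cmp (C \<otimes>\<^sub>c D) g (p2 C D)) (pt C D c d)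
    = sw (C \<otimes>\<^sub>c D) H (\<lambda>a b. f (p1 C D a) \<otimes> g (p2 C D b)) (pt C D c d)"
    using m c d by (simp add: conv_apply) (intro sw_cong, simp add: compose_def)
  also have "\<dots> = f c \<otimes> g d"
    using H m c d b by (subst sw_proj[OF C D _ b]) (auto simp: tensor_lift_pure)
  finally show ?thesis .
qed

lemma pre_hopfD:
  fixes H (structure)
  assumes "pre_hopf H"
  shows "coalg H" "mult H \<in> bil H H H" "\<one> \<in> carrier H"
    "\<And>x y. x \<in> carrier H \<Longrightarrow> y \<in> carrier H \<Longrightarrow> comult H (x \<otimes> y) =
        sw2 H H (T H H) (\<lambda>x1 y1 x2 y2. pt H H (x1 \<otimes> y1) (x2 \<otimes> y2)) x y"
    "comult H \<one> = pt H H \<one> \<one>"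
    "\<And>x y. x \<in> carrier H \<Longrightarrow> y \<in> carrier H \<Longrightarrow> counit H (x \<otimes> y) = counit H x \<otimes>\<^bsub>K\<^esub> counit H y"
    "counit H \<one> = \<one>\<^bsub>K\<^esub>" "antipode H \<in> chom H H"
  using assms by (simp_all add: pre_hopf_def)

lemma pre_hopf_md [simp, intro]: "pre_hopf H \<Longrightarrow> md H"
  by (simp add: pre_hopf_def)

lemma mult_map_Hom:
  assumes "pre_hopf H"
  shows "tl H H H (mult H) \<in> Hom (H \<otimes>\<^sub>c H) H"
  by (rule tensor_homI) (use pre_hopfD[OF assms] in auto)

lemma pre_hopf_mult_closed:
  "pre_hopf H \<Longrightarrow> x \<in> carrier H \<Longrightarrow> y \<in> carrier H \<Longrightarrow> x \<otimes>\<^bsub>H\<^esub> y \<in> carrier H"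
  using bil_closed pre_hopfD(2) by metis

text \<open>Convolution is the multiplication map after the pairing, both of which are coalgebra
  maps; hence products of points are points again.\<close>

lemma conv_eq:
  assumes H: "pre_hopf H" and C: "coalg C" and f: "f \<in> Hom C H" and g: "g \<in> Hom C H"
  shows "conv C H f g = cmp C (tl H H H (mult H)) (pair C H H f g)"
proof (rule extensionalityI[where A = "carrier C"])
  note P = pre_hopfD[OF H]
  have m: "md H" "md C" using H C by auto
  note b = pairing_bil[OF m(1,1) Hom_lin[OF f] Hom_lin[OF g]]
  fix c assume c: "c \<in> carrier C"
  have "tl H H H (mult H) (pair C H H f g c) = sw C H (\<lambda>a b. tl H H H (mult H) (pt H H (f a) (g b))) c"
    using C m b c tensor_lift_linear[OF m(1,1,1) P(2)]
    by (simp add: pairing_apply sw_push[of C "T H H" H])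
  also have "\<dots> = conv C H f g c"
    unfolding conv_apply[OF c] using m P(2)
    by (intro sw_cong) (simp add: tensor_lift_pure Hom_closed[OF f] Hom_closed[OF g])
  finally show "conv C H f g c = cmp C (tl H H H (mult H)) (pair C H H f g) c"
    using c by (simp add: compose_def)
qed (auto simp: conv_def compose_def)

lemma conv_Hom [simp, intro]:
  assumes H: "pre_hopf H" and C: "coalg C" and f: "f \<in> Hom C H" and g: "g \<in> Hom C H"
  shows "conv C H f g \<in> Hom C H"
  unfolding conv_eq[OF assms] using pre_hopfD(1)[OF H] C f g mult_map_Hom[OF H]
  by (intro compose_Hom[where D = "H \<otimes>\<^sub>c H"]) auto

lemma conv_bil:
  assumes "mult H \<in> bil H H H" "f \<in> lin C H" "g \<in> lin C H"
  shows "(\<lambda>a b. f a \<otimes>\<^bsub>H\<^esub> g b) \<in> bil C C H"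
  by (rule bil_comp[OF assms])

lemma conv_compose:
  assumes H: "pre_hopf H" and C: "coalg C" and f: "f \<in> Hom C H" and g: "g \<in> Hom C H"
    and B: "coalg B" and k: "k \<in> Hom B C"
  shows "cmp B (conv C H f g) k =
    conv B H (cmp B f k) (cmp B g k)"
proof (rule extensionalityI[where A = "carrier B"])
  note P = pre_hopfD[OF H]
  fix b assume b: "b \<in> carrier B"
  have "conv C H f g (k b) = sw B H (\<lambda>x y. f (k x) \<otimes>\<^bsub>H\<^esub> g (k y)) b"
    using Hom_closed[OF k b] b B C H conv_bil[OF P(2) Hom_lin[OF f] Hom_lin[OF g]]
    by (simp add: conv_apply sw_chom[OF B _ _ Hom_chom[OF k]])
  also have "\<dots> = conv B H (cmp B f k) (cmp B g k) b"
    unfolding conv_apply[OF b] by (intro sw_cong) (simp add: compose_def)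
  finally show "cmp B (conv C H f g) k b =
    conv B H (cmp B f k) (cmp B g k) b"
    using b by (simp add: compose_def)
qed (auto simp: conv_def compose_def)

section \<open>Group-like elements, constant points and recognition of Hopf algebras\<close>

definition group_like where
  "group_like H g \<longleftrightarrow> g \<in> carrier H \<and> comult H g = pt H H g g \<and> counit H g = \<one>\<^bsub>K\<^esub>"

text \<open>A group-like element is a point over the ground coalgebra; pulling it back along the
  counit of \<open>C\<close> gives the constant point.\<close>

lemma const_map_Hom:
  fixes H (structure)
  assumes H: "coalg H" and C: "coalg C" and g: "group_like H g"
  shows "const_map C H g \<in> Hom C H"
  unfolding const_map_def
proof (rule restrict_Hom[OF C], rule chomI)
  interpret K: cring K by (rule cring_K)
  have g: "g \<in> carrier H" "comult H g = pt H H g g" "counit H g = \<one>\<^bsub>K\<^esub>" using g by (simp_all add: group_like_def)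
  have m: "md H" "md C" using H C by auto
  show "(\<lambda>c. counit C c \<odot> g) \<in> lin C H"
    using m g C by (intro lin_intros)
  fix c assume c: "c \<in> carrier C"
  have l: "(\<lambda>b. counit C b \<odot>\<^bsub>T H H\<^esub> pt H H g g) \<in> lin C (T H H)"
    using m g C by (intro lin_intros) auto
  have "sw C (T H H) (\<lambda>a b. pt H H (counit C a \<odot> g) (counit C b \<odot> g)) c =
      sw C (T H H) (\<lambda>a b. counit C a \<odot>\<^bsub>T H H\<^esub> (counit C b \<odot>\<^bsub>T H H\<^esub> pt H H g g)) c"
    using m C g(1)
    by (intro sw_cong) (simp add: lin_smult[OF bilD(1)[OF pt_bil]]
      lin_smult[OF bilD(2)[OF pt_bil]] smult_closedK smult_left_commute)
  also have "\<dots> = counit C c \<odot>\<^bsub>T H H\<^esub> pt H H g g"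
    using m by (intro sw_counit_left[OF C _ l c]) auto
  also have "\<dots> = comult H (counit C c \<odot> g)"
    using C c g H by (simp add: lin_smult[OF comult_lin[OF H]])
  finally show "comult H (counit C c \<odot> g) =
    sw C (T H H) (\<lambda>a b. pt H H (counit C a \<odot> g) (counit C b \<odot> g)) c" ..
  show "counit H (counit C c \<odot> g) = counit C c"
    using C c g H by (simp add: lin_smult[OF counit_lin[OF H]])
qed

lemma group_like_image:
  assumes "md C" "md D" and f: "f \<in> chom C D" and g: "group_like C g"
  shows "group_like D (f g)"
proof -
  have g: "g \<in> carrier C" "comult C g = pt C C g g" "counit C g = \<one>\<^bsub>K\<^esub>" using g by (simp_all add: group_like_def)
  show ?thesis
    using chom_closed[OF f g(1)] chom_counit[OF f g(1)] chom_comult[OF f g(1)] g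
      pairing_bil[OF assms(2,2) chom_lin[OF f] chom_lin[OF f]] assms(1,2)
    by (simp add: group_like_def sweedler_def tensor_lift_pure)
qed

lemma group_like_ground: "group_like (ground_coalgebra K) \<one>\<^bsub>K\<^esub>"
proof -
  interpret K: cring K by (rule cring_K)
  have gg: "same_module (ground_coalgebra K) G" by (simp add: same_module_def)
  have "comult (ground_coalgebra K) \<one>\<^bsub>K\<^esub> = pt G G \<one>\<^bsub>K\<^esub> \<one>\<^bsub>K\<^esub>" "counit (ground_coalgebra K) \<one>\<^bsub>K\<^esub> = \<one>\<^bsub>K\<^esub>"
    by (simp_all add: ground_coalgebra_def Let_def)
  then show ?thesis by (simp add: group_like_def same_tensor(2)[OF gg gg])
qed

lemma conv_one_const: "conv_one C H = const_map C H \<one>\<^bsub>H\<^esub>"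
  by (simp add: conv_one_def const_map_def)

lemma group_like_one: "pre_hopf H \<Longrightarrow> group_like H \<one>\<^bsub>H\<^esub>"
  by (simp add: group_like_def pre_hopfD)

lemma conv_one_Hom [simp, intro]: "pre_hopf H \<Longrightarrow> coalg C \<Longrightarrow> conv_one C H \<in> Hom C H"
  unfolding conv_one_const by (intro const_map_Hom group_like_one pre_hopfD(1))

lemma conv_const:
  fixes H (structure)
  assumes C: "coalg C" and H: "pre_hopf H" and z: "z \<in> lin C H" and g: "g \<in> carrier H" and c: "c \<in> carrier C"
  shows "conv C H (const_map C H g) z c = g \<otimes> z c" "conv C H z (const_map C H g) c = z c \<otimes> g"
proof -
  have m: "md H" using H by auto
  note mu = bilD[OF pre_hopfD(2)[OF H]]
  have "conv C H (const_map C H g) z c = sw C H (\<lambda>a b. counit C a \<odot> (g \<otimes> z b)) c"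
    unfolding conv_apply[OF c] using C g lin_closed[OF z] by (intro sw_cong) (simp add: const_map_def lin_smult[OF mu(1)])
  then show "conv C H (const_map C H g) z c = g \<otimes> z c"
    using sw_counit_left[OF C m lin_comp[OF mu(2)[OF g] z] c] by simp
  have "conv C H z (const_map C H g) c = sw C H (\<lambda>a b. counit C b \<odot> (z a \<otimes> g)) c"
    unfolding conv_apply[OF c] using C g lin_closed[OF z] by (intro sw_cong) (simp add: const_map_def lin_smult[OF mu(2)])
  then show "conv C H z (const_map C H g) c = z c \<otimes> g"
    using sw_counit_right[OF C m lin_comp[OF mu(1)[OF g] z] c] by simp
qed

lemma pairing_const:
  assumes C: "coalg C" and m: "md X" "md D" and x: "x \<in> lin C X" and g: "g \<in> carrier D" and c: "c \<in> carrier C"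
  shows "pair C X D x (const_map C D g) c = pt X D (x c) g"
proof -
  have "pair C X D x (const_map C D g) c = sw C (T X D) (\<lambda>a b. counit C b \<odot>\<^bsub>T X D\<^esub> pt X D (x a) g) c"
    unfolding pairing_apply[OF c] using C m g lin_closed[OF x]
    by (intro sw_cong) (simp add: const_map_def lin_smult[OF bilD(2)[OF pt_bil]])
  also have "\<dots> = pt X D (x c) g"
    using C m g c x by (intro sw_counit_right lin_pt1) auto
  finally show ?thesis .
qed

lemma conv_proj_pure:
  assumes H: "pre_hopf H" and xy: "x \<in> carrier H" "y \<in> carrier H"
  shows "conv (H \<otimes>\<^sub>c H) H (p1 H H) (p2 H H) (pt H H x y) = x \<otimes>\<^bsub>H\<^esub> y"
proof -
  note P = pre_hopfD[OF H]
  have m: "md H" using H by auto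
  have id: "cmp (H \<otimes>\<^sub>c H) (\<lambda>x. x) (p1 H H) = p1 H H" "cmp (H \<otimes>\<^sub>c H) (\<lambda>x. x) (p2 H H) = p2 H H"
    using Hom_ext[OF proj_Hom(1)[OF P(1,1)]] Hom_ext[OF proj_Hom(2)[OF P(1,1)]]
    by (auto simp: compose_def fun_eq_iff extensional_def)
  show ?thesis
    using conv_pure[OF P(1,1) m P(2) lin_id lin_id xy] by (simp only: id)
qed

lemma conv_one_compose:
  assumes "k \<in> Hom B C"
  shows "cmp B (conv_one C H) k = conv_one B H"
  using Hom_closed[OF assms] chom_counit[OF Hom_chom[OF assms]]
  by (auto simp: conv_one_def compose_def fun_eq_iff)

lemma antipode_Hom [simp, intro]:
  assumes "pre_hopf H" "coalg C" "f \<in> Hom C H"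
  shows "cmp C (antipode H) f \<in> Hom C H"
  unfolding compose_def
  by (rule restrict_Hom) (use assms pre_hopfD[OF assms(1)] in \<open>auto intro: chom_comp Hom_chom\<close>)

text \<open>The compatibility of the product with comultiplication and counit is the statement that
  \<open>M\<close> is a coalgebra map, read on pure tensors.\<close>

lemma pre_hopfI:
  fixes H (structure)
  assumes H: "coalg H" and M: "M \<in> Hom (H \<otimes>\<^sub>c H) H"
    and mult: "\<And>x y. x \<in> carrier H \<Longrightarrow> y \<in> carrier H \<Longrightarrow> x \<otimes> y = M (pt H H x y)"
    and one: "group_like H \<one>"
    and S: "antipode H \<in> chom H H"
  shows "pre_hopf H"
proof -
  have m: "md H" using H by auto
  have Ml: "M \<in> lin (T H H) H" using Hom_lin[OF M] by simp
  have b: "(\<lambda>x y. M (pt H H x y)) \<in> bil H H H"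
    using m by (intro bil_post[OF pt_bil Ml])
  have mu: "mult H \<in> bil H H H"
    using lin_cong[OF bilD(1)[OF b] m] lin_cong[OF bilD(2)[OF b] m] mult
    by (intro bilI) auto
  have co: "comult H (x \<otimes> y) = sw2 H H (T H H) (\<lambda>x1 y1 x2 y2. pt H H (x1 \<otimes> y1) (x2 \<otimes> y2)) x y"
    if xy: "x \<in> carrier H" "y \<in> carrier H" for x y
  proof -
    have "comult H (x \<otimes> y) = sw (H \<otimes>\<^sub>c H) (T H H) (\<lambda>a b. pt H H (M a) (M b)) (pt H H x y)"
      using chom_comult[OF Hom_chom[OF M], of "pt H H x y"] xy m by (simp add: mult)
    also have "\<dots> = sw2 H H (T H H) (\<lambda>x1 y1 x2 y2. pt H H (M (pt H H x1 y1)) (M (pt H H x2 y2))) x y"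
      using m xy H by (intro sw_tensor_pure bil_comp[OF pt_bil] Ml) auto
    also have "\<dots> = sw2 H H (T H H) (\<lambda>x1 y1 x2 y2. pt H H (x1 \<otimes> y1) (x2 \<otimes> y2)) x y"
      by (intro sw2_cong) (simp add: mult)
    finally show ?thesis .
  qed
  have cu: "counit H (x \<otimes> y) = counit H x \<otimes>\<^bsub>K\<^esub> counit H y" if xy: "x \<in> carrier H" "y \<in> carrier H" for x y
    using chom_counit[OF Hom_chom[OF M], of "pt H H x y"] xy m H by (simp add: mult tensor_counit_pure)
  show ?thesis
    unfolding pre_hopf_def using H mu one co cu S by (auto simp: group_like_def)
qed

lemma hopfI:
  fixes H (structure)
  assumes H: "pre_hopf H"
    and assoc: "\<And>x y z. x \<in> carrier H \<Longrightarrow> y \<in> carrier H \<Longrightarrow> z \<in> carrier H \<Longrightarrow>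
      (x \<otimes> y) \<otimes> z = x \<otimes> (y \<otimes> z)"
    and l_one: "\<And>x. x \<in> carrier H \<Longrightarrow> \<one> \<otimes> x = x" and r_one: "\<And>x. x \<in> carrier H \<Longrightarrow> x \<otimes> \<one> = x"
    and l_inv: "\<And>x. x \<in> carrier H \<Longrightarrow> sw H H (\<lambda>x1 x2. antipode H x1 \<otimes> x2) x = counit H x \<odot> \<one>"
    and r_inv: "\<And>x. x \<in> carrier H \<Longrightarrow> sw H H (\<lambda>x1 x2. x1 \<otimes> antipode H x2) x = counit H x \<odot> \<one>"
  shows "hopf H"
proof -
  note P = pre_hopfD[OF H]
  interpret M: module K H using H by auto
  note mu = bilD[OF P(2)]
  have "monoid H"
    by (rule monoidI) (use assoc l_one r_one P(3) pre_hopf_mult_closed[OF H] in auto)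
  then have "ring H"
    by (intro ringI M.abelian_group_axioms) (auto simp: lin_add[OF mu(1)] lin_add[OF mu(2)])
  then show ?thesis
    using P l_inv r_inv chom_lin[OF P(8)]
    by (intro cocomm_hopf_algebra.intro cocomm_hopf_algebra_axioms.intro)
      (auto simp: lin_smult[OF mu(1)] lin_smult[OF mu(2)])
qed

text \<open>The group identities of a group object need only be checked on the generic points.\<close>

lemma hopf_of_points:
  fixes H :: "('k, 'a, 'h) hopf_algebra_scheme" (structure)
  assumes H: "pre_hopf H"
  defines "C \<equiv> (H \<otimes>\<^sub>c H) \<otimes>\<^sub>c H"
  assumes assoc: "\<And>f g h. f \<in> Hom C H \<Longrightarrow> g \<in> Hom C H \<Longrightarrow> h \<in> Hom C H \<Longrightarrow>
      conv C H (conv C H f g) h = conv C H f (conv C H g h)"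
    and laws: "\<And>i. i \<in> Hom H H \<Longrightarrow> conv H H (conv_one H H) i = i"
      "\<And>i. i \<in> Hom H H \<Longrightarrow> conv H H i (conv_one H H) = i"
      "\<And>i. i \<in> Hom H H \<Longrightarrow> conv H H (cmp H (antipode H) i) i = conv_one H H"
      "\<And>i. i \<in> Hom H H \<Longrightarrow> conv H H i (cmp H (antipode H) i) = conv_one H H"
  shows "hopf H"
proof (rule hopfI[OF H])
  note P = pre_hopfD[OF H]
  have m: "md H" using H by auto
  have HH: "coalg (H \<otimes>\<^sub>c H)" using P(1) by auto
  have C: "coalg C" unfolding C_def using P(1) by auto
  note mu = bilD[OF P(2)] bil_closed[OF P(2)]
  note pH = proj_Hom[OF P(1) P(1)] and pHH = proj_Hom[OF HH P(1)]
  have pl: "p1 H H \<in> lin (T H H) H" "p2 H H \<in> lin (T H H) H"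
    using Hom_lin[OF pH(1)] Hom_lin[OF pH(2)] by auto
  \<comment> \<open>\<open>f\<close>, \<open>g\<close> and \<open>h\<close> are the three
    projections of \<open>(H \<otimes> H) \<otimes> H\<close>. Their two bracketed products,
    evaluated at \<open>(x \<otimes> y) \<otimes> z\<close>, are the two bracketed products of the
    elements.\<close>
  define q where "q = p1 (H \<otimes>\<^sub>c H) H"
  define f where "f = cmp C (p1 H H) q"
  define g where "g = cmp C (p2 H H) q"
  define h where "h = p2 (H \<otimes>\<^sub>c H) H"
  let ?i = "\<lambda>x\<in>carrier H. x"
  have i: "?i \<in> Hom H H" by (rule ident_Hom[OF P(1)])
  have fH: "f \<in> Hom C H" "g \<in> Hom C H" "h \<in> Hom C H"
    unfolding f_def g_def h_def q_def by (rule compose_Hom[OF C coalg_md[OF HH] m pH(1) pHH(1)[folded C_def]]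
      compose_Hom[OF C coalg_md[OF HH] m pH(2) pHH(1)[folded C_def]] pHH(2)[folded C_def])+
  have one: "\<one> \<in> carrier H" by (rule P(3))
  fix x assume x: "x \<in> carrier H"
  {
    fix y z assume yz: "y \<in> carrier H" "z \<in> carrier H"
    let ?t = "pt (T H H) H (pt H H x y) z"
    have t: "?t \<in> carrier C" using m x yz by (simp add: C_def)
    have hid: "h = cmp C (\<lambda>x. x) h" unfolding h_def C_def
      by (rule extensionalityI[OF Hom_ext[OF pHH(2)]]) (auto simp: compose_def)
    have fg: "conv C H f g = cmp C (conv (H \<otimes>\<^sub>c H) H (p1 H H) (p2 H H)) q"
      unfolding f_def g_def q_def using conv_compose[OF H HH pH C pHH(1)[folded C_def]] by simp
    have xy: "conv (H \<otimes>\<^sub>c H) H (p1 H H) (p2 H H) (pt H H x y) = x \<otimes> y" by (rule conv_proj_pure[OF H x yz(1)])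
    have cl: "conv (H \<otimes>\<^sub>c H) H (p1 H H) (p2 H H) \<in> lin (T H H) H"
      using Hom_lin[OF conv_Hom[OF H HH pH]] by simp
    have "conv C H (conv C H f g) h ?t = conv (H \<otimes>\<^sub>c H) H (p1 H H) (p2 H H) (pt H H x y) \<otimes> z"
      unfolding fg unfolding C_def q_def h_def
      using conv_pure[OF HH P(1) m P(2), of "conv (H \<otimes>\<^sub>c H) H (p1 H H) (p2 H H)" "\<lambda>x. x" "pt H H x y" z]
        cl m x yz hid[unfolded C_def h_def]
      by (simp add: lin_id)
    then have L: "conv C H (conv C H f g) h ?t = (x \<otimes> y) \<otimes> z" using xy by simp
    have ghl: "conv C H g h \<in> lin (T (T H H) H) H"
      using Hom_lin[OF conv_Hom[OF H C fH(2,3)]] by (simp add: C_def)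
    have gh: "conv C H g h (pt (T H H) H s z) = p2 H H s \<otimes> z" if "s \<in> carrier (T H H)" for s
      unfolding C_def g_def q_def h_def
      using conv_pure[OF HH P(1) m P(2), of "p2 H H" "\<lambda>x. x" s z] pl m yz that hid[unfolded C_def h_def]
      by (simp add: lin_id)
    have bb: "(\<lambda>a b. p1 H H a \<otimes> conv C H g h b) \<in> bil (T H H) (T (T H H) H) H"
      by (rule bil_comp[OF P(2) pl(1) ghl])
    have b3: "(\<lambda>a b. a \<otimes> (b \<otimes> z)) \<in> bil H H H"
      by (rule bil_comp[OF P(2) lin_id mu(1)[OF yz(2)]])
    have "conv C H f (conv C H g h) ?t =
        sw ((H \<otimes>\<^sub>c H) \<otimes>\<^sub>c H) H (\<lambda>a b. p1 H H (p1 (H \<otimes>\<^sub>c H) H a) \<otimes> conv C H g h b) (pt (H \<otimes>\<^sub>c H) H (pt H H x y) z)"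
      unfolding conv_apply[OF t] unfolding C_def by simp (intro sw_cong, simp add: f_def q_def compose_def C_def)
    also have "\<dots> = sw (H \<otimes>\<^sub>c H) H (\<lambda>a b. p1 H H a \<otimes> conv C H g h (pt (H \<otimes>\<^sub>c H) H b z)) (pt H H x y)"
      using m x yz bb by (intro sw_proj_left[OF HH P(1) m]) auto
    also have "\<dots> = sw (H \<otimes>\<^sub>c H) H (\<lambda>a b. p1 H H a \<otimes> (p2 H H b \<otimes> z)) (pt H H x y)"
      by (intro sw_cong) (simp add: gh)
    also have "\<dots> = x \<otimes> (y \<otimes> z)"
      using m x yz b3 by (subst sw_proj[OF P(1) P(1) m b3]) (auto simp: tensor_lift_pure)
    finally show "(x \<otimes> y) \<otimes> z = x \<otimes> (y \<otimes> z)" using L assoc[OF fH] by simp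
  }
  note c = conv_const[OF P(1) H Hom_lin[OF i] one x, folded conv_one_const]
  show "\<one> \<otimes> x = x" "x \<otimes> \<one> = x" using c laws(1,2)[OF i] x by simp_all
  show "sw H H (\<lambda>x1 x2. antipode H x1 \<otimes> x2) x = counit H x \<odot> \<one>"
  proof -
    have "conv H H (cmp H (antipode H) ?i) ?i x = sw H H (\<lambda>x1 x2. antipode H x1 \<otimes> x2) x"
      unfolding conv_apply[OF x] by (intro sw_cong) (simp add: compose_def)
    then show ?thesis using laws(3)[OF i] x by (simp add: conv_one_def)
  qed
  have "conv H H ?i (cmp H (antipode H) ?i) x = sw H H (\<lambda>x1 x2. x1 \<otimes> antipode H x2) x"
    unfolding conv_apply[OF x] by (intro sw_cong) (simp add: compose_def)
  then show "sw H H (\<lambda>x1 x2. x1 \<otimes> antipode H x2) x = counit H x \<odot> \<one>"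
    using laws(4)[OF i] x by (simp add: conv_one_def)
qed

lemma chom_tm:
  "f \<in> chom C D \<Longrightarrow> c \<in> carrier C \<Longrightarrow> comult D (f c) = tm C C D D f f (comult C c)"
  by (simp add: coalgebra_hom_def)

text \<open>Stated for a source whose comultiplication is only known to be linear, because
  \<open>coalg_inj\<close> uses it to deduce the coalgebra laws of that source.\<close>

lemma sw_injected:
  assumes E: "md E" "comult E \<in> lin E (T E E)" and W: "md W" and i: "i \<in> chom E W"
    and U: "md U" and b: "\<beta> \<in> bil W W U" and c: "c \<in> carrier E"
  shows "sw W U \<beta> (i c) = sw E U (\<lambda>a b. \<beta> (i a) (i b)) c"
proof -
  have "sw W U \<beta> (i c) = tl W W U \<beta> (tm E E W W i i (comult E c))"
    using i c by (simp add: coalgebra_hom_def sweedler_def)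
  also have "\<dots> = sw E U (\<lambda>a b. \<beta> (i a) (i b)) c"
    unfolding sweedler_def using assms chom_lin[OF i] lin_closed[OF E(2) c] by (intro tl_tm)
  finally show ?thesis .
qed

text \<open>An injective coalgebra map has a linear retraction \<open>p\<close>, so Sweedler sums over the source are
  Sweedler sums over the target.\<close>

lemma sw_retract:
  assumes E: "md E" "comult E \<in> lin E (T E E)" and W: "md W" and i: "i \<in> chom E W"
    and p: "p \<in> lin W E" "\<And>x. x \<in> carrier E \<Longrightarrow> p (i x) = x"
    and U: "md U" and b: "\<beta> \<in> bil E E U" and c: "c \<in> carrier E"
  shows "sw E U \<beta> c = sw W U (\<lambda>a b. \<beta> (p a) (p b)) (i c)"
  unfolding sw_injected[OF E W i U bil_comp[OF b p(1) p(1)] c] by (intro sw_cong) (simp add: p(2))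

lemma comult_retract:
  assumes E: "md E" "comult E \<in> lin E (T E E)" and W: "md W" and i: "i \<in> chom E W"
    and p: "p \<in> lin W E" "\<And>x. x \<in> carrier E \<Longrightarrow> p (i x) = x" and c: "c \<in> carrier E"
  shows "comult E c = sw W (T E E) (\<lambda>a b. pt E E (p a) (p b)) (i c)"
proof -
  have b: "pt E E \<in> bil E E (T E E)" by (rule pt_bil[OF E(1,1)])
  have "sw E (T E E) (pt E E) c = comult E c"
    unfolding sweedler_def using E lin_closed[OF E(2) c] b by (intro tl_eqI lin_id) auto
  then show ?thesis using sw_retract[OF E W i p _ b c] E(1) by simp
qed

text \<open>Applying the retraction \<open>p\<close> to both legs of the comultiplication of
  \<open>i (f c)\<close> returns that of \<open>f c\<close>. The lemma serves to corestrict maps to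
  subobjects and to invert bijective coalgebra maps.\<close>

lemma chom_reflect:
  assumes C: "coalg C" and E: "coalg E" and W: "coalg W" and i: "i \<in> chom E W" and inj: "inj_on i (carrier E)"
    and f: "\<And>c. c \<in> carrier C \<Longrightarrow> f c \<in> carrier E" and fi: "(\<lambda>c. i (f c)) \<in> chom C W"
  shows "f \<in> chom C E"
proof (rule chomI)
  have m: "md C" "md E" "md W" using C E W by auto
  obtain p where p: "p \<in> lin W E" "\<And>x. x \<in> carrier E \<Longrightarrow> p (i x) = x"
    using lin_retraction[OF m(2,3) chom_lin[OF i] inj] by blast
  show "f \<in> lin C E"
    using lin_comp[OF p(1) chom_lin[OF fi]] m(1) by (rule lin_cong) (simp add: p(2) f)
  fix c assume c: "c \<in> carrier C"
  have b: "(\<lambda>a b. pt E E (p a) (p b)) \<in> bil W W (T E E)"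
    by (rule bil_comp[OF pt_bil[OF m(2,2)] p(1) p(1)])
  have "comult E (f c) = sw W (T E E) (\<lambda>a b. pt E E (p a) (p b)) (i (f c))"
    by (rule comult_retract[OF m(2) comult_lin[OF E] m(3) i p f[OF c]])
  also have "\<dots> = sw C (T E E) (\<lambda>a b. pt E E (p (i (f a))) (p (i (f b)))) c"
    using m by (intro sw_chom[OF C m(3) _ fi b c]) auto
  also have "\<dots> = sw C (T E E) (\<lambda>a b. pt E E (f a) (f b)) c"
    by (intro sw_cong) (simp add: p(2) f)
  finally show "comult E (f c) = sw C (T E E) (\<lambda>a b. pt E E (f a) (f b)) c" .
  show "counit E (f c) = counit C c"
    using chom_counit[OF i f[OF c]] chom_counit[OF fi c] by simp
qed

lemma hopf_coalg [simp, intro]: "hopf H \<Longrightarrow> coalg H"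
  by (simp add: cocomm_hopf_algebra_def)

lemma hopf_ring: "hopf H \<Longrightarrow> ring H"
  by (simp add: cocomm_hopf_algebra_def)

lemma hopf_mult_bil:
  assumes "hopf H" shows "mult H \<in> bil H H H"
proof -
  interpret H: ring H by (rule hopf_ring[OF assms])
  interpret cocomm_hopf_algebra K H by fact
  show ?thesis
    using smult_mult_left smult_mult_right
    by (intro bilI linI) (auto simp: H.l_distr H.r_distr)
qed

text \<open>The shear maps \<open>a \<otimes> c \<mapsto> a\<^sub>1 \<otimes> f(a\<^sub>2) c\<close> for \<open>f = id\<close> and \<open>f = S\<close> are mutually inverse.\<close>

lemma shear_inverse:
  fixes H (structure)
  assumes H: "hopf H" and f: "f \<in> lin H H" and g: "g \<in> lin H H"
    and inv: "\<And>v. v \<in> carrier H \<Longrightarrow> sw H H (\<lambda>x y. f x \<otimes> g y) v = counit H v \<odot> \<one>"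
    and a: "a \<in> carrier H" and c: "c \<in> carrier H"
    and L: "L \<in> lin (T H H) (T H H)"
      "\<And>a c. a \<in> carrier H \<Longrightarrow> c \<in> carrier H \<Longrightarrow> L (pt H H a c) = sw H (T H H) (\<lambda>u v. pt H H u (f v \<otimes> c)) a"
  shows "L (sw H (T H H) (\<lambda>u v. pt H H u (g v \<otimes> c)) a) = pt H H a c"
proof -
  interpret R: ring H by (rule hopf_ring[OF H])
  interpret HH: cocomm_hopf_algebra K H by fact
  note mu = hopf_mult_bil[OF H]
  have C: "coalg H" and m: "md H" "md (T H H)" using H by auto
  note cl = lin_closed[OF f] lin_closed[OF g]
  note gc = lin_comp[OF bilD(1)[OF mu c] g]
  have b: "(\<lambda>u v. pt H H u (g v \<otimes> c)) \<in> bil H H (T H H)"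
    by (rule bil_comp[OF pt_bil[OF m(1,1)] lin_id gc])
  have b': "(\<lambda>x y. f x \<otimes> (g y \<otimes> c)) \<in> bil H H H" by (rule bil_comp[OF mu f gc])
  have fg: "(\<lambda>x y. f x \<otimes> g y) \<in> bil H H H" by (rule bil_comp[OF mu f g])
  have t: "(\<lambda>u x y. pt H H u (f x \<otimes> (g y \<otimes> c))) \<in> tri H H H (T H H)"
    using m cl c f gc
    by (intro triI lin_pt1 lin_comp[OF bilD(2)[OF pt_bil]]
      lin_comp[OF bilD(1)[OF mu] f] lin_comp[OF bilD(2)[OF mu] gc] lin_id) auto
  have "L (sw H (T H H) (\<lambda>u v. pt H H u (g v \<otimes> c)) a) = sw H (T H H) (\<lambda>u v. L (pt H H u (g v \<otimes> c))) a"
    by (rule sw_push[OF C m(2,2) b L(1) a])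
  also have "\<dots> = sw H (T H H) (\<lambda>u v. sw H (T H H) (\<lambda>s t. pt H H s (f t \<otimes> (g v \<otimes> c))) u) a"
    using cl c by (intro sw_cong L(2)) auto
  also have "\<dots> = sw H (T H H) (\<lambda>u v. sw H (T H H) (\<lambda>x y. pt H H u (f x \<otimes> (g y \<otimes> c))) v) a"
    by (rule sw_coassoc[OF C m(2) t a])
  also have "\<dots> = sw H (T H H) (\<lambda>u v. pt H H u (sw H H (\<lambda>x y. f x \<otimes> (g y \<otimes> c)) v)) a"
    using C m b' by (intro sw_cong sw_push[where h = "pt H H _", symmetric] bilD(2)[OF pt_bil])
  also have "\<dots> = sw H (T H H) (\<lambda>u v. counit H v \<odot>\<^bsub>T H H\<^esub> pt H H u c) a"
  proof (rule sw_cong)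
    fix u v assume uv: "u \<in> carrier H" "v \<in> carrier H"
    have "sw H H (\<lambda>x y. f x \<otimes> (g y \<otimes> c)) v = sw H H (\<lambda>x y. f x \<otimes> g y \<otimes> c) v"
      using cl c by (intro sw_cong) (simp add: R.m_assoc)
    also have "\<dots> = sw H H (\<lambda>x y. f x \<otimes> g y) v \<otimes> c"
      by (rule sw_push[OF C m(1,1) fg bilD(1)[OF mu c] uv(2), symmetric])
    finally show "pt H H u (sw H H (\<lambda>x y. f x \<otimes> (g y \<otimes> c)) v) = counit H v \<odot>\<^bsub>T H H\<^esub> pt H H u c"
      using uv c C m by (simp add: inv HH.smult_mult_left lin_smult[OF bilD(2)[OF pt_bil]])
  qed
  also have "\<dots> = pt H H a c"
    using C m a c by (intro sw_counit_right lin_pt1 lin_id) auto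
  finally show ?thesis .
qed

text \<open>Hence \<open>y \<mapsto> y\<^sub>1 \<otimes> S(y\<^sub>2)\<close> is a coalgebra map, being the preimage of \<open>y \<mapsto> y \<otimes> 1\<close> under the
  injective coalgebra map \<open>a \<otimes> c \<mapsto> a\<^sub>1 \<otimes> a\<^sub>2 c\<close>.\<close>

lemma antipode_chom:
  fixes H (structure)
  assumes H: "hopf H"
  shows "antipode H \<in> chom H H"
proof -
  interpret R: ring H by (rule hopf_ring[OF H])
  interpret HH: cocomm_hopf_algebra K H by fact
  note mu = hopf_mult_bil[OF H]
  have C: "coalg H" and m: "md H" "md (T H H)" using H by auto
  let ?S = "antipode H" and ?T = "T H H" and ?C = "H \<otimes>\<^sub>c H"
  have Sl: "?S \<in> lin H H" by (rule HH.antipode_linear)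
  have M: "tl H H H (mult H) \<in> Hom ?C H"
    by (rule tensor_homI[OF C C C mu]) (auto simp: HH.comult_mult HH.counit_mult)
  have C2: "coalg ?C" using C by auto
  define s where "s f c a = sw H ?T (\<lambda>u v. pt H H u (f v \<otimes> c)) a" for f c a
  have b: "(\<lambda>u v. pt H H u (f v \<otimes> c)) \<in> bil H H ?T" if "f \<in> lin H H" "c \<in> carrier H" for f c
    by (rule bil_comp[OF pt_bil[OF m(1,1)] lin_id lin_comp[OF bilD(1)[OF mu that(2)] that(1)]])
  have sb: "(\<lambda>a c. s f c a) \<in> bil H H ?T" if f: "f \<in> lin H H" for f
    unfolding s_def
  proof (rule bilI)
    show "(\<lambda>a. sw H ?T (\<lambda>u v. pt H H u (f v \<otimes> c)) a) \<in> lin H ?T" if "c \<in> carrier H" for c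
      using C m b[OF f that] by (intro lin_sw lin_id)
    show "(\<lambda>c. sw H ?T (\<lambda>u v. pt H H u (f v \<otimes> c)) a) \<in> lin H ?T" if "a \<in> carrier H" for a
      using C m b[OF f] that lin_closed[OF f]
      by (intro lin_sw_param lin_comp[OF bilD(2)[OF pt_bil] bilD(2)[OF mu]]) auto
  qed
  let ?G = "pair ?C H H (p1 H H) (tl H H H (mult H))"
  have G: "?G \<in> Hom ?C ?C" using C C2 M by auto
  have Gl: "?G \<in> lin ?T ?T" using Hom_lin[OF G] by simp
  have Gp: "?G (pt H H a c) = s (\<lambda>x. x) c a" if "a \<in> carrier H" "c \<in> carrier H" for a c
  proof -
    have be: "(\<lambda>x t. pt H H x (tl H H H (mult H) t)) \<in> bil H ?T ?T"
      using tensor_lift_linear[OF m(1,1,1) mu] by (rule bil_comp[OF pt_bil[OF m(1,1)] lin_id])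
    have "pt H H a c \<in> carrier ?C" using that m by simp
    then have "?G (pt H H a c) = sw H ?T (\<lambda>x y. pt H H x (tl H H H (mult H) (pt H H y c))) a"
      using sw_proj_left[OF C C m(2) be that] by (simp only: pairing_apply)
    also have "\<dots> = s (\<lambda>x. x) c a"
      unfolding s_def using that m mu by (intro sw_cong) (simp add: tensor_lift_pure)
    finally show ?thesis .
  qed
  define L where "L = tl H H ?T (\<lambda>a c. s ?S c a)"
  have Ll: "L \<in> lin ?T ?T" unfolding L_def by (rule tensor_lift_linear[OF m(1,1,2) sb[OF Sl]])
  have Lp: "L (pt H H a c) = s ?S c a" if "a \<in> carrier H" "c \<in> carrier H" for a c
    using that by (simp add: L_def tensor_lift_pure[OF m(1,1,2) sb[OF Sl]])
  \<comment> \<open>\<open>L\<close> is the shear of the antipode. That it undoes the shear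
    \<open>?G\<close> of the identity uses the left antipode law; the opposite composition in
    \<open>GL\<close> uses the right one.\<close>
  have inj: "inj_on ?G (carrier ?C)"
  proof (rule inj_on_inverseI)
    fix t assume "t \<in> carrier ?C"
    then have t: "t \<in> carrier ?T" by simp
    show "L (?G t) = t"
    proof (rule tensor_lin_eqI[OF m(1,1) lin_comp[OF Ll Gl] lin_id _ t])
      show "L (?G (pt H H a c)) = pt H H a c" if "a \<in> carrier H" "c \<in> carrier H" for a c
        unfolding Gp[OF that] s_def
        by (rule shear_inverse[OF H Sl lin_id HH.antipode_left that Ll Lp[unfolded s_def]])
    qed
  qed
  have one: "\<one> \<in> carrier H" by simp
  have GL: "?G (s ?S \<one> y) = pt H H y \<one>" if "y \<in> carrier H" for y
    unfolding s_def by (rule shear_inverse[OF H lin_id Sl HH.antipode_right that one Gl Gp[unfolded s_def]])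
  have "(\<lambda>y. s ?S \<one> y) \<in> chom H ?C"
  proof (rule chom_reflect[OF C C2 C2 Hom_chom[OF G] inj])
    show "s ?S \<one> y \<in> carrier ?C" if "y \<in> carrier H" for y
      using bil_closed[OF sb[OF Sl] that one] by simp
    have g: "group_like H \<one>" using one by (simp add: group_like_def HH.comult_one HH.counit_one)
    note P = Hom_chom[OF pairing_Hom[OF C C C ident_Hom[OF C] const_map_Hom[OF C C g]]]
    show "(\<lambda>y. ?G (s ?S \<one> y)) \<in> chom H ?C"
      by (rule chom_cong[OF P C], subst pairing_const[OF C m(1,1) Hom_lin[OF ident_Hom[OF C]] one]) (simp_all add: GL)
  qed
  \<comment> \<open>The second projection applies the counit to the first leg, so it turns
    \<open>y1 \<otimes> S(y2)\<close> into \<open>S(y)\<close>.\<close>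
  then have *: "(\<lambda>y. p2 H H (s ?S \<one> y)) \<in> chom H H"
    using C C2 m by (intro chom_comp[OF C _ _ Hom_chom[OF proj_Hom(2)]]) auto
  show ?thesis
  proof (rule chom_cong[OF * C])
    fix y assume y: "y \<in> carrier H"
    have p2l: "p2 H H \<in> lin ?T H" using Hom_lin[OF proj_Hom(2)[OF C C]] by simp
    have "p2 H H (s ?S \<one> y) = sw H H (\<lambda>u v. p2 H H (pt H H u (?S v \<otimes> \<one>))) y"
      unfolding s_def by (rule sw_push[OF C m(2,1) b[OF Sl one] p2l y])
    also have "\<dots> = sw H H (\<lambda>u v. counit H u \<odot> ?S v) y"
      using C lin_closed[OF Sl] by (intro sw_cong) (simp add: proj2_pure)
    finally show "p2 H H (s ?S \<one> y) = ?S y" using sw_counit_left[OF C m(1) Sl y] by simp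
  qed
qed

lemma hopf_pre_hopf [simp, intro]:
  assumes H: "hopf H" shows "pre_hopf H"
proof -
  interpret R: ring H by (rule hopf_ring[OF H])
  interpret cocomm_hopf_algebra K H by fact
  show ?thesis
    unfolding pre_hopf_def
    using H hopf_mult_bil[OF H] antipode_chom[OF H] comult_mult comult_one counit_mult counit_one by auto
qed

section \<open>Convolution groups and Hopf maps\<close>

lemma conv_group_simps [simp]:
  "carrier (conv_group C H) = Hom C H"
  "mult (conv_group C H) = conv C H"
  "one (conv_group C H) = conv_one C H"
  by (simp_all add: conv_group_def)

text \<open>Associativity is coassociativity of the source. The inverse law is the antipode law of
  \<open>H\<close> at the element \<open>f c\<close>, because sums over the legs of \<open>c\<close>
  push forward along the coalgebra map \<open>f\<close>.\<close>

lemma group_conv: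
  fixes H (structure)
  assumes C: "coalg C" and H: "hopf H"
  shows "group (conv_group C H)"
    and "f \<in> Hom C H \<Longrightarrow> m_inv (conv_group C H) f = cmp C (antipode H) f"
proof -
  interpret R: ring H by (rule hopf_ring[OF H])
  interpret cocomm_hopf_algebra K H by fact
  note mu = hopf_mult_bil[OF H]
  have m: "md H" and pH: "pre_hopf H" using H by auto
  note b = conv_bil[OF mu Hom_lin Hom_lin]
  have assoc: "conv C H (conv C H f g) h = conv C H f (conv C H g h)"
    if fgh: "f \<in> Hom C H" "g \<in> Hom C H" "h \<in> Hom C H" for f g h
  proof (rule extensionalityI[where A = "carrier C"])
    fix c assume c: "c \<in> carrier C"
    note cl = Hom_closed[OF fgh(1)] Hom_closed[OF fgh(2)] Hom_closed[OF fgh(3)]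
    note li = Hom_lin[OF fgh(1)] Hom_lin[OF fgh(2)] Hom_lin[OF fgh(3)]
    have t: "(\<lambda>x y z. f x \<otimes> (g y \<otimes> h z)) \<in> tri C C C H"
      using cl li by (intro triI lin_comp[OF bilD(1)[OF mu]]
          lin_comp[OF bilD(2)[OF mu]]) auto
    have "conv C H (conv C H f g) h c = sw C H (\<lambda>a b. sw C H (\<lambda>x y. f x \<otimes> g y) a \<otimes> h b) c"
      unfolding conv_apply[OF c] by (intro sw_cong) (simp add: conv_apply)
    also have "\<dots> = sw C H (\<lambda>a b. sw C H (\<lambda>x y. f x \<otimes> (g y \<otimes> h b)) a) c"
    proof (rule sw_cong)
      fix u v assume uv: "u \<in> carrier C" "v \<in> carrier C"
      have "sw C H (\<lambda>x y. f x \<otimes> g y) u \<otimes> h v = sw C H (\<lambda>x y. (f x \<otimes> g y) \<otimes> h v) u"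
        using C m uv cl b[OF fgh(1,2)] by (intro sw_push[where h = "\<lambda>u. u \<otimes> h v"] bilD(1)[OF mu]) auto
      also have "\<dots> = sw C H (\<lambda>x y. f x \<otimes> (g y \<otimes> h v)) u"
        using cl uv by (intro sw_cong) (simp add: R.m_assoc)
      finally show "sw C H (\<lambda>x y. f x \<otimes> g y) u \<otimes> h v = sw C H (\<lambda>x y. f x \<otimes> (g y \<otimes> h v)) u" .
    qed
    also have "\<dots> = sw C H (\<lambda>a b. sw C H (\<lambda>x y. f a \<otimes> (g x \<otimes> h y)) b) c"
      by (rule sw_coassoc[OF C m t c])
    also have "\<dots> = sw C H (\<lambda>a b. f a \<otimes> sw C H (\<lambda>x y. g x \<otimes> h y) b) c"
      using C m cl b[OF fgh(2,3)]
      by (intro sw_cong sw_push[where h = "\<lambda>u. f _ \<otimes> u", symmetric] bilD(2)[OF mu]) auto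
    also have "\<dots> = conv C H f (conv C H g h) c"
      unfolding conv_apply[OF c] by (intro sw_cong) (simp add: conv_apply)
    finally show "conv C H (conv C H f g) h c = conv C H f (conv C H g h) c" .
  qed (auto simp: conv_def)
  have l_one: "conv C H (conv_one C H) f = f" if f: "f \<in> Hom C H" for f
  proof (rule extensionalityI[where A = "carrier C"])
    fix c assume c: "c \<in> carrier C"
    have "conv C H (conv_one C H) f c = sw C H (\<lambda>a b. counit C a \<odot> f b) c"
      unfolding conv_apply[OF c] using C Hom_closed[OF f]
      by (intro sw_cong) (simp add: conv_one_def smult_mult_left)
    then show "conv C H (conv_one C H) f c = f c"
      using sw_counit_left[OF C m Hom_lin[OF f] c] by simp
  qed (use Hom_ext[OF f] in \<open>auto simp: conv_def\<close>)
  have inv: "conv C H (cmp C (antipode H) f) f = conv_one C H" if f: "f \<in> Hom C H" for f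
  proof (rule extensionalityI[where A = "carrier C"])
    fix c assume c: "c \<in> carrier C"
    have "conv C H (cmp C (antipode H) f) f c = sw C H (\<lambda>a b. antipode H (f a) \<otimes> f b) c"
      unfolding conv_apply[OF c] by (intro sw_cong) (simp add: compose_def)
    also have "\<dots> = sw H H (\<lambda>a b. antipode H a \<otimes> b) (f c)"
      using C m c by (intro sw_chom[symmetric] Hom_chom[OF f] bil_comp[OF mu antipode_linear lin_id])
    also have "\<dots> = conv_one C H c"
      using c Hom_closed[OF f c] chom_counit[OF Hom_chom[OF f] c] by (simp add: antipode_left conv_one_def)
    finally show "conv C H (cmp C (antipode H) f) f c = conv_one C H c" .
  qed (auto simp: conv_def conv_one_def)
  have ex: "\<exists>g \<in> Hom C H. conv C H g f = conv_one C H" if f: "f \<in> Hom C H" for f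
    using inv[OF f] antipode_Hom[OF pH C f] by blast
  show grp: "group (conv_group C H)"
    by (rule groupI) (use assoc l_one C pH ex in auto)
  show "m_inv (conv_group C H) f = cmp C (antipode H) f" if "f \<in> Hom C H"
    by (rule group.inv_equality[OF grp]) (use that inv C pH in auto)
qed

lemma conv_laws:
  assumes C: "coalg C" and H: "hopf H"
  shows "f \<in> Hom C H \<Longrightarrow> g \<in> Hom C H \<Longrightarrow> h \<in> Hom C H \<Longrightarrow>
      conv C H (conv C H f g) h = conv C H f (conv C H g h)"
    and "f \<in> Hom C H \<Longrightarrow> conv C H (conv_one C H) f = f" "f \<in> Hom C H \<Longrightarrow> conv C H f (conv_one C H) = f"
    and "f \<in> Hom C H \<Longrightarrow> conv C H (cmp C (antipode H) f) f = conv_one C H"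
    and "f \<in> Hom C H \<Longrightarrow> conv C H f (cmp C (antipode H) f) = conv_one C H"
    and "f \<in> Hom C H \<Longrightarrow> g \<in> Hom C H \<Longrightarrow> conv C H (cmp C (antipode H) f) (conv C H f g) = g"
    and "f \<in> Hom C H \<Longrightarrow> g \<in> Hom C H \<Longrightarrow> conv C H f (conv C H (cmp C (antipode H) f) g) = g"
    and "cmp C (antipode H) (conv_one C H) = conv_one C H"
    and "f \<in> Hom C H \<Longrightarrow> g \<in> Hom C H \<Longrightarrow> cmp C (antipode H) (conv C H f g) =
      conv C H (cmp C (antipode H) g) (cmp C (antipode H) f)"
    and "f \<in> Hom C H \<Longrightarrow> cmp C (antipode H) (cmp C (antipode H) f) = f"
    and "f \<in> Hom C H \<Longrightarrow> g \<in> Hom C H \<Longrightarrow> conv C H f g \<in> Hom C H" "conv_one C H \<in> Hom C H"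
    and "f \<in> Hom C H \<Longrightarrow> cmp C (antipode H) f \<in> Hom C H"
proof -
  interpret G: group "conv_group C H" by (rule group_conv[OF C H])
  note inv = group_conv(2)[OF C H]
  have SH: "cmp C (antipode H) f \<in> Hom C H" if "f \<in> Hom C H" for f
    by (rule antipode_Hom[OF hopf_pre_hopf[OF H] C that])
  have CH: "conv C H f g \<in> Hom C H" if "f \<in> Hom C H" "g \<in> Hom C H" for f g
    by (rule conv_Hom[OF hopf_pre_hopf[OF H] C that])
  have OH: "conv_one C H \<in> Hom C H" by (rule conv_one_Hom[OF hopf_pre_hopf[OF H] C])
  show assoc: "conv C H (conv C H f g) h = conv C H f (conv C H g h)" if "f \<in> Hom C H" "g \<in> Hom C H" "h \<in> Hom C H" for f g h
    using G.m_assoc[of f g h] that by simp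
  show l1: "conv C H (conv_one C H) f = f" if "f \<in> Hom C H" for f using G.l_one[of f] that by simp
  show "conv C H f (conv_one C H) = f" if "f \<in> Hom C H" for f using G.r_one[of f] that by simp
  show li: "conv C H (cmp C (antipode H) f) f = conv_one C H" if "f \<in> Hom C H" for f
    using G.l_inv[of f] that by (simp add: inv)
  show ri: "conv C H f (cmp C (antipode H) f) = conv_one C H" if "f \<in> Hom C H" for f
    using G.r_inv[of f] that by (simp add: inv)
  show "conv C H (cmp C (antipode H) f) (conv C H f g) = g" if "f \<in> Hom C H" "g \<in> Hom C H" for f g
    using that by (simp add: assoc[symmetric] SH li l1)
  show "conv C H f (conv C H (cmp C (antipode H) f) g) = g" if "f \<in> Hom C H" "g \<in> Hom C H" for f g
    using that by (simp add: assoc[symmetric] SH ri l1)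
  show "cmp C (antipode H) (conv_one C H) = conv_one C H"
    using G.inv_one inv[OF OH] by simp
  show "cmp C (antipode H) (conv C H f g) =
      conv C H (cmp C (antipode H) g) (cmp C (antipode H) f)" if "f \<in> Hom C H" "g \<in> Hom C H" for f g
    using G.inv_mult_group[of f g] that by (simp add: inv CH)
  show "cmp C (antipode H) (cmp C (antipode H) f) = f" if "f \<in> Hom C H" for f
    using G.inv_inv[of f] that by (simp add: inv SH)
qed (use C H in auto)

lemma conv_post:
  assumes C: "coalg C" and H: "md H" "mult H \<in> bil H H H" and H': "md H'" and \<Phi>: "\<Phi> \<in> lin H H'"
    and mult: "\<And>x y. x \<in> carrier H \<Longrightarrow> y \<in> carrier H \<Longrightarrow> \<Phi> (x \<otimes>\<^bsub>H\<^esub> y) = \<Phi> x \<otimes>\<^bsub>H'\<^esub> \<Phi> y"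
    and f: "f \<in> Hom C H" and g: "g \<in> Hom C H"
  shows "cmp C \<Phi> (conv C H f g) = conv C H' (cmp C \<Phi> f) (cmp C \<Phi> g)"
proof (rule extensionalityI[where A = "carrier C"])
  fix c assume c: "c \<in> carrier C"
  have "\<Phi> (conv C H f g c) = sw C H' (\<lambda>a b. \<Phi> (f a \<otimes>\<^bsub>H\<^esub> g b)) c"
    unfolding conv_apply[OF c]
    by (rule sw_push[OF C H(1) H' conv_bil[OF H(2) Hom_lin[OF f] Hom_lin[OF g]] \<Phi> c])
  also have "\<dots> = conv C H' (cmp C \<Phi> f) (cmp C \<Phi> g) c"
    unfolding conv_apply[OF c]
    by (intro sw_cong) (simp add: mult compose_def Hom_closed[OF f] Hom_closed[OF g])
  finally show "cmp C \<Phi> (conv C H f g) c = conv C H' (cmp C \<Phi> f) (cmp C \<Phi> g) c"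
    using c by (simp add: compose_def)
qed (auto simp: conv_def compose_def)

lemma hopf_homD:
  assumes "\<Phi> \<in> hhom H H'"
  shows "\<Phi> \<in> chom H H'" "\<And>x y. x \<in> carrier H \<Longrightarrow> y \<in> carrier H \<Longrightarrow> \<Phi> (x \<otimes>\<^bsub>H\<^esub> y) = \<Phi> x \<otimes>\<^bsub>H'\<^esub> \<Phi> y"
    "\<Phi> \<one>\<^bsub>H\<^esub> = \<one>\<^bsub>H'\<^esub>" "\<And>x. x \<in> carrier H \<Longrightarrow> \<Phi> (antipode H x) = antipode H' (\<Phi> x)"
    "\<And>x. x \<in> carrier H \<Longrightarrow> \<Phi> x \<in> carrier H'" "\<Phi> \<in> lin H H'"
  using assms by (auto simp: hopf_hom_def ring_hom_def dest: chom_closed chom_lin)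

lemma conv_hopf_hom:
  assumes "coalg C" "hopf H" "hopf H'" "\<Phi> \<in> hhom H H'" "f \<in> Hom C H" "g \<in> Hom C H"
  shows "cmp C \<Phi> (conv C H f g) = conv C H' (cmp C \<Phi> f) (cmp C \<Phi> g)"
  using assms hopf_homD[OF assms(4)] hopf_mult_bil[of H] by (intro conv_post) auto

lemma compose_hopf_hom:
  "coalg C \<Longrightarrow> hopf H \<Longrightarrow> hopf H' \<Longrightarrow> \<Phi> \<in> hhom H H' \<Longrightarrow> f \<in> Hom C H \<Longrightarrow>
    cmp C \<Phi> f \<in> Hom C H'"
  unfolding compose_def
  by (rule restrict_Hom, assumption, rule chom_comp[OF _ _ _ hopf_homD(1) Hom_chom]) auto

text \<open>A multiplicative coalgebra map sends \<open>1\<close> to an idempotent invertible element, and commutes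
  with inverses because it induces homomorphisms of convolution groups.\<close>

lemma hopf_homI:
  fixes H (structure)
  assumes H: "hopf H" and H': "hopf H'" and \<Phi>: "\<Phi> \<in> chom H H'"
    and mult: "\<And>x y. x \<in> carrier H \<Longrightarrow> y \<in> carrier H \<Longrightarrow> \<Phi> (x \<otimes> y) = \<Phi> x \<otimes>\<^bsub>H'\<^esub> \<Phi> y"
  shows "\<Phi> \<in> hhom H H'"
proof -
  interpret R: ring H by (rule hopf_ring[OF H])
  interpret R': ring H' by (rule hopf_ring[OF H'])
  interpret G: group "conv_group H H'" by (rule group_conv(1)) (use H H' in auto)
  interpret G0: group "conv_group H H" by (rule group_conv(1)) (use H in auto)
  have m: "coalg H" "md H" "md H'" "pre_hopf H" "pre_hopf H'" using H H' by auto
  let ?c = "cmp H"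
  define i where "i = (\<lambda>x\<in>carrier H. x)"
  have i: "i \<in> Hom H H" unfolding i_def using m by (intro ident_Hom)
  have post: "?c \<Phi> f \<in> Hom H H'" if "f \<in> Hom H H" for f
    unfolding compose_def by (rule restrict_Hom) (use m that \<Phi> in \<open>auto intro: chom_comp Hom_chom\<close>)
  have cv: "?c \<Phi> (conv H H f g) = conv H H' (?c \<Phi> f) (?c \<Phi> g)" if "f \<in> Hom H H" "g \<in> Hom H H" for f g
    using m that mult hopf_mult_bil[OF H] chom_lin[OF \<Phi>] by (intro conv_post)
  have one: "?c \<Phi> (conv_one H H) = conv_one H H'"
  proof (rule G.r_cancel_one[THEN iffD1, of "?c \<Phi> (conv_one H H)", simplified])
    show "?c \<Phi> (conv_one H H) \<in> Hom H H'" "?c \<Phi> (conv_one H H) \<in> Hom H H'"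
      using m by (auto intro!: post)
    show "conv H H' (?c \<Phi> (conv_one H H)) (?c \<Phi> (conv_one H H)) = ?c \<Phi> (conv_one H H)"
      using cv[of "conv_one H H" "conv_one H H"] m G0.l_one[of "conv_one H H"] by simp
  qed
  then have "?c \<Phi> (conv_one H H) \<one> = conv_one H H' \<one>" by simp
  moreover have "counit H \<one> = \<one>\<^bsub>K\<^esub>" by (rule pre_hopfD(7)[OF m(4)])
  ultimately have one': "\<Phi> \<one> = \<one>\<^bsub>H'\<^esub>"
    using m(2,3) by (simp add: conv_one_def compose_def module.smult_one)
  let ?S = "?c (antipode H) i"
  have S: "?S \<in> Hom H H" using m i by (intro antipode_Hom)
  have "conv H H ?S i = conv_one H H"
    using G0.l_inv[of i] i m H by (simp add: group_conv(2))
  then have "conv H H' (?c \<Phi> ?S) (?c \<Phi> i) = conv_one H H'"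
    using cv[OF S i] one by simp
  then have "m_inv (conv_group H H') (?c \<Phi> i) = ?c \<Phi> ?S"
    using post[OF S] post[OF i] by (intro G.inv_equality) auto
  then have "?c (antipode H') (?c \<Phi> i) = ?c \<Phi> ?S"
    using group_conv(2)[OF m(1) H' post[OF i]] by simp
  then have "antipode H' (\<Phi> x) = \<Phi> (antipode H x)" if "x \<in> carrier H" for x
    using that by (auto simp: compose_def i_def fun_eq_iff dest!: spec[of _ x])
  then show ?thesis
    using \<Phi> mult one' by (auto simp: hopf_hom_def ring_hom_def chom_closed lin_add[OF chom_lin[OF \<Phi>]])
qed

end

section \<open>Sub-coalgebras, images and transport of structure\<close>

text \<open>The comultiplication takes values in tensors over the new carrier, so the module part
  \<open>M\<close> has to be available before that field can be written down.\<close>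

definition transport_coalgebra ::
  "('k, 'm) ring_scheme \<Rightarrow> ('a \<Rightarrow> 'b) \<Rightarrow> ('k, 'a, 'c) coalgebra_scheme \<Rightarrow> ('k, 'b) coalgebra" where
  "transport_coalgebra K g C = (let h = inv_into (carrier C) g;
     M = \<lparr>carrier = g ` carrier C, mult = (\<lambda>x y. g (h x \<otimes>\<^bsub>C\<^esub> h y)), one = g \<one>\<^bsub>C\<^esub>,
       zero = g \<zero>\<^bsub>C\<^esub>, add = (\<lambda>x y. g (h x \<oplus>\<^bsub>C\<^esub> h y)), smult = (\<lambda>a x. g (a \<odot>\<^bsub>C\<^esub> h x))\<rparr> in
     \<lparr>carrier = carrier M, mult = mult M, one = one M, zero = zero M, add = add M, smult = smult M,
      comult = (\<lambda>x. tensor_map K C C M M g g (comult C (h x))), counit = (\<lambda>x. counit C (h x))\<rparr>)"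

definition transport_hopf ::
  "('k, 'm) ring_scheme \<Rightarrow> ('a \<Rightarrow> 'b) \<Rightarrow> ('k, 'a, 'c) hopf_algebra_scheme \<Rightarrow> ('k, 'b) hopf_algebra" where
  "transport_hopf K g H = (let R = transport_coalgebra K g H in
     \<lparr>carrier = carrier R, mult = mult R, one = one R, zero = zero R, add = add R, smult = smult R,
      comult = comult R, counit = counit R,
      antipode = (\<lambda>x. g (antipode H (inv_into (carrier H) g x)))\<rparr>)"

context kvec
begin

text \<open>With a linear retraction \<open>p\<close> of \<open>i\<close>, a Sweedler sum over
  \<open>E\<close> becomes one over \<open>W\<close> with \<open>p\<close> applied in each leg, and
  there the coalgebra laws hold.\<close>

lemma coalg_inj:
  fixes E :: "('k, 'a, 'e) coalgebra_scheme" (structure) and W :: "('k, 'b, 'w) coalgebra_scheme"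
  assumes E: "md E" "comult E \<in> lin E (T E E)" and W: "coalg W" and i: "i \<in> chom E W"
    and inj: "inj_on i (carrier E)"
  shows "coalg E"
proof (rule cocomm_coalgebraI)
  have mW: "md W" using W by auto
  note il = chom_lin[OF i] and ic = chom_closed[OF i]
  obtain p where p: "p \<in> lin W E" "\<And>x. x \<in> carrier E \<Longrightarrow> p (i x) = x"
    using lin_retraction[OF E(1) mW il inj] by blast
  note pc = lin_closed[OF p(1)]
  note inject = sw_injected[OF E mW i]
  show "md E" "comult E \<in> lin E (T E E)" by fact+
  have cu: "counit E x = counit W (i x)" if "x \<in> carrier E" for x using chom_counit[OF i that] by simp
  show "counit E \<in> lin E G"
    by (rule lin_cong[OF lin_comp[OF counit_lin[OF W] il] E(1)]) (simp add: cu)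
  fix c assume c: "c \<in> carrier E"
  let ?U = "T E (T E E)"
  have U: "md ?U" using E by auto
  let ?F = "\<lambda>x y z. pt E (T E E) (p x) (pt E E (p y) (p z))"
  have t: "?F \<in> tri W W W ?U"
    using E pc by (intro triI lin_pt1[OF _ _ _ p(1)] lin_pt2[OF _ _ _ lin_pt1[OF _ _ _ p(1)]]
      lin_pt2[OF _ _ _ lin_pt2[OF _ _ _ p(1)]]) auto
  have b1: "(\<lambda>x y. ?F x y b) \<in> bil W W ?U" "(\<lambda>x y. ?F b x y) \<in> bil W W ?U" if "b \<in> carrier W" for b
    using that by (auto intro!: bilI intro: triD[OF t])
  have b2: "(\<lambda>a b. sw W ?U (\<lambda>x y. ?F x y b) a) \<in> bil W W ?U" "(\<lambda>a b. sw W ?U (\<lambda>x y. ?F a x y) b) \<in> bil W W ?U"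
    using W U mW b1 by (auto intro!: bilI lin_sw lin_sw_param lin_id intro: triD[OF t])
  have "sw E ?U (\<lambda>a b. sw E ?U (\<lambda>x y. pt E (T E E) x (pt E E y b)) a) c =
      sw E ?U (\<lambda>a b. sw E ?U (\<lambda>x y. ?F (i x) (i y) (i b)) a) c"
    by (intro sw_cong) (simp add: p(2))
  also have "\<dots> = sw E ?U (\<lambda>a b. sw W ?U (\<lambda>x y. ?F x y (i b)) (i a)) c"
    by (intro sw_cong inject[OF U b1(1), symmetric] ic)
  also have "\<dots> = sw W ?U (\<lambda>a b. sw W ?U (\<lambda>x y. ?F x y b) a) (i c)"
    by (rule inject[OF U b2(1) c, symmetric])
  also have "\<dots> = sw W ?U (\<lambda>a b. sw W ?U (\<lambda>x y. ?F a x y) b) (i c)"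
    by (rule sw_coassoc[OF W U t ic[OF c]])
  also have "\<dots> = sw E ?U (\<lambda>a b. sw W ?U (\<lambda>x y. ?F (i a) x y) (i b)) c"
    by (rule inject[OF U b2(2) c])
  also have "\<dots> = sw E ?U (\<lambda>a b. sw E ?U (\<lambda>x y. ?F (i a) (i x) (i y)) b) c"
    by (intro sw_cong inject[OF U b1(2)] ic)
  also have "\<dots> = sw E ?U (\<lambda>a b. sw E ?U (\<lambda>x y. pt E (T E E) a (pt E E x y)) b) c"
    by (intro sw_cong) (simp add: p(2))
  finally show "sw E ?U (\<lambda>a b. sw E ?U (\<lambda>x y. pt E (T E E) x (pt E E y b)) a) c =
      sw E ?U (\<lambda>a b. sw E ?U (\<lambda>x y. pt E (T E E) a (pt E E x y)) b) c" .
  have "sw E E (\<lambda>a b. counit E a \<odot> b) c = sw E E (\<lambda>a b. counit W (i a) \<odot> p (i b)) c"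
    by (intro sw_cong) (simp add: cu p(2))
  also have "\<dots> = sw W E (\<lambda>a b. counit W a \<odot> p b) (i c)"
    using W E p(1) pc by (intro inject[OF E(1) _ c, symmetric] bilI lin_intros) auto
  finally show "sw E E (\<lambda>a b. counit E a \<odot> b) c = c"
    using sw_counit_left[OF W E(1) p(1) ic[OF c]] p(2)[OF c] by simp
  have bp: "(\<lambda>a b. pt E E (p a) (p b)) \<in> bil W W (T E E)"
    by (rule bil_comp[OF pt_bil[OF E(1,1)] p(1) p(1)])
  have "sw E (T E E) (\<lambda>a b. pt E E b a) c = sw W (T E E) (\<lambda>a b. pt E E (p b) (p a)) (i c)"
    using E(1) by (intro sw_retract[OF E mW i p _ _ c] bil_flip[OF pt_bil]) auto
  also have "\<dots> = sw W (T E E) (\<lambda>a b. pt E E (p a) (p b)) (i c)"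
    using sw_comm[OF W _ bp ic[OF c]] E(1) by simp
  finally show "sw E (T E E) (\<lambda>a b. pt E E b a) c = comult E c"
    by (simp only: comult_retract[OF E mW i p c])
qed

lemma Hom_cancel:
  assumes "f \<in> Hom C D" "g \<in> Hom C D" "inj_on i (carrier D)" "cmp C i f = cmp C i g"
  shows "f = g"
proof (rule Hom_eqI[OF assms(1,2)])
  fix c assume c: "c \<in> carrier C"
  show "f c = g c"
    by (rule inj_onD[OF assms(3) _ Hom_closed[OF assms(1) c] Hom_closed[OF assms(2) c]])
      (use fun_cong[OF assms(4), of c] c in \<open>simp add: compose_eq\<close>)
qed

text \<open>The group identities of \<open>E\<close> follow from those of \<open>W\<close> because
  an injective map can be cancelled on points. This presupposes that the structure maps of
  \<open>E\<close> are coalgebra maps, so that they act on points at all;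
  \<open>chom_reflect\<close> provides that.\<close>

lemma hopf_inj:
  fixes E :: "('k, 'a, 'e) hopf_algebra_scheme" (structure)
  assumes E: "coalg E" and W: "hopf W" and i: "i \<in> chom E W" and inj: "inj_on i (carrier E)"
    and one: "\<one> \<in> carrier E" "i \<one> = \<one>\<^bsub>W\<^esub>"
    and mult: "\<And>x y. x \<in> carrier E \<Longrightarrow> y \<in> carrier E \<Longrightarrow> x \<otimes> y \<in> carrier E"
      "\<And>x y. x \<in> carrier E \<Longrightarrow> y \<in> carrier E \<Longrightarrow> i (x \<otimes> y) = i x \<otimes>\<^bsub>W\<^esub> i y"
    and S: "\<And>x. x \<in> carrier E \<Longrightarrow> antipode E x \<in> carrier E"
      "\<And>x. x \<in> carrier E \<Longrightarrow> i (antipode E x) = antipode W (i x)"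
  shows "hopf E"
proof -
  interpret E: module K E using E by auto
  have m: "md E" "md W" and cW: "coalg W" and pW: "pre_hopf W" using E W by auto
  note PW = pre_hopfD[OF pW] and il = chom_lin[OF i] and ic = chom_closed[OF i]
  note mu = bilD[OF PW(2)]
  obtain p where p: "p \<in> lin W E" "\<And>x. x \<in> carrier E \<Longrightarrow> p (i x) = x"
    using lin_retraction[OF m il inj] by blast
  have mE: "mult E \<in> bil E E E"
  proof (intro bilI linI)
  qed (auto intro!: inj_onD[OF inj] simp: mult lin_add[OF il] lin_smult[OF il] ic
      lin_add[OF mu(1)] lin_add[OF mu(2)] lin_smult[OF mu(1)] lin_smult[OF mu(2)])
  let ?C = "E \<otimes>\<^sub>c E" and ?M = "tl E E E (mult E)"
  have C: "coalg ?C" using E by auto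
  have Ml: "?M \<in> lin (T E E) E" by (rule tensor_lift_linear[OF m(1,1,1) mE])
  have ip: "cmp ?C i f \<in> Hom ?C W" if "f \<in> Hom ?C E" for f
    unfolding compose_def by (rule restrict_Hom[OF C chom_comp[OF C m i Hom_chom[OF that]]])
  \<comment> \<open>\<open>?N\<close> multiplies in \<open>W\<close> the images of the two
    projections. It is a coalgebra map, being a product of points, and it agrees with
    \<open>i\<close> after \<open>?M\<close>; so \<open>?M\<close> is one too.\<close>
  let ?N = "conv ?C W (cmp ?C i (p1 E E)) (cmp ?C i (p2 E E))"
  have N: "?N \<in> Hom ?C W" using E by (intro conv_Hom[OF pW C] ip) auto
  have "?M \<in> chom ?C E"
  proof (rule chom_reflect[OF C E cW i inj])
    show "?M t \<in> carrier E" if "t \<in> carrier ?C" for t using lin_closed[OF Ml, of t] that by simp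
    show "(\<lambda>t. i (?M t)) \<in> chom ?C W"
    proof (rule chom_cong[OF Hom_chom[OF N] C])
      have Nl: "?N \<in> lin (T E E) W" using Hom_lin[OF N] by simp
      fix t assume "t \<in> carrier ?C"
      then have t: "t \<in> carrier (T E E)" by simp
      show "?N t = i (?M t)"
      proof (rule tensor_lin_eqI[OF m(1,1) Nl lin_comp[OF il Ml] _ t])
        show "?N (pt E E v w) = i (?M (pt E E v w))" if "v \<in> carrier E" "w \<in> carrier E" for v w
          unfolding conv_pure[OF E E m(2) PW(2) il il that] tensor_lift_pure[OF m(1,1,1) mE that]
          by (rule mult(2)[OF that, symmetric])
      qed
    qed
  qed
  then have M: "restrict ?M (carrier ?C) \<in> Hom ?C E" by (rule restrict_Hom[OF C])
  have "comult E \<one> = pt E E \<one> \<one>"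
    using comult_retract[OF m(1) comult_lin[OF E] m(2) i p one(1)] p(2)[OF one(1)] one(2) PW(3,5) m p(1)
      bil_comp[OF pt_bil[OF m(1,1)] p(1) p(1)]
    by (simp add: sweedler_def tensor_lift_pure)
  then have g: "group_like E \<one>"
    using one chom_counit[OF i one(1)] PW(7) by (simp add: group_like_def)
  have Schom: "antipode E \<in> chom E E"
  proof (rule chom_reflect[OF E E cW i inj])
    show "(\<lambda>c. i (antipode E c)) \<in> chom E W"
      using chom_comp[OF E m(2,2) PW(8) i] E by (rule chom_cong) (simp add: S)
  qed (use S in auto)
  have pE: "pre_hopf E"
    by (rule pre_hopfI[OF E M _ g Schom]) (simp add: tensor_lift_pure[OF m(1,1,1) mE] m)
  have post: "cmp C i f \<in> Hom C W"
      "cmp C i (conv C E f g) = conv C W (cmp C i f) (cmp C i g)"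
      "cmp C i (conv_one C E) = conv_one C W"
      "cmp C i (cmp C (antipode E) f) = cmp C (antipode W) (cmp C i f)"
    if C: "coalg C" and f: "f \<in> Hom C E" and g: "g \<in> Hom C E" for C :: "('k, 'cc, 'dd) coalgebra_scheme" and f g
  proof -
    show "cmp C i f \<in> Hom C W"
      unfolding compose_def by (rule restrict_Hom[OF C chom_comp[OF C m i Hom_chom[OF f]]])
    show "cmp C i (conv C E f g) = conv C W (cmp C i f) (cmp C i g)"
      by (rule conv_post[OF C m(1) mE m(2) il mult(2) f g])
    show "cmp C i (conv_one C E) = conv_one C W"
      using C one by (auto simp: conv_one_def compose_def fun_eq_iff lin_smult[OF il])
    show "cmp C i (cmp C (antipode E) f) = cmp C (antipode W) (cmp C i f)"
      using Hom_closed[OF f] by (auto simp: compose_def fun_eq_iff S)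
  qed
  show ?thesis
  proof (rule hopf_of_points[OF pE])
    define C3 where "C3 = (E \<otimes>\<^sub>c E) \<otimes>\<^sub>c E"
    have C: "coalg C3" using E by (auto simp: C3_def)
    have "conv C3 E (conv C3 E f g) h = conv C3 E f (conv C3 E g h)"
      if H: "f \<in> Hom C3 E" "g \<in> Hom C3 E" "h \<in> Hom C3 E" for f g h
    proof (rule Hom_cancel[OF _ _ inj])
      note c = conv_Hom[OF pE C]
      show "conv C3 E (conv C3 E f g) h \<in> Hom C3 E" "conv C3 E f (conv C3 E g h) \<in> Hom C3 E"
        by (intro c H)+
      show "cmp C3 i (conv C3 E (conv C3 E f g) h) = cmp C3 i (conv C3 E f (conv C3 E g h))"
        unfolding post(2)[OF C c[OF H(1,2)] H(3)] post(2)[OF C H(1,2)] post(2)[OF C H(1) c[OF H(2,3)]] post(2)[OF C H(2,3)]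
        by (intro conv_laws(1)[OF C W] post(1)[OF C _ H(1)] H)
    qed
    then show "conv ((E \<otimes>\<^sub>c E) \<otimes>\<^sub>c E) E (conv ((E \<otimes>\<^sub>c E) \<otimes>\<^sub>c E) E f g) h = conv ((E \<otimes>\<^sub>c E) \<otimes>\<^sub>c E) E f (conv ((E \<otimes>\<^sub>c E) \<otimes>\<^sub>c E) E g h)"
      if "f \<in> Hom ((E \<otimes>\<^sub>c E) \<otimes>\<^sub>c E) E" "g \<in> Hom ((E \<otimes>\<^sub>c E) \<otimes>\<^sub>c E) E" "h \<in> Hom ((E \<otimes>\<^sub>c E) \<otimes>\<^sub>c E) E" for f g h
      using that unfolding C3_def by blast
    fix f assume f: "f \<in> Hom E E"
    note r = conv_laws(2,3,4,5)[OF E W post(1)[OF E f f]]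
    note H = f conv_one_Hom[OF pE E] antipode_Hom[OF pE E f]
    show "conv E E (conv_one E E) f = f" "conv E E f (conv_one E E) = f"
      "conv E E (cmp E (antipode E) f) f = conv_one E E"
      "conv E E f (cmp E (antipode E) f) = conv_one E E"
      by - (rule Hom_cancel[where C = E, OF _ _ inj], (simp_all add: conv_Hom[OF pE E] H post(1,3,4)[OF E f f] post(2)[OF E] r)[3])+
  qed
qed

lemma hopf_hom_id: "hopf H \<Longrightarrow> (\<lambda>x. x) \<in> hhom H H"
  by (auto simp: hopf_hom_def ring_hom_def chom_id)

lemma hopf_hom_comp:
  assumes "hopf B" "hopf H" "hopf J" "f \<in> hhom H J" "g \<in> hhom B H"
  shows "(\<lambda>x. f (g x)) \<in> hhom B J"
proof (rule hopf_homI[OF assms(1,3)])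
  show "(\<lambda>x. f (g x)) \<in> chom B J"
    using assms by (intro chom_comp[of B H J] hopf_homD(1)) auto
qed (use hopf_homD[OF assms(4)] hopf_homD[OF assms(5)] in auto)

lemma hopf_hom_cong:
  assumes "hopf B" "hopf H" "f \<in> hhom B H" "\<And>x. x \<in> carrier B \<Longrightarrow> f x = g x"
  shows "g \<in> hhom B H"
proof (rule hopf_homI[OF assms(1,2)])
  interpret B: ring B by (rule hopf_ring[OF assms(1)])
  show "g \<in> chom B H"
    by (rule chom_cong[OF hopf_homD(1)[OF assms(3)] hopf_coalg[OF assms(1)] assms(4)])
  show "g (x \<otimes>\<^bsub>B\<^esub> y) = g x \<otimes>\<^bsub>H\<^esub> g y" if "x \<in> carrier B" "y \<in> carrier B" for x y
    using that hopf_homD(2)[OF assms(3) that] assms(4)[OF that(1)] assms(4)[OF that(2)]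
      assms(4)[OF B.m_closed[OF that]] by simp
qed

lemma hopf_isoD:
  "f \<in> hiso B H \<Longrightarrow> f \<in> hhom B H" "f \<in> hiso B H \<Longrightarrow> bij_betw f (carrier B) (carrier H)"
  by (simp_all add: hopf_iso_def)

lemma hopf_iso_comp:
  assumes "hopf B" "hopf H" "hopf J" "f \<in> hiso H J" "g \<in> hiso B H"
  shows "(\<lambda>x. f (g x)) \<in> hiso B J"
  using assms hopf_hom_comp[of B H J f g] bij_betw_trans[of g "carrier B" "carrier H" f "carrier J"]
  by (auto simp: hopf_iso_def comp_def)

text \<open>Composed with \<open>f\<close>, the inverse is the identity and thus a coalgebra map;
  \<open>chom_reflect\<close> cancels the injective \<open>f\<close>, and injectivity also yields
  multiplicativity.\<close>

lemma hopf_iso_inv: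
  assumes B: "hopf B" and H: "hopf H" and f: "f \<in> hiso B H"
  shows "inv_into (carrier B) f \<in> hiso H B"
proof -
  note h = hopf_homD[OF hopf_isoD(1)[OF f]] and b = hopf_isoD(2)[OF f]
  let ?g = "inv_into (carrier B) f"
  interpret B: ring B by (rule hopf_ring[OF B])
  have inj: "inj_on f (carrier B)" using b by (simp add: bij_betw_def)
  have g: "?g y \<in> carrier B" "f (?g y) = y" if "y \<in> carrier H" for y
    using that b by (auto simp: bij_betw_def inv_into_into f_inv_into_f)
  have "?g \<in> hhom H B"
  proof (rule hopf_homI[OF H B])
    show "?g \<in> chom H B"
    proof (rule chom_reflect[OF _ _ _ h(1) inj])
      show "(\<lambda>c. f (?g c)) \<in> chom H H"
        by (rule chom_cong[OF chom_id]) (use H g in auto)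
    qed (use B H g in auto)
    show "?g (x \<otimes>\<^bsub>H\<^esub> y) = ?g x \<otimes>\<^bsub>B\<^esub> ?g y" if "x \<in> carrier H" "y \<in> carrier H" for x y
    proof -
      interpret H: ring H by (rule hopf_ring[OF H])
      show ?thesis by (rule inj_onD[OF inj]) (use that g h(2) in auto)
    qed
  qed
  then show ?thesis using bij_betw_inv_into[OF b] by (simp add: hopf_iso_def)
qed

subsection \<open>Hopf subalgebras\<close>

lemma sub_hopf_simps [simp]:
  "carrier (sub W E) = E" "mult (sub W E) = mult W" "one (sub W E) = one W"
  "zero (sub W E) = zero W" "add (sub W E) = add W" "smult (sub W E) = smult W"
  "counit (sub W E) = counit W" "antipode (sub W E) = antipode W"
  by (simp_all add: sub_hopf_def)

lemma sub_tensor_norm: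
  "sub_tensors K W E = carrier (T (sub W E) (sub W E))"
  "sub_tensor_incl K W E = tm (sub W E) (sub W E) W W (\<lambda>x. x) (\<lambda>x. x)"
proof -
  have s: "same_module (W\<lparr>carrier := E\<rparr>) (sub W E)" by (simp add: same_module_def)
  show "sub_tensors K W E = carrier (T (sub W E) (sub W E))"
    by (simp add: sub_tensors_def same_tensor[OF s s])
  show "sub_tensor_incl K W E = tm (sub W E) (sub W E) W W (\<lambda>x. x) (\<lambda>x. x)"
    unfolding sub_tensor_incl_def by (rule same_tm[OF s s same_refl same_refl])
qed

lemma sub_md:
  assumes "md W" "submodule E K W"
  shows "md (sub W E)"
proof -
  have "md (W\<lparr>carrier := E\<rparr>)" using submodule.submodule_is_module[OF assms(2,1)] .
  then show ?thesis by (rule same_module_module[rotated]) (simp add: same_module_def)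
qed

lemma sub_incl_lin:
  assumes "md W" "submodule E K W"
  shows "(\<lambda>x. x) \<in> lin (sub W E) W"
proof -
  interpret W: module K W by fact
  show ?thesis using W.submoduleE(1)[OF assms(2)] by (intro linI) auto
qed

lemma sub_incl_inj:
  fixes W :: "('k, 'w) hopf_algebra"
  assumes "md W" "submodule E K W"
  shows "inj_on (sub_tensor_incl K W E) (sub_tensors K W E)"
  unfolding sub_tensor_norm using assms sub_md[OF assms] sub_incl_lin[OF assms]
  by (intro tm_inj) auto

lemma hopf_subalgebraD:
  assumes "hsub W E"
  shows "submodule E K W" "\<one>\<^bsub>W\<^esub> \<in> E" "x \<in> E \<Longrightarrow> y \<in> E \<Longrightarrow> x \<otimes>\<^bsub>W\<^esub> y \<in> E" "x \<in> E \<Longrightarrow> antipode W x \<in> E"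
  using assms by (auto simp: hopf_subalgebra_def)

text \<open>Injectivity of the comparison map on tensors makes the definite description in
  \<open>sub_hopf\<close> proper: the comultiplication of the ambient algebra has exactly one
  preimage over \<open>E\<close>.\<close>

lemma sub_hopf_comult:
  assumes W: "md W" and E: "hsub W E" and x: "x \<in> E"
  shows "comult (sub W E) x \<in> carrier (T (sub W E) (sub W E))"
    and "tm (sub W E) (sub W E) W W (\<lambda>x. x) (\<lambda>x. x) (comult (sub W E) x) = comult W x"
proof -
  let ?P = "\<lambda>t. t \<in> sub_tensors K W E \<and> sub_tensor_incl K W E t = comult W x"
  obtain t where "?P t" using E x by (auto simp: hopf_subalgebra_def)
  moreover have "s = t" if "?P s" "?P t" for s t
    using that inj_onD[OF sub_incl_inj[OF W hopf_subalgebraD(1)[OF E]]] by auto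
  ultimately have "\<exists>!t. ?P t" by blast
  then have "?P (THE t. ?P t)" by (rule theI')
  moreover have "comult (sub W E) x = (THE t. ?P t)" by (simp add: sub_hopf_def)
  ultimately show "comult (sub W E) x \<in> carrier (T (sub W E) (sub W E))"
    "tm (sub W E) (sub W E) W W (\<lambda>x. x) (\<lambda>x. x) (comult (sub W E) x) = comult W x"
    by (simp_all only: sub_tensor_norm)
qed

lemma hopf_sub:
  assumes W: "hopf W" and E: "hsub W E"
  shows sub_hopf_hopf: "hopf (sub W E)"
    and sub_hopf_incl: "(\<lambda>x. x) \<in> hhom (sub W E) W"
proof -
  let ?S = "sub W E"
  interpret W: module K W using W by auto
  have mW: "md W" using W by auto
  note D = hopf_subalgebraD[OF E]
  have sub: "E \<subseteq> carrier W" using W.submoduleE(1)[OF D(1)] .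
  have mS: "md ?S" by (rule sub_md[OF mW D(1)])
  note il = sub_incl_lin[OF mW D(1)]
  note inj = sub_incl_inj[OF mW D(1), unfolded sub_tensor_norm]
  note cm = sub_hopf_comult[OF mW E]
  have til: "tm ?S ?S W W (\<lambda>x. x) (\<lambda>x. x) \<in> lin (T ?S ?S) (T W W)"
    using mS mW il by (intro tm_lin)
  interpret TS: module K "T ?S ?S" using mS by simp
  have cl: "comult ?S \<in> lin ?S (T ?S ?S)"
  proof (rule linI)
    fix x y assume xy: "x \<in> carrier ?S" "y \<in> carrier ?S"
    then have s: "x \<oplus>\<^bsub>W\<^esub> y \<in> E" using W.submoduleE(5)[OF D(1)] by simp
    show "comult ?S (x \<oplus>\<^bsub>?S\<^esub> y) = comult ?S x \<oplus>\<^bsub>T ?S ?S\<^esub> comult ?S y"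
      by (rule inj_onD[OF inj]) (use xy s cm W in \<open>auto simp: subsetD[OF sub] lin_add[OF til] lin_add[OF comult_lin[OF hopf_coalg[OF W]]]\<close>)
  next
    fix a x assume ax: "a \<in> carrier K" "x \<in> carrier ?S"
    then have s: "a \<odot>\<^bsub>W\<^esub> x \<in> E" using W.submoduleE(4)[OF D(1)] by simp
    show "comult ?S (a \<odot>\<^bsub>?S\<^esub> x) = a \<odot>\<^bsub>T ?S ?S\<^esub> comult ?S x"
      by (rule inj_onD[OF inj]) (use ax s cm W in \<open>auto simp: subsetD[OF sub] lin_smult[OF til] lin_smult[OF comult_lin[OF hopf_coalg[OF W]]]\<close>)
  qed (use cm in auto)
  have ic: "(\<lambda>x. x) \<in> chom ?S W"
    using il cm by (simp add: coalgebra_hom_def)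
  have co: "coalg ?S" by (rule coalg_inj[OF mS cl _ ic]) (use W in auto)
  show h: "hopf ?S"
    by (rule hopf_inj[OF co W ic]) (use D in auto)
  show "(\<lambda>x. x) \<in> hhom ?S W"
    by (rule hopf_homI[OF h W ic]) simp
qed

lemma chom_corestrict:
  assumes W: "hopf W" and E: "hsub W E" and C: "coalg C"
    and f: "f \<in> chom C W" and im: "\<And>c. c \<in> carrier C \<Longrightarrow> f c \<in> E"
  shows "f \<in> chom C (sub W E)"
  by (rule chom_reflect[OF C _ _ hopf_homD(1)[OF sub_hopf_incl[OF W E]]])
    (use sub_hopf_hopf[OF W E] W im f in auto)

lemma hopf_corestrict:
  assumes W: "hopf W" and E: "hsub W E" and B: "hopf B"
    and f: "f \<in> hhom B W" and im: "\<And>c. c \<in> carrier B \<Longrightarrow> f c \<in> E"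
  shows "f \<in> hhom B (sub W E)"
  by (rule hopf_homI[OF B sub_hopf_hopf[OF W E] chom_corestrict[OF W E _ hopf_homD(1)[OF f] im]])
    (use B hopf_homD(2)[OF f] in auto)

text \<open>A coalgebra map corestricts linearly to its image, so \<open>f \<otimes> f\<close>
  factors through the tensor square of the image; the comultiplication of \<open>f c\<close> comes
  from there.\<close>

lemma comult_image:
  fixes W :: "('k, 'w) hopf_algebra"
  assumes C: "coalg C" and W: "md W" and f: "f \<in> chom C W"
  shows "submodule (f ` carrier C) K W"
    and "x \<in> f ` carrier C \<Longrightarrow> comult W x \<in> sub_tensor_incl K W (f ` carrier C) ` sub_tensors K W (f ` carrier C)"
proof -
  have m: "md C" using C by auto
  note fl = chom_lin[OF f]
  let ?S = "sub W (f ` carrier C)"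
  show sub: "submodule (f ` carrier C) K W" by (rule submodule_lin_image[OF fl m W])
  have mS: "md ?S" by (rule sub_md[OF W sub])
  have fS: "f \<in> lin C ?S" using fl by (auto simp: linear_maps_def)
  note il = sub_incl_lin[OF W sub]
  show "comult W x \<in> sub_tensor_incl K W (f ` carrier C) ` sub_tensors K W (f ` carrier C)"
    if x: "x \<in> f ` carrier C"
  proof -
    obtain c where c: "c \<in> carrier C" "x = f c" using x by blast
    have "comult W x = tm C C W W f f (comult C c)" using c f by (simp add: chom_tm)
    also have "\<dots> = tm ?S ?S W W (\<lambda>x. x) (\<lambda>x. x) (tm C C ?S ?S f f (comult C c))"
      using m W mS fS il c C by (subst tm_tm) auto
    finally show ?thesis
      unfolding sub_tensor_norm using m mS fS c C tm_closed[OF m m mS mS fS fS] by auto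
  qed
qed

lemma hopf_image:
  assumes B: "hopf B" and W: "hopf W" and f: "f \<in> hhom B W"
  shows "hsub W (f ` carrier B)"
    and "f \<in> hhom B (sub W (f ` carrier B))"
proof -
  interpret B: ring B by (rule hopf_ring[OF B])
  note h = hopf_homD[OF f]
  have Sc: "antipode B x \<in> carrier B" if "x \<in> carrier B" for x
    using chom_closed[OF antipode_chom[OF B] that] .
  show s: "hsub W (f ` carrier B)"
    unfolding hopf_subalgebra_def
  proof (intro conjI ballI)
    show "\<one>\<^bsub>W\<^esub> \<in> f ` carrier B" using h(3) by force
    show "x \<otimes>\<^bsub>W\<^esub> y \<in> f ` carrier B" if "x \<in> f ` carrier B" "y \<in> f ` carrier B" for x y
      using that by (auto simp flip: h(2))
    show "antipode W x \<in> f ` carrier B" if "x \<in> f ` carrier B" for x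
      using that Sc by (auto simp flip: h(4))
  qed (use comult_image[OF _ _ h(1)] B W in auto)
  show "f \<in> hhom B (sub W (f ` carrier B))"
    by (rule hopf_corestrict[OF W s B f]) simp
qed

lemma hopf_image_iso:
  assumes B: "hopf B" and W: "hopf W" and f: "f \<in> hhom B W" and inj: "inj_on f (carrier B)"
  shows "f \<in> hiso B (sub W (f ` carrier B))"
  using hopf_image[OF assms(1-3)] inj by (simp add: hopf_iso_def bij_betw_def)

subsection \<open>Transport along injections\<close>

lemma coalg_transport:
  fixes C :: "('k, 'a, 'c) coalgebra_scheme" (structure) and g :: "'a \<Rightarrow> 'b"
  assumes C: "coalg C" and inj: "inj_on g (carrier C)"
  shows "coalg (transport_coalgebra K g C)"
    and "inv_into (carrier C) g \<in> chom (transport_coalgebra K g C) C"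
proof -
  interpret C: module K C using C by auto
  have mC: "md C" using C by auto
  let ?h = "inv_into (carrier C) g"
  let ?R = "transport_coalgebra K g C"
  have h: "?h (g x) = x" if "x \<in> carrier C" for x using inj that by simp
  have R: "carrier ?R = g ` carrier C" "zero ?R = g \<zero>" "add ?R = (\<lambda>x y. g (?h x \<oplus> ?h y))"
    "smult ?R = (\<lambda>a x. g (a \<odot> ?h x))" "counit ?R = (\<lambda>x. counit C (?h x))"
    by (simp_all add: transport_coalgebra_def Let_def)
  have "abelian_group ?R"
  proof (rule abelian_groupI)
    show "\<exists>y\<in>carrier ?R. y \<oplus>\<^bsub>?R\<^esub> x = \<zero>\<^bsub>?R\<^esub>" if "x \<in> carrier ?R" for x
      using that by (auto simp: R h C.l_neg intro!: bexI[of _ "\<ominus> _"])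
  qed (auto simp: R h C.a_ac)
  then have mR: "md ?R"
    by (rule moduleI[OF cring_K]) (auto simp: R h C.smult_l_distr C.smult_r_distr C.smult_assoc1)
  have gl: "g \<in> lin C ?R" by (rule linI) (auto simp: R h)
  have hl: "?h \<in> lin ?R C" by (rule linI) (auto simp: R h)
  define M :: "('k, 'b) module" where "M = \<lparr>carrier = g ` carrier C, mult = (\<lambda>x y. g (?h x \<otimes> ?h y)), one = g \<one>,
       zero = g \<zero>, add = (\<lambda>x y. g (?h x \<oplus> ?h y)), smult = (\<lambda>a x. g (a \<odot> ?h x))\<rparr>"
  have sM: "same_module M ?R" by (simp add: same_module_def M_def R)
  have "comult ?R = (\<lambda>x. tm C C M M g g (comult C (?h x)))"
    by (simp add: transport_coalgebra_def Let_def M_def)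
  then have cR: "comult ?R = (\<lambda>x. tm C C ?R ?R g g (comult C (?h x)))"
    using same_tm[OF same_refl same_refl sM sM, where K = K] by metis
  have cl: "comult ?R \<in> lin ?R (T ?R ?R)"
    unfolding cR using mC mR gl hl C by (intro lin_intros)
  have hc: "?h \<in> chom ?R C"
    using hl mC mR gl C by (auto simp: coalgebra_hom_def cR R h tm_retract)
  show "coalg ?R"
    by (rule coalg_inj[OF mR cl C hc]) (auto simp: R h inj_on_def)
  show "?h \<in> chom ?R C" by (rule hc)
qed

lemma transport_carrier [simp]: "carrier (transport_coalgebra K g C) = g ` carrier C"
  by (simp add: transport_coalgebra_def Let_def)

lemma hopf_transport:
  fixes H :: "('k, 'a, 'c) hopf_algebra_scheme" and g :: "'a \<Rightarrow> 'b"
  assumes H: "hopf H" and inj: "inj_on g (carrier H)"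
  shows "hopf (transport_hopf K g H)"
    and "inv_into (carrier H) g \<in> hiso (transport_hopf K g H) H"
proof -
  interpret H: ring H by (rule hopf_ring[OF H])
  interpret HH: cocomm_hopf_algebra K H by fact
  let ?R = "transport_coalgebra K g H" and ?S = "transport_hopf K g H"
  let ?h = "inv_into (carrier H) g"
  have h: "?h (g x) = x" if "x \<in> carrier H" for x using inj that by simp
  have S: "carrier ?S = g ` carrier H" "mult ?S = (\<lambda>x y. g (?h x \<otimes>\<^bsub>H\<^esub> ?h y))" "one ?S = g \<one>\<^bsub>H\<^esub>"
    "antipode ?S = (\<lambda>x. g (antipode H (?h x)))"
    by (simp_all add: transport_hopf_def transport_coalgebra_def Let_def)
  have same: "same_module ?R ?S" "comult ?S = comult ?R" "counit ?S = counit ?R"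
    by (simp_all add: same_module_def transport_hopf_def Let_def)
  note R = coalg_transport[OF hopf_coalg[OF H] inj]
  have mS: "md ?S" using same_module_module[OF same(1)] R(1) by auto
  have cS: "comult ?S \<in> lin ?S (T ?S ?S)"
    using comult_lin[OF R(1)]
    by (simp only: same(2) same_tensor(1)[OF same(1,1)] same_lin[OF same(1) same_refl])
  have carr: "carrier ?R = carrier ?S" using same(1) by (simp add: same_module_def)
  have hc: "?h \<in> chom ?S H"
    using R(2) unfolding coalgebra_hom_def
    by (simp only: carr same(2,3) same_lin[OF same(1) same_refl]
        same_tm[OF same(1,1) same_refl same_refl])
  have hinj: "inj_on ?h (carrier ?S)" by (auto simp: S h inj_on_def)
  have co: "coalg ?S" by (rule coalg_inj[OF mS cS _ hc hinj]) (use H in auto)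
  have Sc: "antipode H x \<in> carrier H" if "x \<in> carrier H" for x
    using chom_closed[OF antipode_chom[OF H] that] .
  show hS: "hopf ?S"
    by (rule hopf_inj[OF co H hc hinj]) (auto simp: S h Sc)
  have "?h \<in> hhom ?S H"
    by (rule hopf_homI[OF hS H hc]) (auto simp: S h)
  then show "?h \<in> hiso ?S H"
    using inj by (auto simp: hopf_iso_def bij_betw_def S hinj[unfolded S] h image_image)
qed

text \<open>A tensor is a finite sum of pure tensors, hence the image of a list of pairs.\<close>

lemma tensor_lepoll:
  assumes inf: "infinite (UNIV :: 'u set)" and V: "md V" and W: "md W"
    and sV: "carrier V \<lesssim> (UNIV :: 'u set)" and sW: "carrier W \<lesssim> (UNIV :: 'u set)"
  shows "carrier (T V W) \<lesssim> (UNIV :: 'u set)"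
proof -
  interpret TT: module K "T V W" using V W by simp
  obtain p :: "'u \<times> 'u \<Rightarrow> 'u" where p: "inj p"
    using card_of_Times_same_infinite[OF inf] by (metis UNIV_Times_UNIV bij_betw_def card_of_ordIso)
  obtain n :: "nat \<Rightarrow> 'u" where n: "inj n" using inf by (metis infinite_countable_subset)
  \<comment> \<open>Folding a list with the pairing \<open>p\<close> separates only lists of equal
    length, so the length is coded next to it.\<close>
  define enc where "enc xs = foldr (\<lambda>x y. p (x, y)) xs (n 0)" for xs
  have enc: "xs = ys" if "length xs = length ys" "enc xs = enc ys" for xs ys
    using that by (induction xs ys rule: list_induct2) (auto simp: enc_def inj_eq[OF p])
  have "inj (\<lambda>xs. p (n (length xs), enc xs))"
    by (rule injI) (auto simp: inj_eq[OF p] inj_eq[OF n] intro: enc)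
  then have lists: "(UNIV :: 'u list set) \<lesssim> (UNIV :: 'u set)"
    by (auto simp: lepoll_def)
  obtain f where f: "inj_on f (carrier V)" "f ` carrier V \<subseteq> (UNIV :: 'u set)" using sV by (auto simp: lepoll_def)
  obtain g where g: "inj_on g (carrier W)" "g ` carrier W \<subseteq> (UNIV :: 'u set)" using sW by (auto simp: lepoll_def)
  define dec where "dec u = (let (a, b) = inv_into UNIV p u in pt V W (inv_into (carrier V) f a) (inv_into (carrier W) g b))" for u
  have dec: "dec (p (f v, g w)) = pt V W v w" if "v \<in> carrier V" "w \<in> carrier W" for v w
    using that f g p by (simp add: dec_def)
  define \<Sigma> where "\<Sigma> us = foldr (\<lambda>u t. dec u \<oplus>\<^bsub>T V W\<^esub> t) us \<zero>\<^bsub>T V W\<^esub>" for us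
  define good where "good us \<longleftrightarrow> set us \<subseteq> {p (f v, g w) | v w. v \<in> carrier V \<and> w \<in> carrier W}" for us
  have dc: "dec u \<in> carrier (T V W)" if "good [u]" for u
    using that V W by (auto simp: good_def dec)
  have \<Sigma>c: "\<Sigma> us \<in> carrier (T V W)" if "good us" for us
    using that dc by (induction us) (auto simp: \<Sigma>_def good_def)
  have app: "\<Sigma> (us @ vs) = \<Sigma> us \<oplus>\<^bsub>T V W\<^esub> \<Sigma> vs" if "good us" "good vs" for us vs
    using that(1)
  proof (induction us)
    case Nil
    then show ?case using \<Sigma>c[OF that(2)] by (simp add: \<Sigma>_def)
  next
    case (Cons u us)
    then have "good us" "good [u]" by (auto simp: good_def)
    then show ?case
      using Cons.IH dc \<Sigma>c[OF that(2)] \<Sigma>c[of us] by (simp add: \<Sigma>_def TT.a_assoc)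
  qed
  have "\<exists>us. good us \<and> t = \<Sigma> us" if "t \<in> carrier (T V W)" for t
    using V W that
  proof (induction t rule: tensor_induct)
    case (pure v w)
    then show ?case using V W
      by (intro exI[of _ "[p (f v, g w)]"]) (auto simp: good_def \<Sigma>_def dec)
  next
    case (add s t)
    then obtain us vs where "good us" "s = \<Sigma> us" "good vs" "t = \<Sigma> vs" by blast
    then show ?case by (intro exI[of _ "us @ vs"]) (auto simp: app, auto simp: good_def)
  qed
  then have "carrier (T V W) \<subseteq> \<Sigma> ` UNIV" by blast
  then have "carrier (T V W) \<lesssim> (UNIV :: 'u list set)" by (rule subset_image_lepoll)
  then show ?thesis using lists by (rule lepoll_trans)
qed

end

section \<open>Exponentials\<close>

definition same_coalgebra ::
  "('k, 'a, 'c) coalgebra_scheme \<Rightarrow> ('k, 'a, 'd) coalgebra_scheme \<Rightarrow> bool" where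
  "same_coalgebra C D \<longleftrightarrow> same_module C D \<and> comult C = comult D \<and> counit C = counit D"

definition small_for :: "'u itself \<Rightarrow> ('a, 'c) partial_object_scheme \<Rightarrow> bool" where
  "small_for (_ :: 'u itself) C \<longleftrightarrow> carrier C \<lesssim> (UNIV :: 'u set)"

context kvec
begin

lemma same_coalgebra_simps:
  assumes s: "same_coalgebra C D"
  shows "chom C E = chom D E" "chom E C = chom E D" "Hom C E = Hom D E" "Hom E C = Hom E D"
    "C \<otimes>\<^sub>c E = D \<otimes>\<^sub>c E" "E \<otimes>\<^sub>c C = E \<otimes>\<^sub>c D" "p1 C E = p1 D E" "p1 E C = p1 E D"
    "p2 C E = p2 D E" "p2 E C = p2 E D" "pair B C E = pair B D E" "pair B E C = pair B E D"
proof -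
  have m: "same_module C D" and co: "comult C = comult D" and cu: "counit C = counit D"
    using s by (simp_all add: same_coalgebra_def)
  have car: "carrier C = carrier D" using m by (simp add: same_module_def)
  note l = same_lin[OF m same_refl] same_lin[OF same_refl m]
  note t = same_tensor[OF m same_refl] same_tensor[OF same_refl m] same_tensor[OF m m]
  note tl = same_tl[OF m same_refl same_refl] same_tl[OF same_refl m same_refl]
    same_tl[OF m m same_refl] same_tl[OF same_refl m m] same_tl[OF m same_refl m]
    same_tl[OF same_refl same_refl m]
  note tmn = same_tm[OF m m same_refl same_refl] same_tm[OF same_refl same_refl m m]
  have sm: "smult C = smult D" using m by (simp add: same_module_def)
  show c: "chom C E = chom D E" "chom E C = chom E D"
    unfolding coalgebra_hom_def by (simp_all only: l tmn co cu car)
  show "Hom C E = Hom D E" "Hom E C = Hom E D"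
    unfolding Hom_def by (simp_all only: c car)
  show "C \<otimes>\<^sub>c E = D \<otimes>\<^sub>c E" "E \<otimes>\<^sub>c C = E \<otimes>\<^sub>c D"
    unfolding tensor_coalgebra_def Let_def sweedler_def by (simp_all only: t tl co cu)
  show "p1 C E = p1 D E" "p1 E C = p1 E D" "p2 C E = p2 D E" "p2 E C = p2 E D"
    unfolding p1_def p2_def by (simp_all only: tl cu sm)
  show "pair B C E = pair B D E" "pair B E C = pair B E D"
    unfolding pair_def by (simp_all only: t)
qed

lemma same_coalgebra_coalg:
  assumes s: "same_coalgebra C D" and D: "coalg D"
  shows "coalg C"
proof -
  have m: "same_module C D" and co: "comult C = comult D" using s by (simp_all add: same_coalgebra_def)
  have mC: "md C" using same_module_module[OF same_sym[OF m]] D by auto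
  have car: "carrier C = carrier D" using m by (simp add: same_module_def)
  have "comult C \<in> lin C (T C C)"
    using comult_lin[OF D] by (simp only: co same_tensor(1)[OF m m] same_lin[OF m same_refl])
  moreover have "(\<lambda>x. x) \<in> chom C D" using chom_id[OF D] by (simp only: same_coalgebra_simps(1)[OF s])
  ultimately show ?thesis by (rule coalg_inj[OF mC _ D]) simp
qed

end

locale exponential_data = kvec K for K :: "('k, 'm) ring_scheme" +
  fixes A :: "('k, 'a) hopf_algebra" and Q :: "('k, 'q) hopf_algebra"
    and X :: "('k, 'x) coalgebra" and ev :: "('k, 'x, 'q) tensor \<Rightarrow> 'a" and univ :: "'u itself"
  assumes A: "hopf A" and Q: "hopf Q"
    and expo: "exponential univ K Q A X ev"
    and inf: "infinite (UNIV :: 'u set)"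
    and small_A: "carrier A \<lesssim> (UNIV :: 'u set)"
    and small_Q: "carrier Q \<lesssim> (UNIV :: 'u set)"
    and small_X: "carrier X \<lesssim> (UNIV :: 'u set)"
begin

abbreviation small where "small C \<equiv> small_for univ C"

lemma small_tensor [simp, intro]:
  "coalg C \<Longrightarrow> coalg D \<Longrightarrow> small C \<Longrightarrow> small D \<Longrightarrow> small (C \<otimes>\<^sub>c D)"
  using tensor_lepoll[OF inf, of C D] by (auto simp: small_for_def)

lemma small_objects [simp]: "small A" "small Q" "small X"
  using small_A small_Q small_X by (simp_all add: small_for_def)

lemma cA [simp]: "coalg A" and cQ [simp]: "coalg Q"
  using A Q by auto

lemma cX [simp]: "coalg X"
  using expo by (simp add: exponential_def)

lemma mA [simp]: "md A" and mQ [simp]: "md Q" and mX [simp]: "md X"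
  by (auto intro: coalg_md)

lemma ev_chom: "ev \<in> chom (X \<otimes>\<^sub>c Q) A"
  using expo by (simp add: exponential_def)

lemma ev_lin: "ev \<in> lin (T X Q) A"
  using chom_lin[OF ev_chom] by simp

text \<open>The evaluation \<open>x@c\<close> of the exponential for points over a common coalgebra
  \<open>C\<close>; in Sweedler form it sends \<open>e\<close> to
  \<open>x(e1)@c(e2)\<close>.\<close>

definition at where
  "at C x c = cmp C ev (pair C X Q x c)"

lemma compose_chom: "coalg C \<Longrightarrow> md D \<Longrightarrow> md E \<Longrightarrow> f \<in> chom D E \<Longrightarrow> g \<in> Hom C D \<Longrightarrow> cmp C f g \<in> Hom C E"
  unfolding compose_def by (rule restrict_Hom) (auto intro: chom_comp Hom_chom)

lemma at_Hom [simp, intro]: "coalg C \<Longrightarrow> x \<in> Hom C X \<Longrightarrow> c \<in> Hom C Q \<Longrightarrow> at C x c \<in> Hom C A"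
  unfolding at_def by (rule compose_chom[OF _ _ _ ev_chom]) auto

lemma at_compose:
  assumes "coalg C" "coalg B" "x \<in> Hom C X" "c \<in> Hom C Q" "k \<in> Hom B C"
  shows "cmp B (at C x c) k = at B (cmp B x k) (cmp B c k)"
  unfolding at_def using assms by (simp add: compose_compose pairing_compose)

lemma at_apply:
  assumes "coalg C" "x \<in> Hom C X" "c \<in> Hom C Q" "e \<in> carrier C"
  shows "at C x c e = sw C A (\<lambda>a b. ev (pt X Q (x a) (c b))) e"
proof -
  have "at C x c e = ev (sw C (T X Q) (\<lambda>a b. pt X Q (x a) (c b)) e)"
    using assms by (simp add: at_def compose_def pairing_apply)
  also have "\<dots> = sw C A (\<lambda>a b. ev (pt X Q (x a) (c b))) e"
    using assms by (intro sw_push ev_lin pairing_bil Hom_lin) auto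
  finally show ?thesis .
qed

lemma ev_bil: "(\<lambda>x c. ev (pt X Q x c)) \<in> bil X Q A"
  by (intro bil_post[OF pt_bil ev_lin]) auto

lemma compose_id: "f \<in> Hom C D \<Longrightarrow> cmp C (\<lambda>x. x) f = f"
  by (rule extensionalityI[where A = "carrier C"]) (auto simp: compose_def Hom_ext)

lemma at_pure:
  assumes C: "coalg C" and g: "g \<in> Hom C X" and c: "c \<in> carrier C" and q: "q \<in> carrier Q"
  shows "at (C \<otimes>\<^sub>c Q) (cmp (C \<otimes>\<^sub>c Q) g (p1 C Q)) (p2 C Q) (pt C Q c q) = ev (pt X Q (g c) q)"
proof -
  have "pair (C \<otimes>\<^sub>c Q) X Q (cmp (C \<otimes>\<^sub>c Q) g (p1 C Q)) (cmp (C \<otimes>\<^sub>c Q) (\<lambda>x. x) (p2 C Q)) (pt C Q c q)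
      = pt X Q (g c) q"
    using C c q Hom_lin[OF g] by (intro pairing_pure lin_id) auto
  then show ?thesis
    using C c q compose_id[OF proj_Hom(2)[OF C cQ]] by (simp add: at_def compose_def)
qed

lemma tensor_Hom_eqI:
  assumes "coalg C" "coalg D" "f \<in> Hom (C \<otimes>\<^sub>c D) E" "g \<in> Hom (C \<otimes>\<^sub>c D) E"
    and "\<And>c d. c \<in> carrier C \<Longrightarrow> d \<in> carrier D \<Longrightarrow> f (pt C D c d) = g (pt C D c d)"
  shows "f = g"
proof (rule extensionalityI[OF Hom_ext[OF assms(3)] Hom_ext[OF assms(4)]])
  have l: "f \<in> lin (T C D) E" "g \<in> lin (T C D) E"
    using Hom_lin[OF assms(3)] Hom_lin[OF assms(4)] by simp_all
  fix t assume "t \<in> carrier (C \<otimes>\<^sub>c D)"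
  then have t: "t \<in> carrier (T C D)" by simp
  show "f t = g t"
    by (rule tensor_lin_eqI[OF coalg_md[OF assms(1)] coalg_md[OF assms(2)] l _ t]) (rule assms(5))
qed

text \<open>Transposition is evaluation at the generic point: the transpose of \<open>\<phi>\<close>
  is \<open>\<phi>\<close> after the first projection of \<open>R \<otimes> Q\<close>, evaluated at
  the second. In this form the universal property speaks only of points.\<close>

lemma exponential_universe:
  fixes R :: "('k, 'u) coalgebra"
  assumes R: "coalg R" and F: "F \<in> Hom (R \<otimes>\<^sub>c Q) A"
  shows "\<exists>!g. g \<in> Hom R X \<and> at (R \<otimes>\<^sub>c Q) (cmp (R \<otimes>\<^sub>c Q) g (p1 R Q)) (p2 R Q) = F"
proof -
  let ?t = "\<lambda>\<phi>. restrict (\<lambda>t. ev (tm R Q X Q \<phi> (\<lambda>c. c) t)) (carrier (R \<otimes>\<^sub>c Q))"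
  let ?a = "\<lambda>\<phi>. at (R \<otimes>\<^sub>c Q) (cmp (R \<otimes>\<^sub>c Q) \<phi> (p1 R Q)) (p2 R Q)"
  have bij: "bij_betw ?t (Hom R X) (Hom (R \<otimes>\<^sub>c Q) A)"
    using expo R by (simp add: exponential_def Hom_def)
  have eq: "?t \<phi> = ?a \<phi>" if \<phi>: "\<phi> \<in> Hom R X" for \<phi>
  proof (rule tensor_Hom_eqI[OF R cQ])
    show "?t \<phi> \<in> Hom (R \<otimes>\<^sub>c Q) A" using bij \<phi> unfolding bij_betw_def by blast
    show "?a \<phi> \<in> Hom (R \<otimes>\<^sub>c Q) A"
      using R \<phi> by (intro at_Hom compose_Hom[of _ R]) auto
    show "?t \<phi> (pt R Q r q) = ?a \<phi> (pt R Q r q)" if "r \<in> carrier R" "q \<in> carrier Q" for r q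
      using that R Hom_lin[OF \<phi>] by (subst at_pure[OF R \<phi> that]) (simp add: tm_pt lin_id)
  qed
  have "F \<in> ?t ` Hom R X" using F by (simp only: bij_betw_imp_surj_on[OF bij])
  then obtain g where Fg: "F = ?t g" and gR: "g \<in> Hom R X" by (rule imageE)
  note g = gR Fg[symmetric]
  show ?thesis
  proof (rule ex1I[of _ g])
    show "g \<in> Hom R X \<and> ?a g = F" using g eq[OF g(1)] by simp
    fix g' assume g': "g' \<in> Hom R X \<and> ?a g' = F"
    then have g'R: "g' \<in> Hom R X" by (rule conjunct1)
    have "?t g' = F" using eq[OF g'R] conjunct2[OF g'] by (rule trans)
    then show "g' = g" using g by (intro inj_onD[OF bij_betw_imp_inj_on[OF bij] _ g'R g(1)]) (rule trans[OF _ sym])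
  qed
qed

text \<open>A coalgebra that embeds in the universe type is isomorphic, by transport along the
  embedding \<open>j\<close>, to one carried by that type. Existence and uniqueness of transposes
  pass through the mutually inverse maps \<open>h\<close> and \<open>i\<close>.\<close>

lemma curry_exists:
  assumes R: "coalg R" and s: "small R" and F: "F \<in> Hom (R \<otimes>\<^sub>c Q) A"
  shows "\<exists>!g. g \<in> Hom R X \<and> at (R \<otimes>\<^sub>c Q) (cmp (R \<otimes>\<^sub>c Q) g (p1 R Q)) (p2 R Q) = F"
proof -
  obtain j :: "_ \<Rightarrow> 'u" where j: "inj_on j (carrier R)" using s by (auto simp: lepoll_def small_for_def)
  let ?S = "transport_coalgebra K j R"
  let ?h = "inv_into (carrier R) j"
  note S = coalg_transport[OF R j]
  have hj: "?h (j r) = r" if "r \<in> carrier R" for r using j that by simp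
  have jchom: "j \<in> chom R ?S"
    by (rule chom_reflect[OF R S(1) R S(2)])
      (auto simp: hj inj_on_def intro!: chom_cong[OF chom_id[OF R] R])
  define h where "h = restrict ?h (carrier ?S)"
  define i where "i = restrict j (carrier R)"
  have h: "h \<in> Hom ?S R" unfolding h_def by (rule restrict_Hom[OF S(1,2)])
  have i: "i \<in> Hom R ?S" unfolding i_def by (rule restrict_Hom[OF R jchom])
  have hi: "h (i r) = r" if "r \<in> carrier R" for r using that by (simp add: h_def i_def hj)
  have ih: "i (h y) = y" if "y \<in> carrier ?S" for y using that by (auto simp: h_def i_def hj)
  let ?hq = "pair (?S \<otimes>\<^sub>c Q) R Q (cmp (?S \<otimes>\<^sub>c Q) h (p1 ?S Q)) (p2 ?S Q)"
  have hq: "?hq \<in> Hom (?S \<otimes>\<^sub>c Q) (R \<otimes>\<^sub>c Q)"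
    using R S(1) h by (intro pairing_Hom compose_Hom[of _ ?S]) auto
  have hq_pure: "?hq (pt ?S Q y q) = pt R Q (h y) q" if "y \<in> carrier ?S" "q \<in> carrier Q" for y q
    using pairing_pure[OF S(1) cQ _ _ Hom_lin[OF h] lin_id that] R compose_id[OF proj_Hom(2)[OF S(1) cQ]]
    by simp
  let ?F = "cmp (?S \<otimes>\<^sub>c Q) F ?hq"
  have F': "?F \<in> Hom (?S \<otimes>\<^sub>c Q) A"
    using R S(1) F hq by (intro compose_Hom[of _ "R \<otimes>\<^sub>c Q"]) auto
  let ?a = "\<lambda>R \<phi>. at (R \<otimes>\<^sub>c Q) (cmp (R \<otimes>\<^sub>c Q) \<phi> (p1 R Q)) (p2 R Q)"
  have aR: "?a R \<phi> \<in> Hom (R \<otimes>\<^sub>c Q) A" if "\<phi> \<in> Hom R X" for \<phi>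
    using R that by (intro at_Hom compose_Hom[of _ R]) auto
  have aS: "?a ?S \<phi> \<in> Hom (?S \<otimes>\<^sub>c Q) A" if "\<phi> \<in> Hom ?S X" for \<phi>
    using S(1) that by (intro at_Hom compose_Hom[of _ ?S]) auto
  have F'pure: "?F (pt ?S Q y q) = F (pt R Q (h y) q)" if "y \<in> carrier ?S" "q \<in> carrier Q" for y q
    using that hq_pure[OF that] S(1) by (simp add: compose_def)
  obtain g where g: "g \<in> Hom ?S X" "?a ?S g = ?F"
    and guniq: "\<And>g'. g' \<in> Hom ?S X \<Longrightarrow> ?a ?S g' = ?F \<Longrightarrow> g' = g"
    using exponential_universe[OF S(1) F'] by blast
  have gi: "cmp R g i \<in> Hom R X"
    using R S(1) g i by (intro compose_Hom[of _ ?S]) auto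
  show ?thesis
  proof (rule ex1I[of _ "cmp R g i"], intro conjI gi)
    show "?a R (cmp R g i) = F"
    proof (rule tensor_Hom_eqI[OF R cQ aR[OF gi] F])
      fix r q assume rq: "r \<in> carrier R" "q \<in> carrier Q"
      have "?a R (cmp R g i) (pt R Q r q) = ev (pt X Q (g (i r)) q)"
        using rq by (subst at_pure[OF R gi rq]) (simp add: compose_def)
      also have "\<dots> = ?a ?S g (pt ?S Q (i r) q)"
        by (rule at_pure[OF S(1) g(1) Hom_closed[OF i rq(1)] rq(2), symmetric])
      also have "\<dots> = F (pt R Q r q)"
        unfolding g(2) using F'pure[OF Hom_closed[OF i rq(1)] rq(2)] hi[OF rq(1)] by simp
      finally show "?a R (cmp R g i) (pt R Q r q) = F (pt R Q r q)" .
    qed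
    fix g' assume g': "g' \<in> Hom R X \<and> ?a R g' = F"
    then have g'h: "cmp ?S g' h \<in> Hom ?S X"
      using R S(1) h by (intro compose_Hom[of _ R]) auto
    have "?a ?S (cmp ?S g' h) = ?F"
    proof (rule tensor_Hom_eqI[OF S(1) cQ aS[OF g'h] F'])
      fix y q assume yq: "y \<in> carrier ?S" "q \<in> carrier Q"
      have "?a ?S (cmp ?S g' h) (pt ?S Q y q) = ev (pt X Q (g' (h y)) q)"
        using yq by (subst at_pure[OF S(1) g'h yq]) (simp add: compose_def)
      also have "\<dots> = ?a R g' (pt R Q (h y) q)"
        using g' by (intro at_pure[OF R _ Hom_closed[OF h yq(1)] yq(2), symmetric]) simp
      finally show "?a ?S (cmp ?S g' h) (pt ?S Q y q) = ?F (pt ?S Q y q)"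
        using g' F'pure[OF yq] by simp
    qed
    then have eq: "cmp ?S g' h = g" by (rule guniq[OF g'h])
    show "g' = cmp R g i"
    proof (rule Hom_eqI[OF _ gi])
      show "g' \<in> Hom R X" using g' by simp
      show "g' r = cmp R g i r" if "r \<in> carrier R" for r
        using that eq[symmetric] Hom_closed[OF i that] hi[OF that] by (simp add: compose_def)
    qed
  qed
qed

text \<open>This is the substitute for comparing values at elements: two points of
  \<open>A^Q\<close> agree as soon as they agree at the generic point of \<open>Q\<close>, which is
  the uniqueness half of \<open>curry_exists\<close>.\<close>

lemma X_eqI:
  assumes R: "coalg R" and s: "small R" and f: "f \<in> Hom R X" and g: "g \<in> Hom R X"
    and eq: "at (R \<otimes>\<^sub>c Q) (cmp (R \<otimes>\<^sub>c Q) f (p1 R Q)) (p2 R Q) =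
      at (R \<otimes>\<^sub>c Q) (cmp (R \<otimes>\<^sub>c Q) g (p1 R Q)) (p2 R Q)"
  shows "f = g"
proof -
  have "at (R \<otimes>\<^sub>c Q) (cmp (R \<otimes>\<^sub>c Q) f (p1 R Q)) (p2 R Q) \<in> Hom (R \<otimes>\<^sub>c Q) A"
    using R f by (intro at_Hom compose_Hom[of _ R]) auto
  from curry_exists[OF R s this] show ?thesis
  proof (rule ex1E)
    fix h
    assume u: "\<forall>y. y \<in> Hom R X \<and> at (R \<otimes>\<^sub>c Q) (cmp (R \<otimes>\<^sub>c Q) y (p1 R Q)) (p2 R Q) =
      at (R \<otimes>\<^sub>c Q) (cmp (R \<otimes>\<^sub>c Q) f (p1 R Q)) (p2 R Q) \<longrightarrow> y = h"
    have "f = h" by (rule u[rule_format]) (rule conjI[OF f refl])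
    moreover have "g = h" by (rule u[rule_format]) (rule conjI[OF g eq[symmetric]])
    ultimately show "f = g" by simp
  qed
qed

text \<open>\<open>exp_curry\<close> describes a map by its values at pairs of elements. For a whole
  coalgebra map \<open>R \<rightarrow> X\<close> this is enough, because pure tensors span
  \<open>R \<otimes> Q\<close> and so fix the transpose. The coalgebra map \<open>F\<close> with the
  same values guarantees existence.\<close>

lemma exp_curry_props:
  assumes R: "coalg R" and s: "small R" and F: "F \<in> Hom (R \<otimes>\<^sub>c Q) A"
    and Ffb: "\<forall>r \<in> carrier R. \<forall>q \<in> carrier Q. F (pt R Q r q) = f r q"
  shows exp_curry_Hom: "exp_curry K Q X ev R f \<in> Hom R X"
    and exp_curry_ev: "r \<in> carrier R \<Longrightarrow> q \<in> carrier Q \<Longrightarrow> ev (pt X Q (exp_curry K Q X ev R f r) q) = f r q"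
    and exp_curry_at: "\<And>r c. coalg C \<Longrightarrow> r \<in> Hom C R \<Longrightarrow> c \<in> Hom C Q \<Longrightarrow>
      at C (cmp C (exp_curry K Q X ev R f) r) c = cmp C F (pair C R Q r c)"
proof -
  have Ff: "F (pt R Q r q) = f r q" if "r \<in> carrier R" "q \<in> carrier Q" for r q
    using Ffb that by simp
  let ?P = "\<lambda>g. g \<in> chom R X \<and> g \<in> extensional (carrier R) \<and>
    (\<forall>r \<in> carrier R. \<forall>c \<in> carrier Q. ev (pt X Q (g r) c) = f r c)"
  let ?a = "\<lambda>\<phi>. at (R \<otimes>\<^sub>c Q) (cmp (R \<otimes>\<^sub>c Q) \<phi> (p1 R Q)) (p2 R Q)"
  have aR: "?a \<phi> \<in> Hom (R \<otimes>\<^sub>c Q) A" if "\<phi> \<in> Hom R X" for \<phi>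
    using R that by (intro at_Hom compose_Hom[of _ R]) auto
  have iff: "?P g \<longleftrightarrow> g \<in> Hom R X \<and> ?a g = F" for g
  proof
    assume P: "?P g"
    then have g: "g \<in> Hom R X" by (simp add: Hom_def)
    have "?a g = F"
      by (rule tensor_Hom_eqI[OF R cQ aR[OF g] F], subst at_pure[OF R g]) (use P Ff in auto)
    with g show "g \<in> Hom R X \<and> ?a g = F" by blast
  next
    assume H: "g \<in> Hom R X \<and> ?a g = F"
    have "ev (pt X Q (g r) c) = f r c" if "r \<in> carrier R" "c \<in> carrier Q" for r c
    proof -
      have "?a g (pt R Q r c) = f r c" using H Ff[OF that] by simp
      then show ?thesis by (subst (asm) at_pure[OF R _ that]) (use H in simp)
    qed
    then show "?P g" using H by (simp add: Hom_def)
  qed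
  have "\<exists>!g. ?P g" unfolding iff by (rule curry_exists[OF R s F])
  then have P: "?P (exp_curry K Q X ev R f)" unfolding exp_curry_def by (rule theI')
  then show g: "exp_curry K Q X ev R f \<in> Hom R X" by (simp add: Hom_def)
  show "ev (pt X Q (exp_curry K Q X ev R f r) q) = f r q" if "r \<in> carrier R" "q \<in> carrier Q"
    using P that by simp
  show "at C (cmp C (exp_curry K Q X ev R f) r) c = cmp C F (pair C R Q r c)"
    if C: "coalg C" and r: "r \<in> Hom C R" and c: "c \<in> Hom C Q" for r c
  proof (rule extensionalityI[where A = "carrier C"])
    have gr: "cmp C (exp_curry K Q X ev R f) r \<in> Hom C X"
      using C R r g by (intro compose_Hom[of _ R]) auto
    show "at C (cmp C (exp_curry K Q X ev R f) r) c \<in> extensional (carrier C)"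
      by (rule Hom_ext[OF at_Hom[OF C gr c]])
    fix e assume e: "e \<in> carrier C"
    have "at C (cmp C (exp_curry K Q X ev R f) r) c e =
        sw C A (\<lambda>a b. F (pt R Q (r a) (c b))) e"
      unfolding at_apply[OF C gr c e] using P Ff Hom_closed[OF r] Hom_closed[OF c]
      by (intro sw_cong) (simp add: compose_def)
    also have "\<dots> = F (sw C (T R Q) (\<lambda>a b. pt R Q (r a) (c b)) e)"
      using C R e Hom_lin[OF F] by (intro sw_push[symmetric] pairing_bil Hom_lin r c) auto
    finally show "at C (cmp C (exp_curry K Q X ev R f) r) c e = cmp C F (pair C R Q r c) e"
      using e by (simp add: compose_def pairing_apply)
  qed (simp add: compose_def)
qed

end

context kvec
begin

declare tensor_coalgebra_simps(1) [simp del]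

lemma tensor_coalgebra_mem [simp]: "t \<in> carrier (C \<otimes>\<^sub>c D) \<longleftrightarrow> t \<in> carrier (T C D)"
  by (simp add: tensor_coalgebra_simps(1))

lemma counit_ground [simp]: "counit (ground_coalgebra K) = (\<lambda>a. a)"
  by (simp add: ground_coalgebra_def Let_def)

text \<open>The first leg of the comultiplication feeds the second tensor factor here;
  cocommutativity of the tensor coalgebra restores the order expected by
  \<open>sw_proj\<close>.\<close>

lemma conv_pure_flip:
  fixes H (structure)
  assumes C: "coalg C" and D: "coalg D" and H: "md H" and mu: "mult H \<in> bil H H H"
    and f: "f \<in> lin C H" and g: "g \<in> lin D H" and c: "c \<in> carrier C" and d: "d \<in> carrier D"
  shows "conv (C \<otimes>\<^sub>c D) H (cmp (C \<otimes>\<^sub>c D) g (p2 C D)) (cmp (C \<otimes>\<^sub>c D) f (p1 C D)) (pt C D c d)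
    = g d \<otimes> f c"
proof -
  have m: "md C" "md D" using C D by auto
  have b: "(\<lambda>a b. g b \<otimes> f a) \<in> bil C D H"
    by (rule bil_flip[OF bil_comp[OF mu g f]])
  have b': "(\<lambda>a b. g (p2 C D b) \<otimes> f (p1 C D a)) \<in> bil (C \<otimes>\<^sub>c D) (C \<otimes>\<^sub>c D) H"
    by (rule bil_flip[OF bil_comp[OF mu lin_comp[OF g Hom_lin[OF proj_Hom(2)[OF C D]]]
      lin_comp[OF f Hom_lin[OF proj_Hom(1)[OF C D]]]]])
  have t: "pt C D c d \<in> carrier (C \<otimes>\<^sub>c D)" using m c d by simp
  have "conv (C \<otimes>\<^sub>c D) H (cmp (C \<otimes>\<^sub>c D) g (p2 C D)) (cmp (C \<otimes>\<^sub>c D) f (p1 C D)) (pt C D c d)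
    = sw (C \<otimes>\<^sub>c D) H (\<lambda>a b. g (p2 C D a) \<otimes> f (p1 C D b)) (pt C D c d)"
    using m c d by (simp add: conv_apply) (intro sw_cong, simp add: compose_def)
  also have "\<dots> = sw (C \<otimes>\<^sub>c D) H (\<lambda>a b. g (p2 C D b) \<otimes> f (p1 C D a)) (pt C D c d)"
    using sw_comm[OF coalg_tensor[OF C D] H b' t] by simp
  also have "\<dots> = g d \<otimes> f c"
    using H m c d b by (subst sw_proj[OF C D _ b]) (auto simp: tensor_lift_pure)
  finally show ?thesis .
qed

lemma pairing_pure_flip:
  assumes C: "coalg C" and D: "coalg D" and A: "md A" and B: "md B" and f: "f \<in> lin C A" and g: "g \<in> lin D B"
    and c: "c \<in> carrier C" and d: "d \<in> carrier D"
  shows "pair (C \<otimes>\<^sub>c D) B A (cmp (C \<otimes>\<^sub>c D) g (p2 C D)) (cmp (C \<otimes>\<^sub>c D) f (p1 C D)) (pt C D c d)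
    = pt B A (g d) (f c)"
proof -
  have m: "md C" "md D" using C D by auto
  have b: "(\<lambda>a b. pt B A (g b) (f a)) \<in> bil C D (T B A)"
    by (rule bil_flip[OF bil_comp[OF pt_bil[OF B A] g f]])
  have b': "(\<lambda>a b. pt B A (g (p2 C D b)) (f (p1 C D a))) \<in> bil (C \<otimes>\<^sub>c D) (C \<otimes>\<^sub>c D) (T B A)"
    by (rule bil_flip[OF bil_comp[OF pt_bil[OF B A] lin_comp[OF g Hom_lin[OF proj_Hom(2)[OF C D]]]
      lin_comp[OF f Hom_lin[OF proj_Hom(1)[OF C D]]]]])
  have t: "pt C D c d \<in> carrier (C \<otimes>\<^sub>c D)" using m c d by simp
  have "pair (C \<otimes>\<^sub>c D) B A (cmp (C \<otimes>\<^sub>c D) g (p2 C D)) (cmp (C \<otimes>\<^sub>c D) f (p1 C D)) (pt C D c d)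
    = sw (C \<otimes>\<^sub>c D) (T B A) (\<lambda>a b. pt B A (g (p2 C D a)) (f (p1 C D b))) (pt C D c d)"
    using m c d by (simp add: pairing_apply) (intro sw_cong, simp add: compose_def)
  also have "\<dots> = sw (C \<otimes>\<^sub>c D) (T B A) (\<lambda>a b. pt B A (g (p2 C D b)) (f (p1 C D a))) (pt C D c d)"
    using sw_comm[OF coalg_tensor[OF C D] _ b' t] A B by simp
  also have "\<dots> = pt B A (g d) (f c)"
    using A B m c d b by (subst sw_proj[OF C D _ b]) (auto simp: tensor_lift_pure)
  finally show ?thesis .
qed

end

section \<open>The Hopf structure on \<open>A^Q\<close>\<close>

context exponential_data
begin

abbreviation XH where "XH \<equiv> exp_hopf K A Q X ev"

lemma XH_simps [simp]:
  "carrier XH = carrier X" "zero XH = zero X" "add XH = add X" "smult XH = smult X"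
  "comult XH = comult X" "counit XH = counit X"
  by (simp_all add: exp_hopf_def Let_def)

lemma XH_same: "same_coalgebra XH X"
  by (simp add: same_coalgebra_def same_module_def)

lemma XH_same_module: "same_module XH X"
  by (simp add: same_module_def)

lemmas XH_norm [simp] = same_coalgebra_simps[OF XH_same]

lemma XH_coalg [simp]: "coalg XH"
  by (rule same_coalgebra_coalg[OF XH_same cX])

lemma XH_module_norm [simp]:
  "lin V XH = lin V X" "lin XH V = lin X V"
  "T V XH = T V X" "T XH V = T X V"
  "pt V XH = pt V X" "pt XH V = pt X V"
  "tl V W XH = tl V W X"
  "tl V XH U = tl V X U"
  "tl XH V U = tl X V U"
  by (rule same_lin same_tensor same_tl; rule same_refl XH_same_module)+

lemma XH_sw_norm [simp]: "sw C XH = sw C X"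
  by (simp add: sweedler_def fun_eq_iff)

lemma XH_bil_norm [simp]:
  "bil V W XH = bil V W X" "bil XH W U = bil X W U" "bil V XH U = bil V X U"
  by (simp_all add: bilinear_maps_def)

lemma XH_md [simp]: "md XH"
  using XH_coalg by auto

lemma preA [simp]: "pre_hopf A" and preQ [simp]: "pre_hopf Q"
  using A Q by auto

abbreviation mult_curried where
  "mult_curried \<equiv> exp_curry K Q X ev (X \<otimes>\<^sub>c X) (\<lambda>t c. tl X X A
     (\<lambda>x y. sw Q A (\<lambda>c1 c2. ev (pt X Q x c1) \<otimes>\<^bsub>A\<^esub> ev (pt X Q y c2)) c) t)"

lemma XH_mult: "x \<otimes>\<^bsub>XH\<^esub> y = mult_curried (pt X X x y)"
  by (simp add: exp_hopf_def Let_def)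

lemma multA_bil: "mult A \<in> bil A A A"
  by (rule hopf_mult_bil[OF A])

lemma multQ_bil: "mult Q \<in> bil Q Q Q"
  by (rule hopf_mult_bil[OF Q])

text \<open>The product of \<open>A^Q\<close> is specified by a formula for its transpose on
  elements. \<open>?F\<close> writes this transpose as a convolution of two evaluations at the
  generic point, hence as a coalgebra map; \<open>Ff\<close> matches the two descriptions, and
  naturality in \<open>C\<close> gives the pointwise rule.\<close>

lemma mult_curried:
  shows mult_curried_Hom: "mult_curried \<in> Hom (X \<otimes>\<^sub>c X) X"
    and mult_curried_at: "coalg C \<Longrightarrow> x \<in> Hom C X \<Longrightarrow> y \<in> Hom C X \<Longrightarrow> c \<in> Hom C Q \<Longrightarrow>
      at C (cmp C mult_curried (pair C X X x y)) c = conv C A (at C x c) (at C y c)"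
proof -
  let ?XX = "X \<otimes>\<^sub>c X"
  let ?E = "?XX \<otimes>\<^sub>c Q"
  let ?P = "p1 ?XX Q"
  let ?c = "\<lambda>f. cmp ?E f ?P"
  have XX: "coalg ?XX" "small ?XX" by auto
  have E: "coalg ?E" by auto
  have P: "?P \<in> Hom ?E ?XX" "p2 ?XX Q \<in> Hom ?E Q" by auto
  have pX: "p1 X X \<in> Hom ?XX X" "p2 X X \<in> Hom ?XX X" by auto
  have cp: "?c (p1 X X) \<in> Hom ?E X" "?c (p2 X X) \<in> Hom ?E X"
    using P pX by (auto intro!: compose_Hom[where D = ?XX])
  let ?u = "at ?E (?c (p1 X X)) (p2 ?XX Q)" and ?v = "at ?E (?c (p2 X X)) (p2 ?XX Q)"
  have uv: "?u \<in> Hom ?E A" "?v \<in> Hom ?E A" using cp P by auto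
  let ?F = "conv ?E A ?u ?v"
  have F: "?F \<in> Hom ?E A" using uv by auto
  have Ff: "?F (pt ?XX Q t c) = tl X X A (\<lambda>x y. sw Q A (\<lambda>c1 c2. ev (pt X Q x c1) \<otimes>\<^bsub>A\<^esub> ev (pt X Q y c2)) c) t"
    if t: "t \<in> carrier ?XX" and c: "c \<in> carrier Q" for t c
  proof -
    have te: "pt ?XX Q t c \<in> carrier ?E" using t c by simp
    have b: "(\<lambda>a b. ?u a \<otimes>\<^bsub>A\<^esub> ?v b) \<in> bil (T ?XX Q) (T ?XX Q) A"
      using bil_comp[OF multA_bil Hom_lin[OF uv(1)] Hom_lin[OF uv(2)]] by simp
    have bi: "(\<lambda>c1 c2. ev (pt X Q x c1) \<otimes>\<^bsub>A\<^esub> ev (pt X Q y c2)) \<in> bil Q Q A" if "x \<in> carrier X" "y \<in> carrier X" for x y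
      using that by (intro bil_comp[OF multA_bil] bilD(2)[OF ev_bil])
    have bo: "(\<lambda>x y. sw Q A (\<lambda>c1 c2. ev (pt X Q x c1) \<otimes>\<^bsub>A\<^esub> ev (pt X Q y c2)) c) \<in> bil X X A"
    proof (rule bilI)
      show "(\<lambda>x. sw Q A (\<lambda>c1 c2. ev (pt X Q x c1) \<otimes>\<^bsub>A\<^esub> ev (pt X Q y c2)) c) \<in> lin X A" if "y \<in> carrier X" for y
        using that c bi bil_closed[OF ev_bil]
        by (intro lin_sw_param lin_comp[OF bilD(1)[OF multA_bil] bilD(1)[OF ev_bil]]) auto
      show "(\<lambda>y. sw Q A (\<lambda>c1 c2. ev (pt X Q x c1) \<otimes>\<^bsub>A\<^esub> ev (pt X Q y c2)) c) \<in> lin X A" if "x \<in> carrier X" for x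
        using that c bi bil_closed[OF ev_bil]
        by (intro lin_sw_param lin_comp[OF bilD(2)[OF multA_bil] bilD(1)[OF ev_bil]]) auto
    qed
    have "?F (pt ?XX Q t c) = sw ?E A (\<lambda>a b. ?u a \<otimes>\<^bsub>A\<^esub> ?v b) (pt ?XX Q t c)"
      by (rule conv_apply[OF te])
    also have "\<dots> = sw2 ?XX Q A (\<lambda>s1 d1 s2 d2. ?u (pt ?XX Q s1 d1) \<otimes>\<^bsub>A\<^esub> ?v (pt ?XX Q s2 d2)) t c"
      by (rule sw_tensor_pure[OF XX(1) cQ mA b t c])
    also have "\<dots> = sw2 ?XX Q A (\<lambda>s1 d1 s2 d2. ev (pt X Q (p1 X X s1) d1) \<otimes>\<^bsub>A\<^esub> ev (pt X Q (p2 X X s2) d2)) t c"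
      by (intro sw2_cong) (simp only: at_pure[OF XX(1) pX(1)] at_pure[OF XX(1) pX(2)])
    also have "\<dots> = tl X X A (\<lambda>x y. sw Q A (\<lambda>c1 c2. ev (pt X Q x c1) \<otimes>\<^bsub>A\<^esub> ev (pt X Q y c2)) c) t"
      using t by (intro sw_proj[OF cX cX mA bo]) simp
    finally show ?thesis .
  qed
  have "\<forall>t \<in> carrier ?XX. \<forall>c \<in> carrier Q. ?F (pt ?XX Q t c) =
      tl X X A (\<lambda>x y. sw Q A (\<lambda>c1 c2. ev (pt X Q x c1) \<otimes>\<^bsub>A\<^esub> ev (pt X Q y c2)) c) t"
    using Ff by blast
  note ec = exp_curry_props[OF XX F this]
  show "mult_curried \<in> Hom ?XX X" by (rule ec(1))
  show "at C (cmp C mult_curried (pair C X X x y)) c = conv C A (at C x c) (at C y c)"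
    if C: "coalg C" and x: "x \<in> Hom C X" and y: "y \<in> Hom C X" and c: "c \<in> Hom C Q"
  proof -
    let ?r = "pair C X X x y"
    let ?k = "pair C ?XX Q ?r c"
    have r: "?r \<in> Hom C ?XX" using C x y by auto
    have k: "?k \<in> Hom C ?E" using C XX r c by auto
    have "at C (cmp C mult_curried ?r) c = cmp C ?F ?k"
      by (rule ec(3)[OF C r c])
    also have "\<dots> = conv C A (at C x c) (at C y c)"
      using conv_compose[OF preA E uv C k] at_compose[OF E C cp(1) P(2) k] at_compose[OF E C cp(2) P(2) k]
        proj_pairing[OF C XX(1) cQ r c] proj_pairing[OF C cX cX x y]
      by (simp add: compose_compose[OF k])
    finally show ?thesis .
  qed
qed

abbreviation one_curried where
  "one_curried \<equiv> exp_curry K Q X ev (ground_coalgebra K) (\<lambda>a c. a \<odot>\<^bsub>A\<^esub> (counit Q c \<odot>\<^bsub>A\<^esub> \<one>\<^bsub>A\<^esub>))"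

lemma XH_one: "\<one>\<^bsub>XH\<^esub> = one_curried \<one>\<^bsub>K\<^esub>"
  by (simp add: exp_hopf_def Let_def)

text \<open>\<open>K\<close> embeds into \<open>A\<close> by scalar multiples of the unit, with the
  counit as left inverse, so the smallness of \<open>A\<close> bounds the ground field as
  well.\<close>

lemma small_ground [simp]: "small (ground_coalgebra K)"
proof -
  interpret A: module K A by simp
  interpret HA: cocomm_hopf_algebra K A by (rule A)
  have oneA: "\<one>\<^bsub>A\<^esub> \<in> carrier A" by (rule pre_hopfD(3)[OF preA])
  have "counit A (a \<odot>\<^bsub>A\<^esub> \<one>\<^bsub>A\<^esub>) = a" if "a \<in> carrier K" for a
    using that oneA pre_hopfD(7)[OF preA] by (simp add: lin_smult[OF counit_lin[OF cA]])
  then have "inj_on (\<lambda>a. a \<odot>\<^bsub>A\<^esub> \<one>\<^bsub>A\<^esub>) (carrier K)" by (rule inj_on_inverseI)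
  then have "carrier K \<lesssim> carrier A" using oneA by (auto simp: lepoll_def)
  then show ?thesis using small_A by (simp add: small_for_def lepoll_trans)
qed

lemma one_curried:
  shows one_curried_Hom: "one_curried \<in> Hom (ground_coalgebra K) X"
    and one_at: "c \<in> carrier Q \<Longrightarrow> ev (pt X Q \<one>\<^bsub>XH\<^esub> c) = counit Q c \<odot>\<^bsub>A\<^esub> \<one>\<^bsub>A\<^esub>"
proof -
  interpret A: module K A by simp
  let ?g = "ground_coalgebra K"
  have oneA: "\<one>\<^bsub>A\<^esub> \<in> carrier A" by (rule pre_hopfD(3)[OF preA])
  have F: "conv_one (?g \<otimes>\<^sub>c Q) A \<in> Hom (?g \<otimes>\<^sub>c Q) A" by auto
  have Ff: "conv_one (?g \<otimes>\<^sub>c Q) A (pt ?g Q a c) = a \<odot>\<^bsub>A\<^esub> (counit Q c \<odot>\<^bsub>A\<^esub> \<one>\<^bsub>A\<^esub>)"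
    if "a \<in> carrier ?g" "c \<in> carrier Q" for a c
    using that oneA tensor_counit_pure[of ?g Q a c]
    by (simp add: conv_one_def A.smult_assoc1)
  have "\<forall>a \<in> carrier ?g. \<forall>c \<in> carrier Q. conv_one (?g \<otimes>\<^sub>c Q) A (pt ?g Q a c) = a \<odot>\<^bsub>A\<^esub> (counit Q c \<odot>\<^bsub>A\<^esub> \<one>\<^bsub>A\<^esub>)"
    using Ff by blast
  note ec = exp_curry_props[OF coalg_ground small_ground F this]
  show "one_curried \<in> Hom ?g X" by (rule ec(1))
  show "ev (pt X Q \<one>\<^bsub>XH\<^esub> c) = counit Q c \<odot>\<^bsub>A\<^esub> \<one>\<^bsub>A\<^esub>" if "c \<in> carrier Q"
    using ec(2)[of "\<one>\<^bsub>K\<^esub>" c] that oneA by (simp add: XH_one A.smult_assoc1[symmetric])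
qed

abbreviation antipode_curried where
  "antipode_curried \<equiv> exp_curry K Q X ev X (\<lambda>x c. antipode A (ev (pt X Q x c)))"

lemma XH_antipode: "antipode XH = antipode_curried"
  by (simp add: exp_hopf_def Let_def)

lemma antipode_curried:
  shows antipode_curried_Hom: "antipode_curried \<in> Hom X X"
    and at_antipode: "\<And>C x c. coalg C \<Longrightarrow> x \<in> Hom C X \<Longrightarrow> c \<in> Hom C Q \<Longrightarrow>
      at C (cmp C (antipode XH) x) c = cmp C (antipode A) (at C x c)"
proof -
  let ?F = "cmp (X \<otimes>\<^sub>c Q) (antipode A) (restrict ev (carrier (X \<otimes>\<^sub>c Q)))"
  have evH: "restrict ev (carrier (X \<otimes>\<^sub>c Q)) \<in> Hom (X \<otimes>\<^sub>c Q) A" by (rule restrict_Hom) (auto intro: ev_chom)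
  have F: "?F \<in> Hom (X \<otimes>\<^sub>c Q) A" using evH by auto
  have Ff: "?F (pt X Q x c) = antipode A (ev (pt X Q x c))" if "x \<in> carrier X" "c \<in> carrier Q" for x c
    using that by (simp add: compose_def)
  have "\<forall>x \<in> carrier X. \<forall>c \<in> carrier Q. ?F (pt X Q x c) = antipode A (ev (pt X Q x c))"
    using Ff by blast
  note ec = exp_curry_props[OF cX small_objects(3) F this]
  show "antipode_curried \<in> Hom X X" by (rule ec(1))
  fix C :: "('k, 'cc, 'dd) coalgebra_scheme" and x c
  assume C: "coalg C" "x \<in> Hom C X" "c \<in> Hom C Q"
  have pc: "pair C X Q x c e \<in> carrier (T X Q)" if "e \<in> carrier C" for e
    using Hom_closed[OF pairing_Hom[OF C(1) cX cQ C(2,3)] that] by simp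
  have "at C (cmp C (antipode XH) x) c = cmp C ?F (pair C X Q x c)"
    unfolding XH_antipode by (rule ec(3)[OF C])
  also have "\<dots> = cmp C (antipode A) (at C x c)"
    using pc by (auto simp: compose_def at_def fun_eq_iff)
  finally show "at C (cmp C (antipode XH) x) c = cmp C (antipode A) (at C x c)" .
qed

lemma preXH [simp]: "pre_hopf XH"
proof (rule pre_hopfI)
  show "mult_curried \<in> Hom (XH \<otimes>\<^sub>c XH) XH" using mult_curried_Hom by simp
  have "group_like X \<one>\<^bsub>XH\<^esub>"
    unfolding XH_one by (rule group_like_image[OF _ mX Hom_chom[OF one_curried_Hom] group_like_ground]) auto
  then show "group_like XH \<one>\<^bsub>XH\<^esub>" by (simp add: group_like_def)
  show "antipode XH \<in> chom XH XH" using Hom_chom[OF antipode_curried_Hom] by (simp add: XH_antipode)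
qed (simp_all add: XH_mult)

lemma conv_XH_Hom [simp, intro]: "coalg C \<Longrightarrow> x \<in> Hom C X \<Longrightarrow> y \<in> Hom C X \<Longrightarrow> conv C XH x y \<in> Hom C X"
  using conv_Hom[OF preXH, of C x y] by simp

lemma conv_one_XH_Hom [simp, intro]: "coalg C \<Longrightarrow> conv_one C XH \<in> Hom C X"
  using conv_one_Hom[OF preXH, of C] by simp

lemma antipode_XH_Hom [simp, intro]: "coalg C \<Longrightarrow> x \<in> Hom C X \<Longrightarrow> cmp C (antipode XH) x \<in> Hom C X"
  using antipode_Hom[OF preXH, of C x] by simp

lemma at_conv:
  assumes C: "coalg C" and x: "x \<in> Hom C X" and y: "y \<in> Hom C X" and c: "c \<in> Hom C Q"
  shows "at C (conv C XH x y) c = conv C A (at C x c) (at C y c)"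
proof -
  have "conv C XH x y = cmp C mult_curried (pair C X X x y)"
  proof (rule extensionalityI[where A = "carrier C"])
    fix e assume e: "e \<in> carrier C"
    have "mult_curried (sw C (T X X) (\<lambda>a b. pt X X (x a) (y b)) e) = sw C X (\<lambda>a b. mult_curried (pt X X (x a) (y b))) e"
      using C e Hom_lin[OF mult_curried_Hom] Hom_lin[OF x] Hom_lin[OF y] by (intro sw_push pairing_bil) auto
    then show "conv C XH x y e = cmp C mult_curried (pair C X X x y) e"
      using e by (simp add: conv_apply compose_def pairing_apply XH_mult)
  qed (auto simp: conv_def compose_def)
  then show ?thesis using mult_curried_at[OF assms] by simp
qed

lemma at_conv_one:
  assumes C: "coalg C" and c: "c \<in> Hom C Q"
  shows "at C (conv_one C XH) c = conv_one C A"
proof (rule Hom_eqI)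
  have oneX: "\<one>\<^bsub>XH\<^esub> \<in> carrier X" using pre_hopfD(3)[OF preXH] by simp
  show "at C (conv_one C XH) c \<in> Hom C A" using C c by auto
  show "conv_one C A \<in> Hom C A" using C by auto
  fix e assume e: "e \<in> carrier C"
  note ce = Hom_closed[OF c]
  have "at C (conv_one C XH) c e = sw C A (\<lambda>a b. counit C a \<odot>\<^bsub>A\<^esub> ev (pt X Q \<one>\<^bsub>XH\<^esub> (c b))) e"
    unfolding at_apply[OF C conv_one_XH_Hom[OF C] c e] using C oneX ce
    by (intro sw_cong) (simp add: conv_one_def lin_smult[OF bilD(1)[OF ev_bil]])
  also have "\<dots> = ev (pt X Q \<one>\<^bsub>XH\<^esub> (c e))"
    using C e oneX by (intro sw_counit_left lin_comp[OF bilD(2)[OF ev_bil] Hom_lin[OF c]]) auto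
  also have "\<dots> = conv_one C A e"
    using e ce chom_counit[OF Hom_chom[OF c] e] by (simp add: one_at conv_one_def)
  finally show "at C (conv_one C XH) c e = conv_one C A e" .
qed

lemma conv_XH_compose:
  assumes "coalg C" "x \<in> Hom C X" "y \<in> Hom C X" "coalg B" "k \<in> Hom B C"
  shows "cmp B (conv C XH x y) k = conv B XH (cmp B x k) (cmp B y k)"
  using conv_compose[OF preXH, of C x y B k] assms by simp

text \<open>At the generic point each law becomes the same law in the convolution group of points of
  \<open>A\<close>, because evaluation at a fixed point of \<open>Q\<close> is multiplicative;
  \<open>X_eqI\<close> carries it back.\<close>

lemma XH_group_laws:
  assumes C: "coalg C" and s: "small C" and f: "f \<in> Hom C X" and g: "g \<in> Hom C X" and h: "h \<in> Hom C X"
  shows "conv C XH (conv C XH f g) h = conv C XH f (conv C XH g h)"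
    and "conv C XH (conv_one C XH) f = f" "conv C XH f (conv_one C XH) = f"
    and "conv C XH (cmp C (antipode XH) f) f = conv_one C XH"
    and "conv C XH f (cmp C (antipode XH) f) = conv_one C XH"
proof -
  let ?D = "C \<otimes>\<^sub>c Q"
  let ?k = "\<lambda>f. cmp ?D f (p1 C Q)"
  have D: "coalg ?D" using C by auto
  have k: "p1 C Q \<in> Hom ?D C" and q: "p2 C Q \<in> Hom ?D Q" using C by auto
  have kH: "?k f \<in> Hom ?D X" if "f \<in> Hom C X" for f using that C D k by (intro compose_Hom[where D = C]) auto
  interpret GA: group "conv_group ?D A" by (rule group_conv[OF D A])
  note inv = group_conv(2)[OF D A]
  have kS: "?k (cmp C (antipode XH) f) = cmp ?D (antipode XH) (?k f)"
    by (rule compose_compose[OF k])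
  note at = at_conv[OF D] at_conv_one[OF D q] conv_XH_compose[OF C _ _ D k] conv_one_compose[OF k] kS at_antipode[OF D] kH
  note aH = at_Hom[OF D kH q]
  show "conv C XH (conv C XH f g) h = conv C XH f (conv C XH g h)"
    using GA.m_assoc[of "at ?D (?k f) (p2 C Q)" "at ?D (?k g) (p2 C Q)" "at ?D (?k h) (p2 C Q)"]
    by (intro X_eqI[OF C s]) (simp_all add: at C D f g h q)
  show "conv C XH (conv_one C XH) f = f"
    using GA.l_one[of "at ?D (?k f) (p2 C Q)"]
    by (intro X_eqI[OF C s]) (simp_all add: at C D f q)
  show "conv C XH f (conv_one C XH) = f"
    using GA.r_one[of "at ?D (?k f) (p2 C Q)"]
    by (intro X_eqI[OF C s]) (simp_all add: at C D f q)
  show "conv C XH (cmp C (antipode XH) f) f = conv_one C XH"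
    using GA.l_inv[of "at ?D (?k f) (p2 C Q)"]
    by (intro X_eqI[OF C s]) (simp_all add: at C D f q inv)
  show "conv C XH f (cmp C (antipode XH) f) = conv_one C XH"
    using GA.r_inv[of "at ?D (?k f) (p2 C Q)"]
    by (intro X_eqI[OF C s]) (simp_all add: at C D f q inv)
qed

lemma XH_hopf: "hopf XH"
proof (rule hopf_of_points[OF preXH])
  let ?C = "(XH \<otimes>\<^sub>c XH) \<otimes>\<^sub>c XH"
  show "conv ?C XH (conv ?C XH f g) h = conv ?C XH f (conv ?C XH g h)"
    if "f \<in> Hom ?C XH" "g \<in> Hom ?C XH" "h \<in> Hom ?C XH" for f g h
    using XH_group_laws(1)[of "(X \<otimes>\<^sub>c X) \<otimes>\<^sub>c X" f g h] that by simp
  have eq: "conv XH XH = conv X XH" "conv_one XH XH = conv_one X XH"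
    by (auto simp: conv_def conv_one_def sweedler_def fun_eq_iff)
  fix i assume "i \<in> Hom XH XH"
  then have i: "i \<in> Hom X X" by simp
  note L = XH_group_laws[OF cX small_objects(3) i i i]
  show "conv XH XH (conv_one XH XH) i = i" "conv XH XH i (conv_one XH XH) = i"
    "conv XH XH (cmp XH (antipode XH) i) i = conv_one XH XH"
    "conv XH XH i (cmp XH (antipode XH) i) = conv_one XH XH"
    using L by (simp_all add: eq)
qed

section \<open>The action of \<open>Q\<close> on \<open>A^Q\<close>\<close>

abbreviation action_curried where
  "action_curried \<equiv> exp_curry K Q X ev (Q \<otimes>\<^sub>c X)
     (\<lambda>t r. tl Q X A (\<lambda>q x. ev (pt X Q x (r \<otimes>\<^bsub>Q\<^esub> q))) t)"

definition act where
  "act C q x = cmp C action_curried (pair C Q X q x)"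

lemma exp_action_eq: "exp_action K A Q X ev q x = action_curried (pt Q X q x)"
  by (simp add: exp_action_def)

text \<open>The transpose of the action is the evaluation of \<open>x\<close> at the point
  \<open>c q\<close>. Writing it through points makes it a coalgebra map and gives the rule over
  every \<open>C\<close> by naturality.\<close>

lemma action_curried:
  shows action_curried_Hom: "action_curried \<in> Hom (Q \<otimes>\<^sub>c X) X"
    and at_act: "\<And>C q x c. coalg C \<Longrightarrow> q \<in> Hom C Q \<Longrightarrow> x \<in> Hom C X \<Longrightarrow> c \<in> Hom C Q \<Longrightarrow>
      at C (act C q x) c = at C x (conv C Q c q)"
proof -
  let ?R = "Q \<otimes>\<^sub>c X"
  let ?E = "?R \<otimes>\<^sub>c Q"
  let ?P = "p1 ?R Q"
  let ?c = "\<lambda>f. cmp ?E f ?P"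
  have R: "coalg ?R" "small ?R" and E: "coalg ?E" by auto
  have P: "?P \<in> Hom ?E ?R" "p2 ?R Q \<in> Hom ?E Q" by auto
  have pR: "p1 Q X \<in> Hom ?R Q" "p2 Q X \<in> Hom ?R X" by auto
  have cp: "?c (p1 Q X) \<in> Hom ?E Q" "?c (p2 Q X) \<in> Hom ?E X"
    using P pR by (auto intro!: compose_Hom[where D = ?R])
  let ?cc = "conv ?E Q (p2 ?R Q) (?c (p1 Q X))"
  have cc: "?cc \<in> Hom ?E Q" using cp P by auto
  let ?F = "at ?E (?c (p2 Q X)) ?cc"
  have F: "?F \<in> Hom ?E A" using cp cc by auto
  have pl: "p1 Q X \<in> lin (T Q X) Q" "p2 Q X \<in> lin (T Q X) X" and ccl: "?cc \<in> lin (T ?R Q) Q"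
    using Hom_lin[OF pR(1)] Hom_lin[OF pR(2)] Hom_lin[OF cc] by simp_all
  have Ff: "?F (pt ?R Q t r) = tl Q X A (\<lambda>q x. ev (pt X Q x (r \<otimes>\<^bsub>Q\<^esub> q))) t"
    if t: "t \<in> carrier ?R" and r: "r \<in> carrier Q" for t r
  proof -
    have tT: "t \<in> carrier (T Q X)" using t by simp
    have te: "pt ?R Q t r \<in> carrier ?E" using t r by simp
    have b1: "(\<lambda>s e. ev (pt X Q (p2 Q X s) (?cc e))) \<in> bil ?R (T ?R Q) A"
      using bil_comp[OF ev_bil pl(2) ccl] by simp
    have ccp: "?cc (pt ?R Q s r) = r \<otimes>\<^bsub>Q\<^esub> p1 Q X s" if "s \<in> carrier ?R" for s
      using conv_pure_flip[OF R(1) cQ mQ multQ_bil _ lin_id that r, of "p1 Q X"] pl(1)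
        compose_id[OF P(2)] by simp
    have g: "(\<lambda>q x. ev (pt X Q x (r \<otimes>\<^bsub>Q\<^esub> q))) \<in> bil Q X A"
      by (rule bil_flip[OF bil_comp[OF ev_bil lin_id bilD(2)[OF multQ_bil r]]])
    have g': "(\<lambda>a b. ev (pt X Q (p2 Q X b) (r \<otimes>\<^bsub>Q\<^esub> p1 Q X a))) \<in> bil ?R ?R A"
      using bil_comp[OF g pl] by simp
    have "?F (pt ?R Q t r) = sw ?E A (\<lambda>a b. ev (pt X Q (p2 Q X (?P a)) (?cc b))) (pt ?R Q t r)"
      unfolding at_apply[OF E cp(2) cc te] by (intro sw_cong) (simp add: compose_def)
    also have "\<dots> = sw ?R A (\<lambda>s1 s2. ev (pt X Q (p2 Q X s1) (?cc (pt ?R Q s2 r)))) t"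
      by (rule sw_proj_left[OF R(1) cQ mA _ t r]) (use b1 in simp)
    also have "\<dots> = sw ?R A (\<lambda>s1 s2. ev (pt X Q (p2 Q X s1) (r \<otimes>\<^bsub>Q\<^esub> p1 Q X s2))) t"
      by (intro sw_cong) (subst ccp, simp_all)
    \<comment> \<open>So far the first leg supplies \<open>x\<close> and the second supplies
      \<open>q\<close>; cocommutativity puts them in the order of the factors of
      \<open>Q \<otimes> X\<close>.\<close>
    also have "\<dots> = sw ?R A (\<lambda>s1 s2. ev (pt X Q (p2 Q X s2) (r \<otimes>\<^bsub>Q\<^esub> p1 Q X s1))) t"
      by (rule sw_comm[OF R(1) mA g' t])
    also have "\<dots> = tl Q X A (\<lambda>q x. ev (pt X Q x (r \<otimes>\<^bsub>Q\<^esub> q))) t"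
      by (rule sw_proj[OF cQ cX mA g tT])
    finally show ?thesis .
  qed
  have "\<forall>t \<in> carrier ?R. \<forall>r \<in> carrier Q. ?F (pt ?R Q t r) = tl Q X A (\<lambda>q x. ev (pt X Q x (r \<otimes>\<^bsub>Q\<^esub> q))) t"
    using Ff by blast
  note ec = exp_curry_props[OF R F this]
  show "action_curried \<in> Hom ?R X" by (rule ec(1))
  fix C :: "('k, 'cc, 'dd) coalgebra_scheme" and q x c
  assume C: "coalg C" and q: "q \<in> Hom C Q" and x: "x \<in> Hom C X" and c: "c \<in> Hom C Q"
  let ?r = "pair C Q X q x"
  let ?k = "pair C ?R Q ?r c"
  have r: "?r \<in> Hom C ?R" using C x q by auto
  have k: "?k \<in> Hom C ?E" using C R r c by auto
  have "at C (act C q x) c = cmp C ?F ?k"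
    unfolding act_def by (rule ec(3)[OF C r c])
  also have "\<dots> = at C x (conv C Q c q)"
    using conv_compose[OF preQ E P(2) cp(1) C k] at_compose[OF E C cp(2) cc k]
      proj_pairing[OF C R(1) cQ r c] proj_pairing[OF C cQ cX q x]
    by (simp add: compose_compose[OF k])
  finally show "at C (act C q x) c = at C x (conv C Q c q)" .
qed

lemma act_Hom [simp, intro]: "coalg C \<Longrightarrow> q \<in> Hom C Q \<Longrightarrow> x \<in> Hom C X \<Longrightarrow> act C q x \<in> Hom C X"
  unfolding act_def by (rule compose_Hom[OF _ _ _ action_curried_Hom]) auto

lemma act_compose:
  assumes "coalg C" "coalg B" "q \<in> Hom C Q" "x \<in> Hom C X" "k \<in> Hom B C"
  shows "cmp B (act C q x) k = act B (cmp B q k) (cmp B x k)"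
  unfolding act_def using assms by (simp add: compose_compose pairing_compose)

text \<open>At the generic point \<open>c\<close> one has
  \<open>(q \<star> (r \<star> x))@c = (r \<star> x)@(cq) = x@(cqr)\<close>, so right translation of
  the argument is a left action. It acts by automorphisms because products in \<open>A^Q\<close> are
  pointwise.\<close>

lemma act_laws:
  assumes C: "coalg C" and s: "small C" and q: "q \<in> Hom C Q" and r: "r \<in> Hom C Q"
    and x: "x \<in> Hom C X" and y: "y \<in> Hom C X"
  shows "act C q (conv C XH x y) = conv C XH (act C q x) (act C q y)"
    and "act C q (conv_one C XH) = conv_one C XH"
    and "act C q (act C r x) = act C (conv C Q q r) x"
    and "act C (conv_one C Q) x = x"
proof -
  let ?D = "C \<otimes>\<^sub>c Q"
  let ?k = "\<lambda>f. cmp ?D f (p1 C Q)"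
  let ?q = "p2 C Q"
  have D: "coalg ?D" using C by auto
  have k: "p1 C Q \<in> Hom ?D C" and c: "?q \<in> Hom ?D Q" using C by auto
  have kX: "cmp ?D f (p1 C Q) \<in> Hom ?D X" if "f \<in> Hom C X" for f
    using that C D k by (intro compose_Hom[where D = C]) auto
  have kQ: "cmp ?D f (p1 C Q) \<in> Hom ?D Q" if "f \<in> Hom C Q" for f
    using that C D k by (intro compose_Hom[where D = C]) auto
  interpret GQ: group "conv_group ?D Q" by (rule group_conv[OF D Q])
  note r1 = at_act[OF D] at_conv[OF D] at_conv_one[OF D] conv_XH_compose[OF C _ _ D k]
    conv_one_compose[OF k] act_compose[OF C D _ _ k] conv_compose[OF preQ C _ _ D k] kX kQ
  show "act C q (conv C XH x y) = conv C XH (act C q x) (act C q y)"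
    by (intro X_eqI[OF C s]) (simp_all add: r1 C D q x y c)
  show "act C q (conv_one C XH) = conv_one C XH"
    by (intro X_eqI[OF C s]) (simp_all add: r1 C D q c)
  show "act C q (act C r x) = act C (conv C Q q r) x"
    using GQ.m_assoc[of ?q "?k q" "?k r"] by (intro X_eqI[OF C s]) (simp_all add: r1 C D q r x c)
  show "act C (conv_one C Q) x = x"
    using GQ.r_one[of ?q] by (intro X_eqI[OF C s]) (simp_all add: r1 C D x c)
qed

end

section \<open>The wreath product\<close>

context exponential_data
begin

abbreviation adm where "adm \<equiv> admissible K A Q X ev"
abbreviation assoc where "assoc \<equiv> assoc_extension K A Q X ev"
abbreviation Ad where "Ad \<equiv> wreath_Ad K A Q X ev"
abbreviation base where "base \<equiv> wreath_base K Q X"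
abbreviation W where "W \<equiv> wreath_product K A Q X ev"
abbreviation Y where "Y \<equiv> X \<otimes>\<^sub>c Q"

lemma cY [simp]: "coalg Y" and mY [simp]: "md (T X Q)" and small_Y [simp]: "small Y"
  by auto

lemma W_simps [simp]:
  "zero W = zero (T X Q)" "add W = add (T X Q)" "smult W = smult (T X Q)"
  "comult W = comult Y" "counit W = counit Y"
  by (simp_all add: wreath_product_def smash_product_def Let_def)

lemma W_carrier: "carrier W = carrier Y"
  by (simp add: wreath_product_def smash_product_def Let_def)

lemma W_mem [simp]: "t \<in> carrier W \<longleftrightarrow> t \<in> carrier (T X Q)"
  by (simp add: W_carrier)

lemma W_same_module: "same_module W (T X Q)"
  by (simp add: same_module_def W_carrier tensor_coalgebra_simps(1))

lemma W_same: "same_coalgebra W Y"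
  by (simp add: same_coalgebra_def same_module_def W_carrier)

lemmas W_norm [simp] = same_coalgebra_simps[OF W_same]

lemma W_coalg [simp]: "coalg W"
  by (rule same_coalgebra_coalg[OF W_same cY])

lemma W_module_norm [simp]:
  "lin V W = lin V (T X Q)" "lin W V = lin (T X Q) V"
  "T V W = T V (T X Q)" "T W V = T (T X Q) V"
  "pt V W = pt V (T X Q)" "pt W V = pt (T X Q) V"
  by (rule same_lin same_tensor; rule same_refl W_same_module)+

lemma W_sw_norm [simp]: "sw C W = sw C (T X Q)"
  unfolding sweedler_def fun_eq_iff using same_tl[OF same_refl same_refl W_same_module, of K C C] by simp

lemma W_mult: "s \<otimes>\<^bsub>W\<^esub> t = tl X Q (T X Q) (\<lambda>h q. tl X Q (T X Q) (\<lambda>k r.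
    sw Q (T X Q) (\<lambda>q1 q2. pt X Q (h \<otimes>\<^bsub>XH\<^esub> action_curried (pt Q X q1 k)) (q2 \<otimes>\<^bsub>Q\<^esub> r)) q) t) s"
  by (simp add: wreath_product_def smash_product_def Let_def exp_action_eq)

lemma W_one: "\<one>\<^bsub>W\<^esub> = pt X Q \<one>\<^bsub>XH\<^esub> \<one>\<^bsub>Q\<^esub>"
  by (simp add: wreath_product_def smash_product_def Let_def)

lemma W_antipode: "antipode W = tl X Q (T X Q) (\<lambda>h q.
    sw Q (T X Q) (\<lambda>q1 q2. pt X Q (action_curried (pt Q X (antipode Q q1) (antipode XH h))) (antipode Q q2)) q)"
  by (simp add: wreath_product_def smash_product_def Let_def exp_action_eq)

lemma action_bil: "(\<lambda>q x. action_curried (pt Q X q x)) \<in> bil Q X X"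
  using Hom_lin[OF action_curried_Hom] by (intro bil_post[OF pt_bil]) auto

lemma XH_mult_bil: "mult XH \<in> bil X X X"
  using hopf_mult_bil[OF XH_hopf] by simp

lemma XH_one_closed [simp]: "\<one>\<^bsub>XH\<^esub> \<in> carrier X"
  using pre_hopfD(3)[OF preXH] by simp

lemma Q_one_closed [simp]: "\<one>\<^bsub>Q\<^esub> \<in> carrier Q"
  by (rule pre_hopfD(3)[OF preQ])

lemma A_one_closed [simp]: "\<one>\<^bsub>A\<^esub> \<in> carrier A"
  by (rule pre_hopfD(3)[OF preA])

section \<open>Points of the wreath product\<close>

definition wX where
  "wX C w = cmp C (p1 X Q) w"

definition wQ where
  "wQ C w = cmp C (p2 X Q) w"

lemma wXQ_Hom [simp, intro]:
  assumes "coalg C" "w \<in> Hom C Y"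
  shows "wX C w \<in> Hom C X" "wQ C w \<in> Hom C Q"
  unfolding wX_def wQ_def using assms by (auto intro!: compose_Hom[where D = Y])

lemma wXQ_pair [simp]:
  assumes "coalg C" "x \<in> Hom C X" "q \<in> Hom C Q"
  shows "wX C (pair C X Q x q) = x" "wQ C (pair C X Q x q) = q"
  unfolding wX_def wQ_def using assms by (simp_all add: proj_pairing)

lemma wXQ_eqI:
  assumes "coalg C" "w \<in> Hom C Y" "w' \<in> Hom C Y" "wX C w = wX C w'" "wQ C w = wQ C w'"
  shows "w = w'"
  using assms unfolding wX_def wQ_def by (intro Hom_tensor_eqI[of C X Q]) auto

lemma wXQ_compose:
  assumes "k \<in> Hom B C"
  shows "cmp B (wX C w) k = wX B (cmp B w k)"
    "cmp B (wQ C w) k = wQ B (cmp B w k)"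
  unfolding wX_def wQ_def by (rule compose_compose[OF assms])+

text \<open>The semidirect product \<open>(h, q)(k, r) = (h (q \<star> k), q r)\<close> of the two
  generic points of \<open>Y\<close>, a coalgebra map by construction.\<close>

abbreviation W_mult_map where
  "W_mult_map \<equiv> (let E = Y \<otimes>\<^sub>c Y; s = p1 Y Y; t = p2 Y Y in
     pair E X Q (conv E XH (wX E s) (act E (wQ E s) (wX E t))) (conv E Q (wQ E s) (wQ E t)))"

text \<open>The smash product is given by a formula on pure tensors, from which it is not evident
  that multiplication is a coalgebra map. Identifying it with the product of the two generic points
  settles this.\<close>

lemma W_mult_map:
  shows W_mult_map_Hom: "W_mult_map \<in> Hom (Y \<otimes>\<^sub>c Y) Y"
    and W_mult_map_pure: "c \<in> carrier Y \<Longrightarrow> d \<in> carrier Y \<Longrightarrow> W_mult_map (pt Y Y c d) = c \<otimes>\<^bsub>W\<^esub> d"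
proof -
  let ?E = "Y \<otimes>\<^sub>c Y"
  let ?s = "p1 Y Y" and ?t = "p2 Y Y"
  let ?T = "T X Q"
  have E: "coalg ?E" by auto
  have st: "?s \<in> Hom ?E Y" "?t \<in> Hom ?E Y" by auto
  let ?h = "wX ?E ?s" and ?q = "wQ ?E ?s" and ?k = "wX ?E ?t" and ?r = "wQ ?E ?t"
  have hqkr: "?h \<in> Hom ?E X" "?q \<in> Hom ?E Q" "?k \<in> Hom ?E X" "?r \<in> Hom ?E Q"
    using E st by auto
  let ?f = "conv ?E XH ?h (act ?E ?q ?k)" and ?g = "conv ?E Q ?q ?r"
  have aH: "act ?E ?q ?k \<in> Hom ?E X" using hqkr E by auto
  have f: "?f \<in> Hom ?E X" and g: "?g \<in> Hom ?E Q" using hqkr E aH by auto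
  show M: "W_mult_map \<in> Hom ?E Y" unfolding Let_def using f g E by auto
  have pl: "p1 X Q \<in> lin ?T X" "p2 X Q \<in> lin ?T Q"
    using Hom_lin[OF proj_Hom(1)[OF cX cQ]] Hom_lin[OF proj_Hom(2)[OF cX cQ]] by simp_all
  have al: "act ?E ?q ?k \<in> lin (T ?T ?T) X" and fl: "?f \<in> lin (T ?T ?T) X" and gl: "?g \<in> lin (T ?T ?T) Q"
    using Hom_lin[OF aH] Hom_lin[OF f] Hom_lin[OF g] by simp_all
  \<comment> \<open>\<open>\<gamma> x q y\<close> stands for \<open>x (q \<star> y)\<close>, and
    \<open>\<phi>\<close> extends it from a pure tensor of \<open>x\<close> and \<open>q\<close> to
    arbitrary tensors.\<close>
  define \<gamma> where "\<gamma> x q y = x \<otimes>\<^bsub>XH\<^esub> action_curried (pt Q X q y)" for x q y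
  have gb: "(\<lambda>x q. \<gamma> x q y) \<in> bil X Q X" if "y \<in> carrier X" for y
    unfolding \<gamma>_def using that by (intro bil_comp[OF XH_mult_bil lin_id] bilD(1)[OF action_bil])
  have gl3: "(\<lambda>y. \<gamma> x q y) \<in> lin X X" if "x \<in> carrier X" "q \<in> carrier Q" for x q
    unfolding \<gamma>_def using that by (intro lin_comp[OF bilD(2)[OF XH_mult_bil] bilD(2)[OF action_bil]])
  define \<phi> where "\<phi> c y = tl X Q X (\<lambda>x q. \<gamma> x q y) c" for c y
  have \<phi>b: "\<phi> \<in> bil ?T X X"
  proof (rule bilI)
    show "(\<lambda>c. \<phi> c y) \<in> lin ?T X" if "y \<in> carrier X" for y
      unfolding \<phi>_def by (rule lin_tl[OF mX mQ mX gb[OF that] lin_id])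
    show "(\<lambda>y. \<phi> c y) \<in> lin X X" if "c \<in> carrier ?T" for c
      unfolding \<phi>_def by (rule lin_tl_param[OF mX mQ mX mX gb gl3 that])
  qed
  have \<phi>p: "\<phi> (pt X Q x q) y = \<gamma> x q y" if "x \<in> carrier X" "q \<in> carrier Q" "y \<in> carrier X" for x q y
    unfolding \<phi>_def using that gb by (simp add: tensor_lift_pure)
  have fp: "?f (pt Y Y c d) = \<phi> c (p1 X Q d)" if c: "c \<in> carrier Y" and d: "d \<in> carrier Y" for c d
  proof -
    have te: "pt Y Y c d \<in> carrier ?E" using c d by simp
    have dc: "p1 X Q d \<in> carrier X" using Hom_closed[OF proj_Hom(1)[OF cX cQ] d] .
    have b: "(\<lambda>a e. p1 X Q a \<otimes>\<^bsub>XH\<^esub> act ?E ?q ?k e) \<in> bil Y (T Y Y) X"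
      using bil_comp[OF XH_mult_bil pl(1) al] by simp
    have ap: "act ?E ?q ?k (pt Y Y c d) = action_curried (pt Q X (p2 X Q c) (p1 X Q d))" if "c \<in> carrier Y" for c
      using pairing_pure[OF cY cY mQ mX _ _ that d, of "p2 X Q" "p1 X Q"] pl that d
      by (simp add: act_def compose_def wX_def wQ_def)
    have "?f (pt Y Y c d) = sw ?E X (\<lambda>a e. p1 X Q (?s a) \<otimes>\<^bsub>XH\<^esub> act ?E ?q ?k e) (pt Y Y c d)"
      unfolding conv_apply[OF te] by simp (intro sw_cong, simp add: wX_def compose_def)
    also have "\<dots> = sw Y X (\<lambda>c1 c2. p1 X Q c1 \<otimes>\<^bsub>XH\<^esub> act ?E ?q ?k (pt Y Y c2 d)) c"
      by (rule sw_proj_left[OF cY cY mX b c d])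
    also have "\<dots> = sw Y X (\<lambda>c1 c2. \<gamma> (p1 X Q c1) (p2 X Q c2) (p1 X Q d)) c"
      unfolding \<gamma>_def by (intro sw_cong) (subst ap, simp_all)
    also have "\<dots> = \<phi> c (p1 X Q d)"
      unfolding \<phi>_def using c by (intro sw_proj[OF cX cQ mX gb[OF dc]]) simp
    finally show ?thesis .
  qed
  have gp: "?g (pt Y Y c d) = p2 X Q c \<otimes>\<^bsub>Q\<^esub> p2 X Q d" if "c \<in> carrier Y" "d \<in> carrier Y" for c d
    using conv_pure[OF cY cY mQ multQ_bil _ _ that, of "p2 X Q" "p2 X Q"] pl by (simp add: wQ_def)
  define \<mu> where "\<mu> d q1 q2 x = tl X Q ?T (\<lambda>k r. pt X Q (\<gamma> x q1 k) (q2 \<otimes>\<^bsub>Q\<^esub> r)) d" for d q1 q2 x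
  define \<nu> where "\<nu> d c q = tl X Q ?T (\<lambda>k r. pt X Q (\<phi> c k) (q \<otimes>\<^bsub>Q\<^esub> r)) d" for d c q
  have \<nu>i: "(\<lambda>k r. pt X Q (\<phi> c k) (q \<otimes>\<^bsub>Q\<^esub> r)) \<in> bil X Q ?T" if "c \<in> carrier ?T" "q \<in> carrier Q" for c q
    using that by (intro bil_comp[OF pt_bil] bilD(2)[OF \<phi>b] bilD(2)[OF multQ_bil]) auto
  have \<nu>b: "\<nu> d \<in> bil ?T Q ?T" if d: "d \<in> carrier ?T" for d
  proof (rule bilI)
    show "(\<lambda>c. \<nu> d c q) \<in> lin ?T ?T" if "q \<in> carrier Q" for q
      unfolding \<nu>_def using that d \<nu>i bil_closed[OF multQ_bil]
      by (intro lin_tl_param lin_pt1 bilD(1)[OF \<phi>b]) auto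
    show "(\<lambda>q. \<nu> d c q) \<in> lin Q ?T" if "c \<in> carrier ?T" for c
      unfolding \<nu>_def using that d \<nu>i bil_closed[OF \<phi>b]
      by (intro lin_tl_param lin_pt2 bilD(1)[OF multQ_bil]) auto
  qed
  fix c d assume c: "c \<in> carrier Y" and d: "d \<in> carrier Y"
  have cT: "c \<in> carrier ?T" and dT: "d \<in> carrier ?T" using c d by simp_all
  have te: "pt Y Y c d \<in> carrier ?E" using c d by simp
  have b: "(\<lambda>a e. pt X Q (?f a) (?g e)) \<in> bil (T Y Y) (T Y Y) ?T"
    using bil_comp[OF pt_bil fl gl] by simp
  have \<mu>F: "(\<lambda>q1 q2 k r. pt X Q (\<gamma> x q1 k) (q2 \<otimes>\<^bsub>Q\<^esub> r)) \<in> quad Q Q X Q ?T" if x: "x \<in> carrier X" for x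
    using x bil_closed[OF gb] bil_closed[OF multQ_bil]
    by (intro quadI lin_pt1 lin_pt2 bilD(2)[OF gb] gl3 bilD[OF multQ_bil]) auto
  have \<mu>F2: "(\<lambda>k r. sw Q ?T (\<lambda>q1 q2. pt X Q (\<gamma> x q1 k) (q2 \<otimes>\<^bsub>Q\<^esub> r)) q) \<in> bil X Q ?T"
    if x: "x \<in> carrier X" and q: "q \<in> carrier Q" for x q
  proof -
    have "(\<lambda>q1 q2. pt X Q (\<gamma> x q1 k) (q2 \<otimes>\<^bsub>Q\<^esub> r)) \<in> bil Q Q ?T" if "k \<in> carrier X" "r \<in> carrier Q" for k r
      using that by (intro bilI) (auto intro: quadD[OF \<mu>F[OF x]])
    then show ?thesis
      using q by (intro bilI lin_sw_param) (auto intro: quadD[OF \<mu>F[OF x]])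
  qed
  have \<mu>F1: "(\<lambda>k r. pt X Q (\<gamma> x q1 k) (q2 \<otimes>\<^bsub>Q\<^esub> r)) \<in> bil X Q ?T"
    if "x \<in> carrier X" "q1 \<in> carrier Q" "q2 \<in> carrier Q" for x q1 q2
    using that by (intro bilI) (auto intro: quadD[OF \<mu>F])
  have outer: "(\<lambda>h q. tl X Q ?T (\<lambda>k r. sw Q ?T (\<lambda>q1 q2. pt X Q (\<gamma> h q1 k) (q2 \<otimes>\<^bsub>Q\<^esub> r)) q) d) \<in> bil X Q ?T"
  proof (rule bilI)
    have i1: "(\<lambda>q1 q2. pt X Q (\<gamma> x q1 k) (q2 \<otimes>\<^bsub>Q\<^esub> r)) \<in> bil Q Q ?T"
      if "x \<in> carrier X" "k \<in> carrier X" "r \<in> carrier Q" for x k r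
      using that by (intro bilI) (auto intro: quadD[OF \<mu>F])
    show "(\<lambda>h. tl X Q ?T (\<lambda>k r. sw Q ?T (\<lambda>q1 q2. pt X Q (\<gamma> h q1 k) (q2 \<otimes>\<^bsub>Q\<^esub> r)) q) d) \<in> lin X ?T"
      if q: "q \<in> carrier Q" for q
      using q dT \<mu>F2 i1 bil_closed[OF multQ_bil]
      by (intro lin_tl_param lin_sw_param lin_pt1 bilD(1)[OF gb]) auto
    show "(\<lambda>q. tl X Q ?T (\<lambda>k r. sw Q ?T (\<lambda>q1 q2. pt X Q (\<gamma> h q1 k) (q2 \<otimes>\<^bsub>Q\<^esub> r)) q) d) \<in> lin Q ?T"
      if h: "h \<in> carrier X" for h
      using h dT \<mu>F2 i1 by (intro lin_tl_param lin_sw lin_id) auto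
  qed
  have l1: "(\<lambda>c. sw Y ?T (\<lambda>a e. \<nu> d a (p2 X Q e)) c) \<in> lin ?T ?T"
    using bil_comp[OF \<nu>b[OF dT] lin_id pl(2)] by (intro lin_sw_tensor) auto
  have "W_mult_map (pt Y Y c d) = sw ?E ?T (\<lambda>a e. pt X Q (?f a) (?g e)) (pt Y Y c d)"
    unfolding Let_def by (rule pairing_apply[OF te])
  also have "\<dots> = sw2 Y Y ?T (\<lambda>c1 d1 c2 d2. pt X Q (?f (pt Y Y c1 d1)) (?g (pt Y Y c2 d2))) c d"
    by (rule sw_tensor_pure[OF cY cY mY b c d])
  also have "\<dots> = sw Y ?T (\<lambda>c1 c2. sw Y ?T (\<lambda>d1 d2. pt X Q (\<phi> c1 (p1 X Q d1)) (p2 X Q c2 \<otimes>\<^bsub>Q\<^esub> p2 X Q d2)) d) c"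
    by (intro sw2_cong) (simp only: fp gp)
  also have "\<dots> = sw Y ?T (\<lambda>c1 c2. \<nu> d c1 (p2 X Q c2)) c"
  proof (rule sw_cong)
    fix c1 c2 assume c12: "c1 \<in> carrier Y" "c2 \<in> carrier Y"
    have "p2 X Q c2 \<in> carrier Q" using Hom_closed[OF proj_Hom(2)[OF cX cQ] c12(2)] .
    then show "sw Y ?T (\<lambda>d1 d2. pt X Q (\<phi> c1 (p1 X Q d1)) (p2 X Q c2 \<otimes>\<^bsub>Q\<^esub> p2 X Q d2)) d = \<nu> d c1 (p2 X Q c2)"
      unfolding \<nu>_def using c12 dT \<nu>i by (intro sw_proj[OF cX cQ mY]) auto
  qed
  also have "\<dots> = tl X Q ?T (\<lambda>h q. tl X Q ?T (\<lambda>k r. sw Q ?T (\<lambda>q1 q2. pt X Q (\<gamma> h q1 k) (q2 \<otimes>\<^bsub>Q\<^esub> r)) q) d) c"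
  proof (rule tl_eqI[OF mX mQ mY l1 _ outer cT, symmetric])
    fix h q assume hq: "h \<in> carrier X" "q \<in> carrier Q"
    have "sw Y ?T (\<lambda>a e. \<nu> d a (p2 X Q e)) (pt X Q h q) = sw Q ?T (\<lambda>q1 q2. \<nu> d (pt X Q h q1) q2) q"
      by (rule sw_proj_right[OF cX cQ mY \<nu>b[OF dT] hq])
    also have "\<dots> = sw Q ?T (\<lambda>q1 q2. tl X Q ?T (\<lambda>k r. pt X Q (\<gamma> h q1 k) (q2 \<otimes>\<^bsub>Q\<^esub> r)) d) q"
      unfolding \<nu>_def using hq by (intro sw_cong tl_cong[THEN fun_cong]) (simp add: \<phi>p)
    \<comment> \<open>The smash product sums over the legs of \<open>q\<close> inside the lift in
      \<open>d\<close>, the generic product does so outside; multilinearity permits the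
      exchange.\<close>
    also have "\<dots> = tl X Q ?T (\<lambda>k r. sw Q ?T (\<lambda>q1 q2. pt X Q (\<gamma> h q1 k) (q2 \<otimes>\<^bsub>Q\<^esub> r)) q) d"
      unfolding sweedler_def using hq dT by (intro tl_exchange \<mu>F) auto
    finally show "sw Y ?T (\<lambda>a e. \<nu> d a (p2 X Q e)) (pt X Q h q) =
      tl X Q ?T (\<lambda>k r. sw Q ?T (\<lambda>q1 q2. pt X Q (\<gamma> h q1 k) (q2 \<otimes>\<^bsub>Q\<^esub> r)) q) d" .
  qed
  also have "\<dots> = c \<otimes>\<^bsub>W\<^esub> d" unfolding W_mult \<gamma>_def ..
  finally show "W_mult_map (pt Y Y c d) = c \<otimes>\<^bsub>W\<^esub> d" .
qed

text \<open>The inverse of \<open>(x, q)\<close> in a semidirect product is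
  \<open>(S q \<star> S x, S q)\<close>, taken here at the generic point of
  \<open>Y\<close>.\<close>

abbreviation W_antipode_map where
  "W_antipode_map \<equiv> (let S = cmp Y (antipode Q) (p2 X Q) in
     pair Y X Q (act Y S (cmp Y (antipode XH) (p1 X Q))) S)"

lemma W_antipode_map:
  shows W_antipode_map_Hom: "W_antipode_map \<in> Hom Y Y"
    and W_antipode_eq: "w \<in> carrier Y \<Longrightarrow> antipode W w = W_antipode_map w"
proof -
  let ?T = "T X Q"
  let ?S = "cmp Y (antipode Q) (p2 X Q)"
  let ?s = "cmp Y (antipode XH) (p1 X Q)"
  have S: "?S \<in> Hom Y Q" and s: "?s \<in> Hom Y X" by auto
  let ?f = "act Y ?S ?s"
  have f: "?f \<in> Hom Y X" using S s by auto
  show M: "W_antipode_map \<in> Hom Y Y" unfolding Let_def using f S by auto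
  have SQ: "antipode Q \<in> lin Q Q" by (rule chom_lin[OF pre_hopfD(8)[OF preQ]])
  have SX: "antipode XH \<in> lin X X" using chom_lin[OF pre_hopfD(8)[OF preXH]] by simp
  have fl: "?f \<in> lin ?T X" using Hom_lin[OF f] by simp
  have fp: "?f (pt X Q h q) = action_curried (pt Q X (antipode Q q) (antipode XH h))" if "h \<in> carrier X" "q \<in> carrier Q" for h q
    using pairing_pure_flip[OF cX cQ mX mQ SX SQ that] that by (simp add: act_def compose_def)
  have b: "(\<lambda>a q. pt X Q (?f a) (antipode Q q)) \<in> bil ?T Q ?T"
    using fl SQ by (intro bil_comp[OF pt_bil]) auto
  have bi: "(\<lambda>q1 q2. pt X Q (?f (pt X Q h q1)) (antipode Q q2)) \<in> bil Q Q ?T" if "h \<in> carrier X" for h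
    using that by (intro bil_comp[OF b] lin_intros) auto
  have bi': "(\<lambda>q1 q2. pt X Q (action_curried (pt Q X (antipode Q q1) (antipode XH h))) (antipode Q q2)) \<in> bil Q Q ?T" if "h \<in> carrier X" for h
    using that lin_closed[OF SX] SQ
    by (intro bil_comp[OF pt_bil] lin_comp[OF bilD(1)[OF action_bil] SQ]) auto
  have outer: "(\<lambda>h q. sw Q ?T (\<lambda>q1 q2. pt X Q (action_curried (pt Q X (antipode Q q1) (antipode XH h))) (antipode Q q2)) q) \<in> bil X Q ?T"
  proof (rule bilI)
    show "(\<lambda>h. sw Q ?T (\<lambda>q1 q2. pt X Q (action_curried (pt Q X (antipode Q q1) (antipode XH h))) (antipode Q q2)) q) \<in> lin X ?T"
      if "q \<in> carrier Q" for q
      using that bi' lin_closed[OF SQ] SX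
      by (intro lin_sw_param lin_pt1 lin_comp[OF bilD(2)[OF action_bil] SX]) auto
    show "(\<lambda>q. sw Q ?T (\<lambda>q1 q2. pt X Q (action_curried (pt Q X (antipode Q q1) (antipode XH h))) (antipode Q q2)) q) \<in> lin Q ?T"
      if "h \<in> carrier X" for h
      using that bi' by (intro lin_sw lin_id) auto
  qed
  have Ml: "W_antipode_map \<in> lin ?T ?T" using Hom_lin[OF M] by simp
  fix w assume "w \<in> carrier Y"
  then have w: "w \<in> carrier ?T" by simp
  show "antipode W w = W_antipode_map w"
    unfolding W_antipode
  proof (rule tl_eqI[OF mX mQ mY Ml _ outer w])
    fix h q assume hq: "h \<in> carrier X" "q \<in> carrier Q"
    have t: "pt X Q h q \<in> carrier Y" using hq by simp
    have "W_antipode_map (pt X Q h q) = sw Y ?T (\<lambda>a e. pt X Q (?f a) (antipode Q (p2 X Q e))) (pt X Q h q)"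
      unfolding Let_def pairing_apply[OF t] by (intro sw_cong) (simp add: compose_def)
    also have "\<dots> = sw Q ?T (\<lambda>q1 q2. pt X Q (?f (pt X Q h q1)) (antipode Q q2)) q"
      by (rule sw_proj_right[OF cX cQ mY b hq])
    also have "\<dots> = sw Q ?T (\<lambda>q1 q2. pt X Q (action_curried (pt Q X (antipode Q q1) (antipode XH h))) (antipode Q q2)) q"
      using hq by (intro sw_cong) (simp add: fp)
    finally show "W_antipode_map (pt X Q h q) = \<dots>" .
  qed
qed

lemma preW [simp]: "pre_hopf W"
proof (rule pre_hopfI)
  show "W_mult_map \<in> Hom (W \<otimes>\<^sub>c W) W" using W_mult_map_Hom by simp
  show "x \<otimes>\<^bsub>W\<^esub> y = W_mult_map (pt W W x y)" if "x \<in> carrier W" "y \<in> carrier W" for x y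
    using W_mult_map_pure[of x y] that by simp
  let ?g = "ground_coalgebra K"
  interpret Xm: module K X by simp
  have gl: "group_like X \<one>\<^bsub>XH\<^esub>" "group_like Q \<one>\<^bsub>Q\<^esub>"
    using group_like_one[OF preXH] group_like_one[OF preQ] by (simp_all add: group_like_def)
  have c: "const_map ?g X \<one>\<^bsub>XH\<^esub> \<in> Hom ?g X" "const_map ?g Q \<one>\<^bsub>Q\<^esub> \<in> Hom ?g Q"
    using gl by (auto intro: const_map_Hom)
  have one: "\<one>\<^bsub>K\<^esub> \<in> carrier ?g" using group_like_ground by (simp add: group_like_def)
  \<comment> \<open>The unit is the image of the group-like \<open>1\<close> of the ground field
    under a pair of constant points, so it is group-like because coalgebra maps preserve
    group-likes.\<close>
  have "group_like Y (pair ?g X Q (const_map ?g X \<one>\<^bsub>XH\<^esub>) (const_map ?g Q \<one>\<^bsub>Q\<^esub>) \<one>\<^bsub>K\<^esub>)"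
    by (rule group_like_image[OF _ _ Hom_chom[OF pairing_Hom[OF coalg_ground cX cQ c]] group_like_ground]) auto
  also have "pair ?g X Q (const_map ?g X \<one>\<^bsub>XH\<^esub>) (const_map ?g Q \<one>\<^bsub>Q\<^esub>) \<one>\<^bsub>K\<^esub> = \<one>\<^bsub>W\<^esub>"
    unfolding pairing_const[OF coalg_ground mX mQ Hom_lin[OF c(1)] Q_one_closed one] using one by (simp add: const_map_def W_one)
  finally show "group_like W \<one>\<^bsub>W\<^esub>" by (simp add: group_like_def)
  have "antipode W \<in> chom Y Y"
    by (rule chom_cong[OF Hom_chom[OF W_antipode_map_Hom] cY]) (rule W_antipode_eq[symmetric])
  then show "antipode W \<in> chom W W" by simp
qed simp

lemma conv_W_Hom [simp, intro]: "coalg C \<Longrightarrow> w \<in> Hom C Y \<Longrightarrow> w' \<in> Hom C Y \<Longrightarrow> conv C W w w' \<in> Hom C Y"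
  using conv_Hom[OF preW, of C w w'] by simp

lemma conv_one_W_Hom [simp, intro]: "coalg C \<Longrightarrow> conv_one C W \<in> Hom C Y"
  using conv_one_Hom[OF preW, of C] by simp

lemma antipode_W_Hom [simp, intro]: "coalg C \<Longrightarrow> w \<in> Hom C Y \<Longrightarrow> cmp C (antipode W) w \<in> Hom C Y"
  using antipode_Hom[OF preW, of C w] by simp

text \<open>On points the wreath product is the semidirect product of groups.\<close>

lemma conv_W:
  assumes C: "coalg C" and w: "w \<in> Hom C Y" and w': "w' \<in> Hom C Y"
  shows "conv C W w w' = pair C X Q (conv C XH (wX C w) (act C (wQ C w) (wX C w'))) (conv C Q (wQ C w) (wQ C w'))"
proof -
  let ?E = "Y \<otimes>\<^sub>c Y"
  let ?k = "pair C Y Y w w'"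
  have E: "coalg ?E" by auto
  have k: "?k \<in> Hom C ?E" using C w w' by auto
  have st: "p1 Y Y \<in> Hom ?E Y" "p2 Y Y \<in> Hom ?E Y" by auto
  note pk = proj_pairing[OF C cY cY w w']
  have hq: "wX ?E (p1 Y Y) \<in> Hom ?E X" "wQ ?E (p1 Y Y) \<in> Hom ?E Q" "wX ?E (p2 Y Y) \<in> Hom ?E X" "wQ ?E (p2 Y Y) \<in> Hom ?E Q"
    using E st by auto
  have "conv C W w w' = cmp C W_mult_map ?k"
  proof (rule extensionalityI[where A = "carrier C"])
    fix e assume e: "e \<in> carrier C"
    have Ml: "W_mult_map \<in> lin (T Y Y) (T X Q)" using Hom_lin[OF W_mult_map_Hom] by simp
    have "W_mult_map (sw C (T Y Y) (\<lambda>a b. pt Y Y (w a) (w' b)) e) = sw C (T X Q) (\<lambda>a b. W_mult_map (pt Y Y (w a) (w' b))) e"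
      using Hom_lin[OF w] Hom_lin[OF w'] by (intro sw_push[OF C _ _ _ Ml e] pairing_bil) auto
    also have "\<dots> = conv C W w w' e"
      unfolding conv_apply[OF e] W_sw_norm
      by (intro sw_cong W_mult_map_pure Hom_closed[OF w] Hom_closed[OF w'])
    finally show "conv C W w w' e = cmp C W_mult_map ?k e"
      using e by (simp only: compose_eq pairing_apply)
  qed (auto simp: conv_def compose_def)
  also have "\<dots> = pair C X Q (conv C XH (wX C w) (act C (wQ C w) (wX C w'))) (conv C Q (wQ C w) (wQ C w'))"
    unfolding Let_def using C E k hq pk
    by (simp add: pairing_compose conv_XH_compose conv_compose act_compose wXQ_compose[OF k])
  finally show ?thesis .
qed

lemma conv_one_W:
  assumes C: "coalg C"
  shows "conv_one C W = pair C X Q (conv_one C XH) (conv_one C Q)"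
proof (rule wXQ_eqI[OF C])
  interpret Q: module K Q by simp
  interpret X: module K X by simp
  have l: "p1 X Q \<in> lin (T X Q) X" "p2 X Q \<in> lin (T X Q) Q"
    using Hom_lin[OF proj_Hom(1)[OF cX cQ]] Hom_lin[OF proj_Hom(2)[OF cX cQ]] by simp_all
  have e1: "counit X \<one>\<^bsub>XH\<^esub> = \<one>\<^bsub>K\<^esub>" "counit Q \<one>\<^bsub>Q\<^esub> = \<one>\<^bsub>K\<^esub>"
    using pre_hopfD(7)[OF preXH] pre_hopfD(7)[OF preQ] by simp_all
  show "wX C (conv_one C W) = wX C (pair C X Q (conv_one C XH) (conv_one C Q))"
    "wQ C (conv_one C W) = wQ C (pair C X Q (conv_one C XH) (conv_one C Q))"
    using C by (auto simp: wXQ_pair, auto simp: wX_def wQ_def conv_one_def compose_def fun_eq_iff W_one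
      lin_smult[OF l(1)] lin_smult[OF l(2)] proj1_pure proj2_pure e1)
qed (use C in auto)

lemma antipode_W:
  assumes C: "coalg C" and w: "w \<in> Hom C Y"
  shows "cmp C (antipode W) w =
    (let q = cmp C (antipode Q) (wQ C w) in
     pair C X Q (act C q (cmp C (antipode XH) (wX C w))) q)"
proof -
  have S: "cmp Y (antipode Q) (p2 X Q) \<in> Hom Y Q" "cmp Y (antipode XH) (p1 X Q) \<in> Hom Y X" by auto
  have "cmp C (antipode W) w = cmp C W_antipode_map w"
  proof (rule extensionalityI[where A = "carrier C"])
    fix e assume e: "e \<in> carrier C"
    show "cmp C (antipode W) w e = cmp C W_antipode_map w e"
      by (simp only: compose_eq[OF e] W_antipode_eq[OF Hom_closed[OF w e]])
  qed (auto simp: compose_def)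
  also have "\<dots> = (let q = cmp C (antipode Q) (wQ C w) in
     pair C X Q (act C q (cmp C (antipode XH) (wX C w))) q)"
    unfolding Let_def wX_def wQ_def using C w S
    by (simp add: pairing_compose act_compose compose_compose[OF w])
  finally show ?thesis .
qed

text \<open>On points this is the verification of the group laws in a semidirect product, with
  \<open>act_laws\<close> providing an action by automorphisms.\<close>

lemma W_group_laws:
  assumes C: "coalg C" and s: "small C" and f: "f \<in> Hom C Y" and g: "g \<in> Hom C Y" and h: "h \<in> Hom C Y"
  shows "conv C W (conv C W f g) h = conv C W f (conv C W g h)"
    and "conv C W (conv_one C W) f = f" "conv C W f (conv_one C W) = f"
    and "conv C W (cmp C (antipode W) f) f = conv_one C W"
    and "conv C W f (cmp C (antipode W) f) = conv_one C W"
proof -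
  note rQ = conv_laws[OF C Q] and rX = conv_laws[OF C XH_hopf, simplified]
  note act = act_laws[OF C s]
  have a2: "act C q (conv_one C XH) = conv_one C XH" if "q \<in> Hom C Q" for q by (rule act(2)[OF that rQ(12) rX(12,12)])
  have a3: "act C q (act C r x) = act C (conv C Q q r) x" if "q \<in> Hom C Q" "r \<in> Hom C Q" "x \<in> Hom C X" for q r x
    by (rule act(3)[OF that rX(12)])
  have a4: "act C (conv_one C Q) x = x" if "x \<in> Hom C X" for x by (rule act(4)[OF rQ(12,12) that rX(12)])
  show "conv C W (conv C W f g) h = conv C W f (conv C W g h)"
    using C f g h by (simp add: conv_W act(1)[OF _ rQ(12)] a3 rX(1) rQ(1))
  show "conv C W (conv_one C W) f = f"
    using C f by (intro wXQ_eqI[OF C]) (simp_all add: conv_W conv_one_W a4 rQ(2) rX(2))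
  show "conv C W f (conv_one C W) = f"
    using C f by (intro wXQ_eqI[OF C]) (simp_all add: conv_W conv_one_W a2 rQ(3) rX(3))
  let ?q = "wQ C f" and ?x = "wX C f"
  have q: "?q \<in> Hom C Q" and x: "?x \<in> Hom C X" using C f by auto
  note Sq = rQ(13)[OF q] and Sx = rX(13)[OF x]
  show "conv C W (cmp C (antipode W) f) f = conv_one C W"
    using C f q x Sq Sx by (simp add: antipode_W Let_def conv_W conv_one_W act(1)[OF Sq Sq Sx x, symmetric] a2 rQ(4) rX(4))
  show "conv C W f (cmp C (antipode W) f) = conv_one C W"
    using C f q x Sq Sx by (simp add: antipode_W Let_def conv_W conv_one_W a3 a4 rQ(5) rX(5))
qed

lemma W_hopf: "hopf W"
proof (rule hopf_of_points[OF preW])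
  let ?C = "(W \<otimes>\<^sub>c W) \<otimes>\<^sub>c W"
  show "conv ?C W (conv ?C W f g) h = conv ?C W f (conv ?C W g h)"
    if "f \<in> Hom ?C W" "g \<in> Hom ?C W" "h \<in> Hom ?C W" for f g h
    using W_group_laws(1)[of "(Y \<otimes>\<^sub>c Y) \<otimes>\<^sub>c Y" f g h] that by simp
  have sl: "tl W W = (tl (T X Q) (T X Q) :: ('k, ('k, 'x, 'q) tensor, 'h) module_scheme \<Rightarrow> _)"
    by (rule ext, rule same_tl[OF W_same_module W_same_module same_refl])
  have eq: "conv W W = conv Y W" "conv_one W W = conv_one Y W"
    by (auto simp: conv_def conv_one_def sweedler_def fun_eq_iff W_carrier sl)
  fix i assume "i \<in> Hom W W"
  then have i: "i \<in> Hom Y Y" by simp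
  note L = W_group_laws[OF cY small_Y i i i]
  show "conv W W (conv_one W W) i = i" "conv W W i (conv_one W W) = i"
    "conv W W (cmp W (antipode W) i) i = conv_one W W"
    "conv W W i (cmp W (antipode W) i) = conv_one W W"
    using L by (simp_all add: eq W_carrier)
qed

end

section \<open>Coalgebra-split extensions\<close>

context kvec
begin

abbreviation coinv where "coinv E Q \<pi> \<equiv> coinvariants K E Q \<pi>"

text \<open>For an element, \<open>\<pi> e = \<epsilon>(e) 1\<close> does not imply coinvariance. It
  does for the values of a coalgebra map \<open>g\<close> with trivial projection, because the
  condition can then be applied to the second leg of \<open>g c\<close>.\<close>

lemma coinvI_point:
  fixes Q (structure)
  assumes C: "coalg C" and E: "coalg E" and Q: "hopf Q" and p: "\<pi> \<in> lin E Q" and g: "g \<in> chom C E"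
    and t: "\<And>c. c \<in> carrier C \<Longrightarrow> \<pi> (g c) = counit C c \<odot> \<one>" and c: "c \<in> carrier C"
  shows "g c \<in> coinv E Q \<pi>"
proof -
  have m: "md C" "md E" "md Q" using C E Q by auto
  have one: "\<one> \<in> carrier Q" using pre_hopfD(3)[OF hopf_pre_hopf[OF Q]] .
  note gl = chom_lin[OF g]
  have tl: "tm E E E Q (\<lambda>x. x) \<pi> \<in> lin (T E E) (T E Q)"
    using m p by (intro tm_lin lin_id)
  have "tm E E E Q (\<lambda>x. x) \<pi> (comult E (g c)) = tm E E E Q (\<lambda>x. x) \<pi> (sw C (T E E) (\<lambda>a b. pt E E (g a) (g b)) c)"
    by (simp add: chom_comult[OF g c])
  also have "\<dots> = sw C (T E Q) (\<lambda>a b. tm E E E Q (\<lambda>x. x) \<pi> (pt E E (g a) (g b))) c"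
    using C m tl c gl by (intro sw_push bil_comp[OF pt_bil]) auto
  also have "\<dots> = sw C (T E Q) (\<lambda>a b. counit C b \<odot>\<^bsub>T E Q\<^esub> pt E Q (g a) \<one>) c"
    using C m p one lin_closed[OF gl]
    by (intro sw_cong) (simp add: tm_pt lin_id t lin_smult[OF bilD(2)[OF pt_bil]])
  also have "\<dots> = pt E Q (g c) \<one>"
    using C m one gl c by (intro sw_counit_right lin_pt1) auto
  finally show ?thesis using chom_closed[OF g c] by (simp add: coinvariants_def)
qed

lemma coinvD:
  fixes Q (structure)
  assumes E: "coalg E" and Q: "hopf Q" and p: "\<pi> \<in> chom E Q" and b: "b \<in> coinv E Q \<pi>"
  shows "b \<in> carrier E" "tm E E E Q (\<lambda>x. x) \<pi> (comult E b) = pt E Q b \<one>"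
    and "\<pi> b = counit E b \<odot> \<one>"
proof -
  have m: "md E" "md Q" using E Q by auto
  have one: "\<one> \<in> carrier Q" using pre_hopfD(3)[OF hopf_pre_hopf[OF Q]] .
  show bE: "b \<in> carrier E" and eq: "tm E E E Q (\<lambda>x. x) \<pi> (comult E b) = pt E Q b \<one>"
    using b by (simp_all add: coinvariants_def)
  have bi: "(\<lambda>x y. counit E x \<odot> y) \<in> bil E Q Q"
    using E m by (intro bilI lin_intros) auto
  have "\<pi> b = sw E Q (\<lambda>x y. counit E x \<odot> \<pi> y) b"
    using E m bE chom_lin[OF p] by (intro sw_counit_left[symmetric])
  also have "\<dots> = tl E Q Q (\<lambda>x y. counit E x \<odot> y) (tm E E E Q (\<lambda>x. x) \<pi> (comult E b))"
    unfolding sweedler_def using E m bE chom_lin[OF p] bi by (intro tl_tm[symmetric] lin_id) auto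
  also have "\<dots> = counit E b \<odot> \<one>"
    using m one bE bi by (simp add: eq tensor_lift_pure)
  finally show "\<pi> b = counit E b \<odot> \<one>" .
qed

lemma conv_group_like:
  assumes C: "coalg C" and H: "pre_hopf H" and f: "f \<in> lin C H" and g: "g \<in> lin C H"
    and c: "c \<in> carrier C" "comult C c = pt C C c c"
  shows "conv C H f g c = f c \<otimes>\<^bsub>H\<^esub> g c"
  using assms conv_bil[OF pre_hopfD(2)[OF H] f g] by (simp add: conv_apply sweedler_def tensor_lift_pure)

text \<open>Sections may be normalised: replace \<open>\<gamma>(q)\<close> by \<open>\<gamma>(q) \<gamma>(1)\<inverse>\<close>.\<close>

definition normal_section where
  "normal_section E Q \<pi> \<gamma> \<longleftrightarrow> \<gamma> \<in> Hom Q E \<and> \<gamma> \<one>\<^bsub>Q\<^esub> = \<one>\<^bsub>E\<^esub> \<and> (\<forall>q \<in> carrier Q. \<pi> (\<gamma> q) = q)"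

lemma normal_section_exists:
  fixes Q (structure)
  assumes E: "hopf E" and Q: "hopf Q" and p: "\<pi> \<in> hhom E Q" and s: "has_coalgebra_section K E Q \<pi>"
  obtains \<gamma> where "normal_section E Q \<pi> \<gamma>"
proof -
  interpret HE: cocomm_hopf_algebra K E by fact
  interpret RQ: ring Q by (rule hopf_ring[OF Q])
  note ph = hopf_homD[OF p]
  have cQ: "coalg Q" and cE: "coalg E" and mE: "md E" and mQ: "md Q" using E Q by auto
  note PQ = pre_hopfD[OF hopf_pre_hopf[OF Q]] and PE = pre_hopfD[OF hopf_pre_hopf[OF E]]
  obtain g where g: "g \<in> chom Q E" "\<And>q. q \<in> carrier Q \<Longrightarrow> \<pi> (g q) = q"
    using s by (auto simp: has_coalgebra_section_def)
  let ?c = "cmp Q"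
  define \<gamma> where "\<gamma> = restrict g (carrier Q)"
  have \<gamma>: "\<gamma> \<in> Hom Q E" unfolding \<gamma>_def by (rule restrict_Hom[OF cQ g(1)])
  \<comment> \<open>\<open>conv_one Q Q\<close> is the constant point at \<open>1\<close>, so
    \<open>u\<close> is the constant point at \<open>\<gamma> 1\<close>. Its projection is the
    trivial point, which is why \<open>?g\<close> remains a section.\<close>
  define u where "u = ?c \<gamma> (conv_one Q Q)"
  have uH: "u \<in> Hom Q E" unfolding u_def using cQ Q mE \<gamma> by (intro compose_Hom[where D = Q]) auto
  let ?S = "?c (antipode E) u"
  have SH: "?S \<in> Hom Q E" using uH cQ E by auto
  let ?g = "conv Q E \<gamma> ?S"
  have gH: "?g \<in> Hom Q E" using \<gamma> SH cQ E by auto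
  have id: "?c \<pi> \<gamma> = (\<lambda>q\<in>carrier Q. q)"
    using g(2) by (auto simp: compose_def \<gamma>_def fun_eq_iff)
  have idH: "(\<lambda>q\<in>carrier Q. q) \<in> Hom Q Q" by (rule ident_Hom[OF cQ])
  interpret GQ: group "conv_group Q Q" by (rule group_conv[OF cQ Q])
  have pu: "?c \<pi> u = conv_one Q Q"
    using conv_one_Hom[OF hopf_pre_hopf[OF Q] cQ, THEN Hom_closed] g(2)
    by (auto simp: u_def \<gamma>_def compose_def fun_eq_iff conv_one_def)
  have pS: "?c \<pi> ?S = ?c (antipode Q) (?c \<pi> u)"
    using Hom_closed[OF uH] ph(4) by (auto simp: compose_def fun_eq_iff)
  have "?c \<pi> ?g = conv Q Q (\<lambda>q\<in>carrier Q. q) (?c (antipode Q) (conv_one Q Q))"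
    using conv_hopf_hom[OF cQ E Q p \<gamma> SH] id pS pu by simp
  also have "\<dots> = (\<lambda>q\<in>carrier Q. q)"
    using GQ.inv_one group_conv(2)[OF cQ Q, of "conv_one Q Q"] cQ Q GQ.r_one[of "\<lambda>q\<in>carrier Q. q"] idH
    by (simp add: conv_one_Hom)
  finally have pg: "?c \<pi> ?g = (\<lambda>q\<in>carrier Q. q)" .
  have oneQ: "\<one> \<in> carrier Q" by simp
  have d1: "comult Q \<one> = pt Q Q \<one> \<one>" by (rule PQ(5))
  have u1: "u \<one> = \<gamma> \<one>"
    using PQ(7) mQ by (simp add: u_def compose_def conv_one_def module.smult_one)
  interpret GE: group "conv_group Q E" by (rule group_conv[OF cQ E])
  have "conv Q E u ?S = conv_one Q E"
    using GE.r_inv[of u] uH group_conv(2)[OF cQ E uH] by simp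
  then have "u \<one> \<otimes>\<^bsub>E\<^esub> ?S \<one> = conv_one Q E \<one>"
    using conv_group_like[OF cQ hopf_pre_hopf[OF E] Hom_lin[OF uH] Hom_lin[OF SH] oneQ d1] by simp
  then have "?g \<one> = \<one>\<^bsub>E\<^esub>"
    using conv_group_like[OF cQ hopf_pre_hopf[OF E] Hom_lin[OF \<gamma>] Hom_lin[OF SH] oneQ d1] PQ(7) PE(3) mE u1
    by (simp add: conv_one_def module.smult_one)
  moreover have "\<pi> (?g q) = q" if "q \<in> carrier Q" for q
    using fun_cong[OF pg, of q] that by (simp add: compose_def)
  ultimately have "normal_section E Q \<pi> ?g" using gH by (simp add: normal_section_def)
  then show ?thesis by (rule that)
qed

lemma normal_sectionD:
  assumes "normal_section E Q \<pi> \<gamma>"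
  shows "\<gamma> \<in> Hom Q E" "\<gamma> \<one>\<^bsub>Q\<^esub> = \<one>\<^bsub>E\<^esub>" "q \<in> carrier Q \<Longrightarrow> \<pi> (\<gamma> q) = q"
  using assms by (simp_all add: normal_section_def)

lemma section_conv_one:
  assumes "hopf E" "hopf Q" "normal_section E Q \<pi> \<gamma>" "coalg C"
  shows "cmp C \<gamma> (conv_one C Q) = conv_one C E"
  using normal_sectionD[OF assms(3)] pre_hopfD(3)[OF hopf_pre_hopf[OF assms(2)]] assms(4)
  by (auto simp: compose_def conv_one_def fun_eq_iff lin_smult[OF Hom_lin])

lemma antipode_one: "hopf H \<Longrightarrow> antipode H \<one>\<^bsub>H\<^esub> = \<one>\<^bsub>H\<^esub>"
proof -
  assume H: "hopf H"
  interpret R: ring H by (rule hopf_ring[OF H])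
  interpret HH: cocomm_hopf_algebra K H by fact
  have m: "md H" using H by auto
  have Sl: "antipode H \<in> lin H H" by (rule HH.antipode_linear)
  have "sw H H (\<lambda>a b. antipode H a \<otimes>\<^bsub>H\<^esub> b) \<one>\<^bsub>H\<^esub> = antipode H \<one>\<^bsub>H\<^esub> \<otimes>\<^bsub>H\<^esub> \<one>\<^bsub>H\<^esub>"
    using m bil_comp[OF hopf_mult_bil[OF H] Sl lin_id]
    by (simp add: sweedler_def HH.comult_one tensor_lift_pure)
  then show ?thesis
    using HH.antipode_left[of "\<one>\<^bsub>H\<^esub>"] lin_closed[OF Sl, of "\<one>\<^bsub>H\<^esub>"] m
    by (simp add: HH.counit_one module.smult_one)
qed

text \<open>\<open>j\<close> sends \<open>e\<close> to \<open>e1 S(\<gamma>(\<pi> e2))\<close>. Its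
  projection cancels to the trivial point, so its values are coinvariant. On a coinvariant
  \<open>b\<close> the legs \<open>b1 \<otimes> \<pi>(b2)\<close> are \<open>b \<otimes> 1\<close>,
  and \<open>\<gamma> 1 = 1\<close> gives \<open>j b = b\<close>.\<close>

lemma coinv_section:
  fixes Q (structure)
  assumes E: "hopf E" and Q: "hopf Q" and p: "\<pi> \<in> hhom E Q" and s: "normal_section E Q \<pi> \<gamma>"
  defines "j \<equiv> conv E E (\<lambda>x\<in>carrier E. x) (cmp E (antipode E) (cmp E \<gamma> \<pi>))"
  shows "j \<in> Hom E E" "j ` carrier E = coinv E Q \<pi>" "\<And>b. b \<in> coinv E Q \<pi> \<Longrightarrow> j b = b"
    "\<And>e. e \<in> carrier E \<Longrightarrow> \<pi> (j e) = counit E e \<odot> \<one>"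
proof -
  interpret RE: ring E by (rule hopf_ring[OF E])
  have cQ: "coalg Q" and cE: "coalg E" and mE: "md E" and mQ: "md Q" using E Q by auto
  note ph = hopf_homD[OF p] and g = normal_sectionD[OF s]
  have oneQ: "\<one> \<in> carrier Q" using pre_hopfD(3)[OF hopf_pre_hopf[OF Q]] .
  let ?c = "cmp E"
  let ?i = "\<lambda>x\<in>carrier E. x"
  have i: "?i \<in> Hom E E" by (rule ident_Hom[OF cE])
  have gp: "?c \<gamma> \<pi> \<in> Hom E E"
    unfolding compose_def by (rule restrict_Hom[OF cE chom_comp[OF cE mQ mE Hom_chom[OF g(1)] ph(1)]])
  have S: "?c (antipode E) (?c \<gamma> \<pi>) \<in> Hom E E" using gp cE E by auto
  show j: "j \<in> Hom E E" unfolding j_def using i S cE E by auto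
  have pi: "?c \<pi> ?i \<in> Hom E Q" using i by (intro compose_hopf_hom[OF cE E Q p])
  interpret GQ: group "conv_group E Q" by (rule group_conv[OF cE Q])
  have "?c \<pi> (?c (antipode E) (?c \<gamma> \<pi>)) = ?c (antipode Q) (?c \<pi> ?i)"
    using ph(4,5) Hom_closed[OF g(1)] g(3) by (auto simp: compose_def fun_eq_iff)
  then have pj: "?c \<pi> j = conv_one E Q"
    unfolding j_def using conv_hopf_hom[OF cE E Q p i S] GQ.r_inv[of "?c \<pi> ?i"] pi group_conv(2)[OF cE Q pi] by simp
  show t: "\<pi> (j e) = counit E e \<odot> \<one>" if "e \<in> carrier E" for e
    using fun_cong[OF pj, of e] that by (simp add: compose_def conv_one_def)
  have sub: "j e \<in> coinv E Q \<pi>" if "e \<in> carrier E" for e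
    by (rule coinvI_point[OF cE cE Q ph(6) Hom_chom[OF j] t that])
  have Sg: "(\<lambda>q. antipode E (\<gamma> q)) \<in> lin Q E"
    by (rule lin_comp[OF chom_lin[OF antipode_chom[OF E]] Hom_lin[OF g(1)]])
  have bi: "(\<lambda>x q. x \<otimes>\<^bsub>E\<^esub> antipode E (\<gamma> q)) \<in> bil E Q E"
    by (rule bil_comp[OF hopf_mult_bil[OF E] lin_id Sg])
  show fix_b: "j b = b" if b: "b \<in> coinv E Q \<pi>" for b
  proof -
    note bd = coinvD[OF cE Q ph(1) b]
    have "j b = sw E E (\<lambda>x y. x \<otimes>\<^bsub>E\<^esub> antipode E (\<gamma> (\<pi> y))) b"
      unfolding j_def conv_apply[OF bd(1)] by (intro sw_cong) (simp add: compose_def)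
    also have "\<dots> = tl E Q E (\<lambda>x q. x \<otimes>\<^bsub>E\<^esub> antipode E (\<gamma> q)) (tm E E E Q (\<lambda>x. x) \<pi> (comult E b))"
      unfolding sweedler_def using cE mE mQ bd(1) ph(6) bi by (intro tl_tm[symmetric] lin_id) auto
    also have "\<dots> = b"
      using mE mQ bd oneQ bi by (simp add: tensor_lift_pure g(2) antipode_one[OF E])
    finally show ?thesis .
  qed
  have "b \<in> j ` carrier E" if "b \<in> coinv E Q \<pi>" for b
    using fix_b[OF that] coinvD(1)[OF cE Q ph(1) that] by (metis imageI)
  then show "j ` carrier E = coinv E Q \<pi>" using sub by blast
qed

text \<open>\<open>coinvI_point\<close> accepts only values of coalgebra maps, so coinvariant
  elements are written as values of \<open>j\<close>. A product \<open>x y\<close> is then the value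
  at \<open>x \<otimes> y\<close> of a product of two points with trivial projection.\<close>

lemma coinv_closed:
  fixes Q (structure)
  assumes E: "hopf E" and Q: "hopf Q" and p: "\<pi> \<in> hhom E Q" and s: "normal_section E Q \<pi> \<gamma>"
  shows "submodule (coinv E Q \<pi>) K E" "\<one>\<^bsub>E\<^esub> \<in> coinv E Q \<pi>"
    "\<And>x y. x \<in> coinv E Q \<pi> \<Longrightarrow> y \<in> coinv E Q \<pi> \<Longrightarrow> x \<otimes>\<^bsub>E\<^esub> y \<in> coinv E Q \<pi>"
    "\<And>x. x \<in> coinv E Q \<pi> \<Longrightarrow> antipode E x \<in> coinv E Q \<pi>"
proof -
  interpret RE: ring E by (rule hopf_ring[OF E])
  interpret RQ: ring Q by (rule hopf_ring[OF Q])
  have cQ: "coalg Q" and cE: "coalg E" and mE: "md E" and mQ: "md Q" using E Q by auto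
  note ph = hopf_homD[OF p]
  obtain j where j: "j \<in> Hom E E" "j ` carrier E = coinv E Q \<pi>" "\<And>b. b \<in> coinv E Q \<pi> \<Longrightarrow> j b = b"
    "\<And>e. e \<in> carrier E \<Longrightarrow> \<pi> (j e) = counit E e \<odot> \<one>"
    using coinv_section[OF assms] by blast
  note bc = coinvD(1)[OF cE Q ph(1)] and bt = coinvD(3)[OF cE Q ph(1)]
  show "submodule (coinv E Q \<pi>) K E"
    using submodule_lin_image[OF Hom_lin[OF j(1)] mE mE] j(2) by simp
  have "conv_one E E \<one>\<^bsub>E\<^esub> = \<one>\<^bsub>E\<^esub>"
    using pre_hopfD(7)[OF hopf_pre_hopf[OF E]] mE by (simp add: conv_one_def module.smult_one)
  moreover have "conv_one E E \<one>\<^bsub>E\<^esub> \<in> coinv E Q \<pi>"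
    by (rule coinvI_point[OF cE cE Q ph(6) Hom_chom[OF conv_one_Hom[OF hopf_pre_hopf[OF E] cE]]])
      (use cE in \<open>auto simp: conv_one_def lin_smult[OF ph(6)] ph(3)\<close>)
  ultimately show "\<one>\<^bsub>E\<^esub> \<in> coinv E Q \<pi>" by simp
  show "antipode E x \<in> coinv E Q \<pi>" if x: "x \<in> coinv E Q \<pi>" for x
  proof -
    have "antipode E (j x) \<in> coinv E Q \<pi>"
    proof (rule coinvI_point[OF cE cE Q ph(6) chom_comp[OF cE mE mE antipode_chom[OF E] Hom_chom[OF j(1)]] _ bc[OF x]])
      interpret HQ: cocomm_hopf_algebra K Q by (rule Q)
      fix c assume c: "c \<in> carrier E"
      have "\<pi> (antipode E (j c)) = antipode Q (\<pi> (j c))" by (rule ph(4)[OF Hom_closed[OF j(1) c]])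
      also have "\<dots> = counit E c \<odot> \<one>"
        using c cE by (simp add: j(4) lin_smult[OF HQ.antipode_linear] antipode_one[OF Q])
      finally show "\<pi> (antipode E (j c)) = counit E c \<odot> \<one>" .
    qed
    then show ?thesis by (simp add: j(3)[OF x])
  qed
  show "x \<otimes>\<^bsub>E\<^esub> y \<in> coinv E Q \<pi>" if x: "x \<in> coinv E Q \<pi>" and y: "y \<in> coinv E Q \<pi>" for x y
  proof -
    let ?C = "E \<otimes>\<^sub>c E"
    have C: "coalg ?C" using cE by auto
    have pr: "p1 E E \<in> Hom ?C E" "p2 E E \<in> Hom ?C E" using cE by auto
    let ?f = "cmp ?C j (p1 E E)" and ?g = "cmp ?C j (p2 E E)"
    have fg: "?f \<in> Hom ?C E" "?g \<in> Hom ?C E" using C mE pr j(1) by (auto intro!: compose_Hom[where D = E])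
    have t1: "cmp ?C \<pi> ?f = conv_one ?C Q" "cmp ?C \<pi> ?g = conv_one ?C Q"
      using Hom_closed[OF pr(1)] Hom_closed[OF pr(2)] chom_counit[OF Hom_chom[OF pr(1)]] chom_counit[OF Hom_chom[OF pr(2)]] j(4)
      by (auto simp: compose_def conv_one_def fun_eq_iff)
    interpret G: group "conv_group ?C Q" by (rule group_conv[OF C Q])
    have eq: "cmp ?C \<pi> (conv ?C E ?f ?g) = conv_one ?C Q"
      using conv_hopf_hom[OF C E Q p fg] t1 G.l_one[of "conv_one ?C Q"] C Q by (simp add: conv_one_Hom)
    have t: "\<pi> (conv ?C E ?f ?g c) = counit ?C c \<odot> \<one>" if c: "c \<in> carrier ?C" for c
      using fun_cong[OF eq, of c] unfolding compose_eq[OF c] conv_one_def restrict_apply'[OF c] .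
    have "conv ?C E ?f ?g (pt E E x y) \<in> coinv E Q \<pi>"
      by (rule coinvI_point[OF C cE Q ph(6) Hom_chom[OF conv_Hom[OF hopf_pre_hopf[OF E] C fg]] t])
        (use bc[OF x] bc[OF y] mE in auto)
    then show ?thesis
      using conv_pure[OF cE cE mE hopf_mult_bil[OF E] Hom_lin[OF j(1)] Hom_lin[OF j(1)] bc[OF x] bc[OF y]]
      by (simp add: j(3) x y)
  qed
qed

text \<open>With a section \<open>\<gamma>\<close>, every \<open>e\<close> is \<open>\<gamma>(\<pi> e\<^sub>1) j(e\<^sub>2)\<close> with \<open>j\<close> coinvariant; modulo the
  right-hand side \<open>j(e\<^sub>2)\<close> may be replaced by \<open>\<epsilon>(e\<^sub>2)\<close>.\<close>

lemma kernel_of_split: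
  assumes E: "hopf E" and Q: "hopf Q" and p: "\<pi> \<in> hhom E Q" and s: "normal_section E Q \<pi> \<gamma>"
  shows "a_kernel E Q \<pi> = linear_span K E {e \<otimes>\<^bsub>E\<^esub> a | e a.
    e \<in> carrier E \<and> a \<in> coinv E Q \<pi> \<and> counit E a = \<zero>\<^bsub>K\<^esub>}" (is "_ = linear_span K E ?G")
proof -
  interpret RE: ring E by (rule hopf_ring[OF E])
  interpret RQ: ring Q by (rule hopf_ring[OF Q])
  interpret Em: module K E using E by auto
  interpret HE: cocomm_hopf_algebra K E by (rule E)
  interpret Qm: module K Q using Q by auto
  have cQ: "coalg Q" and cE: "coalg E" and mE: "md E" and mQ: "md Q" using E Q by auto
  note ph = hopf_homD[OF p] and g = normal_sectionD[OF s]
  note bc = coinvD(1)[OF cE Q ph(1)] and bt = coinvD(3)[OF cE Q ph(1)]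
  note cc = coinv_closed[OF assms]
  have ker: "a_kernel E Q \<pi> = {x \<in> carrier E. \<pi> x \<in> {\<zero>\<^bsub>Q\<^esub>}}"
    by (auto simp: a_kernel_def')
  have sk: "submodule (a_kernel E Q \<pi>) K E"
    unfolding ker by (rule submodule_lin_vimage[OF ph(6) mE mQ zero_submodule[OF mQ]])
  have G: "?G \<subseteq> carrier E" using bc by auto
  have "?G \<subseteq> a_kernel E Q \<pi>"
    using bc bt by (auto simp: ker ph(2,5))
  then have 1: "linear_span K E ?G \<subseteq> a_kernel E Q \<pi>" by (rule lin_span_minimal[OF sk])
  note sN = lin_span_submodule[OF mE G]
  let ?c = "cmp E"
  let ?i = "\<lambda>x\<in>carrier E. x"
  have i: "?i \<in> Hom E E" by (rule ident_Hom[OF cE])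
  have gp: "?c \<gamma> \<pi> \<in> Hom E E"
    unfolding compose_def by (rule restrict_Hom[OF cE chom_comp[OF cE mQ mE Hom_chom[OF g(1)] ph(1)]])
  have S: "?c (antipode E) (?c \<gamma> \<pi>) \<in> Hom E E" using gp cE E by auto
  \<comment> \<open>Now \<open>j\<close> sends \<open>e\<close> to
    \<open>S(\<gamma>(\<pi> e1)) e2\<close>, with the section on the left, because the spanning
    products of the ideal have their coinvariant factor on the right.\<close>
  define j where "j = conv E E (?c (antipode E) (?c \<gamma> \<pi>)) ?i"
  have j: "j \<in> Hom E E" unfolding j_def using i S cE E by auto
  interpret GE: group "conv_group E E" by (rule group_conv[OF cE E])
  interpret GQ: group "conv_group E Q" by (rule group_conv[OF cE Q])
  have rec: "conv E E (?c \<gamma> \<pi>) j = ?i"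
    unfolding j_def using GE.inv_solve_left[of "?i" "?c \<gamma> \<pi>" j] gp i S j group_conv(2)[OF cE E gp]
      GE.m_assoc[of "?c \<gamma> \<pi>" "m_inv (conv_group E E) (?c \<gamma> \<pi>)" ?i] GE.r_inv[of "?c \<gamma> \<pi>"] GE.l_one[of ?i]
    by simp
  have pi: "?c \<pi> ?i \<in> Hom E Q" using i by (intro compose_hopf_hom[OF cE E Q p])
  have "?c \<pi> (?c (antipode E) (?c \<gamma> \<pi>)) = ?c (antipode Q) (?c \<pi> ?i)"
    using ph(4,5) Hom_closed[OF g(1)] g(3) by (auto simp: compose_def fun_eq_iff)
  then have pj: "?c \<pi> j = conv_one E Q"
    unfolding j_def using conv_hopf_hom[OF cE E Q p S i] GQ.l_inv[of "?c \<pi> ?i"] pi group_conv(2)[OF cE Q pi] by simp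
  have t: "\<pi> (j e) = counit E e \<odot>\<^bsub>Q\<^esub> \<one>\<^bsub>Q\<^esub>" if "e \<in> carrier E" for e
    using fun_cong[OF pj, of e] that by (simp add: compose_def conv_one_def)
  have jc: "j e \<in> coinv E Q \<pi>" if "e \<in> carrier E" for e
    by (rule coinvI_point[OF cE cE Q ph(6) Hom_chom[OF j] t that])
  let ?N = "linear_span K E ?G" and ?U = "quotient_module E (linear_span K E ?G)"
  let ?P = "\<lambda>x. ?N +>\<^bsub>E\<^esub> x"
  note qf = quotient_facts[OF mE sN]
  interpret N: abelian_subgroup ?N E by (rule submodule_abelian_subgroup[OF mE sN])
  have gl: "?c \<gamma> \<pi> \<in> lin E E" by (rule Hom_lin[OF gp])
  have bj: "(\<lambda>a b. ?c \<gamma> \<pi> a \<otimes>\<^bsub>E\<^esub> j b) \<in> bil E E E" by (rule bil_comp[OF hopf_mult_bil[OF E] gl Hom_lin[OF j]])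
  \<comment> \<open>\<open>j b - \<epsilon>(b) 1\<close> is coinvariant and has counit zero, so
    \<open>x\<close> times it is one of the spanning products.\<close>
  have P: "?P (x \<otimes>\<^bsub>E\<^esub> j b) = counit E b \<odot>\<^bsub>?U\<^esub> ?P x" if x: "x \<in> carrier E" and b: "b \<in> carrier E" for x b
  proof -
    let ?e = "counit E b \<odot>\<^bsub>E\<^esub> \<one>\<^bsub>E\<^esub>"
    note sE = Em.submoduleE[OF cc(1)]
    have c: "j b \<in> carrier E" "counit E b \<in> carrier K" "?e \<in> carrier E" using Hom_closed[OF j b] cE b by auto
    have "counit E ?e = counit E b"
      using b cE by (simp add: lin_smult[OF counit_lin[OF cE]] HE.counit_one)
    then have "counit E (j b \<ominus>\<^bsub>E\<^esub> ?e) = counit E b \<ominus>\<^bsub>G\<^esub> counit E b"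
      using c by (simp add: lin_minus[OF counit_lin[OF cE] mE module_ground] chom_counit[OF Hom_chom[OF j] b])
    also have "\<dots> = \<zero>\<^bsub>K\<^esub>"
      using abelian_group.r_neg[OF module.axioms(2)[OF module_ground], of "counit E b"] c(2) by (simp add: a_minus_def)
    finally have "x \<otimes>\<^bsub>E\<^esub> (j b \<ominus>\<^bsub>E\<^esub> ?e) \<in> ?G"
      using x sE(5)[OF jc[OF b] sE(3)[OF sE(4)[OF c(2) cc(2)]]] by (auto simp: a_minus_def)
    moreover have "x \<otimes>\<^bsub>E\<^esub> (j b \<ominus>\<^bsub>E\<^esub> ?e) = x \<otimes>\<^bsub>E\<^esub> j b \<ominus>\<^bsub>E\<^esub> counit E b \<odot>\<^bsub>E\<^esub> x"
      using x c by (simp add: a_minus_def RE.r_distr RE.r_minus HE.smult_mult_right)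
    ultimately have "x \<otimes>\<^bsub>E\<^esub> j b \<ominus>\<^bsub>E\<^esub> counit E b \<odot>\<^bsub>E\<^esub> x \<in> ?N"
      using lin_span_superset[of ?G E] by auto
    then have "x \<otimes>\<^bsub>E\<^esub> j b \<in> ?N +>\<^bsub>E\<^esub> (counit E b \<odot>\<^bsub>E\<^esub> x)"
      using x c by (simp add: N.a_rcos_module a_minus_def)
    then have "?P (x \<otimes>\<^bsub>E\<^esub> j b) = ?P (counit E b \<odot>\<^bsub>E\<^esub> x)"
      using N.a_repr_independence'[of "x \<otimes>\<^bsub>E\<^esub> j b" "counit E b \<odot>\<^bsub>E\<^esub> x"] x c(2) by simp
    then show ?thesis using lin_smult[OF qf(2) c(2) x] by simp
  qed
  have "e \<in> ?N" if e: "e \<in> a_kernel E Q \<pi>" for e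
  proof -
    have eE: "e \<in> carrier E" and gpe: "?c \<gamma> \<pi> e = \<zero>\<^bsub>E\<^esub>"
      using e lin_zero[OF Hom_lin[OF g(1)] mQ mE] by (auto simp: ker compose_def)
    have "?P e = ?P (sw E E (\<lambda>a b. ?c \<gamma> \<pi> a \<otimes>\<^bsub>E\<^esub> j b) e)"
      using fun_cong[OF rec, of e] eE by (simp add: conv_apply)
    also have "\<dots> = sw E ?U (\<lambda>a b. ?P (?c \<gamma> \<pi> a \<otimes>\<^bsub>E\<^esub> j b)) e"
      by (rule sw_push[OF cE mE qf(1) bj qf(2) eE])
    also have "\<dots> = sw E ?U (\<lambda>a b. counit E b \<odot>\<^bsub>?U\<^esub> ?P (?c \<gamma> \<pi> a)) e"
      by (intro sw_cong P Hom_closed[OF gp])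
    \<comment> \<open>For \<open>e\<close> in the kernel the surviving term is the class of
      \<open>\<gamma>(\<pi> e) = \<gamma>(0) = 0\<close>.\<close>
    also have "\<dots> = ?P \<zero>\<^bsub>E\<^esub>"
      using sw_counit_right[OF cE qf(1) lin_comp[OF qf(2) gl] eE] by (simp only: gpe)
    also have "\<dots> = ?N"
      using lin_zero[OF qf(2) mE qf(1)] by (simp add: quotient_module_def)
    finally show ?thesis using N.a_rcos_self[OF eE] by simp
  qed
  with 1 show ?thesis by blast
qed

text \<open>The section yields surjectivity of \<open>\<pi>\<close>, and a normalised section yields
  the description of the kernel by \<open>kernel_of_split\<close>.\<close>

lemma split_extensions_iff:
  assumes A: "hopf A" and Q: "hopf Q"
  shows "(E, \<iota>, \<pi>) \<in> splits A Q \<longleftrightarrow> hopf E \<and> \<iota> \<in> hhom A E \<and> \<pi> \<in> hhom E Q \<and>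
    inj_on \<iota> (carrier A) \<and> \<iota> ` carrier A = coinv E Q \<pi> \<and> has_coalgebra_section K E Q \<pi>" (is "?L \<longleftrightarrow> ?R")
proof
  assume R: ?R
  then obtain \<gamma> where s: "normal_section E Q \<pi> \<gamma>" using normal_section_exists[of E Q \<pi>] Q by blast
  note g = normal_sectionD[OF s]
  have "\<pi> ` carrier E = carrier Q"
  proof
    show "\<pi> ` carrier E \<subseteq> carrier Q" using R hopf_homD(5)[of \<pi> E Q] by blast
    show "carrier Q \<subseteq> \<pi> ` carrier E" using g(3) Hom_closed[OF g(1)] by (metis imageI subsetI)
  qed
  then show ?L
    using R kernel_of_split[OF _ Q _ s] by (simp add: split_extensions_def extension_def)
qed (auto simp: split_extensions_def extension_def)

text \<open>A Hopf map over \<open>Q\<close> carries coinvariants to coinvariants, since it can be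
  applied to the left factor of the defining equation; equality needs this for the inverse
  too.\<close>

lemma coinv_iso:
  fixes Q (structure)
  assumes E: "hopf E" and E': "hopf E'" and Q: "hopf Q" and f: "f \<in> hiso E E'"
    and p: "\<pi> \<in> lin E Q" and p': "\<pi>' \<in> lin E' Q" and pf: "\<And>e. e \<in> carrier E \<Longrightarrow> \<pi>' (f e) = \<pi> e"
  shows "coinv E' Q \<pi>' = f ` coinv E Q \<pi>"
proof -
  \<comment> \<open>Stated for Hopf maps between arbitrary Hopf algebras over \<open>Q\<close>, so
    that it covers \<open>f\<close> as well as its inverse.\<close>
  have *: "f e \<in> coinv E' Q \<pi>'"
    if E: "hopf E" and E': "hopf E'" and f: "f \<in> hhom E E'" and p: "\<pi> \<in> lin E Q" and p': "\<pi>' \<in> lin E' Q"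
      and pf: "\<And>e. e \<in> carrier E \<Longrightarrow> \<pi>' (f e) = \<pi> e" and e: "e \<in> coinv E Q \<pi>"
    for E :: "('k, 'v, 'vv) hopf_algebra_scheme" and E' :: "('k, 'w, 'ww) hopf_algebra_scheme" and f \<pi> \<pi>' e
  proof -
    have m: "md E" "md E'" "md Q" using E E' Q by auto
    note fh = hopf_homD[OF f]
    have oneQ: "\<one> \<in> carrier Q" using pre_hopfD(3)[OF hopf_pre_hopf[OF Q]] .
    have eE: "e \<in> carrier E" and eq: "tm E E E Q (\<lambda>x. x) \<pi> (comult E e) = pt E Q e \<one>"
      using e by (simp_all add: coinvariants_def)
    have d: "comult E e \<in> carrier (T E E)" using eE E by auto
    have "tm E' E' E' Q (\<lambda>x. x) \<pi>' (comult E' (f e)) = tm E E E' Q f (\<lambda>x. \<pi>' (f x)) (comult E e)"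
      using m fh(6) p' d by (simp add: chom_tm[OF fh(1) eE] tm_tm lin_id)
    also have "\<dots> = tm E E E' Q f \<pi> (comult E e)"
      using pf tm_cong[of E f f E "\<lambda>x. \<pi>' (f x)" \<pi> E' Q] by simp
    also have "\<dots> = tm E Q E' Q f (\<lambda>x. x) (tm E E E Q (\<lambda>x. x) \<pi> (comult E e))"
      using m fh(6) p d by (simp add: tm_tm lin_id)
    also have "\<dots> = pt E' Q (f e) \<one>"
      using m fh(6) eE oneQ by (simp add: eq tm_pt lin_id)
    finally show ?thesis using fh(5)[OF eE] by (simp add: coinvariants_def)
  qed
  let ?g = "inv_into (carrier E) f"
  have g: "?g \<in> hhom E' E" using hopf_isoD(1)[OF hopf_iso_inv[OF E E' f]] .
  have b: "bij_betw f (carrier E) (carrier E')" using hopf_isoD(2)[OF f] .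
  have fg: "f (?g y) = y" "?g y \<in> carrier E" if "y \<in> carrier E'" for y
    using b that by (auto simp: bij_betw_def f_inv_into_f inv_into_into)
  show ?thesis
  proof
    show "f ` coinv E Q \<pi> \<subseteq> coinv E' Q \<pi>'"
      using *[OF E E' hopf_isoD(1)[OF f] p p' pf] by blast
    show "coinv E' Q \<pi>' \<subseteq> f ` coinv E Q \<pi>"
    proof
      fix y assume y: "y \<in> coinv E' Q \<pi>'"
      then have yE: "y \<in> carrier E'" by (simp add: coinvariants_def)
      have "?g y \<in> coinv E Q \<pi>"
        by (rule *[OF E' E g p' p _ y]) (use fg pf in \<open>metis\<close>)
      then show "y \<in> f ` coinv E Q \<pi>" using fg(1)[OF yE] by (metis imageI)
    qed
  qed
qed

lemma split_extension_transfer: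
  assumes A: "hopf A" and Q: "hopf Q" and X: "(E, \<iota>, \<pi>) \<in> splits A Q" and E': "hopf E'"
    and f: "f \<in> hiso E E'"
  defines "g \<equiv> inv_into (carrier E) f"
  shows "(E', \<lambda>a. f (\<iota> a), \<lambda>y. \<pi> (g y)) \<in> splits A Q"
    and "exteq A (E, \<iota>, \<pi>) (E', \<lambda>a. f (\<iota> a), \<lambda>y. \<pi> (g y))"
proof -
  note R = X[unfolded split_extensions_iff[OF A Q]]
  have E: "hopf E" and i: "\<iota> \<in> hhom A E" and p: "\<pi> \<in> hhom E Q" and inj: "inj_on \<iota> (carrier A)"
    and im: "\<iota> ` carrier A = coinv E Q \<pi>" and s: "has_coalgebra_section K E Q \<pi>" using R by auto
  have fh: "f \<in> hhom E E'" and b: "bij_betw f (carrier E) (carrier E')"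
    using hopf_isoD[OF f] by auto
  have g: "g \<in> hhom E' E" unfolding g_def using hopf_isoD(1)[OF hopf_iso_inv[OF E E' f]] .
  have gf: "g (f x) = x" if "x \<in> carrier E" for x
    unfolding g_def using b that by (simp add: bij_betw_def)
  have i': "(\<lambda>a. f (\<iota> a)) \<in> hhom A E'" by (rule hopf_hom_comp[OF A E E' fh i])
  have p': "(\<lambda>y. \<pi> (g y)) \<in> hhom E' Q" by (rule hopf_hom_comp[OF E' E Q p g])
  have inj': "inj_on (\<lambda>a. f (\<iota> a)) (carrier A)"
    using inj b hopf_homD(5)[OF i] by (auto simp: inj_on_def bij_betw_def)
  have "coinv E' Q (\<lambda>y. \<pi> (g y)) = f ` coinv E Q \<pi>"
    by (rule coinv_iso[OF E E' Q f hopf_homD(6)[OF p] hopf_homD(6)[OF p']]) (simp add: gf)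
  then have im': "(\<lambda>a. f (\<iota> a)) ` carrier A = coinv E' Q (\<lambda>y. \<pi> (g y))"
    by (simp only: im[symmetric] image_image)
  obtain c where c: "c \<in> chom Q E" "\<And>q. q \<in> carrier Q \<Longrightarrow> \<pi> (c q) = q"
    using s by (auto simp: has_coalgebra_section_def)
  have "(\<lambda>q. f (c q)) \<in> chom Q E'"
    using Q E E' hopf_homD(1)[OF fh] c(1) by (intro chom_comp[of Q E E']) auto
  then have s': "has_coalgebra_section K E' Q (\<lambda>y. \<pi> (g y))"
    unfolding has_coalgebra_section_def using c chom_closed[OF c(1)] gf by (intro bexI[of _ "\<lambda>q. f (c q)"]) auto
  show "(E', \<lambda>a. f (\<iota> a), \<lambda>y. \<pi> (g y)) \<in> splits A Q"
    unfolding split_extensions_iff[OF A Q] using E' i' p' inj' im' s' by blast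
  show "exteq A (E, \<iota>, \<pi>) (E', \<lambda>a. f (\<iota> a), \<lambda>y. \<pi> (g y))"
    unfolding ext_equivalent_def by (simp, rule bexI[OF _ f]) (simp add: gf)
qed

lemma ext_equivalent_refl: "hopf E \<Longrightarrow> exteq A (E, \<iota>, \<pi>) (E, \<iota>, \<pi>)"
  unfolding ext_equivalent_def
  by (simp, rule bexI[of _ "\<lambda>x. x"]) (auto simp: hopf_iso_def hopf_hom_id bij_betw_def)

lemma ext_equivalent_sym:
  assumes E: "hopf E" and E': "hopf E'" and i: "\<iota> \<in> carrier A \<rightarrow> carrier E"
    and eq: "exteq A (E, \<iota>, \<pi>) (E', \<iota>', \<pi>')"
  shows "exteq A (E', \<iota>', \<pi>') (E, \<iota>, \<pi>)"
proof -
  obtain f where f: "f \<in> hiso E E'" "\<And>a. a \<in> carrier A \<Longrightarrow> f (\<iota> a) = \<iota>' a"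
    "\<And>e. e \<in> carrier E \<Longrightarrow> \<pi>' (f e) = \<pi> e"
    using eq by (auto simp: ext_equivalent_def)
  let ?g = "inv_into (carrier E) f"
  note b = hopf_isoD(2)[OF f(1)]
  have "?g (\<iota>' a) = \<iota> a" if "a \<in> carrier A" for a
    using b i that f(2)[OF that, symmetric] by (auto simp: bij_betw_def Pi_iff)
  moreover have "\<pi> (?g y) = \<pi>' y" if "y \<in> carrier E'" for y
    using b that f(3)[of "?g y"] by (auto simp: bij_betw_def inv_into_into f_inv_into_f)
  ultimately show ?thesis
    unfolding ext_equivalent_def using hopf_iso_inv[OF E E' f(1)] by auto
qed

lemma ext_equivalent_trans:
  assumes "hopf E" "hopf E'" "hopf E''"
    and "exteq A (E, \<iota>, \<pi>) (E', \<iota>', \<pi>')" "exteq A (E', \<iota>', \<pi>') (E'', \<iota>'', \<pi>'')"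
  shows "exteq A (E, \<iota>, \<pi>) (E'', \<iota>'', \<pi>'')"
proof -
  obtain f where f: "f \<in> hiso E E'" "\<And>a. a \<in> carrier A \<Longrightarrow> f (\<iota> a) = \<iota>' a"
    "\<And>e. e \<in> carrier E \<Longrightarrow> \<pi>' (f e) = \<pi> e"
    using assms(4) by (auto simp: ext_equivalent_def)
  obtain g where g: "g \<in> hiso E' E''" "\<And>a. a \<in> carrier A \<Longrightarrow> g (\<iota>' a) = \<iota>'' a"
    "\<And>e. e \<in> carrier E' \<Longrightarrow> \<pi>'' (g e) = \<pi>' e"
    using assms(5) by (auto simp: ext_equivalent_def)
  have "(\<lambda>x. g (f x)) \<in> hiso E E''" by (rule hopf_iso_comp[OF assms(1-3) g(1) f(1)])
  moreover have "\<pi>'' (g (f e)) = \<pi> e" if "e \<in> carrier E" for e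
    using f(3) g(3) hopf_homD(5)[OF hopf_isoD(1)[OF f(1)] that] that by simp
  ultimately show ?thesis
    unfolding ext_equivalent_def using f(2) g(2) by (auto intro!: bexI[of _ "\<lambda>x. g (f x)"])
qed

text \<open>The two conditions are equations in different spaces, \<open>E \<otimes> Q\<close> and
  \<open>W \<otimes> Q\<close>; the inclusion between them is injective by \<open>tm_inj\<close> and
  identifies them.\<close>

lemma coinv_sub:
  fixes Q (structure) and W :: "('k, 'w) hopf_algebra"
  assumes W: "hopf W" and E: "hsub W E" and Q: "hopf Q" and p: "\<pi> \<in> lin W Q"
  shows "coinv (sub W E) Q \<pi> = E \<inter> coinv W Q \<pi>"
proof -
  let ?S = "sub W E"
  note ih = hopf_homD[OF sub_hopf_incl[OF W E]]
  have m: "md W" "md ?S" "md Q" using W sub_hopf_hopf[OF W E] Q by auto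
  have oneQ: "\<one> \<in> carrier Q" using pre_hopfD(3)[OF hopf_pre_hopf[OF Q]] .
  interpret Wm: module K W using m by simp
  have sub: "E \<subseteq> carrier W" using Wm.submoduleE(1)[OF hopf_subalgebraD(1)[OF E]] .
  have pS: "\<pi> \<in> lin ?S Q" using lin_comp[OF p ih(6)] .
  have inj: "inj_on (tm ?S Q W Q (\<lambda>x. x) (\<lambda>x. x)) (carrier (T ?S Q))"
    using m ih(6) by (intro tm_inj lin_id) auto
  have key: "x \<in> coinv ?S Q \<pi> \<longleftrightarrow> x \<in> coinv W Q \<pi>" if x: "x \<in> E" for x
  proof -
    have xW: "x \<in> carrier W" using sub x by blast
    note cm = sub_hopf_comult[OF m(1) E x]
    have "tm ?S Q W Q (\<lambda>x. x) (\<lambda>x. x) (tm ?S ?S ?S Q (\<lambda>x. x) \<pi> (comult ?S x)) = tm ?S ?S W Q (\<lambda>x. x) \<pi> (comult ?S x)"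
      using m ih(6) pS cm by (simp add: tm_tm lin_id)
    also have "\<dots> = tm W W W Q (\<lambda>x. x) \<pi> (tm ?S ?S W W (\<lambda>x. x) (\<lambda>x. x) (comult ?S x))"
      using m ih(6) p cm(1) by (simp add: tm_tm lin_id)
    also have "\<dots> = tm W W W Q (\<lambda>x. x) \<pi> (comult W x)" by (simp only: cm(2))
    finally have 1: "tm ?S Q W Q (\<lambda>x. x) (\<lambda>x. x) (tm ?S ?S ?S Q (\<lambda>x. x) \<pi> (comult ?S x)) = tm W W W Q (\<lambda>x. x) \<pi> (comult W x)" .
    have 2: "tm ?S Q W Q (\<lambda>x. x) (\<lambda>x. x) (pt ?S Q x \<one>) = pt W Q x \<one>"
      using m ih(6) x oneQ by (simp add: tm_pt lin_id)
    have 3: "tm ?S ?S ?S Q (\<lambda>x. x) \<pi> (comult ?S x) \<in> carrier (T ?S Q)" "pt ?S Q x \<one> \<in> carrier (T ?S Q)"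
      using m pS cm x oneQ by (auto intro!: tm_closed lin_id)
    have "tm ?S ?S ?S Q (\<lambda>x. x) \<pi> (comult ?S x) = pt ?S Q x \<one> \<longleftrightarrow>
        tm W W W Q (\<lambda>x. x) \<pi> (comult W x) = pt W Q x \<one>"
      using inj_on_eq_iff[OF inj 3] unfolding 1 2 by simp
    then show ?thesis using x xW by (simp add: coinvariants_def)
  qed
  show ?thesis
  proof (intro equalityI subsetI)
    fix x assume x: "x \<in> coinv ?S Q \<pi>"
    then have "x \<in> E" by (simp add: coinvariants_def)
    then show "x \<in> E \<inter> coinv W Q \<pi>" using key x by blast
  qed (use key in blast)
qed

section \<open>Admissible Hopf subalgebras\<close>

text \<open>The product of the two projections is the generic product; evaluating an identity about
  it at \<open>x \<otimes> y\<close> gives multiplicativity on elements.\<close>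

lemma hopf_homI_points:
  assumes H: "hopf H" and H': "hopf H'" and \<Phi>: "\<Phi> \<in> chom H H'"
    and mult: "cmp (H \<otimes>\<^sub>c H) \<Phi> (conv (H \<otimes>\<^sub>c H) H (p1 H H) (p2 H H)) =
      conv (H \<otimes>\<^sub>c H) H' (cmp (H \<otimes>\<^sub>c H) \<Phi> (p1 H H)) (cmp (H \<otimes>\<^sub>c H) \<Phi> (p2 H H))"
  shows "\<Phi> \<in> hhom H H'"
proof (rule hopf_homI[OF H H' \<Phi>])
  fix x y assume xy: "x \<in> carrier H" "y \<in> carrier H"
  have c: "coalg H" and m: "md H'" using H H' by auto
  have t: "pt H H x y \<in> carrier (H \<otimes>\<^sub>c H)" using xy c by simp
  have "\<Phi> (x \<otimes>\<^bsub>H\<^esub> y) = cmp (H \<otimes>\<^sub>c H) \<Phi> (conv (H \<otimes>\<^sub>c H) H (p1 H H) (p2 H H)) (pt H H x y)"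
    by (simp only: compose_eq[OF t] conv_proj_pure[OF hopf_pre_hopf[OF H] xy])
  also have "\<dots> = \<Phi> x \<otimes>\<^bsub>H'\<^esub> \<Phi> y"
    unfolding mult by (rule conv_pure[OF c c m hopf_mult_bil[OF H'] chom_lin[OF \<Phi>] chom_lin[OF \<Phi>] xy])
  finally show "\<Phi> (x \<otimes>\<^bsub>H\<^esub> y) = \<Phi> x \<otimes>\<^bsub>H'\<^esub> \<Phi> y" .
qed

lemma hopf_iso_cong:
  assumes "hopf B" "hopf H" "f \<in> hiso B H" "\<And>x. x \<in> carrier B \<Longrightarrow> f x = g x"
  shows "g \<in> hiso B H"
  using hopf_hom_cong[OF assms(1,2) hopf_isoD(1)[OF assms(3)] assms(4)] hopf_isoD(2)[OF assms(3)] bij_betw_cong[of "carrier B" f g] assms(4)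
  by (simp add: hopf_iso_def)

text \<open>The coinvariants are the image of the coalgebra map \<open>e \<mapsto> e\<^sub>1 S(\<gamma>(\<pi> e\<^sub>2))\<close>, so they
  form a subcoalgebra.\<close>

lemma coinv_hopf_subalgebra:
  fixes W :: "('k, 'w) hopf_algebra"
  assumes W: "hopf W" and E: "hsub W E" and Q: "hopf Q"
    and p: "\<pi> \<in> hhom (sub W E) Q" and s: "has_coalgebra_section K (sub W E) Q \<pi>"
  shows "hsub W (coinv (sub W E) Q \<pi>)"
proof -
  let ?S = "sub W E"
  have S: "hopf ?S" by (rule sub_hopf_hopf[OF W E])
  obtain \<gamma> where g: "normal_section ?S Q \<pi> \<gamma>" by (rule normal_section_exists[OF S Q p s])
  note c = coinv_closed[OF S Q p g]
  obtain j where j: "j \<in> Hom ?S ?S" "j ` carrier ?S = coinv ?S Q \<pi>"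
    using coinv_section(1,2)[OF S Q p g] by blast
  have m: "md ?S" "md W" and cS: "coalg ?S" using S W by auto
  have "(\<lambda>x. j x) \<in> chom ?S W"
    by (rule chom_comp[OF cS m hopf_homD(1)[OF sub_hopf_incl[OF W E]] Hom_chom[OF j(1)]])
  note im = comult_image[OF cS m(2) this, unfolded j(2)]
  show ?thesis
    unfolding hopf_subalgebra_def
  proof (intro conjI ballI)
    show "submodule (coinv ?S Q \<pi>) K W" by (rule im(1))
    show "comult W x \<in> sub_tensor_incl K W (coinv ?S Q \<pi>) ` sub_tensors K W (coinv ?S Q \<pi>)" if "x \<in> coinv ?S Q \<pi>" for x
      by (rule im(2)[OF that])
  qed (use c in simp_all)
qed

end

context exponential_data
begin

section \<open>Projection, base and evaluation at \<open>1\<close> in the wreath product\<close>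

lemma wreath_proj_eq: "wreath_proj K Q X = p2 X Q"
  by (simp add: wreath_proj_def p2_def)

lemma proj_hopf_hom: "p2 X Q \<in> hhom W Q"
proof (rule hopf_homI[OF W_hopf Q])
  show "p2 X Q \<in> chom W Q" using Hom_chom[OF proj_Hom(2)[OF cX cQ]] by simp
  fix x y assume xy: "x \<in> carrier W" "y \<in> carrier W"
  let ?E = "Y \<otimes>\<^sub>c Y"
  have E: "coalg ?E" by auto
  have st: "p1 Y Y \<in> Hom ?E Y" "p2 Y Y \<in> Hom ?E Y" by auto
  have xyT: "x \<in> carrier (T X Q)" "y \<in> carrier (T X Q)" "x \<in> carrier Y" "y \<in> carrier Y" using xy by simp_all
  have t: "pt Y Y x y \<in> carrier ?E" using xyT by simp
  have pl: "p2 X Q \<in> lin Y Q" using Hom_lin[OF proj_Hom(2)[OF cX cQ]] .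
  have "wQ ?E W_mult_map = conv ?E Q (wQ ?E (p1 Y Y)) (wQ ?E (p2 Y Y))"
    unfolding Let_def using E st by simp
  from fun_cong[OF this, of "pt Y Y x y"]
  have "p2 X Q (W_mult_map (pt Y Y x y)) = conv ?E Q (wQ ?E (p1 Y Y)) (wQ ?E (p2 Y Y)) (pt Y Y x y)"
    unfolding wQ_def[of ?E W_mult_map] compose_eq[OF t] .
  also have "\<dots> = p2 X Q x \<otimes>\<^bsub>Q\<^esub> p2 X Q y"
    unfolding wQ_def by (rule conv_pure[OF cY cY mQ multQ_bil pl pl xyT(3,4)])
  finally show "p2 X Q (x \<otimes>\<^bsub>W\<^esub> y) = p2 X Q x \<otimes>\<^bsub>Q\<^esub> p2 X Q y"
    by (simp only: W_mult_map_pure[OF xyT(3,4)])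
qed

lemma counit_Q_one [simp]: "counit Q \<one>\<^bsub>Q\<^esub> = \<one>\<^bsub>K\<^esub>"
  by (rule pre_hopfD(7)[OF preQ])

lemma proj1_base [simp]: "x \<in> carrier X \<Longrightarrow> p1 X Q (pt X Q x \<one>\<^bsub>Q\<^esub>) = x"
  by (simp add: proj1_pure module.smult_one[OF mX])

lemma eval_one_base: "x \<in> carrier X \<Longrightarrow> eval_one K Q X ev (pt X Q x \<one>\<^bsub>Q\<^esub>) = ev (pt X Q x \<one>\<^bsub>Q\<^esub>)"
proof -
  assume x: "x \<in> carrier X"
  have "(THE y. y \<in> carrier X \<and> pt X Q x \<one>\<^bsub>Q\<^esub> = pt X Q y \<one>\<^bsub>Q\<^esub>) = x"
    by (rule the_equality) (use x proj1_base in metis)+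
  then show ?thesis by (simp add: eval_one_def)
qed

text \<open>Agrees with \<open>eval_one\<close> on the base and extends it to the whole wreath
  product by sending \<open>x \<otimes> q\<close> to \<open>\<epsilon>(q) (x@1)\<close>. This
  extension is a coalgebra map, so it applies to arbitrary points of \<open>W\<close>.\<close>

definition eval1 :: "('k, 'x, 'q) tensor \<Rightarrow> 'a" where
  "eval1 w = ev (pt X Q (p1 X Q w) \<one>\<^bsub>Q\<^esub>)"

lemma eval_one_eq: "w \<in> base \<Longrightarrow> eval_one K Q X ev w = eval1 w"
  by (auto simp: wreath_base_def eval_one_base eval1_def)

lemma pair_one_apply: "coalg C \<Longrightarrow> x \<in> Hom C X \<Longrightarrow> c \<in> carrier C \<Longrightarrow>
    pair C X Q x (conv_one C Q) c = pt X Q (x c) \<one>\<^bsub>Q\<^esub>"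
  unfolding conv_one_const by (intro pairing_const mX mQ Hom_lin Q_one_closed)

lemma at_one_apply:
  assumes "coalg C" "x \<in> Hom C X" "c \<in> carrier C"
  shows "at C x (conv_one C Q) c = ev (pt X Q (x c) \<one>\<^bsub>Q\<^esub>)"
  unfolding at_def compose_eq[OF assms(3)] pair_one_apply[OF assms] ..

lemma at_wX_one:
  assumes "coalg C" "w \<in> Hom C Y"
  shows "at C (wX C w) (conv_one C Q) = cmp C eval1 w"
proof (rule extensionalityI[where A = "carrier C"])
  have w: "wX C w \<in> Hom C X" using assms by auto
  show "at C (wX C w) (conv_one C Q) c = cmp C eval1 w c" if "c \<in> carrier C" for c
    using that by (subst at_one_apply[OF assms(1) w that]) (simp add: wX_def eval1_def compose_eq)
qed (use assms in \<open>auto intro!: Hom_ext[where D = A]\<close>)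

lemma eval1_chom: "eval1 \<in> chom Y A"
proof (rule chom_cong[OF _ cY])
  show "at Y (p1 X Q) (conv_one Y Q) \<in> chom Y A" by (rule Hom_chom) auto
  show "at Y (p1 X Q) (conv_one Y Q) w = eval1 w" if "w \<in> carrier Y" for w
    by (subst at_one_apply[OF cY _ that]) (simp_all add: eval1_def)
qed

lemma base_hom: "(\<lambda>x. pt X Q x \<one>\<^bsub>Q\<^esub>) \<in> hhom XH W"
proof (rule hopf_homI_points[OF XH_hopf W_hopf])
  let ?i = "\<lambda>x\<in>carrier X. x" and ?o = "conv_one X Q"
  have i: "?i \<in> Hom X X" by (rule ident_Hom) simp
  have P: "pair X X Q ?i ?o \<in> Hom X Y" using i by auto
  have Pe: "pair X X Q ?i ?o x = pt X Q x \<one>\<^bsub>Q\<^esub>" if "x \<in> carrier X" for x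
    using pair_one_apply[OF cX i that] that by simp
  have "(\<lambda>x. pt X Q x \<one>\<^bsub>Q\<^esub>) \<in> chom X Y" by (rule chom_cong[OF Hom_chom[OF P] cX Pe])
  then show "(\<lambda>x. pt X Q x \<one>\<^bsub>Q\<^esub>) \<in> chom XH W" by simp
  let ?C = "X \<otimes>\<^sub>c X"
  let ?b = "\<lambda>x. pt X Q x \<one>\<^bsub>Q\<^esub>"
  have C: "coalg ?C" "small ?C" by auto
  have p: "p1 X X \<in> Hom ?C X" "p2 X X \<in> Hom ?C X" by auto
  interpret GQ: group "conv_group ?C Q" by (rule group_conv[OF C(1) Q])
  have o: "conv_one ?C Q \<in> Hom ?C Q" by (rule conv_one_Hom[OF preQ C(1)])
  have b: "cmp ?C ?b x = pair ?C X Q x (conv_one ?C Q)" if x: "x \<in> Hom ?C X" for x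
  proof (rule extensionalityI[where A = "carrier ?C"])
    have "pair ?C X Q x (conv_one ?C Q) \<in> Hom ?C Y" using x by auto
    then show "pair ?C X Q x (conv_one ?C Q) \<in> extensional (carrier ?C)" by (rule Hom_ext)
  qed (simp_all add: compose_eq pair_one_apply[OF C(1) x] del: tensor_coalgebra_mem)
  have cp: "conv ?C XH (p1 X X) (p2 X X) \<in> Hom ?C X" using C p by auto
  show "cmp (XH \<otimes>\<^sub>c XH) ?b (conv (XH \<otimes>\<^sub>c XH) XH (p1 XH XH) (p2 XH XH)) =
      conv (XH \<otimes>\<^sub>c XH) W (cmp (XH \<otimes>\<^sub>c XH) ?b (p1 XH XH)) (cmp (XH \<otimes>\<^sub>c XH) ?b (p2 XH XH))"
    using C p o act_laws(4)[OF C o o p(2,2)] GQ.l_one[of "conv_one ?C Q"] cp by (simp add: b conv_W)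
qed

lemma ev_one_hom: "(\<lambda>x. ev (pt X Q x \<one>\<^bsub>Q\<^esub>)) \<in> hhom XH A"
proof (rule hopf_homI_points[OF XH_hopf A])
  let ?e = "\<lambda>x. ev (pt X Q x \<one>\<^bsub>Q\<^esub>)"
  have i: "(\<lambda>x\<in>carrier X. x) \<in> Hom X X" by (rule ident_Hom) simp
  have "?e \<in> chom X A"
    by (rule chom_cong[OF Hom_chom[OF at_Hom[OF cX i conv_one_Hom[OF preQ cX]]] cX])
      (subst at_one_apply[OF cX i], simp_all)
  then show "?e \<in> chom XH A" by simp
  let ?C = "X \<otimes>\<^sub>c X"
  have C: "coalg ?C" by auto
  have p: "p1 X X \<in> Hom ?C X" "p2 X X \<in> Hom ?C X" by auto
  have o: "conv_one ?C Q \<in> Hom ?C Q" by (rule conv_one_Hom[OF preQ C])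
  have e: "cmp ?C ?e x = at ?C x (conv_one ?C Q)" if x: "x \<in> Hom ?C X" for x
    by (rule extensionalityI[where A = "carrier ?C"])
      (use Hom_ext[OF at_Hom[OF C x o]] in \<open>simp_all add: compose_eq at_one_apply[OF C x] del: tensor_coalgebra_mem\<close>)
  have cp: "conv ?C XH (p1 X X) (p2 X X) \<in> Hom ?C X" using C p by auto
  show "cmp (XH \<otimes>\<^sub>c XH) ?e (conv (XH \<otimes>\<^sub>c XH) XH (p1 XH XH) (p2 XH XH)) =
      conv (XH \<otimes>\<^sub>c XH) A (cmp (XH \<otimes>\<^sub>c XH) ?e (p1 XH XH)) (cmp (XH \<otimes>\<^sub>c XH) ?e (p2 XH XH))"
    using C p cp o by (simp add: e at_conv)
qed

lemma proj2_base: "x \<in> carrier X \<Longrightarrow> p2 X Q (pt X Q x \<one>\<^bsub>Q\<^esub>) = counit X x \<odot>\<^bsub>Q\<^esub> \<one>\<^bsub>Q\<^esub>"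
  by (simp add: proj2_pure)

lemma W_tensor_norm:
  "tm W W W V = tm (T X Q) (T X Q) (T X Q) V"
  by (intro ext same_tm W_same_module same_refl)

lemma coinv_W: "coinv W Q (p2 X Q) = base"
proof
  let ?T = "T X Q"
  note ph = hopf_homD[OF proj_hopf_hom]
  have pl: "p1 X Q \<in> lin ?T X" "p2 X Q \<in> lin ?T Q"
    using Hom_lin[OF proj_Hom(1)[OF cX cQ]] Hom_lin[OF proj_Hom(2)[OF cX cQ]] by simp_all
  show "coinv W Q (p2 X Q) \<subseteq> base"
  proof
    fix w assume w: "w \<in> coinv W Q (p2 X Q)"
    note d = coinvD[OF W_coalg Q ph(1) w]
    have wT: "w \<in> carrier ?T" and wY: "w \<in> carrier Y" using d(1) by simp_all
    have cw: "comult Y w \<in> carrier (T ?T ?T)" using comult_lin[OF cY] wT by (auto dest: lin_closed)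
    have b: "(\<lambda>a q. pt X Q (p1 X Q a) q) \<in> bil ?T Q ?T"
      by (rule bil_comp[OF pt_bil pl(1) lin_id]) auto
    have id: "(\<lambda>y\<in>carrier Y. y) \<in> Hom Y Y" by (rule ident_Hom) simp
    \<comment> \<open>\<open>w\<close> is recovered as \<open>p1(w1) \<otimes> p2(w2)\<close>, and
      coinvariance replaces \<open>w1 \<otimes> p2(w2)\<close> by \<open>w \<otimes> 1\<close>; what
      remains is \<open>p1(w) \<otimes> 1\<close>, an element of the base.\<close>
    have "w = pair Y X Q (p1 X Q) (p2 X Q) w"
      using pairing_eta[OF cY cX cQ id] compose_ident[OF proj_Hom(1)[OF cX cQ]] compose_ident[OF proj_Hom(2)[OF cX cQ]] wY
      by simp
    also have "\<dots> = tl Y Y ?T (\<lambda>a b. pt X Q (p1 X Q a) (p2 X Q b)) (comult Y w)"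
      unfolding pairing_apply[OF wY] sweedler_def ..
    also have "\<dots> = tl ?T ?T ?T (\<lambda>a b. pt X Q (p1 X Q a) (p2 X Q b)) (comult Y w)"
      by simp
    also have "\<dots> = tl ?T Q ?T (\<lambda>a q. pt X Q (p1 X Q a) q) (tm ?T ?T ?T Q (\<lambda>x. x) (p2 X Q) (comult Y w))"
      using pl b cw by (subst tl_tm) (auto intro: lin_id)
    also have "tm ?T ?T ?T Q (\<lambda>x. x) (p2 X Q) (comult Y w) = pt ?T Q w \<one>\<^bsub>Q\<^esub>"
      using d(2) by (simp add: W_tensor_norm)
    also have "tl ?T Q ?T (\<lambda>a q. pt X Q (p1 X Q a) q) (pt ?T Q w \<one>\<^bsub>Q\<^esub>) = pt X Q (p1 X Q w) \<one>\<^bsub>Q\<^esub>"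
      using b wT by (simp add: tensor_lift_pure)
    finally show "w \<in> base"
      using lin_closed[OF pl(1) wT] unfolding wreath_base_def by blast
  qed
  show "base \<subseteq> coinv W Q (p2 X Q)"
  proof
    fix w assume "w \<in> base"
    then obtain x where x: "x \<in> carrier X" "w = pt X Q x \<one>\<^bsub>Q\<^esub>" by (auto simp: wreath_base_def)
    have "(\<lambda>x. pt X Q x \<one>\<^bsub>Q\<^esub>) \<in> chom X W" using hopf_homD(1)[OF base_hom] by simp
    from coinvI_point[OF cX W_coalg Q ph(6) this proj2_base x(1)]
    show "w \<in> coinv W Q (p2 X Q)" by (simp add: x(2))
  qed
qed

lemma coinv_sub_W: "hsub W E \<Longrightarrow> coinv (sub W E) Q (p2 X Q) = E \<inter> base"
  using coinv_sub[OF W_hopf _ Q hopf_homD(6)[OF proj_hopf_hom]] by (simp add: coinv_W)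

lemma sub_W:
  assumes "hsub W E"
  shows "hopf (sub W E)" "(\<lambda>x. x) \<in> hhom (sub W E) W"
    "p2 X Q \<in> hhom (sub W E) Q" "E \<subseteq> carrier (T X Q)"
proof -
  show h: "hopf (sub W E)" "(\<lambda>x. x) \<in> hhom (sub W E) W"
    using sub_hopf_hopf[OF W_hopf assms] sub_hopf_incl[OF W_hopf assms] by auto
  show "p2 X Q \<in> hhom (sub W E) Q"
    using hopf_hom_comp[OF h(1) W_hopf Q proj_hopf_hom h(2)] by simp
  show "E \<subseteq> carrier (T X Q)" using hopf_homD(5)[OF h(2)] by auto
qed

section \<open>The extension attached to an admissible subalgebra\<close>

lemma admissibleD:
  assumes "E \<in> adm"
  shows "hsub W E" "has_coalgebra_section K (sub W E) Q (p2 X Q)"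
    and "eval_one K Q X ev \<in> hiso (sub W (E \<inter> base)) A"
  using assms coinv_sub_W[of E] by (auto simp: admissible_def Let_def wreath_proj_eq)

definition base_incl :: "('k, 'x, 'q) tensor set \<Rightarrow> 'a \<Rightarrow> ('k, 'x, 'q) tensor" where
  "base_incl E = inv_into (E \<inter> base) (eval_one K Q X ev)"

lemma assoc_extension_eq:
  "hsub W E \<Longrightarrow>
    assoc E = (sub W E, base_incl E, p2 X Q)"
  by (simp add: assoc_extension_def Let_def wreath_proj_eq coinv_sub_W base_incl_def)

lemma admissible_base_incl:
  assumes E: "E \<in> adm"
  shows "base_incl E \<in> hhom A (sub W E)" "inj_on (base_incl E) (carrier A)"
    "base_incl E ` carrier A = E \<inter> base"
    "\<And>a. a \<in> carrier A \<Longrightarrow> eval1 (base_incl E a) = a"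
    "\<And>b. b \<in> E \<inter> base \<Longrightarrow> base_incl E (eval1 b) = b"
proof -
  note d = admissibleD[OF E]
  note S = sub_W[OF d(1)]
  let ?B = "E \<inter> base"
  have B: "hsub W ?B"
    using coinv_hopf_subalgebra[OF W_hopf d(1) Q S(3) d(2)] by (simp add: coinv_sub_W[OF d(1)])
  note SB = sub_W[OF B]
  have iso: "base_incl E \<in> hiso A (sub W ?B)"
    using hopf_iso_inv[OF SB(1) A d(3)] by (simp add: base_incl_def)
  have bij: "bij_betw (base_incl E) (carrier A) ?B" using hopf_isoD(2)[OF iso] by simp
  then show "inj_on (base_incl E) (carrier A)" and im: "base_incl E ` carrier A = ?B"
    by (auto simp: bij_betw_def)
  have hW: "base_incl E \<in> hhom A W"
    using hopf_hom_comp[OF A SB(1) W_hopf SB(2) hopf_isoD(1)[OF iso]] by simp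
  show "base_incl E \<in> hhom A (sub W E)"
    by (rule hopf_corestrict[OF W_hopf d(1) A hW]) (use im in blast)
  have ev: "bij_betw (eval_one K Q X ev) ?B (carrier A)" using hopf_isoD(2)[OF d(3)] by simp
  show "eval1 (base_incl E a) = a" if "a \<in> carrier A" for a
  proof -
    have "base_incl E a \<in> ?B" using im that by blast
    moreover have "eval_one K Q X ev (base_incl E a) = a"
      unfolding base_incl_def by (rule f_inv_into_f) (use ev that in \<open>simp add: bij_betw_def\<close>)
    ultimately show ?thesis by (simp add: eval_one_eq)
  qed
  show "base_incl E (eval1 b) = b" if "b \<in> ?B" for b
    using ev that by (simp add: base_incl_def bij_betw_def eval_one_eq[symmetric])
qed

lemma assoc_extension_split:
  assumes E: "E \<in> adm"
  shows "assoc E \<in> splits A Q"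
proof -
  note d = admissibleD[OF E]
  show ?thesis
    unfolding assoc_extension_eq[OF d(1)] split_extensions_iff[OF A Q]
    using admissible_base_incl[OF E] sub_W[OF d(1)] d(2) by (simp add: coinv_sub_W[OF d(1)])
qed

text \<open>The hypothesis on \<open>eval1\<close> says that evaluation at \<open>1\<close> inverts
  the transported inclusion of \<open>A\<close>, which is condition (ii) for the image. It is
  applied to the Kaloujnine--Krasner embedding and to the restriction of an inner
  automorphism.\<close>

lemma admissible_image:
  assumes X: "(E, \<iota>, \<pi>) \<in> splits A Q" and \<Phi>: "\<Phi> \<in> hhom E W" and inj: "inj_on \<Phi> (carrier E)"
    and p: "\<And>e. e \<in> carrier E \<Longrightarrow> p2 X Q (\<Phi> e) = \<pi> e"
    and i: "\<And>a. a \<in> carrier A \<Longrightarrow> eval1 (\<Phi> (\<iota> a)) = a"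
  shows "\<Phi> ` carrier E \<in> adm"
    "exteq A (E, \<iota>, \<pi>) (assoc (\<Phi> ` carrier E))"
proof -
  have E: "hopf E" and \<iota>: "\<iota> \<in> hhom A E" and \<pi>: "\<pi> \<in> hhom E Q" and ij: "inj_on \<iota> (carrier A)"
    and im: "\<iota> ` carrier A = coinv E Q \<pi>" and s: "has_coalgebra_section K E Q \<pi>"
    using X[unfolded split_extensions_iff[OF A Q]] by auto
  let ?I = "\<Phi> ` carrier E"
  let ?S = "sub W ?I"
  let ?B = "?I \<inter> base"
  note h = hopf_image[OF E W_hopf \<Phi>]
  note S = sub_W[OF h(1)]
  have iso: "\<Phi> \<in> hiso E ?S" by (rule hopf_image_iso[OF E W_hopf \<Phi> inj])
  have "coinv ?S Q (p2 X Q) = \<Phi> ` coinv E Q \<pi>"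
    by (rule coinv_iso[OF E S(1) Q iso hopf_homD(6)[OF \<pi>] hopf_homD(6)[OF S(3)] p])
  then have B: "?B = (\<lambda>a. \<Phi> (\<iota> a)) ` carrier A"
    unfolding coinv_sub_W[OF h(1)] im[symmetric] image_image .
  let ?f = "\<lambda>a. \<Phi> (\<iota> a)"
  have f: "?f \<in> hhom A W" by (rule hopf_hom_comp[OF A E W_hopf \<Phi> \<iota>])
  have fB: "?f a \<in> base" if "a \<in> carrier A" for a using B that by blast
  have ef: "eval_one K Q X ev (?f a) = a" if "a \<in> carrier A" for a
    using eval_one_eq[OF fB[OF that]] i[OF that] by simp
  have finj: "inj_on ?f (carrier A)" using i by (rule inj_on_inverseI)
  have fiso: "?f \<in> hiso A (sub W ?B)"
    unfolding B by (rule hopf_image_iso[OF A W_hopf f finj])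
  have SB: "hopf (sub W ?B)"
    using sub_W(1)[OF hopf_image(1)[OF A W_hopf f]] unfolding B .
  have ev: "eval_one K Q X ev \<in> hiso (sub W ?B) A"
  proof (rule hopf_iso_cong[OF SB A hopf_iso_inv[OF A SB fiso]])
    fix x assume "x \<in> carrier (sub W ?B)"
    then have "x \<in> ?f ` carrier A" unfolding sub_hopf_simps B .
    then obtain a where a: "a \<in> carrier A" "x = ?f a" by (rule imageE)
    show "inv_into (carrier A) ?f x = eval_one K Q X ev x"
      unfolding a(2) inv_into_f_f[OF finj a(1)] ef[OF a(1)] ..
  qed
  obtain c where c: "c \<in> chom Q E" "\<And>q. q \<in> carrier Q \<Longrightarrow> \<pi> (c q) = q"
    using s by (auto simp: has_coalgebra_section_def)
  have m: "md E" "md ?S" using E S(1) by auto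
  have "(\<lambda>q. \<Phi> (c q)) \<in> chom Q ?S"
    by (rule chom_comp[OF cQ m hopf_homD(1)[OF h(2)] c(1)])
  then have sec: "has_coalgebra_section K ?S Q (p2 X Q)"
    unfolding has_coalgebra_section_def using c(2) p chom_closed[OF c(1)] by (intro bexI[of _ "\<lambda>q. \<Phi> (c q)"]) auto
  show "?I \<in> adm"
    unfolding admissible_def Let_def wreath_proj_eq using h(1) sec ev by (simp add: coinv_sub_W[OF h(1)])
  have "base_incl ?I a = ?f a" if "a \<in> carrier A" for a
  proof -
    have "bij_betw (eval_one K Q X ev) ?B (carrier A)" using hopf_isoD(2)[OF ev] by simp
    then have "inv_into ?B (eval_one K Q X ev) (eval_one K Q X ev (?f a)) = ?f a"
      using that B by (intro inv_into_f_f) (auto simp: bij_betw_def)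
    then show ?thesis unfolding ef[OF that] base_incl_def .
  qed
  then show "exteq A (E, \<iota>, \<pi>) (assoc ?I)"
    unfolding assoc_extension_eq[OF h(1)] ext_equivalent_def using p by (auto intro!: bexI[OF _ iso])
qed

end

section \<open>Embedding extensions into the wreath product\<close>

context kvec
begin

definition twist where
  "twist E Q \<pi> \<gamma> C e q = conv C E (conv C E (cmp C \<gamma> q) e)
     (cmp C (antipode E) (cmp C \<gamma> (conv C Q q (cmp C \<pi> e))))"

text \<open>On points, \<open>twist\<close> is \<open>(e, q) \<mapsto> \<gamma>(q) e \<gamma>(q \<pi>(e))\<inverse>\<close>, the Kaloujnine--Krasner
  cocycle.\<close>

context
  fixes E :: "('k, 'e, 'g) hopf_algebra_scheme" and Q :: "('k, 'q, 'h) hopf_algebra_scheme"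
    and \<pi> \<gamma> and C :: "('k, 'c, 'y) coalgebra_scheme"
  assumes E: "hopf E" and Q: "hopf Q" and \<pi>: "\<pi> \<in> hhom E Q" and s: "normal_section E Q \<pi> \<gamma>"
    and C: "coalg C"
begin

lemma proj_Hom_point: "e \<in> Hom C E \<Longrightarrow> cmp C \<pi> e \<in> Hom C Q"
  by (rule compose_hopf_hom[OF C E Q \<pi>])

lemma section_Hom_point: "q \<in> Hom C Q \<Longrightarrow> cmp C \<gamma> q \<in> Hom C E"
  using E Q by (intro compose_Hom[OF C _ _ normal_sectionD(1)[OF s]]) auto

lemma section_point: "q \<in> Hom C Q \<Longrightarrow> cmp C \<pi> (cmp C \<gamma> q) = q"
  by (rule Hom_eqI[OF proj_Hom_point[OF section_Hom_point]]) (auto simp: compose_eq normal_sectionD(3)[OF s] Hom_closed)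

lemma proj_antipode_point: "e \<in> Hom C E \<Longrightarrow>
    cmp C \<pi> (cmp C (antipode E) e) = cmp C (antipode Q) (cmp C \<pi> e)"
  by (auto simp: compose_def fun_eq_iff hopf_homD(4)[OF \<pi>] Hom_closed)

lemmas rE = conv_laws[OF C E]
lemmas rQ = conv_laws[OF C Q]

lemma twist_Hom: "e \<in> Hom C E \<Longrightarrow> q \<in> Hom C Q \<Longrightarrow> twist E Q \<pi> \<gamma> C e q \<in> Hom C E"
  unfolding twist_def by (intro rE(11,13) rQ(11) section_Hom_point proj_Hom_point)

lemma twist_proj:
  assumes e: "e \<in> Hom C E" and q: "q \<in> Hom C Q"
  shows "cmp C \<pi> (twist E Q \<pi> \<gamma> C e q) = conv_one C Q"
proof -
  note P = e q proj_Hom_point[OF e] section_Hom_point[OF q]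
  have g: "conv C Q q (cmp C \<pi> e) \<in> Hom C Q" using P by (intro rQ(11))
  note P' = g section_Hom_point[OF g]
  show ?thesis
    unfolding twist_def using P P'
    by (simp add: conv_hopf_hom[OF C E Q \<pi>] rE(11,13) proj_antipode_point section_point rQ(5))
qed

lemma twist_coinv:
  assumes e: "e \<in> Hom C E" and q: "q \<in> Hom C Q" and c: "c \<in> carrier C"
  shows "twist E Q \<pi> \<gamma> C e q c \<in> coinv E Q \<pi>"
proof (rule coinvI_point[OF C _ Q hopf_homD(6)[OF \<pi>] Hom_chom[OF twist_Hom[OF e q]] _ c])
  show "\<pi> (twist E Q \<pi> \<gamma> C e q c) = counit C c \<odot>\<^bsub>Q\<^esub> \<one>\<^bsub>Q\<^esub>" if "c \<in> carrier C" for c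
    using fun_cong[OF twist_proj[OF e q], of c] that by (simp add: compose_eq conv_one_def)
qed (use E in auto)

text \<open>The cocycle identity: the factor \<open>\<gamma>(q \<pi>(e))\<close> and its inverse
  cancel between the two twists on the right.\<close>

lemma twist_mult:
  assumes e: "e \<in> Hom C E" and e': "e' \<in> Hom C E" and q: "q \<in> Hom C Q"
  shows "twist E Q \<pi> \<gamma> C (conv C E e e') q = conv C E (twist E Q \<pi> \<gamma> C e q)
    (twist E Q \<pi> \<gamma> C e' (conv C Q q (cmp C \<pi> e)))"
proof -
  note P = e e' q proj_Hom_point[OF e] proj_Hom_point[OF e']
  have 1: "conv C Q q (cmp C \<pi> e) \<in> Hom C Q" using P by (intro rQ(11))
  have 2: "conv C Q (conv C Q q (cmp C \<pi> e)) (cmp C \<pi> e') \<in> Hom C Q" using P 1 by (intro rQ(11))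
  note S = section_Hom_point[OF q] section_Hom_point[OF 1] section_Hom_point[OF 2]
  show ?thesis
    unfolding twist_def using P 1 2 S
    by (simp add: conv_hopf_hom[OF C E Q \<pi>] rQ(1)[symmetric] rE(1,6,7,11,12,13))
qed

lemma twist_compose:
  assumes B: "coalg B" and k: "k \<in> Hom B C" and e: "e \<in> Hom C E" and q: "q \<in> Hom C Q"
  shows "cmp B (twist E Q \<pi> \<gamma> C e q) k =
    twist E Q \<pi> \<gamma> B (cmp B e k) (cmp B q k)"
proof -
  have p: "pre_hopf E" "pre_hopf Q" using E Q by auto
  have 1: "conv C Q q (cmp C \<pi> e) \<in> Hom C Q" using q proj_Hom_point[OF e] by (intro rQ(11))
  note S = section_Hom_point[OF q] section_Hom_point[OF 1]
  show ?thesis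
    unfolding twist_def using e q 1 S proj_Hom_point[OF e]
    by (simp add: conv_compose[OF p(1) C _ _ B k] conv_compose[OF p(2) C _ _ B k] compose_compose[OF k] rE(11,13))
qed

lemma twist_one:
  assumes e: "e \<in> Hom C E"
  shows "twist E Q \<pi> \<gamma> C e (conv_one C Q) =
    conv C E e (cmp C (antipode E) (cmp C \<gamma> (cmp C \<pi> e)))"
  unfolding twist_def using e proj_Hom_point[OF e] by (simp add: section_conv_one[OF E Q s C] rQ(2) rE(2))

end

end

context exponential_data
begin

section \<open>The Kaloujnine--Krasner embedding of a split extension\<close>

context
  fixes E :: "('k, 'e) hopf_algebra" and \<iota> :: "'a \<Rightarrow> 'e" and \<pi> :: "'e \<Rightarrow> 'q" and \<gamma> :: "'q \<Rightarrow> 'e"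
  assumes split: "(E, \<iota>, \<pi>) \<in> splits A Q" and \<gamma>: "normal_section E Q \<pi> \<gamma>"
    and small_E: "small E"
begin

lemma E_hopf: "hopf E" and \<iota>_hom: "\<iota> \<in> hhom A E" and \<pi>_hom: "\<pi> \<in> hhom E Q"
  and \<iota>_inj: "inj_on \<iota> (carrier A)" and \<iota>_image: "\<iota> ` carrier A = coinv E Q \<pi>"
  using split[unfolded split_extensions_iff[OF A Q]] by auto

lemma E_coalg: "coalg E" and E_md: "md E"
  using E_hopf by auto

text \<open>The twist of the two generic points takes coinvariant values, that is, values in the
  image of \<open>\<iota>\<close>. Undoing the injective \<open>\<iota>\<close> leaves a coalgebra
  map \<open>E \<otimes> Q \<rightarrow> A\<close>, whose curried form is
  \<open>\<beta>\<close>.\<close>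

lemma kk_exists: "\<exists>\<beta> \<in> Hom E X.
  cmp (E \<otimes>\<^sub>c Q) \<iota> (at (E \<otimes>\<^sub>c Q) (cmp (E \<otimes>\<^sub>c Q) \<beta> (p1 E Q)) (p2 E Q)) =
    twist E Q \<pi> \<gamma> (E \<otimes>\<^sub>c Q) (p1 E Q) (p2 E Q)"
proof -
  let ?D = "E \<otimes>\<^sub>c Q"
  let ?t = "twist E Q \<pi> \<gamma> ?D (p1 E Q) (p2 E Q)"
  have D: "coalg ?D" using E_coalg by auto
  have p: "p1 E Q \<in> Hom ?D E" "p2 E Q \<in> Hom ?D Q" using E_coalg by auto
  have t: "?t \<in> Hom ?D E" by (rule twist_Hom[OF E_hopf Q \<pi>_hom \<gamma> D p])
  let ?F = "\<lambda>d\<in>carrier ?D. inv_into (carrier A) \<iota> (?t d)"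
  have tc: "?t d \<in> \<iota> ` carrier A" if "d \<in> carrier ?D" for d
    unfolding \<iota>_image by (rule twist_coinv[OF E_hopf Q \<pi>_hom \<gamma> D p that])
  have "(\<lambda>d. inv_into (carrier A) \<iota> (?t d)) \<in> chom ?D A"
  proof (rule chom_reflect[OF D cA E_coalg hopf_homD(1)[OF \<iota>_hom] \<iota>_inj])
    show "inv_into (carrier A) \<iota> (?t c) \<in> carrier A" if "c \<in> carrier ?D" for c
      by (rule inv_into_into[OF tc[OF that]])
    show "(\<lambda>c. \<iota> (inv_into (carrier A) \<iota> (?t c))) \<in> chom ?D E"
      by (rule chom_cong[OF Hom_chom[OF t] D]) (rule f_inv_into_f[OF tc, symmetric])
  qed
  then have F: "?F \<in> Hom ?D A" by (rule restrict_Hom[OF D])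
  have iF: "cmp ?D \<iota> ?F = ?t"
    by (rule extensionalityI[where A = "carrier ?D"])
      (simp_all add: compose_eq f_inv_into_f[OF tc] Hom_ext[OF t] del: tensor_coalgebra_mem)
  obtain \<beta> where "\<beta> \<in> Hom E X" "at ?D (cmp ?D \<beta> (p1 E Q)) (p2 E Q) = ?F"
    using curry_exists[OF E_coalg small_E F] by blast
  then show ?thesis using iF by (intro bexI[of _ \<beta>]) simp_all
qed

context
  fixes \<beta> :: "'e \<Rightarrow> 'x"
  assumes \<beta>: "\<beta> \<in> Hom E X"
    and \<beta>_at: "cmp (E \<otimes>\<^sub>c Q) \<iota> (at (E \<otimes>\<^sub>c Q) (cmp (E \<otimes>\<^sub>c Q) \<beta> (p1 E Q)) (p2 E Q)) =
      twist E Q \<pi> \<gamma> (E \<otimes>\<^sub>c Q) (p1 E Q) (p2 E Q)"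
begin

text \<open>\<open>\<beta>\<close> is prescribed only at the generic point, but every pair of points
  factors through it and both sides are natural.\<close>

lemma kk_at:
  assumes C: "coalg C" and e: "e \<in> Hom C E" and q: "q \<in> Hom C Q"
  shows "cmp C \<iota> (at C (cmp C \<beta> e) q) = twist E Q \<pi> \<gamma> C e q"
proof -
  let ?D = "E \<otimes>\<^sub>c Q"
  have D: "coalg ?D" using E_coalg by auto
  have p: "p1 E Q \<in> Hom ?D E" "p2 E Q \<in> Hom ?D Q" using E_coalg by auto
  let ?k = "pair C E Q e q"
  have k: "?k \<in> Hom C ?D" using C e q E_coalg by auto
  note pk = proj_pairing[OF C E_coalg cQ e q]
  have bp: "cmp ?D \<beta> (p1 E Q) \<in> Hom ?D X" using \<beta> p D E_md by (intro compose_Hom[OF D E_md]) auto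
  have "at C (cmp C \<beta> e) q = cmp C (at ?D (cmp ?D \<beta> (p1 E Q)) (p2 E Q)) ?k"
    by (simp only: at_compose[OF D C bp p(2) k] compose_compose[OF k] pk)
  then have "cmp C \<iota> (at C (cmp C \<beta> e) q) =
      cmp C (cmp ?D \<iota> (at ?D (cmp ?D \<beta> (p1 E Q)) (p2 E Q))) ?k"
    by (simp only: compose_compose[OF k])
  also have "\<dots> = twist E Q \<pi> \<gamma> C e q"
    unfolding \<beta>_at twist_compose[OF E_hopf Q \<pi>_hom \<gamma> D C k p] pk ..
  finally show ?thesis .
qed

text \<open>The point with \<open>A^Q\<close>-part \<open>\<beta>(e)\<close> lying over
  \<open>\<pi>(e)\<close>. Composing \<open>\<pi>\<close> with the restricted identity makes it
  extensional, as membership in \<open>Hom\<close> requires.\<close>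

abbreviation kk where "kk \<equiv> pair E X Q \<beta> (cmp E \<pi> (\<lambda>e\<in>carrier E. e))"

lemma kk_Hom: "kk \<in> Hom E Y" and \<pi>_Hom: "cmp E \<pi> (\<lambda>e\<in>carrier E. e) \<in> Hom E Q"
  using E_coalg \<beta> proj_Hom_point[OF E_hopf Q \<pi>_hom \<gamma> E_coalg ident_Hom[OF E_coalg]] by auto

lemma kk_point:
  assumes C: "coalg C" and e: "e \<in> Hom C E"
  shows "cmp C kk e = pair C X Q (cmp C \<beta> e) (cmp C \<pi> e)"
proof -
  have "cmp C (\<lambda>x\<in>carrier E. x) e = e"
    using Hom_closed[OF e] Hom_ext[OF e] by (auto simp: compose_def fun_eq_iff extensional_def)
  then show ?thesis
    by (simp add: pairing_compose[OF E_coalg cX cQ C \<beta> \<pi>_Hom e] compose_compose[OF e])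
qed

lemma \<beta>_point: "coalg C \<Longrightarrow> e \<in> Hom C E \<Longrightarrow> cmp C \<beta> e \<in> Hom C X"
  by (rule compose_Hom[OF _ E_md mX \<beta>])

text \<open>\<open>\<beta>\<close> is a crossed homomorphism along \<open>\<pi>\<close>. At the
  generic point, and after the injective \<open>\<iota>\<close>, the claim is
  \<open>twist_mult\<close>, since acting by \<open>\<pi>(e)\<close> shifts the argument from
  \<open>q\<close> to \<open>q \<pi>(e)\<close>.\<close>

lemma \<beta>_mult:
  assumes C: "coalg C" and s: "small C" and e: "e \<in> Hom C E" and e': "e' \<in> Hom C E"
  shows "cmp C \<beta> (conv C E e e') =
    conv C XH (cmp C \<beta> e) (act C (cmp C \<pi> e) (cmp C \<beta> e'))"
proof -
  let ?D = "C \<otimes>\<^sub>c Q"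
  let ?k = "\<lambda>f. cmp ?D f (p1 C Q)"
  let ?q = "p2 C Q"
  have D: "coalg ?D" using C by auto
  have k: "p1 C Q \<in> Hom ?D C" and q: "?q \<in> Hom ?D Q" using C by auto
  have kE: "?k f \<in> Hom ?D E" if "f \<in> Hom C E" for f using C D E_md k that by (intro compose_Hom[OF D]) auto
  have kQ: "?k f \<in> Hom ?D Q" if "f \<in> Hom C Q" for f using C D k that by (intro compose_Hom[OF D]) auto
  have kX: "?k f \<in> Hom ?D X" if "f \<in> Hom C X" for f using C D k that by (intro compose_Hom[OF D]) auto
  have cE: "conv C E e e' \<in> Hom C E" by (rule conv_laws(11)[OF C E_hopf e e'])
  note pe = proj_Hom_point[OF E_hopf Q \<pi>_hom \<gamma> C e]
  note b = \<beta>_point[OF C e] \<beta>_point[OF C e']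
  have aX: "act C (cmp C \<pi> e) (cmp C \<beta> e') \<in> Hom C X" using C pe b by auto
  have qpe: "conv ?D Q ?q (?k (cmp C \<pi> e)) \<in> Hom ?D Q" using D q kQ[OF pe] by auto
  have pE: "pre_hopf E" using E_hopf by auto
  let ?r = "conv C XH (cmp C \<beta> e) (act C (cmp C \<pi> e) (cmp C \<beta> e'))"
  have rX: "?r \<in> Hom C X" using C b aX by auto
  have atr: "at ?D (?k ?r) ?q = conv ?D A (at ?D (?k (cmp C \<beta> e)) ?q)
      (at ?D (?k (cmp C \<beta> e')) (conv ?D Q ?q (?k (cmp C \<pi> e))))"
    using C D k q pe b aX
    by (simp add: conv_XH_compose act_compose at_conv at_act kX kQ)
  have tl: "cmp ?D \<iota> (at ?D (?k (cmp C \<beta> (conv C E e e'))) ?q) =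
      twist E Q \<pi> \<gamma> ?D (conv ?D E (?k e) (?k e')) ?q"
    using kk_at[OF D kE[OF cE] q] by (simp only: compose_compose[OF k] conv_compose[OF pE C e e' D k])
  have kpe: "?k (cmp C \<pi> e) = cmp ?D \<pi> (?k e)"
    by (rule compose_compose[OF k])
  have tr: "cmp ?D \<iota> (at ?D (?k ?r) ?q) = conv ?D E (twist E Q \<pi> \<gamma> ?D (?k e) ?q)
      (twist E Q \<pi> \<gamma> ?D (?k e') (conv ?D Q ?q (cmp ?D \<pi> (?k e))))"
    unfolding atr using conv_hopf_hom[OF D A E_hopf \<iota>_hom at_Hom[OF D kX[OF b(1)] q] at_Hom[OF D kX[OF b(2)] qpe]]
      kk_at[OF D kE[OF e] q] kk_at[OF D kE[OF e'] qpe]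
    by (simp only: compose_compose[OF k])
  show ?thesis
  proof (rule X_eqI[OF C s \<beta>_point[OF C cE] rX], rule Hom_cancel[OF _ _ \<iota>_inj])
    show "at ?D (?k (cmp C \<beta> (conv C E e e'))) ?q \<in> Hom ?D A" "at ?D (?k ?r) ?q \<in> Hom ?D A"
      using D q kX[OF rX] kX[OF \<beta>_point[OF C cE]] by auto
    show "cmp ?D \<iota> (at ?D (?k (cmp C \<beta> (conv C E e e'))) ?q) =
        cmp ?D \<iota> (at ?D (?k ?r) ?q)"
      unfolding tl tr by (rule twist_mult[OF E_hopf Q \<pi>_hom \<gamma> D kE[OF e] kE[OF e'] q])
  qed
qed

lemma kk_hom: "kk \<in> hhom E W"
proof (rule hopf_homI_points[OF E_hopf W_hopf])
  show "kk \<in> chom E W" using Hom_chom[OF kk_Hom] by simp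
  let ?C = "E \<otimes>\<^sub>c E"
  have C: "coalg ?C" "small ?C" using E_coalg small_E by auto
  have p: "p1 E E \<in> Hom ?C E" "p2 E E \<in> Hom ?C E" using E_coalg by auto
  have c: "conv ?C E (p1 E E) (p2 E E) \<in> Hom ?C E" by (rule conv_laws(11)[OF C(1) E_hopf p])
  note b = \<beta>_point[OF C(1) p(1)] \<beta>_point[OF C(1) p(2)]
  note pp = proj_Hom_point[OF E_hopf Q \<pi>_hom \<gamma> C(1) p(1)] proj_Hom_point[OF E_hopf Q \<pi>_hom \<gamma> C(1) p(2)]
  show "cmp ?C kk (conv ?C E (p1 E E) (p2 E E)) =
    conv ?C W (cmp ?C kk (p1 E E)) (cmp ?C kk (p2 E E))"
    using C b pp by (simp add: kk_point[OF C(1) c] kk_point[OF C(1) p(1)] kk_point[OF C(1) p(2)] conv_W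
      \<beta>_mult[OF C p] conv_hopf_hom[OF C(1) E_hopf Q \<pi>_hom p])
qed

text \<open>A left inverse sends \<open>x \<otimes> q\<close> to
  \<open>\<iota>(x@1) \<gamma>(q)\<close>: at the argument \<open>1\<close> the twist is
  \<open>e S(\<gamma>(\<pi> e))\<close>, and the factor \<open>\<gamma>(\<pi> e)\<close> restores
  \<open>e\<close>.\<close>

lemma kk_inj: "inj_on kk (carrier E)"
proof (rule inj_on_inverseI)
  let ?id = "\<lambda>e\<in>carrier E. e"
  let ?one = "conv_one E Q"
  let ?ia = "cmp Y \<iota> (at Y (p1 X Q) (conv_one Y Q))"
  let ?gp = "cmp Y \<gamma> (p2 X Q)"
  let ?\<Lambda> = "conv Y E ?ia ?gp"
  note g = normal_sectionD[OF \<gamma>]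
  have id: "?id \<in> Hom E E" by (rule ident_Hom[OF E_coalg])
  have one: "?one \<in> Hom E Q" by (rule conv_one_Hom[OF preQ E_coalg])
  have pH: "p1 X Q \<in> Hom Y X" "p2 X Q \<in> Hom Y Q" by auto
  have oneY: "conv_one Y Q \<in> Hom Y Q" by (rule conv_one_Hom[OF preQ cY])
  have ia: "?ia \<in> Hom Y E" by (rule compose_hopf_hom[OF cY A E_hopf \<iota>_hom at_Hom[OF cY pH(1) oneY]])
  have gp: "?gp \<in> Hom Y E" by (rule compose_Hom[OF cY mQ E_md g(1) pH(2)])
  have pE: "pre_hopf E" using E_hopf by auto
  note pr = proj_pairing[OF E_coalg cX cQ \<beta> \<pi>_Hom]
  have b: "cmp E \<beta> ?id = \<beta>" by (rule compose_ident[OF \<beta>])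
  let ?p = "cmp E \<pi> ?id"
  have gpE: "cmp E \<gamma> ?p \<in> Hom E E" by (rule section_Hom_point[OF E_hopf Q \<pi>_hom \<gamma> E_coalg \<pi>_Hom])
  note r = conv_laws[OF E_coalg E_hopf]
  have "cmp E ?\<Lambda> kk = conv E E (cmp E \<iota> (at E \<beta> ?one)) (cmp E \<gamma> ?p)"
    by (simp only: conv_compose[OF pE cY ia gp E_coalg kk_Hom] at_compose[OF cY E_coalg pH(1) oneY kk_Hom]
      conv_one_compose[OF kk_Hom] compose_compose[OF kk_Hom] pr)
  also have "\<dots> = conv E E (twist E Q \<pi> \<gamma> E ?id ?one) (cmp E \<gamma> ?p)"
    using kk_at[OF E_coalg id one] by (simp only: b)
  also have "\<dots> = ?id"
    unfolding twist_one[OF E_hopf Q \<pi>_hom \<gamma> E_coalg id] using id gpE by (simp only: r(1,3,4,13))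
  finally have eq: "cmp E ?\<Lambda> kk = ?id" .
  show "?\<Lambda> (kk e) = e" if "e \<in> carrier E" for e
    using fun_cong[OF eq, of e] that by (simp add: compose_eq)
qed

lemma kk_proj: "e \<in> carrier E \<Longrightarrow> p2 X Q (kk e) = \<pi> e"
  using fun_cong[OF proj_pairing(2)[OF E_coalg cX cQ \<beta> \<pi>_Hom], of e] by (simp add: compose_eq)

text \<open>\<open>\<pi>\<close> after \<open>\<iota>\<close> is the trivial point, so the twist of
  \<open>\<iota>(a)\<close> at \<open>1\<close> is
  \<open>\<iota>(a) S(\<gamma>(1)) = \<iota>(a)\<close>; injectivity of \<open>\<iota>\<close>
  finishes the argument.\<close>

lemma kk_eval: assumes a: "a \<in> carrier A" shows "eval1 (kk (\<iota> a)) = a"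
proof -
  let ?i = "\<lambda>a\<in>carrier A. \<iota> a"
  let ?one = "conv_one A Q"
  note ih = hopf_homD[OF \<iota>_hom]
  have i: "?i \<in> Hom A E" by (rule restrict_Hom[OF cA ih(1)])
  have one: "?one \<in> Hom A Q" by (rule conv_one_Hom[OF preQ cA])
  have ia: "\<iota> a \<in> carrier E" by (rule ih(5)[OF a])
  have p1k: "p1 X Q (kk (\<iota> a)) = \<beta> (\<iota> a)"
    using fun_cong[OF proj_pairing(1)[OF E_coalg cX cQ \<beta> \<pi>_Hom], of "\<iota> a"] ia by (simp add: compose_eq)
  have ba: "\<beta> (\<iota> a) \<in> carrier X" by (rule Hom_closed[OF \<beta> ia])
  have "eval1 (kk (\<iota> a)) = at A (cmp A \<beta> ?i) ?one a"
    using a by (subst at_one_apply[OF cA \<beta>_point[OF cA i] a]) (simp add: eval1_def p1k compose_eq)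
  have pi1: "cmp A \<pi> ?i = conv_one A Q"
  proof (rule Hom_eqI[OF proj_Hom_point[OF E_hopf Q \<pi>_hom \<gamma> cA i] one])
    fix c assume c: "c \<in> carrier A"
    have "\<iota> c \<in> coinv E Q \<pi>" using c \<iota>_image by blast
    from coinvD(3)[OF E_coalg Q hopf_homD(1)[OF \<pi>_hom] this]
    show "cmp A \<pi> ?i c = conv_one A Q c"
      using c chom_counit[OF ih(1) c] by (simp add: compose_eq conv_one_def)
  qed
  note r = conv_laws[OF cA E_hopf]
  have "cmp A \<iota> (at A (cmp A \<beta> ?i) ?one) = twist E Q \<pi> \<gamma> A ?i ?one"
    by (rule kk_at[OF cA i one])
  also have "\<dots> = ?i"
    unfolding twist_one[OF E_hopf Q \<pi>_hom \<gamma> cA i] pi1 section_conv_one[OF E_hopf Q \<gamma> cA] r(8) by (rule r(3)[OF i])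
  finally have eq: "cmp A \<iota> (at A (cmp A \<beta> ?i) ?one) = ?i" .
  have ea: "at A (cmp A \<beta> ?i) ?one a \<in> carrier A"
    by (rule Hom_closed[OF at_Hom[OF cA \<beta>_point[OF cA i] one] a])
  have "\<iota> (at A (cmp A \<beta> ?i) ?one a) = \<iota> a"
    using fun_cong[OF eq, of a] a by (simp add: compose_eq)
  then have "at A (cmp A \<beta> ?i) ?one a = a" by (rule inj_onD[OF \<iota>_inj _ ea a])
  then show ?thesis
    using a by (subst (asm) at_one_apply[OF cA \<beta>_point[OF cA i] a]) (simp add: eval1_def p1k compose_eq)
qed

end

lemma kk_embedding: "\<exists>F \<in> admissible K A Q X ev. exteq A (E, \<iota>, \<pi>) (assoc F)"
proof -
  obtain \<beta> where b: "\<beta> \<in> Hom E X"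
    "cmp (E \<otimes>\<^sub>c Q) \<iota> (at (E \<otimes>\<^sub>c Q) (cmp (E \<otimes>\<^sub>c Q) \<beta> (p1 E Q)) (p2 E Q)) =
      twist E Q \<pi> \<gamma> (E \<otimes>\<^sub>c Q) (p1 E Q) (p2 E Q)"
    using kk_exists by blast
  show ?thesis
    using admissible_image[OF split kk_hom[OF b] kk_inj[OF b] kk_proj[OF b] kk_eval[OF b]] by blast
qed

end

end

section \<open>Conjugation\<close>

context kvec
begin

lemma group_like_inverse:
  fixes H (structure)
  assumes H: "hopf H" and g: "group_like H g"
  shows "antipode H g \<otimes> g = \<one>" "g \<otimes> antipode H g = \<one>" "group_like H (antipode H g)"
proof -
  have c: "coalg H" and m: "md H" using H by auto
  have gD: "g \<in> carrier H" "comult H g = pt H H g g" "counit H g = \<one>\<^bsub>K\<^esub>" using g by (simp_all add: group_like_def)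
  show Sg: "group_like H (antipode H g)" by (rule group_like_image[OF m m antipode_chom[OF H] g])
  let ?i = "\<lambda>x\<in>carrier H. x"
  have i: "?i \<in> Hom H H" by (rule ident_Hom[OF c])
  note r = conv_laws(4,5)[OF c H i]
  note S = conv_laws(13)[OF c H i]
  have one: "conv_one H H g = \<one>"
    using gD m pre_hopfD(3)[OF hopf_pre_hopf[OF H]] by (simp add: conv_one_def module.smult_one)
  show "antipode H g \<otimes> g = \<one>"
    using fun_cong[OF r(1), of g] conv_group_like[OF c hopf_pre_hopf[OF H] Hom_lin[OF S] Hom_lin[OF i] gD(1,2)] gD(1) one
    by (simp add: compose_eq)
  show "g \<otimes> antipode H g = \<one>"
    using fun_cong[OF r(2), of g] conv_group_like[OF c hopf_pre_hopf[OF H] Hom_lin[OF i] Hom_lin[OF S] gD(1,2)] gD(1) one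
    by (simp add: compose_eq)
qed

text \<open>On points, conjugation by a group-like element is conjugation by the constant point it
  defines, hence preserves coalgebra maps.\<close>

lemma conj_point:
  fixes H (structure)
  assumes H: "hopf H" and g: "group_like H g" and C: "coalg C" and z: "z \<in> Hom C H"
  shows "cmp C (\<lambda>z. g \<otimes> z \<otimes> antipode H g) z =
    conv C H (conv C H (const_map C H g) z) (const_map C H (antipode H g))"
    and "cmp C (\<lambda>z. g \<otimes> z \<otimes> antipode H g) z \<in> Hom C H"
proof -
  have c: "coalg H" using H by auto
  note Sg = group_like_inverse(3)[OF H g]
  have gc: "g \<in> carrier H" "antipode H g \<in> carrier H" using g Sg by (simp_all add: group_like_def)
  have 1: "conv C H (const_map C H g) z \<in> Hom C H" by (rule conv_laws(11)[OF C H const_map_Hom[OF c C g] z])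
  have 2: "conv C H (conv C H (const_map C H g) z) (const_map C H (antipode H g)) \<in> Hom C H"
    by (rule conv_laws(11)[OF C H 1 const_map_Hom[OF c C Sg]])
  show "cmp C (\<lambda>z. g \<otimes> z \<otimes> antipode H g) z =
    conv C H (conv C H (const_map C H g) z) (const_map C H (antipode H g))"
    by (rule extensionalityI[where A = "carrier C"])
      (simp_all add: compose_eq conv_const(2)[OF C hopf_pre_hopf[OF H] Hom_lin[OF 1] gc(2)] conv_const(1)[OF C hopf_pre_hopf[OF H] Hom_lin[OF z] gc(1)] Hom_ext[OF 2])
  then show "cmp C (\<lambda>z. g \<otimes> z \<otimes> antipode H g) z \<in> Hom C H" using 2 by simp
qed

lemma conj_hopf_hom:
  fixes H (structure)
  assumes H: "hopf H" and g: "group_like H g"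
  shows "(\<lambda>z. g \<otimes> z \<otimes> antipode H g) \<in> hhom H H"
    and "inj_on (\<lambda>z. g \<otimes> z \<otimes> antipode H g) (carrier H)"
proof -
  interpret R: ring H by (rule hopf_ring[OF H])
  have c: "coalg H" using H by auto
  note I = group_like_inverse[OF H g]
  have gc: "g \<in> carrier H" "antipode H g \<in> carrier H" using g I(3) by (simp_all add: group_like_def)
  have cancel: "antipode H g \<otimes> (g \<otimes> x) = x" if "x \<in> carrier H" for x
    using that gc I(1) by (simp add: R.m_assoc[symmetric])
  show "(\<lambda>z. g \<otimes> z \<otimes> antipode H g) \<in> hhom H H"
  proof (rule hopf_homI[OF H H])
    show "(\<lambda>z. g \<otimes> z \<otimes> antipode H g) \<in> chom H H"
      by (rule chom_cong[OF Hom_chom[OF conj_point(2)[OF H g c ident_Hom[OF c]]] c]) (simp add: compose_eq)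
  qed (use gc cancel in \<open>simp add: R.m_assoc\<close>)
  show "inj_on (\<lambda>z. g \<otimes> z \<otimes> antipode H g) (carrier H)"
  proof (rule inj_on_inverseI)
    show "antipode H g \<otimes> (g \<otimes> z \<otimes> antipode H g) \<otimes> g = z" if "z \<in> carrier H" for z
      using that gc cancel I(1) by (simp add: R.m_assoc)
  qed
qed

end

context exponential_data
begin

section \<open>The inner automorphism attached to a normalized coalgebra map\<close>

context
  fixes \<phi> :: "'q \<Rightarrow> 'a"
  assumes \<phi>: "\<phi> \<in> normalized_maps K A Q"
begin

lemma \<phi>_chom: "\<phi> \<in> chom Q A" and \<phi>_one: "\<phi> \<one>\<^bsub>Q\<^esub> = \<one>\<^bsub>A\<^esub>"
  using \<phi> by (simp_all add: normalized_maps_def)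

abbreviation hat\<phi> where "hat\<phi> \<equiv> hat K A Q X ev \<phi>"
abbreviation g\<phi> where "g\<phi> \<equiv> pt X Q hat\<phi> \<one>\<^bsub>Q\<^esub>"

text \<open>Both facts come from one transpose: \<open>a \<otimes> q \<mapsto> a \<phi>(q)\<close>
  is a coalgebra map on \<open>K \<otimes> Q\<close>, and its curried form sends the group-like
  \<open>1\<close> of the ground coalgebra to \<open>hat\<phi>\<close>.\<close>

lemma hat_group_like: "group_like X hat\<phi>" and hat_at: "q \<in> carrier Q \<Longrightarrow> ev (pt X Q hat\<phi> q) = \<phi> q"
proof -
  let ?g = "ground_coalgebra K"
  let ?F = "cmp (?g \<otimes>\<^sub>c Q) \<phi> (p2 ?g Q)"
  interpret Km: cring K by (rule cring_K)
  interpret Am: module K A by simp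
  have one: "\<one>\<^bsub>K\<^esub> \<in> carrier ?g" by simp
  have p: "p2 ?g Q \<in> Hom (?g \<otimes>\<^sub>c Q) Q" by auto
  have F: "?F \<in> Hom (?g \<otimes>\<^sub>c Q) A" by (rule compose_chom[OF _ mQ mA \<phi>_chom p]) auto
  have "\<forall>a \<in> carrier ?g. \<forall>q \<in> carrier Q. ?F (pt ?g Q a q) = a \<odot>\<^bsub>A\<^esub> \<phi> q"
  proof (intro ballI)
    fix a q assume aq: "a \<in> carrier ?g" "q \<in> carrier Q"
    have t: "pt ?g Q a q \<in> carrier (?g \<otimes>\<^sub>c Q)" using aq by auto
    show "?F (pt ?g Q a q) = a \<odot>\<^bsub>A\<^esub> \<phi> q"
      unfolding compose_eq[OF t] proj2_pure[OF coalg_ground cQ aq] using aq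
      by (simp add: lin_smult[OF chom_lin[OF \<phi>_chom]])
  qed
  note ec = exp_curry_props[OF coalg_ground small_ground F this]
  show "group_like X hat\<phi>"
    unfolding hat_def by (intro group_like_image[OF _ mX Hom_chom[OF ec(1)] group_like_ground]) auto
  show "ev (pt X Q hat\<phi> q) = \<phi> q" if "q \<in> carrier Q"
    unfolding hat_def using ec(2)[OF one that] lin_closed[OF chom_lin[OF \<phi>_chom] that] by simp
qed

lemma hat_closed: "hat\<phi> \<in> carrier X" "antipode XH hat\<phi> \<in> carrier X" "counit X hat\<phi> = \<one>\<^bsub>K\<^esub>"
proof -
  have "group_like XH hat\<phi>" using hat_group_like by (simp add: group_like_def)
  from group_like_inverse(3)[OF XH_hopf this]
  show "hat\<phi> \<in> carrier X" "antipode XH hat\<phi> \<in> carrier X" "counit X hat\<phi> = \<one>\<^bsub>K\<^esub>"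
    using hat_group_like by (simp_all add: group_like_def)
qed

lemma g_group_like: "group_like W g\<phi>"
proof (rule group_like_image[OF _ _ hopf_homD(1)[OF base_hom]])
  show "group_like XH hat\<phi>" using hat_group_like by (simp add: group_like_def)
qed (use W_hopf in auto)

lemma antipode_g: "antipode W g\<phi> = pt X Q (antipode XH hat\<phi>) \<one>\<^bsub>Q\<^esub>"
  using hopf_homD(4)[OF base_hom, of hat\<phi>] hat_closed by simp

lemma wreath_Ad_eq: "Ad \<phi> = (\<lambda>z. g\<phi> \<otimes>\<^bsub>W\<^esub> z \<otimes>\<^bsub>W\<^esub> antipode W g\<phi>)"
  by (rule ext) (simp add: wreath_Ad_def Let_def antipode_g)

lemma Ad_hom: "Ad \<phi> \<in> hhom W W"
  and Ad_inj: "inj_on (Ad \<phi>) (carrier W)"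
  unfolding wreath_Ad_eq by (rule conj_hopf_hom[OF W_hopf g_group_like])+

lemma Ad_proj: assumes z: "z \<in> carrier W" shows "p2 X Q (Ad \<phi> z) = p2 X Q z"
proof -
  interpret RQ: ring Q by (rule hopf_ring[OF Q])
  interpret RW: ring W by (rule hopf_ring[OF W_hopf])
  note h = hopf_homD[OF proj_hopf_hom]
  have g: "g\<phi> \<in> carrier W" using hat_closed by simp
  have Sg: "antipode W g\<phi> \<in> carrier W" using group_like_inverse(3)[OF W_hopf g_group_like] by (simp add: group_like_def)
  have pg: "p2 X Q g\<phi> = \<one>\<^bsub>Q\<^esub>" using hat_closed by (simp add: proj2_base module.smult_one[OF mQ])
  have pS: "p2 X Q (antipode W g\<phi>) = \<one>\<^bsub>Q\<^esub>" using h(4)[OF g] pg by (simp add: antipode_one[OF Q])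
  show ?thesis
    unfolding wreath_Ad_eq using h(2)[OF RW.m_closed[OF g z] Sg] h(2)[OF g z] h(5)[OF z] by (simp add: pg pS)
qed

text \<open>On the base, evaluation at \<open>1\<close> is multiplicative, so \<open>x@1\<close>
  gets conjugated by the value \<open>\<phi>(1)\<close>; normalization makes this
  \<open>1\<close>.\<close>

lemma Ad_eval:
  assumes "w \<in> base"
  shows "eval1 (Ad \<phi> w) = eval1 w"
proof -
  obtain x where x: "x \<in> carrier X" "w = pt X Q x \<one>\<^bsub>Q\<^esub>" using assms by (auto simp: wreath_base_def)
  interpret RX: ring XH by (rule hopf_ring[OF XH_hopf])
  interpret RA: ring A by (rule hopf_ring[OF A])
  note b = hopf_homD[OF base_hom] and e = hopf_homD[OF ev_one_hom]
  note u = hat_closed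
  have c: "hat\<phi> \<otimes>\<^bsub>XH\<^esub> x \<in> carrier X" using RX.m_closed[of hat\<phi> x] u x by simp
  have cc: "hat\<phi> \<otimes>\<^bsub>XH\<^esub> x \<otimes>\<^bsub>XH\<^esub> antipode XH hat\<phi> \<in> carrier X" using RX.m_closed[OF _ _] c u x by simp
  have "Ad \<phi> w = pt X Q (hat\<phi> \<otimes>\<^bsub>XH\<^esub> x \<otimes>\<^bsub>XH\<^esub> antipode XH hat\<phi>) \<one>\<^bsub>Q\<^esub>"
    unfolding wreath_Ad_eq antipode_g x(2) using b(2)[of hat\<phi> x] b(2)[of "hat\<phi> \<otimes>\<^bsub>XH\<^esub> x" "antipode XH hat\<phi>"] u x c by simp
  then have "eval1 (Ad \<phi> w) = ev (pt X Q (hat\<phi> \<otimes>\<^bsub>XH\<^esub> x \<otimes>\<^bsub>XH\<^esub> antipode XH hat\<phi>) \<one>\<^bsub>Q\<^esub>)"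
    using cc by (simp add: eval1_def)
  also have "\<dots> = ev (pt X Q hat\<phi> \<one>\<^bsub>Q\<^esub>) \<otimes>\<^bsub>A\<^esub> ev (pt X Q x \<one>\<^bsub>Q\<^esub>) \<otimes>\<^bsub>A\<^esub> antipode A (ev (pt X Q hat\<phi> \<one>\<^bsub>Q\<^esub>))"
    using e(2)[of hat\<phi> x] e(2)[of "hat\<phi> \<otimes>\<^bsub>XH\<^esub> x" "antipode XH hat\<phi>"] e(4)[of hat\<phi>] u x c by simp
  also have "\<dots> = eval1 w"
    using e(5)[of x] x by (simp add: hat_at \<phi>_one antipode_one[OF A] eval1_def)
  finally show ?thesis .
qed

text \<open>Conjugating \<open>(x, q)\<close> by \<open>(u, 1)\<close> gives \<open>A^Q\<close>-part
  \<open>u x (q \<star> S u)\<close>. With \<open>u@c = \<phi>(c)\<close> its value at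
  \<open>c\<close> is \<open>\<phi>(c) (x@c) S(\<phi>(c q))\<close>: the right factor is shifted by
  \<open>q\<close>, the left one is not.\<close>

lemma Ad_at:
  assumes C: "coalg C" and w: "w \<in> Hom C Y" and c: "c \<in> Hom C Q"
  shows "at C (wX C (cmp C (Ad \<phi>) w)) c =
    conv C A (conv C A (cmp C \<phi> c) (at C (wX C w) c))
      (cmp C (antipode A) (cmp C \<phi> (conv C Q c (wQ C w))))"
proof -
  let ?u = "const_map C X hat\<phi>" and ?Su = "const_map C X (antipode XH hat\<phi>)" and ?o = "conv_one C Q"
  have gX: "group_like XH hat\<phi>" using hat_group_like by (simp add: group_like_def)
  have gS: "group_like XH (antipode XH hat\<phi>)" by (rule group_like_inverse(3)[OF XH_hopf gX])
  then have gS': "group_like X (antipode XH hat\<phi>)" by (simp add: group_like_def)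
  have u: "?u \<in> Hom C X" by (rule const_map_Hom[OF cX C hat_group_like])
  have Su: "?Su \<in> Hom C X" by (rule const_map_Hom[OF cX C gS'])
  have o: "?o \<in> Hom C Q" by (rule conv_one_Hom[OF preQ C])
  note rQ = conv_laws[OF C Q]
  have const: "const_map C W (pt X Q x \<one>\<^bsub>Q\<^esub>) = pair C X Q (const_map C X x) ?o"
    if x: "group_like X x" for x
  proof (rule extensionalityI[where A = "carrier C"])
    have xc: "x \<in> carrier X" using x by (simp add: group_like_def)
    have cx: "const_map C X x \<in> Hom C X" by (rule const_map_Hom[OF cX C x])
    show "const_map C W (pt X Q x \<one>\<^bsub>Q\<^esub>) e = pair C X Q (const_map C X x) ?o e" if e: "e \<in> carrier C" for e
      using pair_one_apply[OF C cx e] e xc C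
      by (simp add: const_map_def lin_smult[OF bilD(1)[OF pt_bil[OF mX mQ]]])
    show "pair C X Q (const_map C X x) ?o \<in> extensional (carrier C)"
      using pairing_Hom[OF C cX cQ cx o] by (rule Hom_ext)
  qed (simp add: const_map_def)
  have wq: "wQ C w \<in> Hom C Q" "wX C w \<in> Hom C X" using C w by auto
  let ?q = "wQ C w" and ?x = "wX C w"
  have cS: "cmp C (antipode XH) ?u = ?Su"
  proof (rule extensionalityI[where A = "carrier C"])
    fix e assume e: "e \<in> carrier C"
    have "antipode XH (counit C e \<odot>\<^bsub>X\<^esub> hat\<phi>) = counit C e \<odot>\<^bsub>X\<^esub> antipode XH hat\<phi>"
      using lin_smult[OF chom_lin[OF antipode_chom[OF XH_hopf]], of "counit C e" hat\<phi>] e C hat_closed by simp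
    then show "cmp C (antipode XH) ?u e = ?Su e" using e by (simp add: compose_eq const_map_def)
  qed (simp_all add: const_map_def)
  have au: "at C ?u c' = cmp C \<phi> c'" if c': "c' \<in> Hom C Q" for c'
  proof (rule extensionalityI[where A = "carrier C"])
    fix e assume e: "e \<in> carrier C"
    have "at C ?u c' e = sw C A (\<lambda>a b. counit C a \<odot>\<^bsub>A\<^esub> ev (pt X Q hat\<phi> (c' b))) e"
      unfolding at_apply[OF C u c' e] using C hat_closed Hom_closed[OF c']
      by (intro sw_cong) (simp add: const_map_def lin_smult[OF bilD(1)[OF ev_bil]])
    also have "\<dots> = ev (pt X Q hat\<phi> (c' e))"
      using C e hat_closed by (intro sw_counit_left lin_comp[OF bilD(2)[OF ev_bil] Hom_lin[OF c']]) auto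
    finally show "at C ?u c' e = cmp C \<phi> c' e"
      using e hat_at[OF Hom_closed[OF c' e]] by (simp add: compose_eq)
  qed (use Hom_ext[OF at_Hom[OF C u c']] in simp_all)
  have oq: "conv C Q ?o ?q \<in> Hom C Q" and cq: "conv C Q c ?q \<in> Hom C Q" using rQ(11) o wq c by auto
  have A1: "act C ?o ?x \<in> Hom C X" and A2: "act C (conv C Q ?o ?q) ?Su \<in> Hom C X" using C o oq wq Su by auto
  have U: "pair C X Q ?u ?o \<in> Hom C Y" and V: "pair C X Q ?Su ?o \<in> Hom C Y" using C u Su o by auto
  have UW: "conv C W (pair C X Q ?u ?o) w \<in> Hom C Y" using C U w by auto
  have w': "w \<in> Hom C W" using w by simp
  have "cmp C (Ad \<phi>) w =
      conv C W (conv C W (pair C X Q ?u ?o) w) (pair C X Q ?Su ?o)"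
    using conj_point(1)[OF W_hopf g_group_like C w'] unfolding wreath_Ad_eq
    by (simp only: antipode_g const[OF hat_group_like] const[OF gS'])
  then have "wX C (cmp C (Ad \<phi>) w) =
      conv C XH (conv C XH ?u (act C ?o ?x)) (act C (conv C Q ?o ?q) ?Su)"
    using C u o Su wq U V UW A1 A2 oq w by (simp add: conv_W)
  then have "at C (wX C (cmp C (Ad \<phi>) w)) c =
      conv C A (conv C A (at C ?u c) (at C ?x (conv C Q c ?o))) (at C ?Su (conv C Q c (conv C Q ?o ?q)))"
    using C u A1 A2 o c wq oq Su by (simp add: at_conv at_act)
  also have "conv C Q c ?o = c" by (rule rQ(3)[OF c])
  also have "conv C Q c (conv C Q ?o ?q) = conv C Q c ?q" by (simp only: rQ(2)[OF wq(1)])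
  also have "at C ?Su (conv C Q c ?q) = cmp C (antipode A) (cmp C \<phi> (conv C Q c ?q))"
    unfolding cS[symmetric] at_antipode[OF C u cq] au[OF cq] ..
  finally show ?thesis unfolding au[OF c] .
qed

text \<open>\<open>Ad\<close> preserves the projection to \<open>Q\<close> and, on the base, the
  evaluation at \<open>1\<close>; so its restriction to \<open>E\<close> satisfies the hypotheses of
  \<open>admissible_image\<close>.\<close>

lemma conjugate_equivalent:
  assumes E: "E \<in> adm"
  shows "Ad \<phi> ` E \<in> adm"
    "exteq A (assoc E) (assoc (Ad \<phi> ` E))"
proof -
  let ?Ad = "Ad \<phi>"
  note d = admissibleD[OF E] and b = admissible_base_incl[OF E]
  note S = sub_W[OF d(1)]
  have split: "(sub W E, base_incl E, p2 X Q) \<in> splits A Q"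
    using assoc_extension_split[OF E] by (simp add: assoc_extension_eq[OF d(1)])
  have EW: "E \<subseteq> carrier W" using S(4) by auto
  have h: "?Ad \<in> hhom (sub W E) W" using hopf_hom_comp[OF S(1) W_hopf W_hopf Ad_hom S(2)] by simp
  have i: "inj_on ?Ad (carrier (sub W E))" using inj_on_subset[OF Ad_inj EW] by simp
  have p: "p2 X Q (?Ad e) = p2 X Q e" if "e \<in> carrier (sub W E)" for e
    using Ad_proj EW that by auto
  have e: "eval1 (?Ad (base_incl E a)) = a" if "a \<in> carrier A" for a
    using Ad_eval[of "base_incl E a"] b(3,4) that by auto
  show "?Ad ` E \<in> adm"
    "exteq A (assoc E) (assoc (?Ad ` E))"
    using admissible_image[OF split h i p e] by (simp_all add: assoc_extension_eq[OF d(1)])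
qed

end
end

section \<open>From equivalence of extensions back to conjugacy\<close>

context exponential_data
begin

lemma sub_Hom:
  assumes E: "hsub W E" and C: "coalg C" and h: "h \<in> Hom C (sub W E)"
  shows "h \<in> Hom C Y"
  using compose_hopf_hom[OF C sub_W(1)[OF E] W_hopf sub_W(2)[OF E] h] by (simp add: compose_id[OF h])

lemma sub_conv:
  assumes E: "hsub W E" and C: "coalg C" and a: "a \<in> Hom C (sub W E)" and b: "b \<in> Hom C (sub W E)"
  shows "conv C (sub W E) a b = conv C W a b"
proof -
  have ab: "conv C (sub W E) a b \<in> Hom C (sub W E)"
    by (rule conv_laws(11)[OF C sub_W(1)[OF E] a b])
  show ?thesis
    using conv_hopf_hom[OF C sub_W(1)[OF E] W_hopf sub_W(2)[OF E] a b]
    by (simp only: compose_id[OF a] compose_id[OF b] compose_id[OF ab])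
qed

lemma eval1_point: "coalg C \<Longrightarrow> w \<in> Hom C Y \<Longrightarrow> cmp C eval1 w \<in> Hom C A"
  by (rule compose_chom[OF _ _ _ eval1_chom]) auto

text \<open>The \<open>A^Q\<close>-part of the product is \<open>x (q \<star> x')\<close>, and
  \<open>(q \<star> x')@1 = x'@q\<close>. Multiplying on the left thus turns an evaluation at
  \<open>1\<close> into one at \<open>q\<close>.\<close>

lemma eval1_conv:
  assumes C: "coalg C" and w: "w \<in> Hom C Y" and w': "w' \<in> Hom C Y"
  shows "cmp C eval1 (conv C W w w') =
    conv C A (cmp C eval1 w) (at C (wX C w') (wQ C w))"
proof -
  let ?o = "conv_one C Q"
  have o: "?o \<in> Hom C Q" by (rule conv_one_Hom[OF preQ C])
  have x: "wX C w \<in> Hom C X" "wX C w' \<in> Hom C X" "wQ C w \<in> Hom C Q" "wQ C w' \<in> Hom C Q" using C w w' by auto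
  have a: "act C (wQ C w) (wX C w') \<in> Hom C X" using C x by auto
  have ww: "conv C W w w' \<in> Hom C Y" using C w w' by auto
  have "at C (wX C (conv C W w w')) ?o = conv C A (at C (wX C w) ?o) (at C (wX C w') (conv C Q ?o (wQ C w)))"
    using C w w' x a o by (simp add: conv_W at_conv at_act)
  then show ?thesis
    by (simp only: at_wX_one[OF C ww] at_wX_one[OF C w] conv_laws(2)[OF C Q x(3)])
qed

text \<open>The evaluations of a point \<open>w\<close> of \<open>E\<close> at arbitrary points \<open>q\<close> of \<open>Q\<close> are recovered from
  evaluations at \<open>1\<close>, because \<open>E\<close> contains \<open>\<gamma>(q)\<close>.\<close>

lemma at_recover:
  assumes C: "coalg C" and g: "g \<in> Hom C Y" and w: "w \<in> Hom C Y"
  shows "at C (wX C w) (wQ C g) =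
    conv C A (cmp C (antipode A) (cmp C eval1 g)) (cmp C eval1 (conv C W g w))"
proof -
  have "at C (wX C w) (wQ C g) \<in> Hom C A" using C g w by auto
  then show ?thesis
    unfolding eval1_conv[OF C g w] using conv_laws(6)[OF C A eval1_point[OF C g]] by simp
qed

context
  fixes E E' f \<gamma>
  assumes E: "E \<in> adm" and E': "E' \<in> adm"
    and f: "f \<in> hiso (sub W E) (sub W E')"
    and f_incl: "\<forall>a \<in> carrier A. f (base_incl E a) = base_incl E' a"
    and f_proj: "\<forall>e \<in> E. p2 X Q (f e) = p2 X Q e"
    and \<gamma>: "normal_section (sub W E) Q (p2 X Q) \<gamma>"
begin

abbreviation S where "S \<equiv> sub W E"

lemmas dE = admissibleD[OF E] and dE' = admissibleD[OF E']
lemmas SE = sub_W[OF dE(1)] and SE' = sub_W[OF dE'(1)]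

lemma f_point: "coalg C \<Longrightarrow> e \<in> Hom C S \<Longrightarrow> cmp C f e \<in> Hom C Y"
  by (rule sub_Hom[OF dE'(1) _ compose_hopf_hom[OF _ SE(1) SE'(1) hopf_isoD(1)[OF f]]])

lemma f_conv:
  assumes C: "coalg C" and a: "a \<in> Hom C S" and b: "b \<in> Hom C S"
  shows "cmp C f (conv C S a b) = conv C W (cmp C f a) (cmp C f b)"
proof -
  note fh = hopf_isoD(1)[OF f]
  show ?thesis
    unfolding conv_hopf_hom[OF C SE(1) SE'(1) fh a b]
    by (rule sub_conv[OF dE'(1) C compose_hopf_hom[OF C SE(1) SE'(1) fh a] compose_hopf_hom[OF C SE(1) SE'(1) fh b]])
qed

lemma wQ_f: "coalg C \<Longrightarrow> e \<in> Hom C S \<Longrightarrow> wQ C (cmp C f e) = wQ C e"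
  using Hom_closed[of e C S] f_proj by (auto simp: wQ_def compose_def fun_eq_iff)

lemma \<gamma>_Hom: "\<gamma> \<in> Hom Q S"
  by (rule normal_sectionD(1)[OF \<gamma>])

lemma S_coalg: "coalg S" and S_md: "md S"
  using SE(1) by auto

lemma \<gamma>_point: "coalg C \<Longrightarrow> q \<in> Hom C Q \<Longrightarrow> cmp C \<gamma> q \<in> Hom C S"
  by (rule section_Hom_point[OF SE(1) Q SE(3) \<gamma>])

lemma wQ_\<gamma>: "coalg C \<Longrightarrow> q \<in> Hom C Q \<Longrightarrow> wQ C (cmp C \<gamma> q) = q"
  unfolding wQ_def by (rule section_point[OF SE(1) Q SE(3) \<gamma>])

text \<open>It sends \<open>q\<close> to the inverse of \<open>\<gamma>(q)@1\<close> times
  \<open>f(\<gamma>(q))@1\<close>, the discrepancy that \<open>f\<close> introduces at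
  \<open>1\<close> along the section. The conjugating map will be its convolution inverse.\<close>

definition twist_map where
  "twist_map = conv Q A (cmp Q (antipode A) (cmp Q eval1 \<gamma>))
     (cmp Q eval1 (cmp Q f \<gamma>))"

lemma twist_map_Hom: "twist_map \<in> Hom Q A"
  unfolding twist_map_def using eval1_point[OF cQ sub_Hom[OF dE(1) cQ \<gamma>_Hom]] eval1_point[OF cQ f_point[OF cQ \<gamma>_Hom]]
  by (intro conv_laws(11,13)[OF cQ A])

lemma twist_map_one: "twist_map \<one>\<^bsub>Q\<^esub> = \<one>\<^bsub>A\<^esub>"
proof -
  interpret RA: ring A by (rule hopf_ring[OF A])
  note e = eval1_point[OF cQ sub_Hom[OF dE(1) cQ \<gamma>_Hom]] eval1_point[OF cQ f_point[OF cQ \<gamma>_Hom]]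
  have "eval1 \<one>\<^bsub>W\<^esub> = \<one>\<^bsub>A\<^esub>" using hopf_homD(3)[OF ev_one_hom] by (simp add: W_one eval1_def)
  moreover have "f \<one>\<^bsub>W\<^esub> = \<one>\<^bsub>W\<^esub>" using hopf_homD(3)[OF hopf_isoD(1)[OF f]] by simp
  moreover have "\<gamma> \<one>\<^bsub>Q\<^esub> = \<one>\<^bsub>W\<^esub>" using normal_sectionD(2)[OF \<gamma>] by simp
  ultimately show ?thesis
    unfolding twist_map_def
    using conv_group_like[OF cQ preA Hom_lin[OF conv_laws(13)[OF cQ A e(1)]] Hom_lin[OF e(2)] Q_one_closed pre_hopfD(5)[OF preQ]]
    by (simp add: compose_eq antipode_one[OF A])
qed

text \<open>On the base, evaluation at \<open>1\<close> is inverse to \<open>base_incl\<close>, and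
  \<open>f\<close> intertwines the two inclusions of \<open>A\<close>.\<close>

lemma f_base: "b \<in> E \<inter> base \<Longrightarrow> eval1 (f b) = eval1 b"
proof -
  assume b: "b \<in> E \<inter> base"
  note i = admissible_base_incl[OF E] and i' = admissible_base_incl[OF E']
  have "b \<in> carrier Y" using b SE(4) by auto
  then have e: "eval1 b \<in> carrier A" by (rule chom_closed[OF eval1_chom])
  have "f b = base_incl E' (eval1 b)" using f_incl[rule_format, OF e] i(5)[OF b] by simp
  then show ?thesis using i'(4)[OF e] by simp
qed

text \<open>Factor the generic point of \<open>E\<close> as \<open>j(e) \<gamma>(\<tau>(e))\<close>
  with \<open>j(e)\<close> in the base. A left factor over the trivial point of \<open>Q\<close>
  leaves the evaluation of the right factor at \<open>1\<close>, and \<open>f\<close> preserves the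
  evaluation of \<open>j(e)\<close>; so only the section part changes, by
  \<open>twist_map\<close>.\<close>

lemma eval1_f_ident:
  "compose E eval1 (compose E f (\<lambda>e\<in>E. e)) = conv S A (compose E eval1 (\<lambda>e\<in>E. e)) (compose E twist_map (p2 X Q))"
proof -
  let ?id = "\<lambda>e\<in>carrier S. e"
  let ?c = "cmp S"
  let ?p = "?c (p2 X Q) ?id"
  let ?g = "?c \<gamma> ?p"
  let ?j = "conv S S ?id (?c (antipode S) ?g)"
  note r = conv_laws[OF S_coalg SE(1)] and rA = conv_laws[OF S_coalg A]
  have id: "?id \<in> Hom S S" by (rule ident_Hom[OF S_coalg])
  have p: "?p \<in> Hom S Q" by (rule proj_Hom_point[OF SE(1) Q SE(3) \<gamma> S_coalg id])
  have g: "?g \<in> Hom S S" by (rule \<gamma>_point[OF S_coalg p])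
  have j: "?j \<in> Hom S S" by (rule r(11)[OF id r(13)[OF g]])
  have jg: "conv S S ?j ?g = ?id" using id g by (simp only: r(1,3,4,13))
  have gp: "?c \<gamma> (p2 X Q) = ?g" by (auto simp: compose_def fun_eq_iff)
  note J = coinv_section[OF SE(1) Q SE(3) \<gamma>, unfolded gp]
  have jc: "?j e \<in> E \<inter> base" if "e \<in> E" for e
  proof -
    have "?j e \<in> ?j ` carrier S" using that by simp
    then show ?thesis unfolding J(2) coinv_sub_W[OF dE(1)] .
  qed
  have wj: "wQ S ?j = conv_one S Q"
    using J(4) by (auto simp: wQ_def compose_def conv_one_def fun_eq_iff)
  have ej: "?c eval1 (?c f ?j) = ?c eval1 ?j"
    using f_base[OF jc] by (auto simp: compose_def fun_eq_iff)
  note Y = sub_Hom[OF dE(1) S_coalg] f_point[OF S_coalg]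
  have one: "at S (wX S w) (conv_one S Q) = ?c eval1 w" if "w \<in> Hom S Y" for w
    by (rule at_wX_one[OF S_coalg that])
  have 1: "?c eval1 ?id = conv S A (?c eval1 ?j) (?c eval1 ?g)"
    using eval1_conv[OF S_coalg Y(1)[OF j] Y(1)[OF g]] unfolding wj one[OF Y(1)[OF g]] sub_conv[OF dE(1) S_coalg j g, symmetric] jg .
  have 2: "?c eval1 (?c f ?id) = conv S A (?c eval1 ?j) (?c eval1 (?c f ?g))"
    using eval1_conv[OF S_coalg Y(2)[OF j] Y(2)[OF g]]
    unfolding wQ_f[OF S_coalg j] wj one[OF Y(2)[OF g]] f_conv[OF S_coalg j g, symmetric] jg ej .
  note eY = eval1_point[OF S_coalg Y(1)[OF j]] eval1_point[OF S_coalg Y(1)[OF g]] eval1_point[OF S_coalg Y(2)[OF g]]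
  note eQ = eval1_point[OF cQ sub_Hom[OF dE(1) cQ \<gamma>_Hom]] eval1_point[OF cQ f_point[OF cQ \<gamma>_Hom]]
  have tw: "?c twist_map ?p = conv S A (?c (antipode A) (?c eval1 ?g)) (?c eval1 (?c f ?g))"
    unfolding twist_map_def
    using conv_compose[OF preA cQ conv_laws(13)[OF cQ A eQ(1)] eQ(2) S_coalg p]
    by (simp only: compose_compose[OF p])
  have "?c eval1 (?c f ?id) = conv S A (?c eval1 ?id) (?c twist_map ?p)"
    unfolding 2 1 tw using eY by (simp only: rA(1,7,11,13))
  moreover have "?c twist_map ?p = ?c twist_map (p2 X Q)" by (auto simp: compose_def fun_eq_iff)
  ultimately show ?thesis by simp
qed

lemma eval1_f:
  assumes C: "coalg C" and e: "e \<in> Hom C S"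
  shows "cmp C eval1 (cmp C f e) =
    conv C A (cmp C eval1 e) (cmp C twist_map (wQ C e))"
proof -
  let ?id = "\<lambda>e\<in>carrier S. e"
  have id: "?id \<in> Hom S S" by (rule ident_Hom[OF S_coalg])
  have p: "cmp S (p2 X Q) ?id \<in> Hom S Q" by (rule proj_Hom_point[OF SE(1) Q SE(3) \<gamma> S_coalg id])
  have ide: "cmp C ?id e = e"
    using Hom_closed[OF e] Hom_ext[OF e] by (auto simp: compose_def fun_eq_iff extensional_def)
  have tp: "cmp S twist_map (p2 X Q) = cmp S twist_map (cmp S (p2 X Q) ?id)"
    by (auto simp: compose_def fun_eq_iff)
  have tH: "cmp S twist_map (p2 X Q) \<in> Hom S A"
    unfolding tp by (rule compose_Hom[OF S_coalg mQ mA twist_map_Hom p])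
  have eH: "cmp S eval1 ?id \<in> Hom S A" by (rule eval1_point[OF S_coalg sub_Hom[OF dE(1) S_coalg id]])
  have "cmp C (cmp S eval1 (cmp S f ?id)) e =
      cmp C (conv S A (cmp S eval1 ?id) (cmp S twist_map (p2 X Q))) e"
    using eval1_f_ident by simp
  then show ?thesis
    unfolding conv_compose[OF preA S_coalg eH tH C e] compose_compose[OF e] ide wQ_def .
qed

text \<open>By \<open>at_recover\<close>, the value of \<open>f(e)\<close> at \<open>q\<close> is
  the inverse of \<open>f(\<gamma>(q))@1\<close> times \<open>f(\<gamma>(q) e)@1\<close>. Each
  factor is corrected by \<open>eval1_f\<close>, at \<open>q\<close> and at \<open>q\<close> times
  the projection of \<open>e\<close>, and the uncorrected part is \<open>e@q\<close>.\<close>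

lemma at_f:
  assumes C: "coalg C" and e: "e \<in> Hom C S" and q: "q \<in> Hom C Q"
  shows "at C (wX C (cmp C f e)) q =
    conv C A (conv C A (cmp C (antipode A) (cmp C twist_map q)) (at C (wX C e) q))
      (cmp C twist_map (conv C Q q (wQ C e)))"
proof -
  let ?c = "cmp C"
  let ?g = "?c \<gamma> q"
  note rA = conv_laws[OF C A]
  have g: "?g \<in> Hom C S" by (rule \<gamma>_point[OF C q])
  have ge: "conv C S ?g e \<in> Hom C S" by (rule conv_laws(11)[OF C SE(1) g e])
  note Y = sub_Hom[OF dE(1) C] f_point[OF C]
  have wq: "wQ C e \<in> Hom C Q" using C Y(1)[OF e] by auto
  have qe: "conv C Q q (wQ C e) \<in> Hom C Q" by (rule conv_laws(11)[OF C Q q wq])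
  have wge: "wQ C (conv C S ?g e) = conv C Q q (wQ C e)"
    using conv_hopf_hom[OF C SE(1) Q SE(3) g e] wQ_\<gamma>[OF C q] unfolding wQ_def by simp
  have t: "?c twist_map q' \<in> Hom C A" if "q' \<in> Hom C Q" for q'
    by (rule compose_Hom[OF C mQ mA twist_map_Hom that])
  note eH = eval1_point[OF C Y(1)[OF g]] eval1_point[OF C Y(1)[OF ge]]
  have "at C (wX C (?c f e)) q = conv C A (?c (antipode A) (?c eval1 (?c f ?g))) (?c eval1 (?c f (conv C S ?g e)))"
    using at_recover[OF C Y(2)[OF g] Y(2)[OF e]] unfolding wQ_f[OF C g] wQ_\<gamma>[OF C q] f_conv[OF C g e] .
  also have "\<dots> = conv C A (?c (antipode A) (conv C A (?c eval1 ?g) (?c twist_map q)))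
      (conv C A (?c eval1 (conv C S ?g e)) (?c twist_map (conv C Q q (wQ C e))))"
    unfolding eval1_f[OF C g] eval1_f[OF C ge] wQ_\<gamma>[OF C q] wge ..
  also have "\<dots> = conv C A (conv C A (?c (antipode A) (?c twist_map q))
      (conv C A (?c (antipode A) (?c eval1 ?g)) (?c eval1 (conv C S ?g e)))) (?c twist_map (conv C Q q (wQ C e)))"
    using eH t[OF q] t[OF qe] by (simp only: rA(1,9,11,13))
  also have "conv C A (?c (antipode A) (?c eval1 ?g)) (?c eval1 (conv C S ?g e)) = at C (wX C e) q"
    using at_recover[OF C Y(1)[OF g] Y(1)[OF e]] unfolding wQ_\<gamma>[OF C q] sub_conv[OF dE(1) C g e] ..
  finally show ?thesis .
qed

lemma equivalent_conjugate_aux: "\<exists>\<phi> \<in> normalized_maps K A Q. E' = Ad \<phi> ` E"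
proof (rule bexI)
  let ?\<phi> = "cmp Q (antipode A) twist_map"
  \<comment> \<open>In \<open>at_f\<close> the inverse of \<open>twist_map\<close> stands on the
    left and \<open>twist_map\<close> on the right, whereas \<open>Ad_at\<close> has
    \<open>\<phi>\<close> on the left and its inverse on the right; hence the antipode.\<close>
  have \<phi>H: "?\<phi> \<in> Hom Q A" by (rule conv_laws(13)[OF cQ A twist_map_Hom])
  show \<phi>: "?\<phi> \<in> normalized_maps K A Q"
    using Hom_chom[OF \<phi>H] by (simp add: normalized_maps_def compose_eq twist_map_one antipode_one[OF A])
  let ?Ad = "Ad ?\<phi>"
  let ?id = "\<lambda>e\<in>carrier S. e"
  let ?D = "S \<otimes>\<^sub>c Q"
  have id: "?id \<in> Hom S S" by (rule ident_Hom[OF S_coalg])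
  have idY: "?id \<in> Hom S Y" by (rule sub_Hom[OF dE(1) S_coalg id])
  have small_S: "small S"
  proof -
    have "carrier S \<subseteq> carrier Y" using SE(4) by auto
    then show ?thesis using small_Y unfolding small_for_def by (rule lepoll_trans[OF subset_imp_lepoll])
  qed
  have D: "coalg ?D" using S_coalg by auto
  have k: "p1 S Q \<in> Hom ?D S" and q: "p2 S Q \<in> Hom ?D Q" using S_coalg by auto
  have kY: "p1 S Q \<in> Hom ?D Y" by (rule sub_Hom[OF dE(1) D k])
  have AdY: "cmp C ?Ad w \<in> Hom C Y" if "coalg C" "w \<in> Hom C Y" for w and C :: "('k, ('k, 'x, 'q) tensor) hopf_algebra"
    using compose_hopf_hom[OF that(1) W_hopf W_hopf Ad_hom[OF \<phi>]] that(2) by simp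
  note h = f_point[OF S_coalg id] AdY[OF S_coalg idY]
  have idk: "cmp ?D ?id (p1 S Q) = p1 S Q"
    using Hom_closed[OF k] Hom_ext[OF k] by (auto simp: compose_def fun_eq_iff extensional_def)
  have wq: "wQ ?D (p1 S Q) \<in> Hom ?D Q" using D kY by auto
  have qe: "conv ?D Q (p2 S Q) (wQ ?D (p1 S Q)) \<in> Hom ?D Q" by (rule conv_laws(11)[OF D Q q wq])
  have t: "cmp ?D twist_map q' \<in> Hom ?D A" if "q' \<in> Hom ?D Q" for q'
    by (rule compose_Hom[OF D mQ mA twist_map_Hom that])
  have eq: "cmp S f ?id = cmp S ?Ad ?id"
  proof (rule wXQ_eqI[OF S_coalg h])
    have "cmp S (p2 X Q) (cmp S ?Ad ?id) = cmp S (p2 X Q) ?id"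
      using Ad_proj[OF \<phi>] SE(4) by (auto simp: compose_def fun_eq_iff)
    then show "wQ S (cmp S f ?id) = wQ S (cmp S ?Ad ?id)"
      unfolding wQ_f[OF S_coalg id] unfolding wQ_def by simp
    show "wX S (cmp S f ?id) = wX S (cmp S ?Ad ?id)"
    proof (rule X_eqI[OF S_coalg small_S])
      show "wX S (cmp S f ?id) \<in> Hom S X" "wX S (cmp S ?Ad ?id) \<in> Hom S X"
        using h S_coalg by auto
      \<comment> \<open>\<open>at_f\<close> and \<open>Ad_at\<close> give the same product of three
        factors, once the double antipode in the right factor is cancelled.\<close>
      show "at ?D (cmp ?D (wX S (cmp S f ?id)) (p1 S Q)) (p2 S Q) =
        at ?D (cmp ?D (wX S (cmp S ?Ad ?id)) (p1 S Q)) (p2 S Q)"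
        unfolding wXQ_compose[OF k] compose_compose[OF k] idk at_f[OF D k q] Ad_at[OF \<phi> D kY q]
          compose_compose[OF q] compose_compose[OF qe] conv_laws(10)[OF D A t[OF qe]] ..
    qed
  qed
  have "f e = ?Ad e" if "e \<in> E" for e using fun_cong[OF eq, of e] that by (simp add: compose_def)
  moreover have "f ` E = E'" using hopf_isoD(2)[OF f] by (simp add: bij_betw_def)
  ultimately show "E' = ?Ad ` E" by auto
qed

end

lemma equivalent_conjugate:
  assumes E: "E \<in> adm" and E': "E' \<in> adm"
    and eq: "exteq A (assoc E) (assoc E')"
  shows "\<exists>\<phi> \<in> normalized_maps K A Q. E' = Ad \<phi> ` E"
proof -
  note d = admissibleD[OF E] and d' = admissibleD[OF E']
  obtain f where f: "f \<in> hiso (sub W E) (sub W E')"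
    "\<forall>a \<in> carrier A. f (base_incl E a) = base_incl E' a" "\<forall>e \<in> E. p2 X Q (f e) = p2 X Q e"
    using eq unfolding assoc_extension_eq[OF d(1)] assoc_extension_eq[OF d'(1)] ext_equivalent_def by auto
  obtain \<gamma> where "normal_section (sub W E) Q (p2 X Q) \<gamma>"
    by (rule normal_section_exists[OF sub_W(1)[OF d(1)] Q sub_W(3)[OF d(1)] d(2)])
  from equivalent_conjugate_aux[OF E E' f this] show ?thesis .
qed

end

section \<open>The classification\<close>

text \<open>\<open>R\<close> need not be a function in either direction. It suffices that each side
  meets the other and that the ambiguity on the left is exactly \<open>r\<close> and on the right
  exactly \<open>s\<close>; a class is then sent to the set of all its partners.\<close>

lemma quotient_correspondence:
  assumes r: "equiv A r" and s: "equiv B s"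
    and ex: "\<And>a. a \<in> A \<Longrightarrow> \<exists>b \<in> B. R a b" "\<And>b. b \<in> B \<Longrightarrow> \<exists>a \<in> A. R a b"
    and left: "\<And>a a' b. a \<in> A \<Longrightarrow> a' \<in> A \<Longrightarrow> b \<in> B \<Longrightarrow> R a b \<Longrightarrow> R a' b \<longleftrightarrow> (a, a') \<in> r"
    and right: "\<And>a b b'. a \<in> A \<Longrightarrow> b \<in> B \<Longrightarrow> b' \<in> B \<Longrightarrow> R a b \<Longrightarrow> R a b' \<longleftrightarrow> (b, b') \<in> s"
  shows "\<exists>F. bij_betw F (A // r) (B // s) \<and> (\<forall>a \<in> A. F (r `` {a}) = {b \<in> B. R a b})"
proof -
  define F where "F c = {b \<in> B. \<exists>a \<in> c. R a b}" for c
  have F: "F (r `` {a}) = {b \<in> B. R a b}" if a: "a \<in> A" for a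
  proof -
    have "R a b" if b: "b \<in> B" and a': "(a, a') \<in> r" "R a' b" for a' b
    proof -
      have a'A: "a' \<in> A" using a' r unfolding equiv_def by blast
      have "(a', a) \<in> r" using a'(1) r by (meson equivE symD)
      then show ?thesis using left[OF a'A a b a'(2)] by simp
    qed
    moreover have "a \<in> r `` {a}" using r a by (rule equiv_class_self)
    ultimately show ?thesis unfolding F_def by blast
  qed
  have cls: "{b' \<in> B. R a b'} = s `` {b}" if "a \<in> A" "b \<in> B" "R a b" for a b
  proof -
    have "s `` {b} \<subseteq> B" using s unfolding equiv_def by blast
    then show ?thesis using right[OF that(1,2) _ that(3)] by blast
  qed
  have "bij_betw F (A // r) (B // s)"
    unfolding bij_betw_def
  proof
    show "inj_on F (A // r)"
    proof (rule inj_onI)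
      fix c c' assume c: "c \<in> A // r" "c' \<in> A // r" and eq: "F c = F c'"
      obtain a a' where a: "a \<in> A" "c = r `` {a}" "a' \<in> A" "c' = r `` {a'}" using c by (auto elim!: quotientE)
      obtain b where b: "b \<in> B" "R a b" using ex(1)[OF a(1)] by blast
      then have "b \<in> F c'" using eq a F[OF a(1)] by auto
      then have "R a' b" using a F[OF a(3)] by auto
      then have "(a, a') \<in> r" using left[OF a(1,3) b] by simp
      then show "c = c'" using a(2,4) r by (simp add: equiv_class_eq)
    qed
    show "F ` (A // r) = B // s"
    proof (intro equalityI subsetI)
      fix d assume "d \<in> F ` (A // r)"
      then obtain a where a: "a \<in> A" "d = F (r `` {a})" by (auto elim!: quotientE)
      obtain b where b: "b \<in> B" "R a b" using ex(1)[OF a(1)] by blast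
      show "d \<in> B // s" unfolding a(2) F[OF a(1)] cls[OF a(1) b] by (rule quotientI[OF b(1)])
    next
      fix d assume "d \<in> B // s"
      then obtain b where b: "b \<in> B" "d = s `` {b}" by (auto elim!: quotientE)
      obtain a where a: "a \<in> A" "R a b" using ex(2)[OF b(1)] by blast
      show "d \<in> F ` (A // r)"
        by (rule image_eqI[OF _ quotientI[OF a(1)]]) (simp only: F[OF a(1)] cls[OF a(1) b(1) a(2)] b(2))
    qed
  qed
  with F show ?thesis by blast
qed

context kvec
begin

lemma split_equivalent:
  assumes A: "hopf A" and Q: "hopf Q"
  shows "X \<in> splits A Q \<Longrightarrow> exteq A X X"
    and "X \<in> splits A Q \<Longrightarrow> Y \<in> splits A Q \<Longrightarrow> exteq A X Y \<Longrightarrow> exteq A Y X"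
    and "X \<in> splits A Q \<Longrightarrow> Y \<in> splits A Q \<Longrightarrow> Z \<in> splits A Q \<Longrightarrow>
      exteq A X Y \<Longrightarrow> exteq A Y Z \<Longrightarrow> exteq A X Z"
proof -
  note iff = split_extensions_iff[OF A Q]
  show "X \<in> splits A Q \<Longrightarrow> exteq A X X"
    by (cases X) (auto simp: iff intro: ext_equivalent_refl)
  show "X \<in> splits A Q \<Longrightarrow> Y \<in> splits A Q \<Longrightarrow> exteq A X Y \<Longrightarrow> exteq A Y X"
    using hopf_homD(5) by (cases X, cases Y) (auto simp: iff intro!: ext_equivalent_sym)
  show "X \<in> splits A Q \<Longrightarrow> Y \<in> splits A Q \<Longrightarrow> Z \<in> splits A Q \<Longrightarrow>
      exteq A X Y \<Longrightarrow> exteq A Y Z \<Longrightarrow> exteq A X Z"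
    by (cases X, cases Y, cases Z) (auto simp: iff intro: ext_equivalent_trans)
qed

lemma ext_rel_equiv: "hopf A \<Longrightarrow> hopf Q \<Longrightarrow> equiv (splits A Q) (ext_rel K A Q)"
  by (intro equivI refl_onI symI transI) (auto simp: ext_rel_def intro: split_equivalent)

end

context exponential_data
begin

text \<open>Through this description conjugacy inherits reflexivity, symmetry and transitivity from
  equivalence of extensions, without composing or inverting the conjugating maps.\<close>

lemma conj_rel_iff:
  "(E, E') \<in> conj_rel K A Q X ev \<longleftrightarrow> E \<in> adm \<and> E' \<in> adm \<and>
    exteq A (assoc E) (assoc E')"
  unfolding conj_rel_def using conjugate_equivalent(2) equivalent_conjugate by blast

lemma conj_rel_equiv: "equiv (adm) (conj_rel K A Q X ev)"
  by (intro equivI refl_onI symI transI)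
    (auto simp: conj_rel_iff intro: split_equivalent[OF A Q] dest: assoc_extension_split)

lemma split_has_admissible:
  fixes Z :: "('k, 'a, 'u, 'q) ext"
  assumes Z: "Z \<in> splits A Q"
  shows "\<exists>F \<in> admissible K A Q X ev. exteq A Z (assoc F)"
proof -
  obtain E \<iota> \<pi> where eq: "Z = (E, \<iota>, \<pi>)" by (cases Z)
  note iff = Z[unfolded eq split_extensions_iff[OF A Q]]
  obtain \<gamma> where "normal_section E Q \<pi> \<gamma>" using normal_section_exists[of E Q \<pi>] iff Q by blast
  moreover have "small E" by (auto simp: small_for_def lepoll_def intro: inj_on_id2)
  ultimately show ?thesis using kk_embedding[OF Z[unfolded eq]] unfolding eq by blast
qed

text \<open>The associated extension lives on tensors, whereas the classified extensions are carried
  by the universe type. Since \<open>E\<close> sits inside the small coalgebra \<open>Y\<close>, it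
  can be transported along an injection, and the transported extension is equivalent to the original
  one.\<close>

lemma admissible_has_split:
  assumes E: "E \<in> adm"
  shows "\<exists>Z \<in> (splits A Q :: ('k, 'a, 'u, 'q) ext set). exteq A Z (assoc E)"
proof -
  let ?S = "sub W E"
  note d = admissibleD[OF E]
  note S = sub_W[OF d(1)]
  note split = assoc_extension_split[OF E]
  note sp = split[unfolded assoc_extension_eq[OF d(1)]]
  have "carrier ?S \<subseteq> carrier Y" using S(4) by auto
  then have "carrier ?S \<lesssim> (UNIV :: 'u set)"
    using small_Y unfolding small_for_def by (rule lepoll_trans[OF subset_imp_lepoll])
  then obtain j :: "_ \<Rightarrow> 'u" where j: "inj_on j (carrier ?S)" by (auto simp: lepoll_def)
  note t = hopf_transport[OF S(1) j]
  note tr = split_extension_transfer[OF A Q sp t(1) hopf_iso_inv[OF t(1) S(1) t(2)]]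
  show ?thesis
    using tr(1) split_equivalent(2)[OF A Q sp tr(1) tr(2)] unfolding assoc_extension_eq[OF d(1)] by blast
qed

lemma classification:
  "\<exists>F. bij_betw F ((splits A Q :: ('k, 'a, 'u, 'q) ext set) // ext_rel K A Q)
      (adm // conj_rel K A Q X ev) \<and>
    (\<forall>Z \<in> (splits A Q :: ('k, 'a, 'u, 'q) ext set). F (ext_rel K A Q `` {Z}) =
      {E \<in> admissible K A Q X ev. exteq A Z (assoc E)})"
proof (rule quotient_correspondence[OF ext_rel_equiv[OF A Q] conj_rel_equiv split_has_admissible admissible_has_split])
  note eq = split_equivalent[OF A Q]
  let ?a = "assoc"
  fix Z Z' :: "('k, 'a, 'u, 'q) ext" and E E'
  assume Z: "Z \<in> splits A Q" and E: "E \<in> adm" and ZE: "exteq A Z (?a E)"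
  note aE = assoc_extension_split[OF E]
  show "exteq A Z' (?a E) \<longleftrightarrow> (Z, Z') \<in> ext_rel K A Q" if Z': "Z' \<in> splits A Q"
    using eq(3)[OF Z aE Z' ZE] eq(2)[OF Z' aE] eq(3)[OF Z' Z aE] eq(2)[OF Z Z'] ZE Z Z' by (auto simp: ext_rel_def)
  show "exteq A Z (?a E') \<longleftrightarrow> (E, E') \<in> conj_rel K A Q X ev" if E': "E' \<in> adm"
  proof -
    note aE' = assoc_extension_split[OF E']
    show ?thesis
      using eq(3)[OF aE Z aE' eq(2)[OF Z aE ZE]] eq(3)[OF Z aE aE' ZE] E E' by (auto simp: conj_rel_iff)
  qed
qed

end

theorem theorem1:
  fixes K :: "('k, 'm) ring_scheme"
    and A :: "('k, 'a) hopf_algebra"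
    and Q :: "('k, 'q) hopf_algebra"
    and AQ :: "('k, 'x) coalgebra"
    and ev :: "('k, 'x, 'q) tensor \<Rightarrow> 'a"
  assumes "field K"
    and "cocomm_hopf_algebra K A"
    and "cocomm_hopf_algebra K Q"
    and "exponential TYPE('u) K Q A AQ ev"
    and "infinite (UNIV :: 'u set)"
    and "carrier A \<lesssim> (UNIV :: 'u set)"
    and "carrier Q \<lesssim> (UNIV :: 'u set)"
    and "carrier AQ \<lesssim> (UNIV :: 'u set)"
  shows "(\<forall>E \<in> admissible K A Q AQ ev.
            coinvariants K (sub_hopf K (wreath_product K A Q AQ ev) E) Q (wreath_proj K Q AQ) =
              E \<inter> wreath_base K Q AQ \<and>
            assoc_extension K A Q AQ ev E \<in> split_extensions K A Q) \<and>
         equiv (split_extensions K A Q :: ('k, 'a, 'u, 'q) ext set) (ext_rel K A Q) \<and>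
         equiv (admissible K A Q AQ ev) (conj_rel K A Q AQ ev) \<and>
         (\<exists>F. bij_betw F
                ((split_extensions K A Q :: ('k, 'a, 'u, 'q) ext set) // ext_rel K A Q)
                (admissible K A Q AQ ev // conj_rel K A Q AQ ev) \<and>
              (\<forall>X \<in> (split_extensions K A Q :: ('k, 'a, 'u, 'q) ext set).
                 F (ext_rel K A Q `` {X}) =
                   {E \<in> admissible K A Q AQ ev.
                      ext_equivalent K A X (assoc_extension K A Q AQ ev E)}))"
proof -
  interpret exponential_data K A Q AQ ev "TYPE('u)"
    by (intro exponential_data.intro kvec.intro exponential_data_axioms.intro assms)
  show ?thesis
    using assoc_extension_split coinv_sub_W[OF admissibleD(1)] ext_rel_equiv[OF A Q] conj_rel_equiv classification
    by (simp add: wreath_proj_eq)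
qed

end
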